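(* The algebra of quasi-Jacobi forms (for the full Jacobi group $\Gamma_1^J=SL_2(\mathbb{Z})\ltimes\mathbb{Z}^2$) is the $\mathbb{C}$-algebra of functions on $\mathbb{H}\times\mathbb{C}$ generated by the functions $E_n(z,\tau)=\sum_{(a,b)\in\mathbb{Z}^2}\frac{1}{(z+a\tau+b)^n}$, $n\ge 1$, and $e_2(\tau)=\sum_{(a,b)\in\mathbb{Z}^2,\,(a,b)\ne(0,0)}\frac{1}{(a\tau+b)^2}$.
   Context: $\mathbb{H}$ is the upper half plane, $\tau\in\mathbb{H}$, $z\in\mathbb{C}$, $q=e^{2\pi i\tau}$. The series $E_1,E_2,e_2$ are taken with Eisenstein summation $\lim_{A\to\infty}\sum_{a=-A}^{A}\bigl(\lim_{B\to\infty}\sum_{b=-B}^{B}\bigr)$; for $n\ge3$ the series $E_n$ converges absolutely. $\mathbb{C}\{q,z\}$ denotes the ring of convergent power series in $q,z$ near $(0,0)$. Put $\lambda(z,\tau)=\frac{z-\bar z}{\tau-\bar\tau}$ and $\mu(\tau)=\frac{1}{\tau-\bar\tau}$. An almost meromorphic Jacobi form of weight $k$, index zero and depth $(s,t)$ for $\Gamma_1^J$ is a function $F=\sum_{0\le i\le s,\,0\le j\le t}f_{i,j}\lambda^i\mu^j$, where the $f_{i,j}$ are meromorphic on $\mathbb{H}\times\mathbb{C}$ with poles only along $z\in\mathbb{Z}\tau+\mathbb{Z}$ and lie in $\mathbb{C}\{q,z\}[z^{-1}]$, such that for all $\begin{pmatrix}a&b\\c&d\end{pmatrix}\in SL_2(\mathbb{Z})$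 and $m,n\in\mathbb{Z}$, $$F\Bigl(\frac{a\tau+b}{c\tau+d},\frac{z}{c\tau+d}\Bigr)=(c\tau+d)^kF(\tau,z),\qquad F(\tau,z+m\tau+n)=F(\tau,z).$$ A quasi-Jacobi form of weight $k$ (index zero, depth $(s,t)$) is the constant term $f_{0,0}$ of such an $F$, regarded as a polynomial in $\lambda,\mu$. The algebra of quasi-Jacobi forms is the $\mathbb{C}$-algebra spanned by quasi-Jacobi forms of all weights and depths. *)

theory Defs
  imports "HOL-Analysis.Analysis" "HOL-Library.Function_Algebras" "HOL.Hull"
begin

text \<open>
  Points of \<open>\<bbbH> \<times> \<complex>\<close> are pairs \<open>(\<tau>, z)\<close>. All functions in play are holomorphic away from the
  divisor \<open>z \<in> \<int>\<tau> + \<int>\<close>, whose complement is dense, so a meromorphic function is represented by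
  its values on that complement and is normalised to be 0 everywhere else. In this way equality
  of HOL functions is equality of meromorphic functions.
\<close>

definition upper_half_plane :: "complex set" where
  "upper_half_plane = {\<tau>. Im \<tau> > 0}"

definition period_lattice :: "complex \<Rightarrow> complex set" where
  "period_lattice \<tau> = {of_int m * \<tau> + of_int n | m n :: int. True}"

definition regular_domain :: "(complex \<times> complex) set" where
  "regular_domain = {(\<tau>, z). \<tau> \<in> upper_half_plane \<and> z \<notin> period_lattice \<tau>}"

definition on_regular :: "(complex \<times> complex \<Rightarrow> complex) \<Rightarrow> complex \<times> complex \<Rightarrow> complex" where
  "on_regular f = (\<lambda>p. if p \<in> regular_domain then f p else 0)"


subsection \<open>Eisenstein series\<close>

definition eisenstein_sum :: "(int \<Rightarrow> int \<Rightarrow> complex) \<Rightarrow> complex" where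
  "eisenstein_sum g =
     lim (\<lambda>A::nat. \<Sum>a = - int A..int A. lim (\<lambda>B::nat. \<Sum>b = - int B..int B. g a b))"

definition Eis :: "nat \<Rightarrow> complex \<times> complex \<Rightarrow> complex" where
  "Eis n = on_regular (\<lambda>(\<tau>, z).
     if n \<ge> 3
     then (\<Sum>\<^sub>\<infinity>(a, b)\<in>(UNIV :: (int \<times> int) set). 1 / (z + of_int a * \<tau> + of_int b) ^ n)
     else eisenstein_sum (\<lambda>a b. 1 / (z + of_int a * \<tau> + of_int b) ^ n))"

definition eis2 :: "complex \<times> complex \<Rightarrow> complex" where
  "eis2 = on_regular (\<lambda>(\<tau>, z).
     eisenstein_sum (\<lambda>a b. if (a, b) = (0, 0) then 0 else 1 / (of_int a * \<tau> + of_int b) ^ 2))"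


subsection \<open>Functions of two complex variables\<close>

text \<open>Complex differentiability: the Frechet derivative exists and is complex linear.
  The set is meant to be open.\<close>

definition holomorphic2_on ::
    "(complex \<times> complex \<Rightarrow> complex) \<Rightarrow> (complex \<times> complex) set \<Rightarrow> bool" where
  "holomorphic2_on f U \<longleftrightarrow>
     (\<forall>p\<in>U. \<exists>a b. (f has_derivative (\<lambda>(u, v). a * u + b * v)) (at p))"

text \<open>Meromorphic on \<open>\<bbbH> \<times> \<complex>\<close> (locally a quotient of holomorphic functions) with poles only along
  \<open>z \<in> \<int>\<tau> + \<int>\<close>. The values of \<open>f\<close> on the divisor itself are irrelevant.\<close>

definition meromorphic_lattice_poles :: "(complex \<times> complex \<Rightarrow> complex) \<Rightarrow> bool" where
  "meromorphic_lattice_poles f \<longleftrightarrow>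
     holomorphic2_on f regular_domain \<and>
     (\<forall>p \<in> upper_half_plane \<times> UNIV. \<exists>V g h.
        open V \<and> connected V \<and> p \<in> V \<and> V \<subseteq> upper_half_plane \<times> UNIV \<and>
        holomorphic2_on g V \<and> holomorphic2_on h V \<and> (\<exists>x\<in>V. h x \<noteq> 0) \<and>
        (\<forall>x \<in> V \<inter> regular_domain. h x \<noteq> 0 \<longrightarrow> f x = g x / h x))"

text \<open>Membership in \<open>\<complex>{q,z}[z\<^sup>-\<^sup>1]\<close> with \<open>q = exp (2\<pi>\<i>\<tau>)\<close>: near \<open>(q, z) = (0, 0)\<close>, the function is
  \<open>z\<^sup>-\<^sup>N\<close> times a convergent power series in \<open>q\<close> and \<open>z\<close>.\<close>

definition convergent_laurent_qz :: "(complex \<times> complex \<Rightarrow> complex) \<Rightarrow> bool" where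
  "convergent_laurent_qz f \<longleftrightarrow>
     (\<exists>(c :: nat \<Rightarrow> nat \<Rightarrow> complex) r N. r > 0 \<and>
        (\<forall>q z. norm q < r \<longrightarrow> norm z < r \<longrightarrow>
           (\<lambda>(m, n). c m n * q ^ m * z ^ n) summable_on UNIV) \<and>
        (\<forall>\<tau> z. (\<tau>, z) \<in> regular_domain \<longrightarrow>
           norm (exp (2 * of_real pi * \<i> * \<tau>)) < r \<longrightarrow> norm z < r \<longrightarrow>
           f (\<tau>, z) =
             (\<Sum>\<^sub>\<infinity>(m, n)\<in>UNIV. c m n * exp (2 * of_real pi * \<i> * \<tau>) ^ m * z ^ n) / z ^ N))"


subsection \<open>Quasi-Jacobi forms\<close>

definition jacobi_lambda :: "complex \<times> complex \<Rightarrow> complex" where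
  "jacobi_lambda = (\<lambda>(\<tau>, z). (z - cnj z) / (\<tau> - cnj \<tau>))"

definition jacobi_mu :: "complex \<times> complex \<Rightarrow> complex" where
  "jacobi_mu = (\<lambda>(\<tau>, z). 1 / (\<tau> - cnj \<tau>))"

definition jacobi_invariant :: "int \<Rightarrow> (complex \<times> complex \<Rightarrow> complex) \<Rightarrow> bool" where
  "jacobi_invariant k F \<longleftrightarrow>
     (\<forall>\<tau> z. (\<tau>, z) \<in> regular_domain \<longrightarrow>
        (\<forall>a b c d :: int. a * d - b * c = 1 \<longrightarrow>
           F ((of_int a * \<tau> + of_int b) / (of_int c * \<tau> + of_int d),
              z / (of_int c * \<tau> + of_int d))
           = (of_int c * \<tau> + of_int d) powi k * F (\<tau>, z)) \<and>
        (\<forall>m n :: int. F (\<tau>, z + of_int m * \<tau> + of_int n) = F (\<tau>, z)))"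

text \<open>An almost meromorphic Jacobi form of weight \<open>k\<close>, index zero and depth \<open>(s, t)\<close>, given by its
  coefficients \<open>f i j\<close> for \<open>i \<le> s\<close>, \<open>j \<le> t\<close>.\<close>

definition almost_meromorphic_jacobi ::
    "int \<Rightarrow> nat \<Rightarrow> nat \<Rightarrow> (nat \<Rightarrow> nat \<Rightarrow> complex \<times> complex \<Rightarrow> complex) \<Rightarrow> bool" where
  "almost_meromorphic_jacobi k s t f \<longleftrightarrow>
     (\<forall>i\<le>s. \<forall>j\<le>t. meromorphic_lattice_poles (f i j) \<and> convergent_laurent_qz (f i j)) \<and>
     jacobi_invariant k
       (\<lambda>p. \<Sum>i\<le>s. \<Sum>j\<le>t. f i j p * jacobi_lambda p ^ i * jacobi_mu p ^ j)"

definition quasi_jacobi_forms ::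
    "int \<Rightarrow> nat \<Rightarrow> nat \<Rightarrow> (complex \<times> complex \<Rightarrow> complex) set" where
  "quasi_jacobi_forms k s t = {on_regular (f 0 0) | f. almost_meromorphic_jacobi k s t f}"


subsection \<open>Complex algebras of functions\<close>

interpretation cfun: vector_space "\<lambda>(c::complex) (f :: 'a \<Rightarrow> complex) x. c * f x"
  by unfold_locales (auto simp: fun_eq_iff algebra_simps)

definition quasi_jacobi_algebra :: "(complex \<times> complex \<Rightarrow> complex) set" where
  "quasi_jacobi_algebra = cfun.span (\<Union>k s t. quasi_jacobi_forms k s t)"

text \<open>Unital complex subalgebras of the algebra of functions on \<open>regular_domain\<close>. Because of the
  normalisation, the unit is the indicator function of that set.\<close>

definition complex_subalgebra :: "(complex \<times> complex \<Rightarrow> complex) set \<Rightarrow> bool" where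
  "complex_subalgebra A \<longleftrightarrow>
     cfun.subspace A \<and> (\<forall>f\<in>A. on_regular f = f) \<and>
     on_regular (\<lambda>_. 1) \<in> A \<and> (\<forall>f\<in>A. \<forall>g\<in>A. f * g \<in> A)"

end

theory Submission imports Defs "HOL-Complex_Analysis.Complex_Analysis" begin

text \<open>
  The two inclusions have different sources.

  The generators are quasi-Jacobi forms because their failure to be Jacobi forms is that of \<open>\<lambda>\<close> and \<open>\<mu>\<close>.
  Summing the rows of the lattice first gives the expansion of \<open>E\<^sub>1\<close> in \<open>q\<close> and \<open>z\<close>: the row \<open>a\<close> is
  \<open>\<pi> cot \<pi>(z + a\<tau>)\<close>, and the rows \<open>\<plusminus>a\<close> together form a term of a Lambert series. The other \<open>E\<^sub>n\<close> follow by
  differentiation, and \<open>e\<^sub>2\<close> is the constant term of \<open>E\<^sub>2\<close> at \<open>z = 0\<close>. The expansion shows that \<open>E\<^sub>1\<close> changes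
  by \<open>-2\<pi>\<i>\<close> under \<open>z \<mapsto> z + \<tau>\<close>, and Liouville's theorem on the torus then determines its behaviour under the
  modular group. The outcome is that \<open>E\<^sub>1 + 2\<pi>\<i>\<lambda>\<close>, \<open>E\<^sub>2 - 2\<pi>\<i>\<mu>\<close> and \<open>e\<^sub>2 - 2\<pi>\<i>\<mu>\<close> are invariant, of weights 1, 2 and 2,
  while \<open>E\<^sub>n\<close> is invariant for \<open>n \<ge> 3\<close>. Products of quasi-Jacobi forms are quasi-Jacobi forms, so the algebra
  generated by the \<open>E\<^sub>n\<close> and \<open>e\<^sub>2\<close> consists of quasi-Jacobi forms (\<open>hull_subset_quasi_jacobi_algebra\<close>).

  Conversely, an almost meromorphic Jacobi form is expanded in powers of the completed series \<open>E\<^sub>1 + 2\<pi>\<i>\<lambda>\<close> and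
  \<open>e\<^sub>2 - 2\<pi>\<i>\<mu>\<close> instead of powers of \<open>\<lambda>\<close> and \<open>\<mu>\<close>. Such an expansion is unique
  (\<open>almost_holomorphic_expansion_unique\<close>), so its coefficients are themselves meromorphic Jacobi forms. Setting
  \<open>\<lambda> = \<mu> = 0\<close> writes the constant term as a polynomial in \<open>E\<^sub>1\<close> and \<open>e\<^sub>2\<close> with these coefficients, and it remains to
  see that meromorphic Jacobi forms lie in the algebra (\<open>jacobi_form_in_subalgebra\<close>). This is an induction on the
  order of the pole along the lattice: the leading Laurent coefficient is a modular form, and it is removed by
  subtracting its product with \<open>E\<^sub>n\<close>, or with \<open>\<wp> = E\<^sub>2 - e\<^sub>2\<close> for a double pole; simple poles do not occur, and
  without poles the form is constant in \<open>z\<close>.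

  Modular forms remain. The differential equation of \<open>\<wp>\<close> exhibits its two invariants, of weights 4 and 6, as
  polynomials in \<open>E\<^sub>2\<close>, \<open>E\<^sub>3\<close>, \<open>E\<^sub>4\<close> and \<open>e\<^sub>2\<close>. They do not vanish simultaneously, since otherwise \<open>\<wp>\<close> would be the
  square of an elliptic function with one simple pole. Two forms of weights 4 and 6 without common zero generate
  all modular forms (\<open>modular_form_generated\<close>): the discriminant, constructed by integrating \<open>e\<^sub>2\<close>, divides every
  form that vanishes at the cusp.
\<close>

section \<open>Holomorphic functions of two variables\<close>

lemma holomorphic2_onI:
  "(\<And>p. p \<in> U \<Longrightarrow> \<exists>a b. (f has_derivative (\<lambda>(u, v). a * u + b * v)) (at p)) \<Longrightarrow> holomorphic2_on f U"
  by (auto simp: holomorphic2_on_def)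

lemma holomorphic2_on_subset: "holomorphic2_on f U \<Longrightarrow> V \<subseteq> U \<Longrightarrow> holomorphic2_on f V"
  by (auto simp: holomorphic2_on_def)

lemma holomorphic2_on_imp_continuous_on:
  assumes "holomorphic2_on f U" shows "continuous_on U f"
proof (rule continuous_at_imp_continuous_on, intro ballI)
  fix x assume "x \<in> U"
  then obtain a b where "(f has_derivative (\<lambda>(u, v). a * u + b * v)) (at x)"
    using assms unfolding holomorphic2_on_def by blast
  then show "isCont f x" by (rule has_derivative_continuous)
qed

lemma holomorphic2_on_const [simp, intro]: "holomorphic2_on (\<lambda>_. c) U"
proof (rule holomorphic2_onI, intro exI)
  show "((\<lambda>_. c) has_derivative (\<lambda>(u, v). 0 * u + 0 * v)) (at p)" for p :: "complex \<times> complex"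
    by (simp add: split_def)
qed

lemma holomorphic2_on_fst [intro]: "holomorphic2_on fst U"
proof (rule holomorphic2_onI, intro exI)
  show "(fst has_derivative (\<lambda>(u, v). 1 * u + 0 * v)) (at p)" for p :: "complex \<times> complex"
    by (simp add: split_def) (rule derivative_intros | simp)+
qed

lemma holomorphic2_on_snd [intro]: "holomorphic2_on snd U"
proof (rule holomorphic2_onI, intro exI)
  show "(snd has_derivative (\<lambda>(u, v). 0 * u + 1 * v)) (at p)" for p :: "complex \<times> complex"
    by (simp add: split_def) (rule derivative_intros | simp)+
qed

lemma holomorphic2_on_add [intro]:
  assumes "holomorphic2_on f U" "holomorphic2_on g U"
  shows "holomorphic2_on (\<lambda>p. f p + g p) U"
proof (rule holomorphic2_onI)
  fix p assume "p \<in> U"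
  then obtain a b c d where "(f has_derivative (\<lambda>(u, v). a * u + b * v)) (at p)"
    "(g has_derivative (\<lambda>(u, v). c * u + d * v)) (at p)"
    using assms unfolding holomorphic2_on_def by blast
  then have "((\<lambda>p. f p + g p) has_derivative (\<lambda>x. (\<lambda>(u, v). a * u + b * v) x + (\<lambda>(u, v). c * u + d * v) x)) (at p)"
    by (rule has_derivative_add)
  also have "(\<lambda>x. (\<lambda>(u, v). a * u + b * v) x + (\<lambda>(u, v). c * u + d * v) x) = (\<lambda>(u, v). (a + c) * u + (b + d) * v)"
    by (auto simp: fun_eq_iff algebra_simps)
  finally show "\<exists>a b. ((\<lambda>p. f p + g p) has_derivative (\<lambda>(u, v). a * u + b * v)) (at p)" by blast
qed

lemma holomorphic2_on_mult [intro]: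
  assumes "holomorphic2_on f U" "holomorphic2_on g U"
  shows "holomorphic2_on (\<lambda>p. f p * g p) U"
proof (rule holomorphic2_onI)
  fix p assume "p \<in> U"
  then obtain a b c d where "(f has_derivative (\<lambda>(u, v). a * u + b * v)) (at p)"
    "(g has_derivative (\<lambda>(u, v). c * u + d * v)) (at p)"
    using assms unfolding holomorphic2_on_def by blast
  then have "((\<lambda>p. f p * g p) has_derivative (\<lambda>x. f p * (\<lambda>(u, v). c * u + d * v) x + (\<lambda>(u, v). a * u + b * v) x * g p)) (at p)"
    by (rule has_derivative_mult)
  also have "(\<lambda>x. f p * (\<lambda>(u, v). c * u + d * v) x + (\<lambda>(u, v). a * u + b * v) x * g p)
     = (\<lambda>(u, v). (f p * c + a * g p) * u + (f p * d + b * g p) * v)"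
    by (auto simp: fun_eq_iff algebra_simps)
  finally show "\<exists>a b. ((\<lambda>p. f p * g p) has_derivative (\<lambda>(u, v). a * u + b * v)) (at p)" by blast
qed

lemma holomorphic2_on_uminus [intro]:
  assumes "holomorphic2_on f U" shows "holomorphic2_on (\<lambda>p. - f p) U"
  using holomorphic2_on_mult[OF holomorphic2_on_const[of "-1"] assms] by simp

lemma holomorphic2_on_diff [intro]:
  assumes "holomorphic2_on f U" "holomorphic2_on g U"
  shows "holomorphic2_on (\<lambda>p. f p - g p) U"
  using holomorphic2_on_add[OF assms(1) holomorphic2_on_uminus[OF assms(2)]] by simp

lemma holomorphic2_on_power [intro]:
  assumes "holomorphic2_on f U" shows "holomorphic2_on (\<lambda>p. f p ^ n) U"
  by (induction n) (use assms in auto)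

lemma holomorphic2_on_sum [intro]:
  assumes "\<And>i. i \<in> I \<Longrightarrow> holomorphic2_on (f i) U"
  shows "holomorphic2_on (\<lambda>p. \<Sum>i\<in>I. f i p) U"
  using assms by (induction I rule: infinite_finite_induct) auto

lemma holomorphic2_on_compose:
  assumes f: "holomorphic2_on f U" and F: "F holomorphic_on V" "open V" and sub: "\<And>p. p \<in> U \<Longrightarrow> f p \<in> V"
  shows "holomorphic2_on (\<lambda>p. F (f p)) U"
proof (rule holomorphic2_onI)
  fix p assume p: "p \<in> U"
  then obtain a b where ab: "(f has_derivative (\<lambda>(u, v). a * u + b * v)) (at p)"
    using f unfolding holomorphic2_on_def by blast
  have "(F has_derivative (*) (deriv F (f p))) (at (f p))"
    using holomorphic_derivI[OF F sub[OF p]] by (simp add: has_field_derivative_def)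
  from has_derivative_compose[OF ab this]
  have "((\<lambda>p. F (f p)) has_derivative (\<lambda>x. deriv F (f p) * (case x of (u, v) \<Rightarrow> a * u + b * v))) (at p)" .
  also have "(\<lambda>x. deriv F (f p) * (case x of (u, v) \<Rightarrow> a * u + b * v)) =
     (\<lambda>(u, v). (deriv F (f p) * a) * u + (deriv F (f p) * b) * v)"
    by (auto simp: fun_eq_iff algebra_simps)
  finally show "\<exists>a b. ((\<lambda>p. F (f p)) has_derivative (\<lambda>(u, v). a * u + b * v)) (at p)" by blast
qed

lemma holomorphic2_on_compose_Pair:
  assumes f: "holomorphic2_on f U" and g: "holomorphic2_on g U" and F: "holomorphic2_on F V"
    and sub: "\<And>p. p \<in> U \<Longrightarrow> (f p, g p) \<in> V"
  shows "holomorphic2_on (\<lambda>p. F (f p, g p)) U"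
proof (rule holomorphic2_onI)
  fix p assume p: "p \<in> U"
  then obtain a b c d where ab: "(f has_derivative (\<lambda>(u, v). a * u + b * v)) (at p)"
    "(g has_derivative (\<lambda>(u, v). c * u + d * v)) (at p)"
    using f g unfolding holomorphic2_on_def by blast
  obtain r s where rs: "(F has_derivative (\<lambda>(u, v). r * u + s * v)) (at (f p, g p))"
    using F sub[OF p] unfolding holomorphic2_on_def by blast
  from has_derivative_compose[OF has_derivative_Pair[OF ab] rs]
  have "((\<lambda>p. F (f p, g p)) has_derivative (\<lambda>x. r * (case x of (u, v) \<Rightarrow> a * u + b * v) + s * (case x of (u, v) \<Rightarrow> c * u + d * v))) (at p)"
    by (simp add: split_def)
  also have "(\<lambda>x. r * (case x of (u, v) \<Rightarrow> a * u + b * v) + s * (case x of (u, v) \<Rightarrow> c * u + d * v)) =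
     (\<lambda>(u, v). (r * a + s * c) * u + (r * b + s * d) * v)"
    by (auto simp: fun_eq_iff algebra_simps)
  finally show "\<exists>a b. ((\<lambda>p. F (f p, g p)) has_derivative (\<lambda>(u, v). a * u + b * v)) (at p)" by blast
qed

lemma holomorphic2_on_divide [intro]:
  assumes "holomorphic2_on f U" "holomorphic2_on g U" "\<And>p. p \<in> U \<Longrightarrow> g p \<noteq> 0"
  shows "holomorphic2_on (\<lambda>p. f p / g p) U"
proof -
  have "holomorphic2_on (\<lambda>p. inverse (g p)) U"
    by (rule holomorphic2_on_compose[OF assms(2), where V = "- {0}"])
       (auto intro!: holomorphic_intros assms(3))
  from holomorphic2_on_mult[OF assms(1) this] show ?thesis by (simp add: divide_inverse)
qed

lemma holomorphic2_on_transform: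
  assumes "holomorphic2_on f U" "open U" "\<And>p. p \<in> U \<Longrightarrow> f p = g p"
  shows "holomorphic2_on g U"
proof (rule holomorphic2_onI)
  fix p assume p: "p \<in> U"
  then obtain a b where "(f has_derivative (\<lambda>(u, v). a * u + b * v)) (at p)"
    using assms(1) unfolding holomorphic2_on_def by blast
  then have "(g has_derivative (\<lambda>(u, v). a * u + b * v)) (at p)"
    by (rule has_derivative_transform_within_open[OF _ assms(2) p]) (use assms(3) in auto)
  then show "\<exists>a b. (g has_derivative (\<lambda>(u, v). a * u + b * v)) (at p)" by blast
qed

lemma holomorphic2_on_local:
  assumes "\<And>p. p \<in> U \<Longrightarrow> \<exists>V. p \<in> V \<and> holomorphic2_on f V"
  shows "holomorphic2_on f U"
  using assms unfolding holomorphic2_on_def by blast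

lemma holomorphic2_on_of_fst:
  assumes "F holomorphic_on V" "open V" "\<And>p. p \<in> U \<Longrightarrow> fst p \<in> V"
  shows "holomorphic2_on (\<lambda>p. F (fst p)) U"
  by (rule holomorphic2_on_compose[OF holomorphic2_on_fst assms])

text \<open>The chain rule along a holomorphic curve; both coordinate slices are instances.\<close>

lemma holomorphic2_on_slice:
  assumes f: "holomorphic2_on f U" and F: "F holomorphic_on V" "open V" and G: "G holomorphic_on V"
    and sub: "\<And>t. t \<in> V \<Longrightarrow> (F t, G t) \<in> U"
  shows "(\<lambda>t. f (F t, G t)) holomorphic_on V"
proof -
  have "\<exists>f'. ((\<lambda>t. f (F t, G t)) has_field_derivative f') (at t)" if t: "t \<in> V" for t
  proof -
    obtain r s where rs: "(f has_derivative (\<lambda>(u, v). r * u + s * v)) (at (F t, G t))"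
      using f sub[OF t] unfolding holomorphic2_on_def by blast
    have "(F has_derivative (*) (deriv F t)) (at t)" "(G has_derivative (*) (deriv G t)) (at t)"
      using holomorphic_derivI[OF F t] holomorphic_derivI[OF G F(2) t] by (simp_all add: has_field_derivative_def)
    from has_derivative_compose[OF has_derivative_Pair[OF this] rs]
    have "((\<lambda>t. f (F t, G t)) has_derivative (*) (r * deriv F t + s * deriv G t)) (at t)"
      by (rule has_derivative_eq_rhs) (auto simp: fun_eq_iff algebra_simps)
    then show ?thesis unfolding has_field_derivative_def by blast
  qed
  then show ?thesis using F(2) by (simp add: holomorphic_on_open)
qed

lemma holomorphic2_on_slice_snd:
  assumes "holomorphic2_on f U" "open V" "\<And>z. z \<in> V \<Longrightarrow> (x, z) \<in> U"
  shows "(\<lambda>z. f (x, z)) holomorphic_on V"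
  using holomorphic2_on_slice[OF assms(1), of "\<lambda>_. x" V "\<lambda>z. z"] assms(2,3) by (auto intro: holomorphic_intros)

lemma holomorphic2_on_slice_fst:
  assumes "holomorphic2_on f U" "open V" "\<And>x. x \<in> V \<Longrightarrow> (x, z) \<in> U"
  shows "(\<lambda>x. f (x, z)) holomorphic_on V"
  using holomorphic2_on_slice[OF assms(1), of "\<lambda>x. x" V "\<lambda>_. z"] assms(2,3) by (auto intro: holomorphic_intros)

lemma open_polydisc:
  fixes U :: "(complex \<times> complex) set"
  assumes "open U" "(a, b) \<in> U"
  obtains r where "r > 0" "cball a r \<times> cball b r \<subseteq> U"
proof -
  obtain A B where AB: "open A" "open B" "(a, b) \<in> A \<times> B" "A \<times> B \<subseteq> U"
    using open_prod_elim[OF assms] by metis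
  obtain r1 where r1: "r1 > 0" "cball a r1 \<subseteq> A" using AB open_contains_cball by blast
  obtain r2 where r2: "r2 > 0" "cball b r2 \<subseteq> B" using AB open_contains_cball by blast
  show ?thesis
  proof (rule that[of "min r1 r2"])
    have "cball a (min r1 r2) \<subseteq> A" "cball b (min r1 r2) \<subseteq> B" using r1 r2 by auto
    then show "cball a (min r1 r2) \<times> cball b (min r1 r2) \<subseteq> U" using AB by blast
  qed (use r1 r2 in auto)
qed

lemma continuous_on_contour_integral_circlepath:
  assumes "continuous_on (X \<times> sphere c r) (\<lambda>(x, w). F x w)" "r \<ge> 0"
  shows "continuous_on X (\<lambda>x. contour_integral (circlepath c r) (F x))"
proof -
  have eq: "contour_integral (circlepath c r) (F x) =
     integral (cbox 0 1) (\<lambda>t. F x (circlepath c r t) * (2 * pi * \<i> * r * exp (2 * of_real pi * \<i> * t)))" for x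
    unfolding contour_integral_integral vector_derivative_circlepath by simp
  have im: "circlepath c r t \<in> sphere c r" if "t \<in> {0..1}" for t
    using that assms(2) path_image_circlepath[of c r] by (auto simp: path_image_def simp del: path_image_circlepath)
  have cc: "continuous_on (X \<times> {0..1}) (\<lambda>(x, t). F x (circlepath c r t))"
  proof -
    have "continuous_on (X \<times> {0..1}) (\<lambda>p. (\<lambda>(x, w). F x w) (fst p, circlepath c r (snd p)))"
    proof (rule continuous_on_compose2[OF assms(1)])
      show "continuous_on (X \<times> {0..1}) (\<lambda>p. (fst p, circlepath c r (snd p)))"
        unfolding circlepath by (intro continuous_intros)
    qed (use im in auto)
    then show ?thesis by (simp add: split_def)
  qed
  show ?thesis unfolding eq
  proof (rule integral_continuous_on_param)
    show "continuous_on (X \<times> cbox 0 1) (\<lambda>(x, t). F x (circlepath c r t) * (2 * pi * \<i> * r * exp (2 * of_real pi * \<i> * t)))"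
      unfolding split_def using cc by (auto intro!: continuous_intros simp: split_def)
  qed
qed

text \<open>A contour integral depends holomorphically on a parameter: write the integrand by Cauchy's
  formula in the parameter and exchange the two integrals. What remains is a Cauchy integral of a
  continuous function.\<close>

lemma holomorphic_contour_integral_circlepath:
  assumes cont: "continuous_on (X \<times> sphere c r) (\<lambda>(x, w). F x w)" and X: "open X" and r: "r \<ge> 0"
    and hol: "\<And>w. w \<in> sphere c r \<Longrightarrow> (\<lambda>x. F x w) holomorphic_on X"
  shows "(\<lambda>x. contour_integral (circlepath c r) (F x)) holomorphic_on X"
proof -
  define K where "K = (\<lambda>x. contour_integral (circlepath c r) (F x))"
  have Kc: "continuous_on X K" unfolding K_def by (rule continuous_on_contour_integral_circlepath[OF cont r])
  have "\<exists>K'. (K has_field_derivative K') (at x0)" if x0: "x0 \<in> X" for x0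
  proof -
    obtain s where s: "s > 0" "cball x0 s \<subseteq> X" using X x0 open_contains_cball by blast
    have sph: "sphere x0 s \<subseteq> X" using s by auto
    define G where "G = (\<lambda>x. contour_integral (circlepath x0 s) (\<lambda>y. K y / (y - x)))"
    have Kcs: "continuous_on (path_image (circlepath x0 s)) K"
      using continuous_on_subset[OF Kc sph] s by simp
    have G1: "((\<lambda>u. K u / (u - w) ^ 1) has_contour_integral G w) (circlepath x0 s)" if "w \<in> ball x0 s" for w
    proof -
      have "continuous_on (path_image (circlepath x0 s)) (\<lambda>u. K u / (u - w))"
        by (intro continuous_intros Kcs) (use that s in \<open>auto simp: dist_commute\<close>)
      then have "(\<lambda>u. K u / (u - w)) contour_integrable_on circlepath x0 s"
        by (rule contour_integrable_continuous_circlepath)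
      then show ?thesis unfolding G_def using has_contour_integral_integral by simp
    qed
    from Cauchy_next_derivative_circlepath(2)[OF Kcs G1, where w = x0] s
    have Gd: "\<exists>G'. (G has_field_derivative G') (at x0)" by auto
    have KG: "K x = G x / (2 * of_real pi * \<i>)" if x: "x \<in> ball x0 s" for x
    proof -
      have F: "contour_integral (circlepath x0 s) (\<lambda>y. F y w / (y - x)) = 2 * of_real pi * \<i> * F x w"
        if w: "w \<in> sphere c r" for w
      proof -
        have "((\<lambda>y. F y w / (y - x)) has_contour_integral (2 * of_real pi * \<i> * F x w)) (circlepath x0 s)"
          by (rule Cauchy_integral_circlepath)
             (use holomorphic_on_imp_continuous_on[OF holomorphic_on_subset[OF hol[OF w] s(2)]]
                holomorphic_on_subset[OF hol[OF w] order_trans[OF ball_subset_cball s(2)]] s x in \<open>auto simp: dist_norm norm_minus_commute\<close>)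
        then show ?thesis by (simp add: contour_integral_unique)
      qed
      have "continuous_on (path_image (circlepath c r)) (F x)"
      proof -
        have "continuous_on (sphere c r) (\<lambda>w. (\<lambda>(x, w). F x w) (x, w))"
          by (rule continuous_on_compose2[OF cont]) (use s x in \<open>auto intro!: continuous_intros\<close>)
        then show ?thesis using r by simp
      qed
      then have "2 * of_real pi * \<i> * K x = contour_integral (circlepath c r) (\<lambda>w. 2 * of_real pi * \<i> * F x w)"
        unfolding K_def by (intro contour_integral_lmul[symmetric] contour_integrable_continuous_circlepath)
      also have "\<dots> = contour_integral (circlepath c r) (\<lambda>w. contour_integral (circlepath x0 s) (\<lambda>y. F y w / (y - x)))"
        by (rule contour_integral_cong) (use F r in auto)
      also have "\<dots> =
         contour_integral (circlepath x0 s) (\<lambda>y. contour_integral (circlepath c r) (\<lambda>w. F y w / (y - x)))"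
      proof (rule contour_integral_swap)
        have 1: "continuous_on (sphere c r \<times> sphere x0 s) (\<lambda>p. (\<lambda>(x, w). F x w) (snd p, fst p))"
          by (rule continuous_on_compose2[OF cont]) (use sph in \<open>auto intro!: continuous_intros\<close>)
        show "continuous_on (path_image (circlepath c r) \<times> path_image (circlepath x0 s)) (\<lambda>(w, y). F y w / (y - x))"
          unfolding split_def
          by (intro continuous_intros) (use 1 r s x in \<open>auto simp: split_def dist_commute\<close>)
      qed (auto simp: vector_derivative_circlepath intro!: continuous_intros)
      also have "\<dots> = contour_integral (circlepath x0 s) (\<lambda>y. K y / (y - x))"
      proof (rule contour_integral_cong)
        fix y assume "y \<in> path_image (circlepath x0 s)"
        then have y: "y \<in> X" using sph s by auto
        have "continuous_on (sphere c r) (\<lambda>w. (\<lambda>(x, w). F x w) (y, w))"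
          by (rule continuous_on_compose2[OF cont]) (use y in \<open>auto intro!: continuous_intros\<close>)
        then have "F y contour_integrable_on circlepath c r"
          using r by (intro contour_integrable_continuous_circlepath) auto
        from contour_integral_rmul[OF this, of "inverse (y - x)"]
        show "contour_integral (circlepath c r) (\<lambda>w. F y w / (y - x)) = K y / (y - x)"
          by (simp add: K_def divide_inverse)
      qed auto
      finally show ?thesis by (simp add: G_def field_simps)
    qed
    from Gd obtain G' where G': "(G has_field_derivative G') (at x0)" by blast
    have "((\<lambda>x. G x / (2 * of_real pi * \<i>)) has_field_derivative G' / (2 * of_real pi * \<i>)) (at x0)"
      by (rule DERIV_cdivide[OF G'])
    then have "(K has_field_derivative G' / (2 * of_real pi * \<i>)) (at x0)"
      by (rule has_field_derivative_transform_within_open[where S = "ball x0 s"]) (use s KG in auto)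
    then show ?thesis by blast
  qed
  then show ?thesis using X by (simp add: holomorphic_on_open K_def)
qed

text \<open>Osgood's lemma. Cauchy's formula for the second variable shows that the second partial
  derivative is jointly continuous, which is what differentiability in both variables needs.\<close>

lemma holomorphic2_on_Osgood:
  fixes f :: "complex \<times> complex \<Rightarrow> complex"
  assumes U: "open U" and cont: "continuous_on U f"
    and h1: "\<And>a b. (a, b) \<in> U \<Longrightarrow> (\<lambda>x. f (x, b)) field_differentiable at a"
    and h2: "\<And>a b. (a, b) \<in> U \<Longrightarrow> (\<lambda>y. f (a, y)) field_differentiable at b"
  shows "holomorphic2_on f U"
proof (rule holomorphic2_onI)
  fix p assume "p \<in> U"
  then obtain a b where p: "p = (a, b)" "(a, b) \<in> U" by (cases p) auto
  obtain r where r: "r > 0" "cball a r \<times> cball b r \<subseteq> U" using open_polydisc[OF U p(2)] by metis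
  define D where "D = (\<lambda>(x, y). deriv (\<lambda>y. f (x, y)) y)"
  have hol: "(\<lambda>y. f (x, y)) holomorphic_on cball b r" if "x \<in> cball a r" for x
    unfolding holomorphic_on_def
  proof
    fix y assume "y \<in> cball b r"
    with that r(2) have "(x, y) \<in> U" by blast
    then show "(\<lambda>y. f (x, y)) field_differentiable at y within cball b r"
      by (rule field_differentiable_at_within[OF h2])
  qed
  have Deq: "D (x, y) = contour_integral (circlepath b r) (\<lambda>u. f (x, u) / (u - y)\<^sup>2) / (2 * of_real pi * \<i>)"
    if "x \<in> ball a r" "y \<in> ball b r" for x y
    using Cauchy_contour_integral_circlepath_2[of b r "\<lambda>y. f (x, y)" y] holomorphic_on_imp_continuous_on[OF hol[of x]]
      holomorphic_on_subset[OF hol[of x] ball_subset_cball] that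
    by (simp add: D_def)
  have Dc: "continuous_on (ball a r \<times> ball b r) D"
  proof -
    have "continuous_on (ball a r \<times> ball b r) (\<lambda>p. contour_integral (circlepath b r) (\<lambda>u. f (fst p, u) / (u - snd p)\<^sup>2))"
    proof (rule continuous_on_contour_integral_circlepath)
      have "continuous_on ((ball a r \<times> ball b r) \<times> sphere b r) (\<lambda>p. f (fst (fst p), snd p))"
        by (rule continuous_on_compose2[OF cont]) (use r in \<open>auto intro!: continuous_intros subsetD[OF r(2)]\<close>)
      then show "continuous_on ((ball a r \<times> ball b r) \<times> sphere b r) (\<lambda>(p, u). f (fst p, u) / (u - snd p)\<^sup>2)"
        unfolding split_def by (intro continuous_intros) (auto simp: dist_commute)
    qed (use r in auto)
    then have "continuous_on (ball a r \<times> ball b r) (\<lambda>p. contour_integral (circlepath b r) (\<lambda>u. f (fst p, u) / (u - snd p)\<^sup>2) / (2 * of_real pi * \<i>))"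
      by (intro continuous_intros) auto
    then show ?thesis by (rule continuous_on_eq) (auto simp: Deq)
  qed
  obtain d where d: "((\<lambda>x. f (x, b)) has_field_derivative d) (at a)"
    using h1[OF p(2)] by (auto simp: field_differentiable_def)
  have "((\<lambda>(x, y). f (x, y)) has_derivative (\<lambda>(tx, ty). d * tx + blinfun_mult_right (D (a, b)) ty)) (at (a, b) within ball a r \<times> ball b r)"
  proof (rule has_derivative_partialsI[where fy = "\<lambda>x y. blinfun_mult_right (D (x, y))"])
    show "((\<lambda>x. f (x, b)) has_derivative (*) d) (at a within ball a r)"
      using d by (simp add: has_field_derivative_def has_derivative_at_withinI)
    show "((\<lambda>y. f (x, y)) has_derivative blinfun_apply (blinfun_mult_right (D (x, y)))) (at y within ball b r)"
      if "x \<in> ball a r" "y \<in> ball b r" for x y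
    proof -
      have "(\<lambda>y. f (x, y)) field_differentiable at y" by (rule h2) (use that r in auto)
      then have "((\<lambda>y. f (x, y)) has_field_derivative D (x, y)) (at y)"
        by (simp add: D_def field_differentiable_derivI)
      then show ?thesis by (auto simp: has_field_derivative_def has_derivative_at_withinI)
    qed
    have "continuous_on (ball a r \<times> ball b r) (\<lambda>p. blinfun_mult_right (D p))"
      by (rule bounded_linear.continuous_on[OF bounded_linear_blinfun_mult_right Dc])
    then show "continuous (at (a, b) within ball a r \<times> ball b r) (\<lambda>(x, y). blinfun_mult_right (D (x, y)))"
      using r by (simp add: split_def continuous_on_eq_continuous_within)
  qed (use r in auto)
  then have "(f has_derivative (\<lambda>(tx, ty). d * tx + D (a, b) * ty)) (at p)"
    using r at_within_open[of "(a, b)" "ball a r \<times> ball b r"] by (simp add: p open_Times)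
  then show "\<exists>a b. (f has_derivative (\<lambda>(u, v). a * u + b * v)) (at p)" by blast
qed

lemma holomorphic2_on_field_differentiable:
  assumes "holomorphic2_on f U" "(a, b) \<in> U"
  shows "(\<lambda>x. f (x, b)) field_differentiable at a" "(\<lambda>y. f (a, y)) field_differentiable at b"
proof -
  obtain r s where rs: "(f has_derivative (\<lambda>(u, v). r * u + s * v)) (at (a, b))"
    using assms unfolding holomorphic2_on_def by blast
  have "((\<lambda>x. (x, b)) has_derivative (\<lambda>x. (x, 0))) (at a)" by (auto intro!: derivative_eq_intros)
  from has_derivative_compose[OF this rs]
  have "((\<lambda>x. f (x, b)) has_derivative (*) r) (at a)" by (rule has_derivative_eq_rhs) (auto simp: fun_eq_iff)
  then show "(\<lambda>x. f (x, b)) field_differentiable at a"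
    unfolding field_differentiable_def has_field_derivative_def by blast
  have "((\<lambda>x. (a, x)) has_derivative (\<lambda>x. (0, x))) (at b)" by (auto intro!: derivative_eq_intros)
  from has_derivative_compose[OF this rs]
  have "((\<lambda>x. f (a, x)) has_derivative (*) s) (at b)" by (rule has_derivative_eq_rhs) (auto simp: fun_eq_iff)
  then show "(\<lambda>y. f (a, y)) field_differentiable at b"
    unfolding field_differentiable_def has_field_derivative_def by blast
qed

definition dz :: "(complex \<times> complex \<Rightarrow> complex) \<Rightarrow> complex \<times> complex \<Rightarrow> complex" where
  "dz f = (\<lambda>(x, y). deriv (\<lambda>w. f (x, w)) y)"

text \<open>Cauchy's formula writes the partial derivative as a contour integral of \<open>f\<close>, which depends
  holomorphically on each of the two variables and continuously on both.\<close>

lemma dz_holomorphic2_on: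
  assumes U: "open U" and f: "holomorphic2_on f U"
  shows "holomorphic2_on (dz f) U"
proof (rule holomorphic2_on_local)
  fix p assume "p \<in> U"
  then obtain a b where p: "p = (a, b)" "(a, b) \<in> U" by (cases p) auto
  obtain r where r: "r > 0" "cball a r \<times> cball b r \<subseteq> U" using open_polydisc[OF U p(2)] by metis
  have hol: "(\<lambda>y. f (x, y)) holomorphic_on cball b r" if "x \<in> cball a r" for x
    unfolding holomorphic_on_def
  proof
    fix y assume "y \<in> cball b r"
    with that r(2) have "(x, y) \<in> U" by blast
    then show "(\<lambda>y. f (x, y)) field_differentiable at y within cball b r"
      by (rule field_differentiable_at_within[OF holomorphic2_on_field_differentiable(2)[OF f]])
  qed
  have Deq: "dz f (x, y) = contour_integral (circlepath b r) (\<lambda>u. f (x, u) / (u - y)\<^sup>2) / (2 * of_real pi * \<i>)"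
    if "x \<in> ball a r" "y \<in> ball b r" for x y
    using Cauchy_contour_integral_circlepath_2[of b r "\<lambda>y. f (x, y)" y] holomorphic_on_imp_continuous_on[OF hol[of x]]
      holomorphic_on_subset[OF hol[of x] ball_subset_cball] that
    by (simp add: dz_def)
  have fc: "continuous_on (ball a r \<times> sphere b r) f"
    using holomorphic2_on_imp_continuous_on[OF f] by (rule continuous_on_subset) (use r in auto)
  have "holomorphic2_on (dz f) (ball a r \<times> ball b r)"
  proof (rule holomorphic2_on_Osgood)
    show "continuous_on (ball a r \<times> ball b r) (dz f)"
    proof -
      have "continuous_on (ball a r \<times> ball b r) (\<lambda>p. contour_integral (circlepath b r) (\<lambda>u. f (fst p, u) / (u - snd p)\<^sup>2))"
      proof (rule continuous_on_contour_integral_circlepath)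
        have "continuous_on ((ball a r \<times> ball b r) \<times> sphere b r) (\<lambda>p. f (fst (fst p), snd p))"
          by (rule continuous_on_compose2[OF fc]) (use r in \<open>auto intro!: continuous_intros\<close>)
        then show "continuous_on ((ball a r \<times> ball b r) \<times> sphere b r) (\<lambda>(p, u). f (fst p, u) / (u - snd p)\<^sup>2)"
          unfolding split_def by (intro continuous_intros) (auto simp: dist_commute)
      qed (use r in auto)
      then have "continuous_on (ball a r \<times> ball b r) (\<lambda>p. contour_integral (circlepath b r) (\<lambda>u. f (fst p, u) / (u - snd p)\<^sup>2) / (2 * of_real pi * \<i>))"
        by (intro continuous_intros) auto
      then show ?thesis by (rule continuous_on_eq) (auto simp: Deq)
    qed
  next
    fix x y assume xy: "(x, y) \<in> ball a r \<times> ball b r"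
    have "(\<lambda>y. deriv (\<lambda>w. f (x, w)) y) holomorphic_on ball b r"
      by (rule holomorphic_deriv) (use holomorphic_on_subset[OF hol[of x] ball_subset_cball] xy in auto)
    then show "(\<lambda>y. dz f (x, y)) field_differentiable at y"
      using xy by (auto simp: dz_def holomorphic_on_imp_differentiable_at)
    have "(\<lambda>x. contour_integral (circlepath b r) (\<lambda>u. f (x, u) / (u - y)\<^sup>2)) holomorphic_on ball a r"
    proof (rule holomorphic_contour_integral_circlepath)
      show "continuous_on (ball a r \<times> sphere b r) (\<lambda>(x, u). f (x, u) / (u - y)\<^sup>2)"
        unfolding split_def using fc xy by (auto intro!: continuous_intros simp: dist_commute)
      show "(\<lambda>x. f (x, w) / (w - y)\<^sup>2) holomorphic_on ball a r" if "w \<in> sphere b r" for w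
      proof -
        have "(\<lambda>x. f (x, w)) holomorphic_on ball a r"
          by (rule holomorphic2_on_slice_fst[OF f]) (use r that in auto)
        then show ?thesis by (intro holomorphic_intros) (use that xy in auto)
      qed
    qed (use r in auto)
    then have "(\<lambda>x. contour_integral (circlepath b r) (\<lambda>u. f (x, u) / (u - y)\<^sup>2) / (2 * of_real pi * \<i>)) holomorphic_on ball a r"
      by (intro holomorphic_intros) auto
    then have "(\<lambda>x. dz f (x, y)) holomorphic_on ball a r"
      by (rule holomorphic_transform) (use xy in \<open>auto simp: Deq\<close>)
    then show "(\<lambda>x. dz f (x, y)) field_differentiable at x"
      using xy by (auto simp: holomorphic_on_imp_differentiable_at)
  qed (auto intro: open_Times)
  then show "\<exists>V. p \<in> V \<and> holomorphic2_on (dz f) V" using p r(1) by (intro exI[of _ "ball a r \<times> ball b r"]) simp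
qed

lemma dz_has_field_derivative:
  assumes "holomorphic2_on f U" "(x, y) \<in> U"
  shows "((\<lambda>w. f (x, w)) has_field_derivative dz f (x, y)) (at y)"
  using holomorphic2_on_field_differentiable(2)[OF assms] by (simp add: dz_def field_differentiable_derivI)

text \<open>Weierstrass' theorem in two variables. The majorant gives locally uniform convergence, hence continuity of
  the sum and holomorphy in each variable, and Osgood's lemma combines them.\<close>

lemma holomorphic2_on_suminf:
  fixes u :: "nat \<Rightarrow> complex \<times> complex \<Rightarrow> complex"
  assumes U: "open U" and hol: "\<And>n. holomorphic2_on (u n) U"
    and bd: "\<And>p. p \<in> U \<Longrightarrow> \<exists>V M. open V \<and> p \<in> V \<and> summable M \<and> (\<forall>\<^sub>F n in sequentially. \<forall>x\<in>V. norm (u n x) \<le> M n)"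
  shows "holomorphic2_on (\<lambda>p. \<Sum>n. u n p) U"
proof (rule holomorphic2_on_Osgood[OF U])
  show "continuous_on U (\<lambda>p. \<Sum>n. u n p)"
  proof (rule continuous_at_imp_continuous_on, intro ballI)
    fix p assume p: "p \<in> U"
    obtain V M where V: "open V" "p \<in> V" "summable M" "\<forall>\<^sub>F n in sequentially. \<forall>x\<in>V. norm (u n x) \<le> M n"
      using bd[OF p] by blast
    have "uniform_limit V (\<lambda>n x. \<Sum>i<n. u i x) (\<lambda>x. \<Sum>i. u i x) sequentially"
      by (rule Weierstrass_m_test_ev) (use V in auto)
    then have ul: "uniform_limit (U \<inter> V) (\<lambda>n x. \<Sum>i<n. u i x) (\<lambda>x. \<Sum>i. u i x) sequentially"
      by (rule uniform_limit_on_subset) auto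
    have "continuous_on (U \<inter> V) (\<lambda>x. \<Sum>i. u i x)"
      by (rule uniform_limit_theorem[OF _ ul])
         (auto intro!: continuous_on_sum holomorphic2_on_imp_continuous_on holomorphic2_on_subset[OF hol] always_eventually)
    then show "isCont (\<lambda>p. \<Sum>n. u n p) p"
      using U V p by (simp add: continuous_on_eq_continuous_at open_Int)
  qed
next
  fix a b assume ab: "(a, b) \<in> U"
  obtain V M where V: "open V" "(a, b) \<in> V" "summable M" "\<forall>\<^sub>F n in sequentially. \<forall>x\<in>V. norm (u n x) \<le> M n"
    using bd[OF ab] by blast
  obtain r where r: "r > 0" "cball a r \<times> cball b r \<subseteq> U \<inter> V" using open_polydisc[of "U \<inter> V" a b] U V ab by auto
  have "uniform_limit V (\<lambda>n x. \<Sum>i<n. u i x) (\<lambda>x. \<Sum>i. u i x) sequentially"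
    by (rule Weierstrass_m_test_ev) (use V in auto)
  then have ul: "uniform_limit (cball a r \<times> cball b r) (\<lambda>n x. \<Sum>i<n. u i x) (\<lambda>x. \<Sum>i. u i x) sequentially"
    by (rule uniform_limit_on_subset) (use r in auto)
  have d1: "(\<lambda>x. \<Sum>n. u n (x, b)) holomorphic_on ball a r"
  proof (rule holomorphic_uniform_limit)
    show "uniform_limit (cball a r) (\<lambda>n x. \<Sum>i<n. u i (x, b)) (\<lambda>x. \<Sum>i. u i (x, b)) sequentially"
      using ul r unfolding uniform_limit_iff by (auto elim!: eventually_mono)
    have hs: "(\<lambda>x. u i (x, b)) holomorphic_on cball a r" for i
      unfolding holomorphic_on_def
    proof
      fix x assume "x \<in> cball a r"
      then have "(x, b) \<in> cball a r \<times> cball b r" using r(1) by simp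
      then have "(x, b) \<in> U" using r(2) by blast
      then show "(\<lambda>x. u i (x, b)) field_differentiable at x within cball a r"
        by (rule field_differentiable_at_within[OF holomorphic2_on_field_differentiable(1)[OF hol]])
    qed
    then show "\<forall>\<^sub>F n in sequentially. continuous_on (cball a r) (\<lambda>x. \<Sum>i<n. u i (x, b)) \<and> (\<lambda>x. \<Sum>i<n. u i (x, b)) holomorphic_on ball a r"
      by (intro always_eventually allI conjI holomorphic_on_imp_continuous_on holomorphic_on_sum hs
            holomorphic_on_subset[OF hs ball_subset_cball])
  qed auto
  then show "(\<lambda>x. \<Sum>n. u n (x, b)) field_differentiable at a"
    using r by (simp add: holomorphic_on_imp_differentiable_at)
  have d1: "(\<lambda>x. \<Sum>n. u n (a, x)) holomorphic_on ball b r"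
  proof (rule holomorphic_uniform_limit)
    show "uniform_limit (cball b r) (\<lambda>n x. \<Sum>i<n. u i (a, x)) (\<lambda>x. \<Sum>i. u i (a, x)) sequentially"
      using ul r unfolding uniform_limit_iff by (auto elim!: eventually_mono)
    have hs: "(\<lambda>x. u i (a, x)) holomorphic_on cball b r" for i
      unfolding holomorphic_on_def
    proof
      fix x assume "x \<in> cball b r"
      then have "(a, x) \<in> cball a r \<times> cball b r" using r(1) by simp
      then have "(a, x) \<in> U" using r(2) by blast
      then show "(\<lambda>x. u i (a, x)) field_differentiable at x within cball b r"
        by (rule field_differentiable_at_within[OF holomorphic2_on_field_differentiable(2)[OF hol]])
    qed
    then show "\<forall>\<^sub>F n in sequentially. continuous_on (cball b r) (\<lambda>x. \<Sum>i<n. u i (a, x)) \<and> (\<lambda>x. \<Sum>i<n. u i (a, x)) holomorphic_on ball b r"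
      by (intro always_eventually allI conjI holomorphic_on_imp_continuous_on holomorphic_on_sum hs
            holomorphic_on_subset[OF hs ball_subset_cball])
  qed auto
  then show "(\<lambda>x. \<Sum>n. u n (a, x)) field_differentiable at b"
    using r by (simp add: holomorphic_on_imp_differentiable_at)
qed

section \<open>Convergent Laurent series at the cusp\<close>

lemma dz_funpow: "(dz ^^ n) f (x, y) = (deriv ^^ n) (\<lambda>w. f (x, w)) y"
proof (induction n arbitrary: y)
  case (Suc n)
  then show ?case by (simp add: dz_def)
qed auto

lemma dz_funpow_holomorphic2_on:
  "open U \<Longrightarrow> holomorphic2_on f U \<Longrightarrow> holomorphic2_on ((dz ^^ n) f) U"
  by (induction n) (auto intro: dz_holomorphic2_on)

lemma has_sum_of_sums:
  fixes f :: "nat \<Rightarrow> complex"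
  assumes "f summable_on UNIV" "f sums a" shows "(f has_sum a) UNIV"
proof -
  have h: "(f has_sum infsum f UNIV) UNIV" using assms(1) by (rule has_sum_infsum)
  then have "f sums infsum f UNIV" by (rule has_sum_imp_sums)
  then have "infsum f UNIV = a" using assms(2) by (rule sums_unique2)
  with h show ?thesis by simp
qed

text \<open>Taylor expansion in two variables: expand in the second variable, then expand the coefficients
  in the first; Cauchy's inequalities make the double series absolutely convergent.\<close>

lemma holomorphic2_on_polydisc_power_series:
  assumes S: "holomorphic2_on S (ball 0 r \<times> ball 0 r)" and R: "0 < R" "R < r"
  obtains c :: "nat \<Rightarrow> nat \<Rightarrow> complex" where
    "\<And>q z. norm q < R \<Longrightarrow> norm z < R \<Longrightarrow> ((\<lambda>(m, n). c m n * q ^ m * z ^ n) has_sum S (q, z)) UNIV"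
proof -
  define b where "b = (\<lambda>n q. (dz ^^ n) S (q, 0) / fact n)"
  define c where "c = (\<lambda>m n. (deriv ^^ m) (b n) 0 / fact m)"
  have bh: "b n holomorphic_on ball 0 r" for n
  proof -
    have "(\<lambda>q. (dz ^^ n) S (q, 0)) holomorphic_on ball 0 r"
      by (rule holomorphic2_on_slice_fst[OF dz_funpow_holomorphic2_on[OF _ S]]) (use R in \<open>auto intro: open_Times\<close>)
    then show ?thesis unfolding b_def by (intro holomorphic_intros) auto
  qed
  have "compact (S ` (cball 0 R \<times> cball 0 R))"
    by (intro compact_continuous_image compact_Times compact_cball
          continuous_on_subset[OF holomorphic2_on_imp_continuous_on[OF S]]) (use R in auto)
  then obtain M where M: "\<And>q z. norm q \<le> R \<Longrightarrow> norm z \<le> R \<Longrightarrow> norm (S (q, z)) \<le> M"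
    unfolding compact_eq_bounded_closed bounded_iff by fastforce
  have M0: "M \<ge> 0" using M[of 0 0] R by (auto intro: order_trans[OF norm_ge_zero])
  have Sz: "(\<lambda>z. S (q, z)) holomorphic_on ball 0 r" if "norm q < r" for q
    by (rule holomorphic2_on_slice_snd[OF S]) (use that in auto)
  have sub: "ball 0 R \<subseteq> ball (0::complex) r" "cball 0 R \<subseteq> ball (0::complex) r" using R by auto
  have bb: "norm (b n q) \<le> M / R ^ n" if "norm q \<le> R" for n q
  proof -
    have "norm ((deriv ^^ n) (\<lambda>z. S (q, z)) 0) \<le> fact n * M / R ^ n"
      by (rule Cauchy_inequality)
         (use Sz[of q] that R M sub in \<open>auto intro!: holomorphic_on_imp_continuous_on dest: holomorphic_on_subset\<close>)
    then show ?thesis by (simp add: b_def dz_funpow norm_divide field_simps)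
  qed
  have cb: "norm (c m n) \<le> M / R ^ n / R ^ m" for m n
  proof -
    have "norm ((deriv ^^ m) (b n) 0) \<le> fact m * (M / R ^ n) / R ^ m"
      by (rule Cauchy_inequality)
         (use bh[of n] bb R sub in \<open>auto intro!: holomorphic_on_imp_continuous_on dest: holomorphic_on_subset\<close>)
    then show ?thesis by (simp add: c_def norm_divide field_simps)
  qed
  have geo: "((\<lambda>(m, n). c m n * q ^ m * z ^ n) summable_on UNIV)" if qz: "norm q < R" "norm z < R" for q z
  proof -
    define s t where "s = norm q / R" and "t = norm z / R"
    have st: "0 \<le> s" "s < 1" "0 \<le> t" "t < 1" using qz R by (auto simp: s_def t_def)
    have gs: "((\<lambda>n. x ^ n) has_sum 1 / (1 - x)) UNIV" if "0 \<le> x" "x < 1" for x :: real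
      by (rule sums_nonneg_imp_has_sum) (use that in \<open>auto intro: geometric_sums\<close>)
    have "(\<lambda>(m, n). s ^ m * t ^ n) summable_on Sigma UNIV (\<lambda>_. UNIV)"
    proof (rule summable_on_SigmaI)
      show "((\<lambda>n. case (m, n) of (m, n) \<Rightarrow> s ^ m * t ^ n) has_sum s ^ m * (1 / (1 - t))) UNIV" for m
        using has_sum_cmult_right[OF gs, of t "s ^ m"] st by simp
      show "(\<lambda>m. s ^ m * (1 / (1 - t))) summable_on UNIV"
        using has_sum_cmult_left[OF gs, of s "1 / (1 - t)"] st by (auto simp: summable_on_def)
    qed (use st in auto)
    then have "(\<lambda>p. M * (case p of (m, n) \<Rightarrow> s ^ m * t ^ n)) summable_on UNIV"
      using st by (intro summable_on_cmult_right) (simp add: split_def)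
    then have "(\<lambda>p. norm (case p of (m, n) \<Rightarrow> c m n * q ^ m * z ^ n)) summable_on UNIV"
    proof (rule summable_on_comparison_test)
      show "norm (case x of (m, n) \<Rightarrow> c m n * q ^ m * z ^ n) \<le> M * (case x of (m, n) \<Rightarrow> s ^ m * t ^ n)" for x
      proof (cases x)
        case (Pair m n)
        have "norm (c m n) * norm q ^ m * norm z ^ n \<le> M / R ^ n / R ^ m * norm q ^ m * norm z ^ n"
          by (intro mult_right_mono cb) auto
        then show ?thesis by (simp add: Pair norm_mult norm_power s_def t_def power_divide field_simps)
      qed
    qed auto
    then show ?thesis by (rule Infinite_Sum.abs_summable_summable)
  qed
  have "((\<lambda>(m, n). c m n * q ^ m * z ^ n) has_sum S (q, z)) UNIV" if qz: "norm q < R" "norm z < R" for q z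
  proof -
    have sm': "(\<lambda>(n, m). c m n * q ^ m * z ^ n) summable_on UNIV \<times> UNIV"
      using geo[OF qz] summable_on_swap[of "\<lambda>(m, n). c m n * q ^ m * z ^ n" UNIV UNIV] by simp
    have "((\<lambda>(n, m). c m n * q ^ m * z ^ n) has_sum S (q, z)) (Sigma UNIV (\<lambda>_. UNIV))"
    proof (rule has_sum_SigmaI)
      have b1: "(\<lambda>m. c m n * q ^ m) sums b n q" for n
        using holomorphic_power_series[OF bh[of n], of q] qz R by (simp add: c_def)
      have s1: "(\<lambda>m. c m n * q ^ m * z ^ n) summable_on UNIV" for n
        using summable_on_SigmaD1[OF sm', of n] by simp
      show *: "((\<lambda>m. case (n, m) of (n, m) \<Rightarrow> c m n * q ^ m * z ^ n) has_sum b n q * z ^ n) UNIV" for n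
      proof -
        have "(\<lambda>m. c m n * q ^ m * z ^ n) sums (b n q * z ^ n)" using b1 by (rule sums_mult2)
        from has_sum_of_sums[OF s1 this] show ?thesis by simp
      qed
      then have s2: "(\<lambda>n. b n q * z ^ n) summable_on UNIV"
        using summable_on_Sigma_banach[OF sm'] *[THEN infsumI] by simp
      have "(\<lambda>n. b n q * z ^ n) sums S (q, z)"
        using holomorphic_power_series[OF Sz, of q z] qz R by (simp add: b_def dz_funpow)
      then show "((\<lambda>n. b n q * z ^ n) has_sum S (q, z)) UNIV"
        by (rule has_sum_of_sums[OF s2])
    qed (use sm' in auto)
    then show ?thesis
      using has_sum_swap[where f = "\<lambda>(m, n). c m n * q ^ m * z ^ n" and S = "S (q, z)" and A = UNIV and B = UNIV] by simp
  qed
  then show ?thesis by (rule that)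
qed

text \<open>The double series is enumerated by natural numbers, so that the theorem on series of functions applies; on a
  polydisc of radius \<open>\<rho>\<close> the absolute values of the terms at \<open>(\<rho>, \<rho>)\<close> are a majorant.\<close>

lemma power_series_holomorphic2_on_polydisc:
  assumes sm: "\<And>q z. norm q < r \<Longrightarrow> norm z < r \<Longrightarrow> (\<lambda>(m, n). c m n * q ^ m * z ^ n) summable_on (UNIV :: (nat \<times> nat) set)"
  shows "holomorphic2_on (\<lambda>(q, z). \<Sum>\<^sub>\<infinity>(m, n)\<in>UNIV. c m n * q ^ m * (z::complex) ^ n) (ball 0 r \<times> ball 0 r)"
proof -
  define u where "u = (\<lambda>k (p :: complex \<times> complex). case prod_decode k of (m, n) \<Rightarrow> c m n * fst p ^ m * snd p ^ n)"
  have bij: "bij_betw prod_decode UNIV UNIV" by (rule bij_prod_decode)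
  have "holomorphic2_on (\<lambda>p. \<Sum>k. u k p) (ball 0 r \<times> ball 0 r)"
  proof (rule holomorphic2_on_suminf)
    show "holomorphic2_on (u k) (ball 0 r \<times> ball 0 r)" for k
      unfolding u_def by (cases "prod_decode k") (auto intro!: holomorphic2_on_mult holomorphic2_on_power)
    fix p :: "complex \<times> complex" assume p: "p \<in> ball 0 r \<times> ball 0 r"
    obtain \<rho> where \<rho>: "max (norm (fst p)) (norm (snd p)) < \<rho>" "\<rho> < r"
      using p dense[of "max (norm (fst p)) (norm (snd p))" r] by auto
    then have \<rho>0: "\<rho> > 0" by (meson le_less_trans max.cobounded1 norm_ge_zero)
    define M where "M = (\<lambda>k. norm (u k (of_real \<rho>, of_real \<rho>)))"
    have "(\<lambda>(m, n). c m n * of_real \<rho> ^ m * of_real \<rho> ^ n) summable_on UNIV"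
      by (rule sm) (use \<rho> \<rho>0 in auto)
    then have "(\<lambda>x. norm (case x of (m, n) \<Rightarrow> c m n * of_real \<rho> ^ m * of_real \<rho> ^ n)) summable_on UNIV"
      by (simp add: summable_on_iff_abs_summable_on_complex)
    then have "M summable_on UNIV"
      using summable_on_reindex_bij_betw[OF bij, of "\<lambda>x. norm (case x of (m, n) \<Rightarrow> c m n * of_real \<rho> ^ m * of_real \<rho> ^ n)"]
      by (simp add: M_def u_def)
    then have sM: "summable M" by (rule summable_on_imp_summable)
    show "\<exists>V M. open V \<and> p \<in> V \<and> summable M \<and> (\<forall>\<^sub>F n in sequentially. \<forall>x\<in>V. norm (u n x) \<le> M n)"
    proof (intro exI conjI always_eventually allI ballI)
      show "open (ball 0 \<rho> \<times> ball 0 \<rho> :: (complex \<times> complex) set)" by (intro open_Times) auto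
      show "p \<in> ball 0 \<rho> \<times> ball 0 \<rho>" using \<rho> by (cases p) auto
      show "norm (u k x) \<le> M k" if "x \<in> ball 0 \<rho> \<times> ball 0 \<rho>" for k x
        using that \<rho>0 by (auto simp: M_def u_def norm_mult norm_power split: prod.split intro!: mult_mono power_mono)
    qed (rule sM)
  qed (auto intro: open_Times)
  then show ?thesis
  proof (rule holomorphic2_on_transform)
    fix p :: "complex \<times> complex" assume p: "p \<in> ball 0 r \<times> ball 0 r"
    have "(\<lambda>(m, n). c m n * fst p ^ m * snd p ^ n) summable_on UNIV"
      by (rule sm) (use p in auto)
    then have "((\<lambda>(m, n). c m n * fst p ^ m * snd p ^ n) has_sum (\<Sum>\<^sub>\<infinity>(m, n)\<in>UNIV. c m n * fst p ^ m * snd p ^ n)) UNIV"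
      by (rule has_sum_infsum)
    then have "((\<lambda>k. u k p) has_sum (\<Sum>\<^sub>\<infinity>(m, n)\<in>UNIV. c m n * fst p ^ m * snd p ^ n)) UNIV"
      using has_sum_reindex_bij_betw[OF bij, of "\<lambda>(m, n). c m n * fst p ^ m * snd p ^ n"]
      by (simp add: u_def)
    then have "(\<lambda>k. u k p) sums (\<Sum>\<^sub>\<infinity>(m, n)\<in>UNIV. c m n * fst p ^ m * snd p ^ n)"
      by (rule has_sum_imp_sums)
    then show "(\<Sum>k. u k p) = (case p of (q, z) \<Rightarrow> \<Sum>\<^sub>\<infinity>(m, n)\<in>UNIV. c m n * q ^ m * z ^ n)"
      by (simp add: sums_iff split_def)
  qed (auto intro: open_Times)
qed

abbreviation nome :: "complex \<Rightarrow> complex" where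
  "nome \<tau> \<equiv> exp (2 * of_real pi * \<i> * \<tau>)"

text \<open>Replacing coefficients by a holomorphic function of \<open>(q, z)\<close> makes closure under sums and products
  immediate and gives access to Cauchy's formula near the cusp.\<close>

lemma convergent_laurent_qz_iff:
  "convergent_laurent_qz f \<longleftrightarrow>
     (\<exists>S r N. r > 0 \<and> holomorphic2_on S (ball 0 r \<times> ball 0 r) \<and>
        (\<forall>\<tau> z. (\<tau>, z) \<in> regular_domain \<longrightarrow> norm (nome \<tau>) < r \<longrightarrow> norm z < r \<longrightarrow> f (\<tau>, z) = S (nome \<tau>, z) / z ^ N))"
  (is "_ \<longleftrightarrow> ?R")
proof
  assume "convergent_laurent_qz f"
  then obtain c :: "nat \<Rightarrow> nat \<Rightarrow> complex" and r N where r: "r > 0"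
    "\<And>q z. norm q < r \<Longrightarrow> norm z < r \<Longrightarrow> (\<lambda>(m, n). c m n * q ^ m * z ^ n) summable_on UNIV"
    "\<And>\<tau> z. (\<tau>, z) \<in> regular_domain \<Longrightarrow> norm (nome \<tau>) < r \<Longrightarrow> norm z < r \<Longrightarrow>
        f (\<tau>, z) = (\<Sum>\<^sub>\<infinity>(m, n)\<in>UNIV. c m n * nome \<tau> ^ m * z ^ n) / z ^ N"
    unfolding convergent_laurent_qz_def by blast
  show ?R
    by (rule exI[of _ "\<lambda>(q, z). \<Sum>\<^sub>\<infinity>(m, n)\<in>UNIV. c m n * q ^ m * z ^ n"], rule exI[of _ r], rule exI[of _ N])
       (use r power_series_holomorphic2_on_polydisc[of r c] in auto)
next
  assume ?R
  then obtain S r N where r: "r > 0" "holomorphic2_on S (ball 0 r \<times> ball 0 r)"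
    "\<And>\<tau> z. (\<tau>, z) \<in> regular_domain \<Longrightarrow> norm (nome \<tau>) < r \<Longrightarrow> norm z < r \<Longrightarrow> f (\<tau>, z) = S (nome \<tau>, z) / z ^ N"
    by blast
  obtain c :: "nat \<Rightarrow> nat \<Rightarrow> complex" where
    c: "\<And>q z. norm q < r / 2 \<Longrightarrow> norm z < r / 2 \<Longrightarrow> ((\<lambda>(m, n). c m n * q ^ m * z ^ n) has_sum S (q, z)) UNIV"
    using holomorphic2_on_polydisc_power_series[OF r(2), of "r / 2"] r(1) by auto
  show "convergent_laurent_qz f" unfolding convergent_laurent_qz_def
  proof (intro exI[of _ c] exI[of _ "r / 2"] exI[of _ N] conjI allI impI)
    show "(\<lambda>(m, n). c m n * q ^ m * z ^ n) summable_on UNIV" if "norm q < r / 2" "norm z < r / 2" for q z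
      using c[OF that] by (rule has_sum_imp_summable)
    show "f (\<tau>, z) = (\<Sum>\<^sub>\<infinity>(m, n)\<in>UNIV. c m n * nome \<tau> ^ m * z ^ n) / z ^ N"
      if "(\<tau>, z) \<in> regular_domain" "norm (nome \<tau>) < r / 2" "norm z < r / 2" for \<tau> z
      using r(3)[OF that(1)] infsumI[OF c[OF that(2,3)]] that(2,3) r(1) by simp
  qed (use r in auto)
qed

lemma convergent_laurent_qz_const: "convergent_laurent_qz (\<lambda>_. c)"
  unfolding convergent_laurent_qz_iff
  by (rule exI[of _ "\<lambda>_. c"], rule exI[of _ 1], rule exI[of _ 0]) auto

lemma convergent_laurent_qz_mult:
  assumes "convergent_laurent_qz f" "convergent_laurent_qz g"
  shows "convergent_laurent_qz (\<lambda>p. f p * g p)"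
proof -
  obtain S r N where r: "r > 0" "holomorphic2_on S (ball 0 r \<times> ball 0 r)"
    "\<And>\<tau> z. (\<tau>, z) \<in> regular_domain \<Longrightarrow> norm (nome \<tau>) < r \<Longrightarrow> norm z < r \<Longrightarrow> f (\<tau>, z) = S (nome \<tau>, z) / z ^ N"
    using assms(1) unfolding convergent_laurent_qz_iff by blast
  obtain S' r' N' where r': "r' > 0" "holomorphic2_on S' (ball 0 r' \<times> ball 0 r')"
    "\<And>\<tau> z. (\<tau>, z) \<in> regular_domain \<Longrightarrow> norm (nome \<tau>) < r' \<Longrightarrow> norm z < r' \<Longrightarrow> g (\<tau>, z) = S' (nome \<tau>, z) / z ^ N'"
    using assms(2) unfolding convergent_laurent_qz_iff by blast
  have "holomorphic2_on (\<lambda>p. S p * S' p) (ball 0 (min r r') \<times> ball 0 (min r r'))"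
    by (intro holomorphic2_on_mult holomorphic2_on_subset[OF r(2)] holomorphic2_on_subset[OF r'(2)]) auto
  then show ?thesis unfolding convergent_laurent_qz_iff
    by (intro exI[of _ "\<lambda>p. S p * S' p"] exI[of _ "min r r'"] exI[of _ "N + N'"])
       (use r r' in \<open>auto simp: power_add\<close>)
qed

lemma convergent_laurent_qz_add:
  assumes "convergent_laurent_qz f" "convergent_laurent_qz g"
  shows "convergent_laurent_qz (\<lambda>p. f p + g p)"
proof -
  obtain S r N where r: "r > 0" "holomorphic2_on S (ball 0 r \<times> ball 0 r)"
    "\<And>\<tau> z. (\<tau>, z) \<in> regular_domain \<Longrightarrow> norm (nome \<tau>) < r \<Longrightarrow> norm z < r \<Longrightarrow> f (\<tau>, z) = S (nome \<tau>, z) / z ^ N"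
    using assms(1) unfolding convergent_laurent_qz_iff by blast
  obtain S' r' N' where r': "r' > 0" "holomorphic2_on S' (ball 0 r' \<times> ball 0 r')"
    "\<And>\<tau> z. (\<tau>, z) \<in> regular_domain \<Longrightarrow> norm (nome \<tau>) < r' \<Longrightarrow> norm z < r' \<Longrightarrow> g (\<tau>, z) = S' (nome \<tau>, z) / z ^ N'"
    using assms(2) unfolding convergent_laurent_qz_iff by blast
  have "holomorphic2_on (\<lambda>p. S p * snd p ^ N' + S' p * snd p ^ N) (ball 0 (min r r') \<times> ball 0 (min r r'))"
    by (intro holomorphic2_on_mult holomorphic2_on_add holomorphic2_on_power holomorphic2_on_snd
         holomorphic2_on_subset[OF r(2)] holomorphic2_on_subset[OF r'(2)]) auto
  moreover have "z \<noteq> 0" if "(\<tau>, z) \<in> regular_domain" for \<tau> z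
  proof
    assume "z = 0"
    then have "z \<in> period_lattice \<tau>" unfolding period_lattice_def by (auto intro!: exI[of _ 0])
    with that show False by (auto simp: regular_domain_def)
  qed
  ultimately show ?thesis unfolding convergent_laurent_qz_iff
    by (intro exI[of _ "\<lambda>p. S p * snd p ^ N' + S' p * snd p ^ N"] exI[of _ "min r r'"] exI[of _ "N + N'"])
       (use r r' in \<open>auto simp: power_add field_simps\<close>)
qed

section \<open>Partial fractions of the cotangent and its derivatives\<close>

text \<open>The symmetric sum of \<open>1/(w + b)\<^sup>n\<close> over all integers \<open>b\<close>, a derivative of \<open>\<pi> cot \<pi>w\<close>. The half sums over \<open>b \<ge> 0\<close>
  and \<open>b < 0\<close> are polygamma functions at \<open>w\<close> and \<open>1 - w\<close>.\<close>

definition int_pole_sum :: "nat \<Rightarrow> complex \<Rightarrow> complex" where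
  "int_pole_sum n w = ((-1) ^ n * Polygamma (n - 1) w + Polygamma (n - 1) (1 - w)) / fact (n - 1)"

lemma symmetric_int_sum:
  fixes f :: "int \<Rightarrow> 'a::comm_monoid_add"
  shows "(\<Sum>b = - int B..int B. f b) = f 0 + (\<Sum>j<B. f (1 + int j) + f (- 1 - int j))"
proof (induction B)
  case (Suc B)
  have "{- int (Suc B)..int (Suc B)} = insert (1 + int B) (insert (- 1 - int B) {- int B..int B})" by auto
  then have "(\<Sum>b = - int (Suc B)..int (Suc B). f b) = f (1 + int B) + (f (- 1 - int B) + (\<Sum>b = - int B..int B. f b))"
    by (simp only:) (subst sum.insert; simp)+
  then show ?case using Suc by (simp add: ac_simps)
qed simp

lemma not_Int_shift:
  fixes w :: complex
  assumes "w \<notin> \<int>" shows "w + of_int b \<noteq> 0" "w + of_nat j \<noteq> 0" "1 - w + of_nat j \<noteq> 0" "w \<notin> \<int>\<^sub>\<le>\<^sub>0" "1 - w \<notin> \<int>\<^sub>\<le>\<^sub>0" "1 - w \<noteq> 0" "w \<noteq> 0"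
proof -
  have i: "w \<noteq> of_int k" for k using assms by auto
  show "w + of_int b \<noteq> 0" using i[of "-b"] by (metis add_eq_0_iff2 of_int_minus)
  show "w + of_nat j \<noteq> 0" using i[of "- int j"] by (metis add_eq_0_iff2 of_int_minus of_int_of_nat_eq)
  show "1 - w + of_nat j \<noteq> 0" using i[of "1 + int j"] by (auto simp: algebra_simps)
  show "w \<notin> \<int>\<^sub>\<le>\<^sub>0" using assms nonpos_Ints_Int by blast
  show "1 - w \<notin> \<int>\<^sub>\<le>\<^sub>0" using assms nonpos_Ints_Int Ints_diff[of 1 "1 - w"] by auto
  show "1 - w \<noteq> 0" "w \<noteq> 0" using i[of 1] i[of 0] by auto
qed

text \<open>For \<open>n = 1\<close> the two half sums diverge, but only by the same logarithm, which cancels.\<close>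

lemma int_pole_sum_LIMSEQ:
  assumes w: "w \<notin> \<int>" and n: "n \<ge> 1"
  shows "(\<lambda>B. \<Sum>b = - int B..int B. 1 / (w + of_int b) ^ n) \<longlonglongrightarrow> int_pole_sum n w"
proof -
  note nz = not_Int_shift[OF w]
  define P where "P = (\<lambda>B. \<Sum>j<B. inverse ((w + of_nat j) ^ n))"
  define Q where "Q = (\<lambda>B. \<Sum>j<B. inverse ((1 - w + of_nat j) ^ n))"
  have eq: "(\<Sum>b = - int B..int B. 1 / (w + of_int b) ^ n) = P B + (-1) ^ n * Q B + inverse ((w + of_nat B) ^ n)" for B
  proof -
    have 1: "P (Suc B) = 1 / w ^ n + (\<Sum>j<B. 1 / (w + of_int (1 + int j)) ^ n)"
      unfolding P_def by (subst sum.lessThan_Suc_shift) (simp add: inverse_eq_divide add_ac)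
    have 2: "(\<Sum>j<B. 1 / (w + of_int (- 1 - int j)) ^ n) = (-1) ^ n * Q B"
      unfolding Q_def sum_distrib_left
    proof (rule sum.cong)
      fix j
      have "w + of_int (- 1 - int j) = - (1 - w + of_nat j)" by simp
      then have "(w + of_int (- 1 - int j)) ^ n = (-1) ^ n * (1 - w + of_nat j) ^ n"
        by (metis power_minus)
      then show "1 / (w + of_int (- 1 - int j)) ^ n = (-1) ^ n * inverse ((1 - w + of_nat j) ^ n)"
        by (simp only:) (cases "even n"; simp add: divide_inverse)
    qed simp
    have "(\<Sum>b = - int B..int B. 1 / (w + of_int b) ^ n) = P (Suc B) + (-1) ^ n * Q B"
      unfolding symmetric_int_sum 1 sum.distrib 2 by (simp add: add_ac)
    also have "P (Suc B) = P B + inverse ((w + of_nat B) ^ n)" by (simp add: P_def)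
    finally show ?thesis by (simp add: add_ac)
  qed
  have "filterlim (\<lambda>B. w + of_nat B) at_infinity sequentially"
    by (intro tendsto_add_filterlim_at_infinity[OF tendsto_const] tendsto_of_nat)
  then have "(\<lambda>B. inverse (w + of_nat B)) \<longlonglongrightarrow> 0"
    by (rule filterlim_compose[OF tendsto_inverse_0])
  from tendsto_power[OF this, of n] have last: "(\<lambda>B. inverse ((w + of_nat B) ^ n)) \<longlonglongrightarrow> 0"
    using n by (simp add: power_inverse zero_power)
  have main: "(\<lambda>B. P B + (-1) ^ n * Q B) \<longlonglongrightarrow> int_pole_sum n w"
  proof (cases "n = 1")
    case True
    have a: "(\<lambda>m. of_real (ln (real m)) - Q m) \<longlonglongrightarrow> Digamma (1 - w)"
      using Digamma_LIMSEQ[OF nz(6)] True by (simp add: Q_def)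
    have b: "(\<lambda>m. of_real (ln (real m)) - P m) \<longlonglongrightarrow> Digamma w"
      using Digamma_LIMSEQ[OF nz(7)] True by (simp add: P_def)
    show ?thesis using tendsto_diff[OF a b] True by (simp add: int_pole_sum_def)
  next
    case False
    define k where "k = n - 1"
    have k: "n = Suc k" "k > 0" using False n by (auto simp: k_def)
    have a: "Q \<longlonglongrightarrow> (-1) ^ Suc k * Polygamma k (1 - w) / fact k"
      using Polygamma_LIMSEQ[OF nz(6) k(2)] unfolding sums_def Q_def k(1) .
    have b: "P \<longlonglongrightarrow> (-1) ^ Suc k * Polygamma k w / fact k"
      using Polygamma_LIMSEQ[OF nz(7) k(2)] unfolding sums_def P_def k(1) .
    have "(\<lambda>B. P B + (-1) ^ n * Q B) \<longlonglongrightarrow> (-1) ^ Suc k * Polygamma k w / fact k + (-1) ^ n * ((-1) ^ Suc k * Polygamma k (1 - w) / fact k)"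
      by (intro tendsto_intros a b)
    also have "(-1) ^ Suc k * Polygamma k w / fact k + (-1) ^ n * ((-1) ^ Suc k * Polygamma k (1 - w) / fact k) = int_pole_sum n w"
      unfolding k(1) int_pole_sum_def by (simp add: add_divide_distrib diff_divide_distrib flip: mult.assoc power_mult_distrib)
    finally show ?thesis .
  qed
  show ?thesis unfolding eq using tendsto_add[OF main last] by simp
qed

lemma int_pole_sum_has_field_derivative:
  assumes w: "w \<notin> \<int>" and n: "n \<ge> 1"
  shows "(int_pole_sum n has_field_derivative - of_nat n * int_pole_sum (Suc n) w) (at w)"
proof -
  note nz = not_Int_shift[OF w]
  obtain k where k: "n = Suc k" using n by (cases n) auto
  have d1: "(Polygamma k has_field_derivative Polygamma (Suc k) w) (at w)"
    by (rule has_field_derivative_Polygamma[OF nz(4)])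
  have "((\<lambda>w. Polygamma k (1 - w)) has_field_derivative Polygamma (Suc k) (1 - w) * (- 1)) (at w)"
    by (rule DERIV_chain2[where f = "Polygamma k" and g = "\<lambda>w. 1 - w", OF has_field_derivative_Polygamma[OF nz(5)]]) (auto intro!: derivative_eq_intros)
  then have "((\<lambda>w. ((-1) ^ Suc k * Polygamma k w + Polygamma k (1 - w)) / fact k) has_field_derivative
      ((-1) ^ Suc k * Polygamma (Suc k) w + Polygamma (Suc k) (1 - w) * (- 1)) / fact k) (at w)"
    by (intro DERIV_cdivide DERIV_add DERIV_cmult d1)
  moreover have "((-1) ^ Suc k * Polygamma (Suc k) w + Polygamma (Suc k) (1 - w) * (- 1)) / fact k
      = - of_nat n * int_pole_sum (Suc n) w"
    using of_nat_neq_0[of k, where 'a = complex]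
    unfolding int_pole_sum_def k by (simp add: divide_simps) (simp add: algebra_simps)
  moreover have "int_pole_sum n = (\<lambda>w. ((-1) ^ Suc k * Polygamma k w + Polygamma k (1 - w)) / fact k)"
    by (simp add: fun_eq_iff int_pole_sum_def k)
  ultimately show ?thesis by metis
qed

text \<open>The logarithmic derivative of the reflection formula for the Gamma function.\<close>

lemma int_pole_sum_1_cot:
  assumes w: "w \<notin> \<int>"
  shows "int_pole_sum 1 w * sin (of_real pi * w) = of_real pi * cos (of_real pi * w)"
proof -
  note nz = not_Int_shift[OF w]
  have "((\<lambda>z. rGamma z * rGamma (1 - z)) has_field_derivative
       - rGamma w * Digamma w * rGamma (1 - w) + (- rGamma (1 - w) * Digamma (1 - w) * (- 1)) * rGamma w) (at w)"
    by (rule DERIV_mult[OF has_field_derivative_rGamma_no_nonpos_int[OF nz(4)]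
         DERIV_chain2[where f = rGamma and g = "\<lambda>w. 1 - w", OF has_field_derivative_rGamma_no_nonpos_int[OF nz(5)]]]) (auto intro!: derivative_eq_intros)
  moreover have "((\<lambda>z. rGamma z * rGamma (1 - z)) has_field_derivative cos (of_real pi * w)) (at w)"
    unfolding rGamma_reflection_complex by (auto intro!: derivative_eq_intros)
  ultimately have "cos (of_real pi * w) = (Digamma (1 - w) - Digamma w) * (rGamma w * rGamma (1 - w))"
    by (auto dest: DERIV_unique simp: algebra_simps)
  then show ?thesis unfolding rGamma_reflection_complex by (simp add: int_pole_sum_def field_simps)
qed

lemma exp_2pi_i_eq_1_iff: "exp (2 * of_real pi * \<i> * w) = 1 \<longleftrightarrow> w \<in> \<int>"
proof
  assume "exp (2 * of_real pi * \<i> * w) = 1"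
  then obtain n :: int where n: "Im (2 * of_real pi * \<i> * w) = of_int (2 * n) * pi" "Re (2 * of_real pi * \<i> * w) = 0"
    by (auto simp: exp_eq_1)
  then have "w = of_int n" by (auto simp: complex_eq_iff)
  then show "w \<in> \<int>" by simp
next
  assume "w \<in> \<int>"
  then obtain n where "w = of_int n" by (auto elim: Ints_cases)
  then show "exp (2 * of_real pi * \<i> * w) = 1" by (auto simp: exp_eq_1)
qed

text \<open>The closed form of the geometric series \<open>X + X\<^sup>2 + X\<^sup>3 + \<dots>\<close> that appears in the expansion of the cotangent at \<open>\<i>\<infinity>\<close>.\<close>

definition lambert :: "complex \<Rightarrow> complex" where "lambert X = X / (1 - X)"

text \<open>The cotangent in terms of \<open>exp (2\<pi>\<i>w)\<close>; its two limits for \<open>Im w \<rightarrow> \<plusminus>\<infinity>\<close> are the source of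
  the quasi-periodicity of the first Eisenstein series.\<close>

lemma int_pole_sum_1_lambert:
  assumes w: "w \<notin> \<int>"
  shows "int_pole_sum 1 w = - of_real pi * \<i> - 2 * of_real pi * \<i> * lambert (nome w)"
proof -
  define E where "E = exp (\<i> * of_real pi * w)"
  have E0: "E \<noteq> 0" by (simp add: E_def)
  have qE: "nome w = E ^ 2" unfolding E_def by (simp add: mult_ac flip: exp_of_nat_mult)
  have ne: "E ^ 2 \<noteq> 1" using exp_2pi_i_eq_1_iff[of w] w qE by simp
  have s: "sin (of_real pi * w) = (E - 1 / E) / (2 * \<i>)"
    by (simp add: sin_exp_eq E_def exp_minus inverse_eq_divide mult.assoc)
  have c: "cos (of_real pi * w) = (E + 1 / E) / 2"
    by (simp add: cos_exp_eq E_def exp_minus inverse_eq_divide mult.assoc)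
  have "int_pole_sum 1 w * ((E ^ 2 - 1) / (2 * \<i> * E)) = of_real pi * ((E ^ 2 + 1) / (2 * E))"
    using int_pole_sum_1_cot[OF w] unfolding s c using E0 by (simp add: field_simps power2_eq_square)
  then have "2 * E * (int_pole_sum 1 w * (E ^ 2 - 1)) = 2 * E * (of_real pi * \<i> * (E ^ 2 + 1))"
    using E0 by (simp add: field_simps)
  then have "int_pole_sum 1 w * (E ^ 2 - 1) = of_real pi * \<i> * (E ^ 2 + 1)"
    using mult_left_cancel[of "2 * E"] E0 by simp
  moreover have "(- of_real pi * \<i> - 2 * of_real pi * \<i> * lambert (nome w)) * (E ^ 2 - 1) = of_real pi * \<i> * (E ^ 2 + 1)"
    using ne unfolding qE lambert_def by (simp add: divide_simps) (simp add: algebra_simps)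
  ultimately show ?thesis using ne by (metis eq_iff_diff_eq_0 mult_right_cancel)
qed

lemma int_pole_sum_1_minus:
  assumes w: "w \<notin> \<int>" shows "int_pole_sum 1 (- w) = - int_pole_sum 1 w"
proof -
  have s: "sin (of_real pi * w) \<noteq> 0"
  proof
    assume 0: "sin (of_real pi * w) = 0"
    then have 1: "cos (of_real pi * w) = 0" using int_pole_sum_1_cot[OF w] by simp
    have "1 = (sin (of_real pi * w))\<^sup>2 + (cos (of_real pi * w))\<^sup>2" by (simp only: sin_cos_squared_add)
    then show False unfolding 0 1 by simp
  qed
  have "- w \<notin> \<int>" using w by simp
  from int_pole_sum_1_cot[OF this] int_pole_sum_1_cot[OF w]
  have "int_pole_sum 1 (- w) * sin (of_real pi * w) = - int_pole_sum 1 w * sin (of_real pi * w)"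
    by simp (metis add.inverse_inverse)
  then have "(int_pole_sum 1 (- w) + int_pole_sum 1 w) * sin (of_real pi * w) = 0"
    by (simp add: algebra_simps)
  with s show ?thesis by (simp add: add_eq_0_iff2)
qed

section \<open>Lambert series\<close>

definition lambert_domain :: "(complex \<times> complex) set" where
  "lambert_domain = {(q, x). norm q < 1 \<and> (\<forall>a. x * q ^ Suc a \<noteq> 1)}"

definition lambert_series :: "complex \<times> complex \<Rightarrow> complex" where
  "lambert_series = (\<lambda>(q, x). \<Sum>a. lambert (x * q ^ Suc a))"

lemma lambert_bound: "norm X \<le> 1 / 2 \<Longrightarrow> norm (lambert X) \<le> 2 * norm X"
proof -
  assume X: "norm X \<le> 1 / 2"
  have "1 - norm X \<le> norm (1 - X)" using norm_triangle_ineq2[of 1 X] by simp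
  then have d: "norm (1 - X) \<ge> 1 / 2" using X by linarith
  have "norm X / norm (1 - X) \<le> norm X / (1 / 2)"
    by (rule divide_left_mono) (use d in auto)
  then show ?thesis by (simp add: lambert_def norm_divide)
qed

text \<open>Near \<open>(q\<^sub>0, x\<^sub>0)\<close> the arguments are bounded by a geometric sequence, and a Lambert term is at most twice its
  argument as soon as that is at most \<open>1/2\<close>.\<close>

lemma lambert_majorant:
  assumes q0: "norm (q0 :: complex) < 1"
  obtains V M where "open V" "(q0, x0) \<in> V" "summable M" "\<And>q x. (q, x) \<in> V \<Longrightarrow> norm q < 1"
    "\<forall>\<^sub>F a in sequentially. \<forall>(q, x)\<in>V. norm (x * q ^ Suc a) \<le> 1 / 2 \<and> norm (lambert (x * q ^ Suc a)) \<le> M a"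
proof -
  obtain \<rho> where \<rho>: "norm q0 < \<rho>" "\<rho> < 1" using dense[OF q0] by blast
  have \<rho>0: "\<rho> > 0" using \<rho>(1) by (meson le_less_trans norm_ge_zero)
  define X where "X = norm (x0 :: complex) + 1"
  have X: "X > 0" unfolding X_def by (simp add: add_nonneg_pos)
  define M where "M = (\<lambda>a. 2 * (X * \<rho> ^ Suc a))"
  have bd: "norm (x * q ^ Suc a) \<le> X * \<rho> ^ Suc a" if "(q, x) \<in> ball 0 \<rho> \<times> ball 0 X" for q x :: complex and a
    unfolding norm_mult norm_power by (intro mult_mono power_mono) (use that X in auto)
  have sr: "summable (\<lambda>a. \<rho> ^ a)" using \<rho> \<rho>0 by (simp add: summable_geometric)
  then have sM: "summable M"
    unfolding M_def power_Suc by (intro summable_mult)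
  have "(\<lambda>a. X * \<rho> ^ Suc a) \<longlonglongrightarrow> X * 0"
    by (intro tendsto_mult tendsto_const LIMSEQ_Suc LIMSEQ_realpow_zero) (use \<rho> \<rho>0 in auto)
  then have ev: "\<forall>\<^sub>F a in sequentially. X * \<rho> ^ Suc a < 1 / 2"
    by (rule order_tendstoD) simp
  show ?thesis
  proof (rule that[of "ball 0 \<rho> \<times> ball 0 X" M])
    show "open (ball 0 \<rho> \<times> ball 0 X :: (complex \<times> complex) set)" by (intro open_Times) auto
    show "(q0, x0) \<in> ball 0 \<rho> \<times> ball 0 X" using \<rho> by (auto simp: X_def)
    show "norm q < 1" if "(q, x) \<in> ball 0 \<rho> \<times> ball 0 X" for q x using that \<rho> by auto
    show "\<forall>\<^sub>F a in sequentially. \<forall>(q, x)\<in>ball 0 \<rho> \<times> ball 0 X. norm (x * q ^ Suc a) \<le> 1 / 2 \<and> norm (lambert (x * q ^ Suc a)) \<le> M a"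
      using ev
    proof eventually_elim
      case (elim a)
      show ?case
      proof safe
        fix q x :: complex assume qx: "q \<in> ball 0 \<rho>" "x \<in> ball 0 X"
        then have b: "norm (x * q ^ Suc a) \<le> X * \<rho> ^ Suc a" using bd[of q x a] by blast
        then show h: "norm (x * q ^ Suc a) \<le> 1 / 2" using elim by linarith
        show "norm (lambert (x * q ^ Suc a)) \<le> M a"
          using lambert_bound[OF h] b unfolding M_def by linarith
      qed
    qed
  qed (rule sM)
qed

lemma open_lambert_domain: "open lambert_domain"
proof (subst open_subopen, intro ballI)
  fix p assume "p \<in> lambert_domain"
  then obtain q0 x0 where p: "p = (q0, x0)" "norm q0 < 1" "\<And>a. x0 * q0 ^ Suc a \<noteq> 1"
    by (auto simp: lambert_domain_def)
  obtain V M where V: "open V" "(q0, x0) \<in> V" "summable M" "\<And>q x. (q, x) \<in> V \<Longrightarrow> norm q < 1"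
    "\<forall>\<^sub>F a in sequentially. \<forall>(q, x)\<in>V. norm (x * q ^ Suc a) \<le> 1 / 2 \<and> norm (lambert (x * q ^ Suc a)) \<le> M a"
    by (rule lambert_majorant[OF p(2), of x0]) (rule that)
  from V(5) obtain N where "\<forall>a\<ge>N. \<forall>(q, x)\<in>V. norm (x * q ^ Suc a) \<le> 1 / 2 \<and> norm (lambert (x * q ^ Suc a)) \<le> M a"
    unfolding eventually_sequentially by (rule exE)
  then have N: "norm (x * q ^ Suc a) \<le> 1 / 2" if "a \<ge> N" "(q, x) \<in> V" for a q x
    using that by blast
  define W where "W = V \<inter> (\<Inter>a\<in>{..<N}. {p. snd p * fst p ^ Suc a \<noteq> 1})"
  have "open W" unfolding W_def
    by (intro open_Int V(1) open_INT ballI open_Collect_neq continuous_intros) auto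
  moreover have "p \<in> W" using V(2) p by (auto simp: W_def)
  moreover have "W \<subseteq> lambert_domain"
  proof
    fix w assume w: "w \<in> W"
    obtain q x where qx: "w = (q, x)" by (cases w)
    have "x * q ^ Suc a \<noteq> 1" for a
    proof (cases "a < N")
      case True then show ?thesis using w by (auto simp: W_def qx)
    next
      case False
      then have "norm (x * q ^ Suc a) \<le> 1 / 2" using N[of a q x] w by (auto simp: W_def qx)
      then show ?thesis by auto
    qed
    then show "w \<in> lambert_domain" using V(4) w by (auto simp: W_def qx lambert_domain_def)
  qed
  ultimately show "\<exists>T. open T \<and> p \<in> T \<and> T \<subseteq> lambert_domain" by blast
qed

lemma lambert_series_holomorphic2_on: "holomorphic2_on lambert_series lambert_domain"
proof -
  have "holomorphic2_on (\<lambda>p. \<Sum>a. lambert (snd p * fst p ^ Suc a)) lambert_domain"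
  proof (rule holomorphic2_on_suminf[OF open_lambert_domain])
    show "holomorphic2_on (\<lambda>p. lambert (snd p * fst p ^ Suc a)) lambert_domain" for a
      unfolding lambert_def
      by (intro holomorphic2_on_divide holomorphic2_on_mult holomorphic2_on_diff holomorphic2_on_power
           holomorphic2_on_fst holomorphic2_on_snd holomorphic2_on_const) (auto simp: lambert_domain_def)
    fix p assume "p \<in> lambert_domain"
    then obtain q0 x0 where p: "p = (q0, x0)" "norm q0 < 1" by (auto simp: lambert_domain_def)
    obtain V M where V: "open V" "(q0, x0) \<in> V" "summable M" "\<And>q x. (q, x) \<in> V \<Longrightarrow> norm q < 1"
      "\<forall>\<^sub>F a in sequentially. \<forall>(q, x)\<in>V. norm (x * q ^ Suc a) \<le> 1 / 2 \<and> norm (lambert (x * q ^ Suc a)) \<le> M a"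
      by (rule lambert_majorant[OF p(2), of x0]) (rule that)
    have "\<forall>\<^sub>F n in sequentially. \<forall>x\<in>V. norm (lambert (snd x * fst x ^ Suc n)) \<le> M n"
      using V(5) by (rule eventually_mono) auto
    then show "\<exists>V M. open V \<and> p \<in> V \<and> summable M \<and> (\<forall>\<^sub>F n in sequentially. \<forall>x\<in>V. norm (lambert (snd x * fst x ^ Suc n)) \<le> M n)"
      using V(1-3) p(1) by blast
  qed
  then show ?thesis by (simp add: lambert_series_def split_def)
qed

section \<open>The regular part of the first Eisenstein series\<close>

text \<open>The difference of the first Eisenstein series and \<open>1/z\<close>, as a function of \<open>q\<close> and \<open>z\<close>. The two digamma values
  are the row \<open>a = 0\<close>, that is \<open>\<pi> cot \<pi>z\<close> without its pole at 0; the Lambert series collect the rows \<open>\<plusminus>a\<close> in pairs.\<close>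

definition e1_regular :: "complex \<times> complex \<Rightarrow> complex" where
  "e1_regular = (\<lambda>(q, z). Digamma (1 - z) - Digamma (1 + z)
      - 2 * of_real pi * \<i> * (lambert_series (q, nome z) - lambert_series (q, nome (- z))))"

text \<open>For \<open>q = exp (2\<pi>\<i>\<tau>)\<close> this removes exactly the nonzero lattice points. Points with \<open>z = 0\<close> and the cusp \<open>q = 0\<close>
  are kept, so that Laurent expansions in \<open>z\<close> and \<open>q\<close> can be read off at \<open>(0, 0)\<close>.\<close>

definition e1_domain :: "(complex \<times> complex) set" where
  "e1_domain = {(q, z). 1 - z \<notin> \<int>\<^sub>\<le>\<^sub>0 \<and> 1 + z \<notin> \<int>\<^sub>\<le>\<^sub>0 \<and> (q, nome z) \<in> lambert_domain \<and> (q, nome (- z)) \<in> lambert_domain}"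

lemma open_e1_domain: "open e1_domain"
proof -
  have o: "open (- \<int>\<^sub>\<le>\<^sub>0 :: complex set)" by (intro open_Compl closed_nonpos_Ints)
  have eq: "e1_domain = (\<lambda>p. 1 - snd p) -` (- \<int>\<^sub>\<le>\<^sub>0) \<inter> (\<lambda>p. 1 + snd p) -` (- \<int>\<^sub>\<le>\<^sub>0) \<inter>
      (\<lambda>p. (fst p, nome (snd p))) -` lambert_domain \<inter> (\<lambda>p. (fst p, nome (- snd p))) -` lambert_domain"
    by (auto simp: e1_domain_def)
  show ?thesis
    unfolding eq by (intro open_Int open_vimage o open_lambert_domain continuous_intros)
qed

lemma e1_regular_holomorphic2_on: "holomorphic2_on e1_regular e1_domain"
proof -
  have o: "open (- \<int>\<^sub>\<le>\<^sub>0 :: complex set)" by (intro open_Compl closed_nonpos_Ints)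
  have 1: "holomorphic2_on (\<lambda>p. Digamma (1 - snd p)) e1_domain" "holomorphic2_on (\<lambda>p. Digamma (1 + snd p)) e1_domain"
    by (rule holomorphic2_on_compose[where V = "- \<int>\<^sub>\<le>\<^sub>0"];
        auto intro!: o holomorphic_on_Polygamma simp: e1_domain_def)+
  have n: "holomorphic2_on (\<lambda>p. nome (c * snd p)) e1_domain" for c
    by (rule holomorphic2_on_compose[where V = UNIV and F = nome]) (auto intro!: holomorphic_intros)
  have 2: "holomorphic2_on (\<lambda>p. lambert_series (fst p, nome (1 * snd p))) e1_domain"
     "holomorphic2_on (\<lambda>p. lambert_series (fst p, nome (-1 * snd p))) e1_domain"
    by (rule holomorphic2_on_compose_Pair[OF holomorphic2_on_fst n lambert_series_holomorphic2_on];
        auto simp: e1_domain_def)+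
  have "holomorphic2_on (\<lambda>p. Digamma (1 - snd p) - Digamma (1 + snd p)
      - 2 * of_real pi * \<i> * (lambert_series (fst p, nome (snd p)) - lambert_series (fst p, nome (- snd p)))) e1_domain"
    using 1 2 by (intro holomorphic2_on_diff holomorphic2_on_mult holomorphic2_on_const) simp_all
  then show ?thesis by (simp add: e1_regular_def split_def)
qed

lemma zero_in_e1_domain: "(0, 0) \<in> e1_domain"
  by (auto simp: e1_domain_def lambert_domain_def elim!: nonpos_Ints_cases)

lemma nome_add: "nome (a + b) = nome a * nome b"
  by (simp add: ring_distribs exp_add)

lemma nome_of_nat_mult: "nome (of_nat n * w) = nome w ^ n"
  by (simp add: mult_ac flip: exp_of_nat_mult)

lemma nome_norm_less_1: "Im \<tau> > 0 \<Longrightarrow> norm (nome \<tau>) < 1"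
  by simp

text \<open>The digamma terms exclude the nonzero integers, the Lambert terms the lattice points in the rows \<open>a > 0\<close> and
  \<open>a < 0\<close>.\<close>

lemma e1_domain_iff:
  assumes \<tau>: "Im \<tau> > 0"
  shows "(nome \<tau>, z) \<in> e1_domain \<longleftrightarrow> (\<forall>m n :: int. z = of_int m * \<tau> + of_int n \<longrightarrow> m = 0 \<and> n = 0)"
proof -
  have x: "nome w * nome \<tau> ^ Suc a = 1 \<longleftrightarrow> w + of_nat (Suc a) * \<tau> \<in> \<int>" for w a
    using exp_2pi_i_eq_1_iff[of "w + of_nat (Suc a) * \<tau>"] nome_add[of w "of_nat (Suc a) * \<tau>"] nome_of_nat_mult[of "Suc a" \<tau>]
    by metis
  have im: "of_int m * \<tau> \<in> \<int> \<longleftrightarrow> m = 0" for m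
    using \<tau> by (auto elim!: Ints_cases simp: complex_eq_iff)
  show ?thesis
  proof safe
    fix m n :: int
    assume d: "(nome \<tau>, of_int m * \<tau> + of_int n) \<in> e1_domain"
    show m: "m = 0"
    proof (rule ccontr)
      assume "m \<noteq> 0"
      then consider a where "m = int (Suc a)" | a where "m = - int (Suc a)"
        by (metis int_cases3 gr0_conv_Suc)
      then show False
      proof cases
        case 1
        have "nome (- (of_int m * \<tau> + of_int n)) * nome \<tau> ^ Suc a = 1"
          unfolding x using 1 by (simp add: algebra_simps)
        with d show False unfolding e1_domain_def lambert_domain_def mem_Collect_eq case_prod_conv by blast
      next
        case 2
        have "nome (of_int m * \<tau> + of_int n) * nome \<tau> ^ Suc a = 1"
        proof -
          have e: "of_int m * \<tau> + of_int n + of_nat (Suc a) * \<tau> = of_int n"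
            unfolding 2 by (simp add: algebra_simps)
          show ?thesis unfolding x e by simp
        qed
        with d show False unfolding e1_domain_def lambert_domain_def mem_Collect_eq case_prod_conv by blast
      qed
    qed
    show "n = 0"
    proof (rule ccontr)
      assume "n \<noteq> 0"
      then have "1 - of_int n \<in> (\<int>\<^sub>\<le>\<^sub>0 :: complex set) \<or> 1 + of_int n \<in> (\<int>\<^sub>\<le>\<^sub>0 :: complex set)"
        using of_int_in_nonpos_Ints_iff[of "1 - n", where 'a = complex] of_int_in_nonpos_Ints_iff[of "1 + n", where 'a = complex]
        by auto
      with d m show False by (auto simp: e1_domain_def)
    qed
  next
    assume a: "\<forall>m n :: int. z = of_int m * \<tau> + of_int n \<longrightarrow> m = 0 \<and> n = 0"
    have 1: "1 - z \<notin> \<int>\<^sub>\<le>\<^sub>0"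
    proof
      assume "1 - z \<in> \<int>\<^sub>\<le>\<^sub>0"
      then obtain k :: int where k: "1 - z = of_int k" "k \<le> 0" by (auto elim!: nonpos_Ints_cases)
      then have "z = of_int 0 * \<tau> + of_int (1 - k)" by (simp add: algebra_simps)
      then show False using a k by fastforce
    qed
    have 2: "1 + z \<notin> \<int>\<^sub>\<le>\<^sub>0"
    proof
      assume "1 + z \<in> \<int>\<^sub>\<le>\<^sub>0"
      then obtain k :: int where k: "1 + z = of_int k" "k \<le> 0" by (auto elim!: nonpos_Ints_cases)
      then have "z = of_int 0 * \<tau> + of_int (k - 1)" by (simp add: algebra_simps)
      then show False using a k by fastforce
    qed
    have 3: "nome z * nome \<tau> ^ Suc b \<noteq> 1" for b
    proof
      assume "nome z * nome \<tau> ^ Suc b = 1"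
      then obtain k :: int where "z + of_nat (Suc b) * \<tau> = of_int k" unfolding x by (auto elim: Ints_cases)
      then have "z = of_int (- int (Suc b)) * \<tau> + of_int k" by (simp add: algebra_simps)
      with a[rule_format, OF this] show False by simp
    qed
    have 4: "nome (- z) * nome \<tau> ^ Suc b \<noteq> 1" for b
    proof
      assume "nome (- z) * nome \<tau> ^ Suc b = 1"
      then obtain k :: int where k: "- z + of_nat (Suc b) * \<tau> = of_int k" unfolding x by (auto elim: Ints_cases)
      have "z = of_int (int (Suc b)) * \<tau> + of_int (- k)"
        using arg_cong[OF k, of uminus] by (simp add: algebra_simps)
      with a[rule_format, OF this] show False by simp
    qed
    show "(nome \<tau>, z) \<in> e1_domain"
      unfolding e1_domain_def lambert_domain_def using 1 2 3 4 nome_norm_less_1[OF \<tau>] by blast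
  qed
qed

lemma regular_domain_iff:
  "(\<tau>, z) \<in> regular_domain \<longleftrightarrow> Im \<tau> > 0 \<and> (nome \<tau>, z) \<in> e1_domain \<and> z \<noteq> 0"
proof (cases "Im \<tau> > 0")
  case True
  have "z \<in> period_lattice \<tau> \<longleftrightarrow> z = 0 \<or> (nome \<tau>, z) \<notin> e1_domain"
  proof -
    have "z \<in> period_lattice \<tau> \<longleftrightarrow> (\<exists>m n :: int. z = of_int m * \<tau> + of_int n)"
      by (auto simp: period_lattice_def)
    moreover have "(0 :: complex) = of_int 0 * \<tau> + of_int 0" by simp
    moreover have "of_int m * \<tau> + of_int n = 0" if "m = 0" "n = 0" for m n :: int using that by simp
    ultimately show ?thesis unfolding e1_domain_iff[OF True] by metis
  qed
  then show ?thesis using True by (auto simp: regular_domain_def upper_half_plane_def)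
qed (auto simp: regular_domain_def upper_half_plane_def)

lemma period_latticeI: "of_int m * \<tau> + of_int n \<in> period_lattice \<tau>"
  unfolding period_lattice_def by blast

lemma zero_in_period_lattice: "0 \<in> period_lattice \<tau>"
  using period_latticeI[of 0 \<tau> 0] by simp

lemma period_lattice_shift:
  "z + of_int m * \<tau> + of_int n \<in> period_lattice \<tau> \<longleftrightarrow> z \<in> period_lattice \<tau>"
proof
  assume "z \<in> period_lattice \<tau>"
  then obtain k l :: int where z: "z = of_int k * \<tau> + of_int l" unfolding period_lattice_def by blast
  have "z + of_int m * \<tau> + of_int n = of_int (k + m) * \<tau> + of_int (l + n)" by (simp add: z algebra_simps)
  then show "z + of_int m * \<tau> + of_int n \<in> period_lattice \<tau>" by (metis period_latticeI)
next
  assume "z + of_int m * \<tau> + of_int n \<in> period_lattice \<tau>"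
  then obtain k l :: int where z: "z + of_int m * \<tau> + of_int n = of_int k * \<tau> + of_int l" unfolding period_lattice_def by blast
  have "z = of_int (k - m) * \<tau> + of_int (l - n)" using z by (simp add: algebra_simps)
  then show "z \<in> period_lattice \<tau>" by (metis period_latticeI)
qed

lemma regular_domain_shift:
  "(\<tau>, z + of_int m * \<tau> + of_int n) \<in> regular_domain \<longleftrightarrow> (\<tau>, z) \<in> regular_domain"
  by (simp add: regular_domain_def period_lattice_shift)

lemma open_regular_domain: "open regular_domain"
proof -
  have eq: "regular_domain = {p. Im (fst p) > 0} \<inter> (\<lambda>p. (nome (fst p), snd p)) -` e1_domain \<inter> {p. snd p \<noteq> 0}"
    by (auto simp: regular_domain_iff)
  have "open {p :: complex \<times> complex. Im (fst p) > 0}"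
    by (intro open_Collect_less continuous_intros)
  moreover have "open {p :: complex \<times> complex. snd p \<noteq> 0}"
    by (intro open_Collect_neq continuous_intros)
  ultimately show ?thesis
    unfolding eq by (intro open_Int open_vimage open_e1_domain continuous_intros)
qed

lemma regular_not_Int:
  assumes "(\<tau>, z) \<in> regular_domain" shows "z + of_int a * \<tau> \<notin> \<int>"
proof
  assume "z + of_int a * \<tau> \<in> \<int>"
  then obtain k :: int where "z + of_int a * \<tau> = of_int k" by (auto elim: Ints_cases)
  then have "z = of_int (- a) * \<tau> + of_int k" by (simp add: algebra_simps)
  then have "z \<in> period_lattice \<tau>" unfolding period_lattice_def by blast
  then show False using assms by (simp add: regular_domain_def)
qed

section \<open>Expansion of the Eisenstein series at the cusp\<close>

lemma cot_pair_lambert: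
  assumes "Im \<tau> > 0" "(nome \<tau>, z) \<in> e1_domain"
  shows "z + of_nat (Suc a) * \<tau> \<notin> \<int>" "z - of_nat (Suc a) * \<tau> \<notin> \<int>"
    "int_pole_sum 1 (z + of_nat (Suc a) * \<tau>) + int_pole_sum 1 (z - of_nat (Suc a) * \<tau>)
      = - 2 * of_real pi * \<i> * (lambert (nome z * nome \<tau> ^ Suc a) - lambert (nome (- z) * nome \<tau> ^ Suc a))"
proof -
  note H = assms(2)[unfolded e1_domain_iff[OF assms(1)], rule_format]
  show 1: "z + of_nat (Suc a) * \<tau> \<notin> \<int>"
  proof
    assume "z + of_nat (Suc a) * \<tau> \<in> \<int>"
    then obtain k :: int where "z + of_nat (Suc a) * \<tau> = of_int k" by (auto elim: Ints_cases)
    then have "z = of_int (- int (Suc a)) * \<tau> + of_int k" by (simp add: algebra_simps)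
    from H[OF this] show False by simp
  qed
  show 2: "z - of_nat (Suc a) * \<tau> \<notin> \<int>"
  proof
    assume "z - of_nat (Suc a) * \<tau> \<in> \<int>"
    then obtain k :: int where "z - of_nat (Suc a) * \<tau> = of_int k" by (auto elim: Ints_cases)
    then have "z = of_int (int (Suc a)) * \<tau> + of_int k" by (simp add: algebra_simps)
    from H[OF this] show False by simp
  qed
  have q: "nome (w + of_nat (Suc a) * \<tau>) = nome w * nome \<tau> ^ Suc a" for w
    by (simp only: nome_add nome_of_nat_mult)
  have "- z + of_nat (Suc a) * \<tau> = - (z - of_nat (Suc a) * \<tau>)" by simp
  then have 3: "- z + of_nat (Suc a) * \<tau> \<notin> \<int>" using 2 by (metis minus_in_Ints_iff)
  have "int_pole_sum 1 (z - of_nat (Suc a) * \<tau>) = - int_pole_sum 1 (- z + of_nat (Suc a) * \<tau>)"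
    using int_pole_sum_1_minus[OF 3] by simp
  then show "int_pole_sum 1 (z + of_nat (Suc a) * \<tau>) + int_pole_sum 1 (z - of_nat (Suc a) * \<tau>)
      = - 2 * of_real pi * \<i> * (lambert (nome z * nome \<tau> ^ Suc a) - lambert (nome (- z) * nome \<tau> ^ Suc a))"
    unfolding int_pole_sum_1_lambert[OF 1] int_pole_sum_1_lambert[OF 3] q by (simp add: algebra_simps)
qed

text \<open>The convergence has to be uniform in \<open>z\<close>, because the derivatives of the row sums are needed as well, and it has
  to hold near \<open>z = 0\<close>, where \<open>e\<^sub>2\<close> is read off.\<close>

lemma cot_pairs_uniform_limit:
  assumes \<tau>: "Im \<tau> > 0" and z0: "(nome \<tau>, z0) \<in> e1_domain"
  obtains B where "open B" "z0 \<in> B" "\<And>z. z \<in> B \<Longrightarrow> (nome \<tau>, z) \<in> e1_domain"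
    "uniform_limit B (\<lambda>A z. \<Sum>a<A. int_pole_sum 1 (z + of_nat (Suc a) * \<tau>) + int_pole_sum 1 (z - of_nat (Suc a) * \<tau>))
       (\<lambda>z. - 2 * of_real pi * \<i> * (lambert_series (nome \<tau>, nome z) - lambert_series (nome \<tau>, nome (- z)))) sequentially"
proof -
  define q where "q = nome \<tau>"
  have q: "norm q < 1" using nome_norm_less_1[OF \<tau>] by (simp only: q_def)
  obtain V M where V: "open V" "(q, nome z0) \<in> V" "summable M" "\<And>q x. (q, x) \<in> V \<Longrightarrow> norm q < 1"
      "\<forall>\<^sub>F a in sequentially. \<forall>(q, x)\<in>V. norm (x * q ^ Suc a) \<le> 1 / 2 \<and> norm (lambert (x * q ^ Suc a)) \<le> M a"
    by (rule lambert_majorant[OF q, of "nome z0"]) (rule that)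
  obtain V' M' where V': "open V'" "(q, nome (- z0)) \<in> V'" "summable M'" "\<And>q x. (q, x) \<in> V' \<Longrightarrow> norm q < 1"
      "\<forall>\<^sub>F a in sequentially. \<forall>(q, x)\<in>V'. norm (x * q ^ Suc a) \<le> 1 / 2 \<and> norm (lambert (x * q ^ Suc a)) \<le> M' a"
    by (rule lambert_majorant[OF q, of "nome (- z0)"]) (rule that)
  define B where "B = (\<lambda>z. (q, z)) -` e1_domain \<inter> (\<lambda>z. (q, nome z)) -` V \<inter> (\<lambda>z. (q, nome (- z))) -` V'"
  have oB: "open B" unfolding B_def by (intro open_Int open_vimage open_e1_domain V(1) V'(1) continuous_intros)
  define f where "f = (\<lambda>a z. - 2 * of_real pi * \<i> * (lambert (nome z * q ^ Suc a) - lambert (nome (- z) * q ^ Suc a)))"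
  have ev1: "\<forall>\<^sub>F a in sequentially. \<forall>z\<in>B. norm (lambert (nome z * q ^ Suc a)) \<le> M a"
    using V(5) by (rule eventually_mono) (auto simp: B_def)
  have ev2: "\<forall>\<^sub>F a in sequentially. \<forall>z\<in>B. norm (lambert (nome (- z) * q ^ Suc a)) \<le> M' a"
    using V'(5) by (rule eventually_mono) (auto simp: B_def)
  have ev: "\<forall>\<^sub>F a in sequentially. \<forall>z\<in>B. norm (f a z) \<le> 2 * pi * (M a + M' a)"
    using ev1 ev2
  proof eventually_elim
    case (elim a)
    show ?case
    proof
      fix z assume z: "z \<in> B"
      have "norm (f a z) = 2 * pi * norm (lambert (nome z * q ^ Suc a) - lambert (nome (- z) * q ^ Suc a))"
        unfolding f_def norm_mult by simp
      also have "\<dots> \<le> 2 * pi * (M a + M' a)"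
        using norm_triangle_ineq4[of "lambert (nome z * q ^ Suc a)" "lambert (nome (- z) * q ^ Suc a)"] elim z
        by (intro mult_left_mono) (auto intro: order_trans[OF norm_triangle_ineq4] add_mono)
      finally show "norm (f a z) \<le> 2 * pi * (M a + M' a)" .
    qed
  qed
  have ul: "uniform_limit B (\<lambda>A z. \<Sum>a<A. f a z) (\<lambda>z. \<Sum>a. f a z) sequentially"
    by (rule Weierstrass_m_test_ev[OF ev]) (intro summable_mult summable_add V(3) V'(3))
  have lim: "(\<Sum>a. f a z) = - 2 * of_real pi * \<i> * (lambert_series (q, nome z) - lambert_series (q, nome (- z)))" if z: "z \<in> B" for z
  proof -
    have "summable (\<lambda>a. lambert (nome z * q ^ Suc a))"
      by (rule summable_comparison_test_ev[OF _ V(3)]) (use ev1 z in \<open>auto elim: eventually_mono\<close>)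
    moreover have "summable (\<lambda>a. lambert (nome (- z) * q ^ Suc a))"
      by (rule summable_comparison_test_ev[OF _ V'(3)]) (use ev2 z in \<open>auto elim: eventually_mono\<close>)
    ultimately show ?thesis
      unfolding f_def lambert_series_def case_prod_conv by (simp only: suminf_mult suminf_diff summable_diff)
  qed
  show ?thesis
  proof (rule that[OF oB])
    show "z0 \<in> B" using z0 V(2) V'(2) by (simp add: B_def q_def)
    show dom: "(nome \<tau>, z) \<in> e1_domain" if "z \<in> B" for z using that by (auto simp: B_def q_def)
    show "uniform_limit B (\<lambda>A z. \<Sum>a<A. int_pole_sum 1 (z + of_nat (Suc a) * \<tau>) + int_pole_sum 1 (z - of_nat (Suc a) * \<tau>))
       (\<lambda>z. - 2 * of_real pi * \<i> * (lambert_series (nome \<tau>, nome z) - lambert_series (nome \<tau>, nome (- z)))) sequentially"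
    proof (rule uniform_limit_cong'[THEN iffD1, OF _ _ ul])
      show "(\<Sum>a<A. f a z) = (\<Sum>a<A. int_pole_sum 1 (z + of_nat (Suc a) * \<tau>) + int_pole_sum 1 (z - of_nat (Suc a) * \<tau>))"
        if "z \<in> B" for A z
        unfolding f_def q_def using cot_pair_lambert(3)[OF \<tau> dom[OF that]] by simp
      show "(\<Sum>a. f a z) = - 2 * of_real pi * \<i> * (lambert_series (nome \<tau>, nome z) - lambert_series (nome \<tau>, nome (- z)))"
        if "z \<in> B" for z using lim[OF that] by (simp add: q_def)
    qed
  qed
qed

lemma higher_deriv_int_pole_sums:
  assumes S: "open S" "\<And>z i. z \<in> S \<Longrightarrow> i \<in> I \<Longrightarrow> z + c i \<notin> \<int>" and z: "z \<in> S"
  shows "(deriv ^^ k) (\<lambda>z. \<Sum>i\<in>I. int_pole_sum 1 (z + c i)) z = (-1) ^ k * fact k * (\<Sum>i\<in>I. int_pole_sum (Suc k) (z + c i))"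
  using z
proof (induction k arbitrary: z)
  case (Suc k)
  have d: "((\<lambda>z. (-1) ^ k * fact k * (\<Sum>i\<in>I. int_pole_sum (Suc k) (z + c i))) has_field_derivative
      (-1) ^ k * fact k * (\<Sum>i\<in>I. - of_nat (Suc k) * int_pole_sum (Suc (Suc k)) (z + c i))) (at z)"
  proof (intro DERIV_cmult DERIV_sum)
    fix i assume "i \<in> I"
    from int_pole_sum_has_field_derivative[OF S(2)[OF Suc.prems this], of "Suc k"]
    show "((\<lambda>z. int_pole_sum (Suc k) (z + c i)) has_field_derivative - of_nat (Suc k) * int_pole_sum (Suc (Suc k)) (z + c i)) (at z)"
      by (simp add: DERIV_shift)
  qed
  have "((deriv ^^ k) (\<lambda>z. \<Sum>i\<in>I. int_pole_sum 1 (z + c i)) has_field_derivative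
      (-1) ^ k * fact k * (\<Sum>i\<in>I. - of_nat (Suc k) * int_pole_sum (Suc (Suc k)) (z + c i))) (at z)"
    by (rule has_field_derivative_transform_within_open[OF d S(1) Suc.prems]) (use Suc.IH in auto)
  then have "(deriv ^^ Suc k) (\<lambda>z. \<Sum>i\<in>I. int_pole_sum 1 (z + c i)) z =
     (-1) ^ k * fact k * (\<Sum>i\<in>I. - of_nat (Suc k) * int_pole_sum (Suc (Suc k)) (z + c i))"
    by (simp add: DERIV_imp_deriv)
  then show ?case by (simp only: flip: sum_distrib_left) (simp add: algebra_simps)
qed simp

lemma higher_deriv_pole_plus:
  assumes S: "open S" "0 \<notin> S" and f: "f holomorphic_on S" and z: "z \<in> S"
  shows "(deriv ^^ k) (\<lambda>z. 1 / z + f z) z = (-1) ^ k * fact k / z ^ Suc k + (deriv ^^ k) f (z :: complex)"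
  using z
proof (induction k arbitrary: z)
  case (Suc k)
  have z0: "z \<noteq> 0" using S Suc.prems by auto
  have "((\<lambda>z. (-1) ^ k * fact k / z ^ Suc k) has_field_derivative (-1) ^ Suc k * fact (Suc k) / z ^ Suc (Suc k)) (at z)"
    using z0 by (auto intro!: derivative_eq_intros simp: divide_simps) (cases k; simp add: algebra_simps)
  moreover have "((deriv ^^ k) f has_field_derivative (deriv ^^ Suc k) f z) (at z)"
    using holomorphic_derivI[OF holomorphic_higher_deriv[OF f S(1), of k] S(1) Suc.prems] by simp
  ultimately have d: "((\<lambda>z. (-1) ^ k * fact k / z ^ Suc k + (deriv ^^ k) f z) has_field_derivative
      (-1) ^ Suc k * fact (Suc k) / z ^ Suc (Suc k) + (deriv ^^ Suc k) f z) (at z)" by (rule DERIV_add)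
  have "((deriv ^^ k) (\<lambda>z. 1 / z + f z) has_field_derivative
      (-1) ^ Suc k * fact (Suc k) / z ^ Suc (Suc k) + (deriv ^^ Suc k) f z) (at z)"
    by (rule has_field_derivative_transform_within_open[OF d S(1) Suc.prems]) (use Suc.IH in auto)
  then show ?case by (simp add: DERIV_imp_deriv)
qed simp

text \<open>The expansion of the Eisenstein series \<open>E\<^sub>n\<close>, which up to a factor is the derivative of order \<open>n - 1\<close> of \<open>E\<^sub>1\<close>.\<close>

definition eis_value :: "nat \<Rightarrow> complex \<times> complex \<Rightarrow> complex" where
  "eis_value n = (\<lambda>(q, z). 1 / z ^ n + (-1) ^ (n - 1) / fact (n - 1) * (dz ^^ (n - 1)) e1_regular (q, z))"

text \<open>Locally uniform convergence of the rows of \<open>E\<^sub>1\<close> implies convergence of all derivatives, which are the rows of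
  the other Eisenstein series.\<close>

lemma eis_rows_LIMSEQ:
  assumes reg: "(\<tau>, z) \<in> regular_domain" and n: "n \<ge> 1"
  shows "(\<lambda>A. \<Sum>a = - int A..int A. int_pole_sum n (z + of_int a * \<tau>)) \<longlonglongrightarrow> eis_value n (nome \<tau>, z)"
proof -
  have \<tau>: "Im \<tau> > 0" and e1: "(nome \<tau>, z) \<in> e1_domain" and z0: "z \<noteq> 0"
    using reg by (auto simp: regular_domain_iff)
  obtain B where B: "open B" "z \<in> B" "\<And>z. z \<in> B \<Longrightarrow> (nome \<tau>, z) \<in> e1_domain"
    "uniform_limit B (\<lambda>A z. \<Sum>a<A. int_pole_sum 1 (z + of_nat (Suc a) * \<tau>) + int_pole_sum 1 (z - of_nat (Suc a) * \<tau>))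
       (\<lambda>z. - 2 * of_real pi * \<i> * (lambert_series (nome \<tau>, nome z) - lambert_series (nome \<tau>, nome (- z)))) sequentially"
    by (rule cot_pairs_uniform_limit[OF \<tau> e1]) (rule that)
  define S where "S = B - {0}"
  have S: "open S" "z \<in> S" "0 \<notin> S" using B(1,2) z0 by (auto simp: S_def)
  have regS: "(\<tau>, w) \<in> regular_domain" if "w \<in> S" for w
    using that B(3) \<tau> by (auto simp: S_def regular_domain_iff)
  define P where "P = (\<lambda>A w. \<Sum>a = - int A..int A. int_pole_sum 1 (w + of_int a * \<tau>))"
  have P: "P A w = int_pole_sum 1 w + (\<Sum>a<A. int_pole_sum 1 (w + of_nat (Suc a) * \<tau>) + int_pole_sum 1 (w - of_nat (Suc a) * \<tau>))" for A w
    unfolding P_def symmetric_int_sum by (simp add: algebra_simps)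
  have val: "int_pole_sum 1 w + (- 2 * of_real pi * \<i> * (lambert_series (nome \<tau>, nome w) - lambert_series (nome \<tau>, nome (- w))))
      = 1 / w + e1_regular (nome \<tau>, w)" if "w \<in> S" for w
  proof -
    have "w \<noteq> 0" using that by (auto simp: S_def)
    then show ?thesis using Digamma_plus1[of w] by (simp add: int_pole_sum_def e1_regular_def add_ac)
  qed
  have "uniform_limit S (\<lambda>A w. P A w) (\<lambda>w. 1 / w + e1_regular (nome \<tau>, w)) sequentially"
  proof (rule uniform_limit_cong'[THEN iffD1])
    show "uniform_limit S (\<lambda>A w. int_pole_sum 1 w + (\<Sum>a<A. int_pole_sum 1 (w + of_nat (Suc a) * \<tau>) + int_pole_sum 1 (w - of_nat (Suc a) * \<tau>)))
      (\<lambda>w. int_pole_sum 1 w + (- 2 * of_real pi * \<i> * (lambert_series (nome \<tau>, nome w) - lambert_series (nome \<tau>, nome (- w))))) sequentially"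
      by (intro uniform_limit_add uniform_limit_const uniform_limit_on_subset[OF B(4)]) (auto simp: S_def)
  qed (use P val in auto)
  moreover have nI: "w + of_int a * \<tau> \<notin> \<int>" if "w \<in> S" for w a using regular_not_Int[OF regS[OF that]] .
  have hol: "P A holomorphic_on S" for A
    unfolding P_def
  proof (intro holomorphic_on_sum)
    fix a
    show "(\<lambda>w. int_pole_sum 1 (w + of_int a * \<tau>)) holomorphic_on S"
      unfolding holomorphic_on_open[OF S(1)]
      using int_pole_sum_has_field_derivative[OF nI] by (force simp: DERIV_shift)
  qed
  ultimately have "(\<lambda>A. (deriv ^^ (n - 1)) (P A) z) \<longlonglongrightarrow> (deriv ^^ (n - 1)) (\<lambda>w. 1 / w + e1_regular (nome \<tau>, w)) z"
    by (intro higher_deriv_complex_uniform_limit) (use S in auto)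
  moreover have "(deriv ^^ (n - 1)) (P A) z = (-1) ^ (n - 1) * fact (n - 1) * (\<Sum>a = - int A..int A. int_pole_sum n (z + of_int a * \<tau>))" for A
    using higher_deriv_int_pole_sums[OF S(1), of "{- int A..int A}" "\<lambda>a. of_int a * \<tau>" z "n - 1"] nI S(2) n
    by (simp add: P_def)
  moreover have "(deriv ^^ (n - 1)) (\<lambda>w. 1 / w + e1_regular (nome \<tau>, w)) z = (-1) ^ (n - 1) * fact (n - 1) / z ^ n + (dz ^^ (n - 1)) e1_regular (nome \<tau>, z)"
  proof -
    have "(\<lambda>w. e1_regular (nome \<tau>, w)) holomorphic_on S"
      by (rule holomorphic2_on_slice_snd[OF e1_regular_holomorphic2_on S(1)]) (use B(3) in \<open>auto simp: S_def\<close>)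
    from higher_deriv_pole_plus[OF S(1,3) this S(2), of "n - 1"] show ?thesis
      using n by (simp add: dz_funpow)
  qed
  ultimately have "(\<lambda>A. (-1) ^ (n - 1) * fact (n - 1) * (\<Sum>a = - int A..int A. int_pole_sum n (z + of_int a * \<tau>)))
     \<longlonglongrightarrow> (-1) ^ (n - 1) * fact (n - 1) / z ^ n + (dz ^^ (n - 1)) e1_regular (nome \<tau>, z)" by simp
  from tendsto_mult[OF tendsto_const[of "(-1) ^ (n - 1) / fact (n - 1)"] this]
  have l: "(\<lambda>A. ((-1) ^ (n - 1) / fact (n - 1)) * ((-1) ^ (n - 1) * fact (n - 1) * (\<Sum>a = - int A..int A. int_pole_sum n (z + of_int a * \<tau>))))
     \<longlonglongrightarrow> ((-1) ^ (n - 1) / fact (n - 1)) * ((-1) ^ (n - 1) * fact (n - 1) / z ^ n + (dz ^^ (n - 1)) e1_regular (nome \<tau>, z))" .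
  have sq: "(-1) ^ k * (-1) ^ k = (1 :: complex)" for k by (simp flip: power_mult_distrib)
  have c1: "((-1) ^ (n - 1) / fact (n - 1)) * ((-1) ^ (n - 1) * fact (n - 1) * X) = X" for X :: complex
    using sq[of "n - 1"] by (simp add: mult.assoc[symmetric])
  have c2: "((-1) ^ (n - 1) / fact (n - 1)) * ((-1) ^ (n - 1) * fact (n - 1) / z ^ n + (dz ^^ (n - 1)) e1_regular (nome \<tau>, z)) = eis_value n (nome \<tau>, z)"
    using c1[of "1 / z ^ n"] by (simp add: eis_value_def distrib_left)
  show ?thesis using l unfolding c1 c2 .
qed

section \<open>Absolute convergence of lattice sums\<close>

lemma has_sum_int_symmetric_LIMSEQ:
  fixes f :: "int \<Rightarrow> 'a::{comm_monoid_add,topological_space}"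
  assumes "(f has_sum s) UNIV"
  shows "(\<lambda>B. \<Sum>b = - int B..int B. f b) \<longlonglongrightarrow> s"
proof -
  have "filterlim (\<lambda>B. {- int B..int B}) (finite_subsets_at_top UNIV) sequentially"
    unfolding filterlim_finite_subsets_at_top
  proof safe
    fix X :: "int set" assume X: "finite X"
    then obtain N where N: "\<And>x. x \<in> X \<Longrightarrow> nat \<bar>x\<bar> \<le> N"
      using finite_nat_set_iff_bounded_le[of "(\<lambda>x. nat \<bar>x\<bar>) ` X"] by auto
    show "\<forall>\<^sub>F B in sequentially. finite {- int B..int B} \<and> X \<subseteq> {- int B..int B} \<and> {- int B..int B} \<subseteq> UNIV"
      using eventually_ge_at_top[of N]
    proof eventually_elim
      case (elim B)
      have "x \<in> {- int B..int B}" if "x \<in> X" for x using N[OF that] elim by auto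
      then show ?case by auto
    qed
  qed
  then show ?thesis using assms unfolding has_sum_def by (rule filterlim_compose[rotated])
qed

lemma summable_on_int_powr: "(\<lambda>a :: int. (1 + \<bar>real_of_int a\<bar>) powr (-3/2)) summable_on UNIV"
proof -
  have "summable (\<lambda>n. real n powr (-3/2))" by (subst summable_real_powr_iff) auto
  then have "summable (\<lambda>n. real (Suc n) powr (-3/2))" by (subst summable_Suc_iff)
  then have "(\<lambda>n. real (Suc n) powr (-3/2)) summable_on UNIV"
    by (subst summable_on_UNIV_nonneg_real_iff) auto
  then have "(\<lambda>n. (1/2) powr (-3/2) * real (Suc n) powr (-3/2)) summable_on UNIV"
    by (rule summable_on_cmult_right)
  then have "(\<lambda>n. (1 + \<bar>real_of_int (int_decode n)\<bar>) powr (-3/2)) summable_on UNIV"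
  proof (rule summable_on_comparison_test)
    fix n :: nat
    have "1 / 2 * real (Suc n) \<le> 1 + \<bar>real_of_int (int_decode n)\<bar>"
      by (auto simp: int_decode_def sum_decode_def elim!: evenE oddE)
    then have "(1 + \<bar>real_of_int (int_decode n)\<bar>) powr (-3/2) \<le> (1 / 2 * real (Suc n)) powr (-3/2)"
      by (intro powr_mono2') auto
    also have "\<dots> = (1/2) powr (-3/2) * real (Suc n) powr (-3/2)"
      by (rule powr_mult)
    finally show "(1 + \<bar>real_of_int (int_decode n)\<bar>) powr (-3/2) \<le> (1/2) powr (-3/2) * real (Suc n) powr (-3/2)" .
  qed auto
  then show ?thesis
    using summable_on_reindex_bij_betw[OF bij_int_decode, of "\<lambda>a. (1 + \<bar>real_of_int a\<bar>) powr (-3/2)"] by simp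
qed

lemma lattice_norm_ge:
  assumes "Im \<tau> > 0"
  obtains c where "c > 0" "\<And>a b :: int. c * (\<bar>real_of_int a\<bar> + \<bar>real_of_int b\<bar>) \<le> norm (of_int a * \<tau> + of_int b)"
proof
  define c where "c = Im \<tau> / (1 + Im \<tau> + norm \<tau>)"
  have pos: "1 + Im \<tau> + norm \<tau> > 0" using assms by (simp add: add_pos_nonneg)
  then show "c > 0" using assms by (simp add: c_def)
  fix a b :: int
  define N where "N = norm (of_int a * \<tau> + of_int b)"
  have 1: "\<bar>real_of_int a\<bar> * Im \<tau> \<le> N"
    using abs_Im_le_cmod[of "of_int a * \<tau> + of_int b"] assms by (simp add: N_def abs_mult)
  have "\<bar>real_of_int b\<bar> \<le> N + norm (of_int a * \<tau>)"
    using norm_triangle_ineq4[of "of_int a * \<tau> + of_int b" "of_int a * \<tau>"] by (simp add: N_def)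
  then have 2: "\<bar>real_of_int b\<bar> \<le> N + \<bar>real_of_int a\<bar> * norm \<tau>" by (simp add: norm_mult)
  have "Im \<tau> * \<bar>real_of_int b\<bar> \<le> Im \<tau> * N + norm \<tau> * (\<bar>real_of_int a\<bar> * Im \<tau>)"
    using mult_left_mono[OF 2, of "Im \<tau>"] assms by (simp add: algebra_simps)
  also have "\<dots> \<le> Im \<tau> * N + norm \<tau> * N" by (intro add_left_mono mult_left_mono 1) auto
  finally have "Im \<tau> * (\<bar>real_of_int a\<bar> + \<bar>real_of_int b\<bar>) \<le> N * (1 + Im \<tau> + norm \<tau>)"
    using 1 by (simp add: algebra_simps)
  then show "c * (\<bar>real_of_int a\<bar> + \<bar>real_of_int b\<bar>) \<le> norm (of_int a * \<tau> + of_int b)"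
    using pos by (simp add: c_def N_def field_simps)
qed

text \<open>Away from a finite box the translation by \<open>z\<close> costs at most half of the bound for the lattice itself; on the box
  a minimum of finitely many positive numbers is taken.\<close>

lemma shifted_lattice_norm_ge:
  assumes reg: "(\<tau>, z) \<in> regular_domain"
  obtains d where "d > 0" "\<And>a b :: int. d * (1 + \<bar>real_of_int a\<bar> + \<bar>real_of_int b\<bar>) \<le> norm (z + of_int a * \<tau> + of_int b)"
proof -
  have \<tau>: "Im \<tau> > 0" using reg by (simp add: regular_domain_iff)
  obtain c where c: "c > 0" "\<And>a b :: int. c * (\<bar>real_of_int a\<bar> + \<bar>real_of_int b\<bar>) \<le> norm (of_int a * \<tau> + of_int b)"
    using lattice_norm_ge[OF \<tau>] by metis
  define K where "K = nat \<lceil>2 * norm z / c + 1\<rceil>"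
  have K: "real K \<ge> 2 * norm z / c + 1" unfolding K_def by linarith
  define F where "F = {- int K..int K} \<times> {- int K..int K}"
  have finF: "finite F" by (simp add: F_def)
  define g where "g = (\<lambda>(a :: int, b :: int). norm (z + of_int a * \<tau> + of_int b) / (1 + \<bar>real_of_int a\<bar> + \<bar>real_of_int b\<bar>))"
  have gpos: "g p > 0" for p
  proof (cases p)
    case (Pair a b)
    have "z + of_int a * \<tau> + of_int b \<noteq> 0"
      using not_Int_shift(1)[OF regular_not_Int[OF reg, of a]] by simp
    then show ?thesis by (auto simp: g_def Pair intro!: divide_pos_pos)
  qed
  define d where "d = Min (insert (c / 2) (g ` F))"
  have d: "d > 0" "d \<le> c / 2" "\<And>p. p \<in> F \<Longrightarrow> d \<le> g p"
  proof -
    show "d > 0" using finF gpos c by (subst d_def, subst Min_gr_iff) auto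
    show "d \<le> c / 2" unfolding d_def by (rule Min_le) (use finF in auto)
    show "d \<le> g p" if "p \<in> F" for p unfolding d_def by (rule Min_le) (use finF that in auto)
  qed
  show ?thesis
  proof (rule that[OF d(1)])
    fix a b :: int
    define s where "s = \<bar>real_of_int a\<bar> + \<bar>real_of_int b\<bar>"
    have s0: "s \<ge> 0" by (simp add: s_def)
    show "d * (1 + \<bar>real_of_int a\<bar> + \<bar>real_of_int b\<bar>) \<le> norm (z + of_int a * \<tau> + of_int b)"
    proof (cases "(a, b) \<in> F")
      case True
      from d(3)[OF this] show ?thesis using s0 unfolding g_def s_def by (simp add: field_simps)
    next
      case False
      then have "s \<ge> real K" unfolding F_def s_def by (auto simp: not_le)
      then have "s \<ge> 2 * norm z / c + 1" using K by linarith
      then have "c * s \<ge> 2 * norm z + c" using c(1) by (simp add: field_simps)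
      moreover have "c * s \<le> norm (z + of_int a * \<tau> + of_int b) + norm z"
        using c(2)[of a b] norm_triangle_ineq4[of "z + of_int a * \<tau> + of_int b" z] by (simp add: s_def)
      ultimately have "c / 2 * (1 + s) \<le> norm (z + of_int a * \<tau> + of_int b)" by (simp add: algebra_simps)
      moreover have "d * (1 + s) \<le> c / 2 * (1 + s)" using d(2) s0 by (intro mult_right_mono) auto
      ultimately show ?thesis by (simp add: s_def add.assoc)
    qed
  qed
qed

text \<open>Comparison with a product of two convergent one-dimensional series:
  \<open>(1 + \<bar>a\<bar> + \<bar>b\<bar>)\<^sup>3 \<ge> (1 + \<bar>a\<bar>)\<^bsup>3/2\<^esup> (1 + \<bar>b\<bar>)\<^bsup>3/2\<^esup>\<close>.\<close>

lemma lattice_sum_summable_on: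
  assumes reg: "(\<tau>, z) \<in> regular_domain" and n: "n \<ge> 3"
  shows "(\<lambda>(a, b). 1 / (z + of_int a * \<tau> + of_int b) ^ n) summable_on (UNIV :: (int \<times> int) set)"
proof -
  obtain d where d: "d > 0" "\<And>a b :: int. d * (1 + \<bar>real_of_int a\<bar> + \<bar>real_of_int b\<bar>) \<le> norm (z + of_int a * \<tau> + of_int b)"
    using shifted_lattice_norm_ge[OF reg] by metis
  define w where "w = (\<lambda>a :: int. (1 + \<bar>real_of_int a\<bar>) powr (-3/2))"
  have w: "w summable_on UNIV" unfolding w_def by (rule summable_on_int_powr)
  have "(\<lambda>(a, b). w a * w b) summable_on Sigma UNIV (\<lambda>_. UNIV)"
  proof (rule summable_on_SigmaI)
    show "((\<lambda>b. case (a, b) of (a, b) \<Rightarrow> w a * w b) has_sum w a * infsum w UNIV) UNIV" for a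
      using has_sum_cmult_right[OF has_sum_infsum[OF w]] by simp
    show "(\<lambda>a. w a * infsum w UNIV) summable_on UNIV" by (rule summable_on_cmult_left[OF w])
  qed (auto simp: w_def)
  then have "(\<lambda>p. inverse d ^ n * (case p of (a, b) \<Rightarrow> w a * w b)) summable_on UNIV"
    by (intro summable_on_cmult_right) simp
  then have "(\<lambda>p. norm (case p of (a, b) \<Rightarrow> 1 / (z + of_int a * \<tau> + of_int b) ^ n)) summable_on (UNIV :: (int \<times> int) set)"
  proof (rule summable_on_comparison_test)
    fix p :: "int \<times> int"
    obtain a b where p: "p = (a, b)" by (cases p)
    define A B where "A = 1 + \<bar>real_of_int a\<bar>" and "B = 1 + \<bar>real_of_int b\<bar>"
    define s where "s = 1 + \<bar>real_of_int a\<bar> + \<bar>real_of_int b\<bar>"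
    have AB: "A \<ge> 1" "B \<ge> 1" "s \<ge> 1" "A \<le> s" "B \<le> s" by (auto simp: A_def B_def s_def)
    have "A powr (3/2) * B powr (3/2) \<le> s powr (3/2) * s powr (3/2)"
      using AB by (intro mult_mono powr_mono2) auto
    also have "\<dots> = s ^ 3" using AB by (simp add: powr_numeral flip: powr_add)
    also have "\<dots> \<le> s ^ n" by (rule power_increasing[OF n]) (use AB in auto)
    finally have "A powr (3/2) * B powr (3/2) \<le> s ^ n" .
    then have i: "inverse (s ^ n) \<le> inverse (A powr (3/2) * B powr (3/2))"
      using AB by (intro le_imp_inverse_le) (auto intro!: mult_pos_pos)
    have "(d * s) ^ n \<le> norm (z + of_int a * \<tau> + of_int b) ^ n"
      using d(2)[of a b] d(1) AB unfolding s_def by (intro power_mono) auto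
    then have "inverse (norm (z + of_int a * \<tau> + of_int b) ^ n) \<le> inverse ((d * s) ^ n)"
      using d(1) AB by (intro le_imp_inverse_le) auto
    also have "\<dots> = inverse d ^ n * inverse (s ^ n)" by (simp add: power_mult_distrib power_inverse)
    also have "\<dots> \<le> inverse d ^ n * inverse (A powr (3/2) * B powr (3/2))"
      by (rule mult_left_mono[OF i]) (use d in auto)
    also have "inverse (A powr (3/2) * B powr (3/2)) = w a * w b"
    proof -
      have "x powr (-3/2) = inverse (x powr (3/2))" for x :: real
        using powr_minus[of x "3/2"] by simp
      then show ?thesis unfolding w_def A_def B_def by (simp only: inverse_mult_distrib)
    qed
    finally show "norm (case p of (a, b) \<Rightarrow> 1 / (z + of_int a * \<tau> + of_int b) ^ n) \<le> inverse d ^ n * (case p of (a, b) \<Rightarrow> w a * w b)"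
      by (simp add: p norm_divide norm_power inverse_eq_divide)
  qed auto
  then show ?thesis by (rule Infinite_Sum.abs_summable_summable)
qed

text \<open>For \<open>n \<le> 2\<close> the series is summed by rows by definition; for \<open>n \<ge> 3\<close> absolute convergence allows it.\<close>

theorem Eis_eq_eis_value:
  assumes reg: "(\<tau>, z) \<in> regular_domain" and n: "n \<ge> 1"
  shows "Eis n (\<tau>, z) = eis_value n (nome \<tau>, z)"
proof -
  have row: "(\<lambda>B. \<Sum>b = - int B..int B. 1 / (z + of_int a * \<tau> + of_int b) ^ n) \<longlonglongrightarrow> int_pole_sum n (z + of_int a * \<tau>)" for a
    using int_pole_sum_LIMSEQ[OF regular_not_Int[OF reg, of a] n] .
  note rows = eis_rows_LIMSEQ[OF reg n]
  show ?thesis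
  proof (cases "n \<ge> 3")
    case False
    have "eisenstein_sum (\<lambda>a b. 1 / (z + of_int a * \<tau> + of_int b) ^ n) = eis_value n (nome \<tau>, z)"
      unfolding eisenstein_sum_def limI[OF row] by (rule limI[OF rows])
    then show ?thesis using False reg by (simp add: Eis_def on_regular_def)
  next
    case True
    define f where "f = (\<lambda>(a :: int, b :: int). 1 / (z + of_int a * \<tau> + of_int b) ^ n)"
    have sm: "f summable_on UNIV" unfolding f_def by (rule lattice_sum_summable_on[OF reg True])
    have sm1: "(\<lambda>b. f (a, b)) summable_on UNIV" for a
      using summable_on_SigmaD1[of "\<lambda>a b. f (a, b)" UNIV "\<lambda>_. UNIV" a] sm by simp
    have inner: "((\<lambda>b. f (a, b)) has_sum int_pole_sum n (z + of_int a * \<tau>)) UNIV" for a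
    proof -
      have h: "((\<lambda>b. f (a, b)) has_sum infsum (\<lambda>b. f (a, b)) UNIV) UNIV" using sm1 by (rule has_sum_infsum)
      from LIMSEQ_unique[OF has_sum_int_symmetric_LIMSEQ[OF this], of "int_pole_sum n (z + of_int a * \<tau>)"] row[of a]
      have "infsum (\<lambda>b. f (a, b)) UNIV = int_pole_sum n (z + of_int a * \<tau>)" by (simp add: f_def)
      with h show ?thesis by simp
    qed
    have "(f has_sum infsum f UNIV) (Sigma UNIV (\<lambda>_. UNIV))" using has_sum_infsum[OF sm] by simp
    from has_sum_SigmaD[OF this inner]
    have "((\<lambda>a. int_pole_sum n (z + of_int a * \<tau>)) has_sum infsum f UNIV) UNIV" by simp
    from LIMSEQ_unique[OF has_sum_int_symmetric_LIMSEQ[OF this] rows]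
    have "infsum f UNIV = eis_value n (nome \<tau>, z)" .
    then show ?thesis using True reg by (simp add: Eis_def on_regular_def f_def)
  qed
qed

lemma zero_in_e1_slice:
  assumes \<tau>: "Im \<tau> > 0" shows "(nome \<tau>, 0) \<in> e1_domain"
proof (subst e1_domain_iff[OF \<tau>], intro allI impI)
  fix m n :: int assume "0 = of_int m * \<tau> + of_int n"
  then have "Im (of_int m * \<tau> + of_int n) = 0 \<and> Re (of_int m * \<tau> + of_int n) = 0" by (metis zero_complex.simps)
  then show "m = 0 \<and> n = 0" using \<tau> by auto
qed

lemma inverse_squares_sums_complex: "(\<lambda>n. 1 / (of_nat n + 1) ^ 2 :: complex) sums (of_real pi ^ 2 / 6)"
  using sums_of_real[OF inverse_squares_sums, where 'a = complex] by (simp add: add.commute)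

lemma Polygamma_1_1: "Polygamma 1 (1::complex) = of_real pi ^ 2 / 6"
proof -
  have "(\<lambda>k. inverse ((1 + of_nat k) ^ Suc 1)) sums ((-1) ^ Suc 1 * Polygamma 1 (1::complex) / fact 1)"
    by (rule Polygamma_LIMSEQ) auto
  then have "(\<lambda>n. 1 / (of_nat n + 1) ^ 2) sums Polygamma 1 (1::complex)"
    by (simp add: inverse_eq_divide add_ac numeral_2_eq_2)
  from sums_unique2[OF this inverse_squares_sums_complex] show ?thesis .
qed

text \<open>The derivative at \<open>z = 0\<close> of the rows \<open>\<plusminus>a\<close> of \<open>E\<^sub>1\<close> is minus the corresponding rows of \<open>e\<^sub>2\<close>. The row \<open>a = 0\<close>
  contributes \<open>2\<zeta>(2)\<close>, which is minus the derivative of the digamma terms.\<close>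

lemma eis2_eq:
  assumes reg: "(\<tau>, z) \<in> regular_domain"
  shows "eis2 (\<tau>, z) = - dz e1_regular (nome \<tau>, 0)"
proof -
  have \<tau>: "Im \<tau> > 0" using reg by (auto simp: regular_domain_iff)
  note e1 = zero_in_e1_slice[OF \<tau>]
  obtain B where B: "open B" "0 \<in> B" "\<And>z. z \<in> B \<Longrightarrow> (nome \<tau>, z) \<in> e1_domain"
    "uniform_limit B (\<lambda>A z. \<Sum>a<A. int_pole_sum 1 (z + of_nat (Suc a) * \<tau>) + int_pole_sum 1 (z - of_nat (Suc a) * \<tau>))
       (\<lambda>z. - 2 * of_real pi * \<i> * (lambert_series (nome \<tau>, nome z) - lambert_series (nome \<tau>, nome (- z)))) sequentially"
    by (rule cot_pairs_uniform_limit[OF \<tau> e1]) (rule that)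
  define R where "R = (\<lambda>z. - 2 * of_real pi * \<i> * (lambert_series (nome \<tau>, nome z) - lambert_series (nome \<tau>, nome (- z))))"
  define P where "P = (\<lambda>A z. \<Sum>a<A. int_pole_sum 1 (z + of_nat (Suc a) * \<tau>) + int_pole_sum 1 (z - of_nat (Suc a) * \<tau>))"
  define C where "C = (\<lambda>a. int_pole_sum 2 (of_nat (Suc a) * \<tau>) + int_pole_sum 2 (- (of_nat (Suc a) * \<tau>)))"
  have Pd: "(P A has_field_derivative (\<Sum>a<A. - int_pole_sum 2 (w + of_nat (Suc a) * \<tau>) - int_pole_sum 2 (w - of_nat (Suc a) * \<tau>))) (at w)"
    if "w \<in> B" for A w
    unfolding P_def
  proof (intro DERIV_sum)
    fix a
    note nI = cot_pair_lambert(1,2)[OF \<tau> B(3)[OF that], of a]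
    have m1: "((\<lambda>z. int_pole_sum 1 (z + of_nat (Suc a) * \<tau>)) has_field_derivative - int_pole_sum 2 (w + of_nat (Suc a) * \<tau>)) (at w)"
      using int_pole_sum_has_field_derivative[OF nI(1), of 1] by (simp add: DERIV_shift numeral_2_eq_2)
    have m2: "((\<lambda>z. int_pole_sum 1 (z + - (of_nat (Suc a) * \<tau>))) has_field_derivative - int_pole_sum 2 (w - of_nat (Suc a) * \<tau>)) (at w)"
    proof -
      have "(int_pole_sum 1 has_field_derivative - int_pole_sum 2 (w - of_nat (Suc a) * \<tau>)) (at (w + - (of_nat (Suc a) * \<tau>)))"
        using int_pole_sum_has_field_derivative[OF nI(2), of 1] by (simp add: numeral_2_eq_2)
      then show ?thesis by (simp only: DERIV_shift)
    qed
    show "((\<lambda>z. int_pole_sum 1 (z + of_nat (Suc a) * \<tau>) + int_pole_sum 1 (z - of_nat (Suc a) * \<tau>)) has_field_derivative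
       - int_pole_sum 2 (w + of_nat (Suc a) * \<tau>) - int_pole_sum 2 (w - of_nat (Suc a) * \<tau>)) (at w)"
      using DERIV_add[OF m1 m2] by (simp only: add_uminus_conv_diff)
  qed
  have "(\<lambda>A. deriv (P A) 0) \<longlonglongrightarrow> deriv R 0"
    using B(4) unfolding P_def[symmetric] R_def[symmetric]
    by (rule deriv_complex_uniform_limit)
       (use B(1,2) Pd in \<open>auto simp: holomorphic_on_open intro!: always_eventually\<close>)
  moreover have "deriv (P A) 0 = - (\<Sum>a<A. C a)" for A
    using DERIV_imp_deriv[OF Pd[OF B(2), of A]] by (simp add: C_def sum_negf[symmetric] sum.distrib sum_subtractf)
  ultimately have "(\<lambda>A. - (\<Sum>a<A. C a)) \<longlonglongrightarrow> deriv R 0" by simp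
  from tendsto_minus[OF this] have lim: "(\<lambda>A. \<Sum>a<A. C a) \<longlonglongrightarrow> - deriv R 0" by simp
  \<comment> \<open>the row \<open>a = 0\<close>\<close>
  have row0: "(\<lambda>B. \<Sum>b = - int B..int B. if (0::int, b) = (0, 0) then 0 else 1 / (of_int 0 * \<tau> + of_int b) ^ 2) \<longlonglongrightarrow> of_real pi ^ 2 / 3"
  proof -
    have "(\<lambda>B. 2 * (\<Sum>n<B. 1 / (of_nat n + 1) ^ 2 :: complex)) \<longlonglongrightarrow> 2 * (of_real pi ^ 2 / 6)"
      using inverse_squares_sums_complex unfolding sums_def by (intro tendsto_mult tendsto_const)
    moreover have "(\<Sum>b = - int B..int B. if (0::int, b) = (0, 0) then 0 else 1 / (of_int 0 * \<tau> + of_int b) ^ 2) = 2 * (\<Sum>n<B. 1 / (of_nat n + 1) ^ 2 :: complex)" for B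
    proof -
      have "(- 1 - complex_of_nat j)\<^sup>2 = (1 + of_nat j)\<^sup>2" for j by (simp add: power2_eq_square algebra_simps)
      then show ?thesis unfolding symmetric_int_sum by (simp add: sum_distrib_left add_ac)
    qed
    ultimately show ?thesis by simp
  qed
  have row: "(\<lambda>B. \<Sum>b = - int B..int B. if (a, b) = (0, 0) then 0 else 1 / (of_int a * \<tau> + of_int b) ^ 2) \<longlonglongrightarrow> int_pole_sum 2 (of_int a * \<tau>)"
    if "a \<noteq> 0" for a :: int
  proof -
    have "of_int a * \<tau> \<notin> \<int>" using that \<tau> by (auto elim!: Ints_cases simp: complex_eq_iff)
    from int_pole_sum_LIMSEQ[OF this, of 2] that show ?thesis by simp
  qed
  have "eisenstein_sum (\<lambda>a b. if (a, b) = (0, 0) then 0 else 1 / (of_int a * \<tau> + of_int b) ^ 2) = of_real pi ^ 2 / 3 - deriv R 0"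
  proof -
    have "(\<Sum>a = - int A..int A. lim (\<lambda>B. \<Sum>b = - int B..int B. if (a, b) = (0, 0) then 0 else 1 / (of_int a * \<tau> + of_int b) ^ 2))
        = of_real pi ^ 2 / 3 + (\<Sum>a<A. C a)" for A
    proof -
      have "lim (\<lambda>B. \<Sum>b = - int B..int B. if (1 + int j, b) = (0, 0) then 0 else 1 / (of_int (1 + int j) * \<tau> + of_int b) ^ 2) +
          lim (\<lambda>B. \<Sum>b = - int B..int B. if (- 1 - int j, b) = (0, 0) then 0 else 1 / (of_int (- 1 - int j) * \<tau> + of_int b) ^ 2) = C j" for j
        using limI[OF row[of "1 + int j"]] limI[OF row[of "- 1 - int j"]] by (simp add: C_def algebra_simps)
      then show ?thesis unfolding symmetric_int_sum[of _ A] limI[OF row0] by simp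
    qed
    then show ?thesis unfolding eisenstein_sum_def using limI[OF tendsto_add[OF tendsto_const lim, of "of_real pi ^ 2 / 3"]] by simp
  qed
  moreover have "dz e1_regular (nome \<tau>, 0) = - (of_real pi ^ 2 / 3) + deriv R 0"
  proof -
    have i1: "(1::complex) \<notin> \<int>\<^sub>\<le>\<^sub>0" by (auto elim!: nonpos_Ints_cases)
    have d1: "((\<lambda>z. Digamma (1 - z)) has_field_derivative Polygamma 1 (1::complex) * (-1)) (at 0)"
      by (rule DERIV_chain2[where f = Digamma and g = "\<lambda>z. 1 - z"])
         (use i1 in \<open>auto intro!: derivative_eq_intros simp: has_field_derivative_Polygamma\<close>)
    have d2: "((\<lambda>z. Digamma (1 + z)) has_field_derivative Polygamma 1 (1::complex) * 1) (at 0)"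
      by (rule DERIV_chain2[where f = Digamma and g = "\<lambda>z. 1 + z"])
         (use i1 in \<open>auto intro!: derivative_eq_intros simp: has_field_derivative_Polygamma\<close>)
    have "R holomorphic_on B"
    proof (rule holomorphic_uniform_sequence[OF B(1)])
      show "P A holomorphic_on B" for A using Pd B(1) by (auto simp: holomorphic_on_open)
      fix x assume "x \<in> B"
      then obtain d where "d > 0" "cball x d \<subseteq> B" using B(1) open_contains_cball by blast
      then show "\<exists>d>0. cball x d \<subseteq> B \<and> uniform_limit (cball x d) P R sequentially"
        using uniform_limit_on_subset[OF B(4)] unfolding P_def R_def by blast
    qed
    then have d3: "(R has_field_derivative deriv R 0) (at 0)" by (rule holomorphic_derivI[OF _ B(1,2)])
    have "((\<lambda>z. Digamma (1 - z) - Digamma (1 + z) + R z) has_field_derivative Polygamma 1 1 * (-1) - Polygamma 1 1 * 1 + deriv R 0) (at 0)"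
      by (intro DERIV_add DERIV_diff d1 d2 d3)
    moreover have "(\<lambda>z. Digamma (1 - z) - Digamma (1 + z) + R z) = (\<lambda>z. e1_regular (nome \<tau>, z))"
      by (simp add: e1_regular_def R_def fun_eq_iff)
    ultimately show ?thesis unfolding Polygamma_1_1 dz_def by (simp add: DERIV_imp_deriv)
  qed
  ultimately show ?thesis using reg by (simp add: eis2_def on_regular_def)
qed

section \<open>Elliptic and modular behaviour of the Eisenstein series\<close>

lemma regular_domain_iff_period_lattice: "(\<tau>, z) \<in> regular_domain \<longleftrightarrow> Im \<tau> > 0 \<and> z \<notin> period_lattice \<tau>"
  by (simp add: regular_domain_def upper_half_plane_def)

lemma open_e1_slice: "open {z. (q, z) \<in> e1_domain}"
proof -
  have "open ((\<lambda>z. (q, z)) -` e1_domain)" by (intro open_vimage open_e1_domain continuous_intros)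
  then show ?thesis by (simp add: vimage_def)
qed

lemma open_period_lattice_compl: assumes "Im \<tau> > 0" shows "open (- period_lattice \<tau>)"
proof -
  have "open ((\<lambda>z. (\<tau>, z)) -` regular_domain)" by (intro open_vimage open_regular_domain continuous_intros)
  moreover have "(\<lambda>z. (\<tau>, z)) -` regular_domain = - period_lattice \<tau>"
    using assms by (auto simp: regular_domain_iff_period_lattice)
  ultimately show ?thesis by simp
qed

lemma punctured_neighbourhood_regular:
  assumes \<tau>: "Im \<tau> > 0"
  obtains r where "r > 0" "\<And>z. norm z < r \<Longrightarrow> (nome \<tau>, z) \<in> e1_domain"
    "\<And>z. norm z < r \<Longrightarrow> z \<noteq> 0 \<Longrightarrow> (\<tau>, z) \<in> regular_domain"
proof -
  obtain r where r: "r > 0" "ball 0 r \<subseteq> {z. (nome \<tau>, z) \<in> e1_domain}"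
    using open_contains_ball_eq[OF open_e1_slice[of "nome \<tau>"], of 0] zero_in_e1_slice[OF \<tau>] by blast
  show ?thesis
  proof (rule that[OF r(1)])
    show 1: "(nome \<tau>, z) \<in> e1_domain" if "norm z < r" for z using r(2) that by auto
    show "(\<tau>, z) \<in> regular_domain" if "norm z < r" "z \<noteq> 0" for z
      using 1[OF that(1)] that(2) \<tau> by (simp add: regular_domain_iff)
  qed
qed

lemma eventually_at_0_regular:
  assumes "Im \<tau> > 0" shows "\<forall>\<^sub>F z in at 0. (\<tau>, z) \<in> regular_domain"
proof -
  obtain r where "r > 0" "\<And>z. norm z < r \<Longrightarrow> z \<noteq> 0 \<Longrightarrow> (\<tau>, z) \<in> regular_domain"
    using punctured_neighbourhood_regular[OF assms] by metis
  then show ?thesis unfolding eventually_at by (auto simp: dist_norm)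
qed

text \<open>Liouville's theorem on the torus: a removable singularity at the origin is removable at all lattice
  points, and the resulting entire function takes all its values on a compact period parallelogram.\<close>

theorem elliptic_Liouville:
  assumes \<tau>: "Im \<tau> > 0" and hol: "f holomorphic_on - period_lattice \<tau>"
    and per: "\<And>z m n. z \<notin> period_lattice \<tau> \<Longrightarrow> f (z + of_int m * \<tau> + of_int n) = f z"
    and lim: "(f \<longlongrightarrow> c) (at 0)"
  shows "\<And>z. z \<notin> period_lattice \<tau> \<Longrightarrow> f z = c"
proof -
  define F where "F = (\<lambda>z. if z \<in> period_lattice \<tau> then c else f z)"
  have Fper: "F (z + of_int m * \<tau> + of_int n) = F z" for z m n
    using per[of z m n] by (simp add: F_def period_lattice_shift)
  obtain r where r: "r > 0" "\<And>z. norm z < r \<Longrightarrow> z \<noteq> 0 \<Longrightarrow> (\<tau>, z) \<in> regular_domain"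
    using punctured_neighbourhood_regular[OF \<tau>] by metis
  have "(\<lambda>y. if y = 0 then c else f y) holomorphic_on ball 0 r"
    by (rule removable_singularity[OF _ _ lim])
       (use r in \<open>auto simp: regular_domain_iff_period_lattice intro!: holomorphic_on_subset[OF hol]\<close>)
  then have F0: "F holomorphic_on ball 0 r"
    by (rule holomorphic_transform)
       (use r zero_in_period_lattice in \<open>auto simp: F_def regular_domain_iff_period_lattice\<close>)
  have Fout: "F holomorphic_on - period_lattice \<tau>"
    by (rule holomorphic_transform[OF hol]) (simp add: F_def)
  have "F field_differentiable at z" for z
  proof (cases "z \<in> period_lattice \<tau>")
    case False
    then show ?thesis using Fout open_period_lattice_compl[OF \<tau>] by (auto intro: holomorphic_on_imp_differentiable_at)
  next
    case True
    then obtain m n :: int where z: "z = of_int m * \<tau> + of_int n" unfolding period_lattice_def by blast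
    obtain F' where "(F has_field_derivative F') (at 0)"
      using F0 r(1) holomorphic_on_imp_differentiable_at[of F "ball 0 r" 0] by (auto simp: field_differentiable_def)
    then have "(F has_field_derivative F') (at (z + (- z)))" by simp
    then have "((\<lambda>w. F (w + (- z))) has_field_derivative F') (at z)" by (simp only: DERIV_shift)
    moreover have "F (w + (- z)) = F w" for w
      using Fper[of "w + (- z)" m n] by (simp add: z)
    ultimately show ?thesis by (auto simp: field_differentiable_def)
  qed
  then have hF: "F holomorphic_on UNIV" by (simp add: holomorphic_on_def)
  define K where "K = (\<lambda>p. of_real (fst p) * \<tau> + of_real (snd p)) ` ({0..1::real} \<times> {0..1::real})"
  have "compact K" unfolding K_def
    by (intro compact_continuous_image compact_Times continuous_intros) auto
  then have "compact (F ` K)"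
    by (intro compact_continuous_image holomorphic_on_imp_continuous_on holomorphic_on_subset[OF hF]) auto
  moreover have "range F \<subseteq> F ` K"
  proof safe
    fix z
    define s where "s = Im z / Im \<tau>"
    define t where "t = Re z - s * Re \<tau>"
    have z: "z = of_real s * \<tau> + of_real t" using \<tau> by (simp add: complex_eq_iff s_def t_def)
    define w where "w = of_real (frac s) * \<tau> + of_real (frac t)"
    have "w + of_int \<lfloor>s\<rfloor> * \<tau> + of_int \<lfloor>t\<rfloor> = z"
      unfolding w_def z frac_def by (simp add: algebra_simps)
    then have "F z = F w" using Fper[of w "\<lfloor>s\<rfloor>" "\<lfloor>t\<rfloor>"] by simp
    moreover have "w \<in> K" unfolding K_def w_def
      by (rule image_eqI[of _ _ "(frac s, frac t)"]) (auto simp: frac_ge_0 less_imp_le[OF frac_lt_1])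
    ultimately show "F z \<in> F ` K" by blast
  qed
  ultimately have "bounded (range F)" using bounded_subset compact_imp_bounded by blast
  from Liouville_theorem[OF hF this] obtain C where "\<And>z. F z = C" unfolding constant_on_def by auto
  moreover have "F 0 = c" using zero_in_period_lattice by (simp add: F_def)
  ultimately show "f z = c" if "z \<notin> period_lattice \<tau>" for z using that by (metis F_def)
qed

lemma eis_regular_part_tendsto:
  assumes "Im \<tau> > 0"
  shows "((\<lambda>z. (dz ^^ k) e1_regular (nome \<tau>, z)) \<longlongrightarrow> (dz ^^ k) e1_regular (nome \<tau>, 0)) (at 0)"
proof -
  have h: "(\<lambda>z. (dz ^^ k) e1_regular (nome \<tau>, z)) holomorphic_on {z. (nome \<tau>, z) \<in> e1_domain}"
    by (rule holomorphic2_on_slice_snd[OF dz_funpow_holomorphic2_on[OF open_e1_domain e1_regular_holomorphic2_on] open_e1_slice]) auto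
  have "isCont (\<lambda>z. (dz ^^ k) e1_regular (nome \<tau>, z)) 0"
    using holomorphic_on_imp_continuous_on[OF h] zero_in_e1_slice[OF assms] open_e1_slice[of "nome \<tau>"]
    by (simp add: continuous_on_eq_continuous_at)
  then show ?thesis by (simp add: isCont_def)
qed

lemma Eis_expansion:
  assumes "(\<tau>, z) \<in> regular_domain"
  shows "Eis (Suc k) (\<tau>, z) = 1 / z ^ Suc k + (-1) ^ k / fact k * (dz ^^ k) e1_regular (nome \<tau>, z)"
  using Eis_eq_eis_value[OF assms, of "Suc k"] by (simp add: eis_value_def)

lemma Eis_has_field_derivative:
  assumes reg: "(\<tau>, z) \<in> regular_domain"
  shows "((\<lambda>w. Eis (Suc k) (\<tau>, w)) has_field_derivative - of_nat (Suc k) * Eis (Suc (Suc k)) (\<tau>, z)) (at z)"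
proof -
  have \<tau>: "Im \<tau> > 0" and z0: "z \<noteq> 0" and e1: "(nome \<tau>, z) \<in> e1_domain" using reg by (auto simp: regular_domain_iff)
  have d1: "((\<lambda>w. 1 / w ^ Suc k) has_field_derivative - of_nat (Suc k) / z ^ Suc (Suc k)) (at z)"
    using z0 by (auto intro!: derivative_eq_intros simp: divide_simps) (cases k; simp add: algebra_simps)
  have d2: "((\<lambda>w. (dz ^^ k) e1_regular (nome \<tau>, w)) has_field_derivative (dz ^^ Suc k) e1_regular (nome \<tau>, z)) (at z)"
    using dz_has_field_derivative[OF dz_funpow_holomorphic2_on[OF open_e1_domain e1_regular_holomorphic2_on, of k] e1] by simp
  have d: "((\<lambda>w. 1 / w ^ Suc k + (-1) ^ k / fact k * (dz ^^ k) e1_regular (nome \<tau>, w)) has_field_derivative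
     - of_nat (Suc k) / z ^ Suc (Suc k) + (-1) ^ k / fact k * (dz ^^ Suc k) e1_regular (nome \<tau>, z)) (at z)"
    by (intro DERIV_add DERIV_cmult d1 d2)
  have c: "of_nat (Suc k) * ((-1) ^ Suc k / fact (Suc k)) = - ((-1) ^ k / fact k :: complex)"
    using of_nat_neq_0[of k, where 'a = complex] by (simp add: fact_Suc del: of_nat_Suc)
  have "- of_nat (Suc k) / z ^ Suc (Suc k) + (-1) ^ k / fact k * D = - of_nat (Suc k) * (1 / z ^ Suc (Suc k) + (-1) ^ Suc k / fact (Suc k) * D)" for D :: complex
  proof -
    have e: "- of_nat (Suc k) * (X + Y * D) = - of_nat (Suc k) * X - (of_nat (Suc k) * Y) * D" for X Y :: complex
      by (simp add: algebra_simps)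
    show ?thesis unfolding e c by simp
  qed
  then have "- of_nat (Suc k) / z ^ Suc (Suc k) + (-1) ^ k / fact k * (dz ^^ Suc k) e1_regular (nome \<tau>, z) = - of_nat (Suc k) * Eis (Suc (Suc k)) (\<tau>, z)"
    unfolding Eis_expansion[OF reg] .
  with d have d': "((\<lambda>w. 1 / w ^ Suc k + (-1) ^ k / fact k * (dz ^^ k) e1_regular (nome \<tau>, w)) has_field_derivative
     - of_nat (Suc k) * Eis (Suc (Suc k)) (\<tau>, z)) (at z)" by (simp only:)
  show ?thesis
  proof (rule has_field_derivative_transform_within_open[OF d' open_period_lattice_compl[OF \<tau>]])
    show "z \<in> - period_lattice \<tau>" using reg by (simp add: regular_domain_iff_period_lattice)
    fix w assume "w \<in> - period_lattice \<tau>"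
    then have "(\<tau>, w) \<in> regular_domain" using \<tau> by (simp add: regular_domain_iff_period_lattice)
    from Eis_expansion[OF this] show "1 / w ^ Suc k + (-1) ^ k / fact k * (dz ^^ k) e1_regular (nome \<tau>, w) = Eis (Suc k) (\<tau>, w)"
      by (rule sym)
  qed
qed

lemma Eis_holomorphic_on_slice:
  assumes "Im \<tau> > 0" shows "(\<lambda>w. Eis (Suc k) (\<tau>, w)) holomorphic_on - period_lattice \<tau>"
  unfolding holomorphic_on_open[OF open_period_lattice_compl[OF assms]]
proof (intro ballI exI)
  fix w assume "w \<in> - period_lattice \<tau>"
  then have "(\<tau>, w) \<in> regular_domain" using assms by (simp add: regular_domain_iff_period_lattice)
  then show "((\<lambda>w. Eis (Suc k) (\<tau>, w)) has_field_derivative - of_nat (Suc k) * Eis (Suc (Suc k)) (\<tau>, w)) (at w)"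
    by (rule Eis_has_field_derivative)
qed

lemma neg_regular_domain: "(\<tau>, - z) \<in> regular_domain \<longleftrightarrow> (\<tau>, z) \<in> regular_domain"
proof -
  have "- z \<in> period_lattice \<tau>" if z: "z \<in> period_lattice \<tau>" for z
  proof -
    obtain m n :: int where "z = of_int m * \<tau> + of_int n" using z unfolding period_lattice_def by blast
    then have "- z = of_int (- m) * \<tau> + of_int (- n)" by simp
    then show ?thesis by (metis period_latticeI)
  qed
  from this[of z] this[of "- z"] show ?thesis by (auto simp: regular_domain_iff_period_lattice)
qed

lemma Eis_1_rows:
  assumes "(\<tau>, z) \<in> regular_domain"
  shows "(\<lambda>A. \<Sum>a = - int A..int A. int_pole_sum 1 (z + of_int a * \<tau>)) \<longlonglongrightarrow> Eis 1 (\<tau>, z)"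
  using eis_rows_LIMSEQ[OF assms, of 1] Eis_eq_eis_value[OF assms, of 1] by simp

lemma nome_add_of_int: "nome (w + of_int n) = nome w"
proof -
  have "nome (of_int n) = 1" by (subst exp_2pi_i_eq_1_iff) simp
  then show ?thesis unfolding nome_add by simp
qed

lemma Eis_1_shift_1:
  assumes reg: "(\<tau>, z) \<in> regular_domain" shows "Eis 1 (\<tau>, z + 1) = Eis 1 (\<tau>, z)"
proof -
  have reg': "(\<tau>, z + 1) \<in> regular_domain" using regular_domain_shift[of \<tau> z 0 1] reg by simp
  have "int_pole_sum 1 (z + 1 + of_int a * \<tau>) = int_pole_sum 1 (z + of_int a * \<tau>)" for a
  proof -
    have "nome (z + 1 + of_int a * \<tau>) = nome (z + of_int a * \<tau>)"
      using nome_add_of_int[of "z + of_int a * \<tau>" 1] by (simp add: add_ac)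
    then show ?thesis
      by (simp only: int_pole_sum_1_lambert[OF regular_not_Int[OF reg]] int_pole_sum_1_lambert[OF regular_not_Int[OF reg']])
  qed
  then show ?thesis using Eis_1_rows[OF reg'] Eis_1_rows[OF reg] by (simp add: LIMSEQ_unique)
qed

text \<open>Shifting by \<open>\<tau>\<close> moves the window of rows by one; the two boundary rows contribute the
  limits of the cotangent for imaginary part \<open>\<plusminus>\<infinity>\<close>.\<close>

lemma Eis_1_shift_tau:
  assumes reg: "(\<tau>, z) \<in> regular_domain" shows "Eis 1 (\<tau>, z + \<tau>) = Eis 1 (\<tau>, z) - 2 * of_real pi * \<i>"
proof -
  have \<tau>: "Im \<tau> > 0" using reg by (simp add: regular_domain_iff)
  have reg': "(\<tau>, z + \<tau>) \<in> regular_domain" using regular_domain_shift[of \<tau> z 1 0] reg by simp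
  have regn: "(\<tau>, - z) \<in> regular_domain" using reg neg_regular_domain by simp
  define f where "f = (\<lambda>a::int. int_pole_sum 1 (z + of_int a * \<tau>))"
  have edge: "(\<lambda>A. int_pole_sum 1 (w + of_int (int A) * \<tau>)) \<longlonglongrightarrow> - of_real pi * \<i>"
    if "(\<tau>, w) \<in> regular_domain" for w
  proof -
    have "(\<lambda>A. nome \<tau> ^ A) \<longlonglongrightarrow> 0" by (rule LIMSEQ_power_zero) (rule nome_norm_less_1[OF \<tau>])
    then have "(\<lambda>A. - of_real pi * \<i> - 2 * of_real pi * \<i> * (nome w * nome \<tau> ^ A / (1 - nome w * nome \<tau> ^ A))) \<longlonglongrightarrow>
       - of_real pi * \<i> - 2 * of_real pi * \<i> * (nome w * 0 / (1 - nome w * 0))"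
      by (intro tendsto_diff tendsto_const tendsto_mult tendsto_divide) simp_all
    moreover have "int_pole_sum 1 (w + of_int (int A) * \<tau>) = - of_real pi * \<i> - 2 * of_real pi * \<i> * (nome w * nome \<tau> ^ A / (1 - nome w * nome \<tau> ^ A))" for A
    proof -
      have "nome (w + of_int (int A) * \<tau>) = nome w * nome \<tau> ^ A"
        unfolding nome_add using nome_of_nat_mult[of A \<tau>] by simp
      then show ?thesis unfolding int_pole_sum_1_lambert[OF regular_not_Int[OF that]] by (simp add: lambert_def)
    qed
    ultimately show ?thesis by simp
  qed
  have e1: "(\<lambda>A. f (int (Suc A))) \<longlonglongrightarrow> - of_real pi * \<i>"
    using LIMSEQ_Suc[OF edge[OF reg]] unfolding f_def .
  have e2: "(\<lambda>A. f (- int A)) \<longlonglongrightarrow> of_real pi * \<i>"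
  proof -
    have "f (- int A) = - int_pole_sum 1 (- z + of_int (int A) * \<tau>)" for A
      using int_pole_sum_1_minus[OF regular_not_Int[OF regn, of "int A"]] by (simp add: f_def)
    then show ?thesis using tendsto_minus[OF edge[OF regn]] by simp
  qed
  have "(\<Sum>a = - int A..int A. int_pole_sum 1 (z + \<tau> + of_int a * \<tau>)) = (\<Sum>a = - int A..int A. f a) + f (int (Suc A)) - f (- int A)" for A
  proof -
    have "(\<Sum>a = - int A..int A. int_pole_sum 1 (z + \<tau> + of_int a * \<tau>)) = (\<Sum>a = - int A..int A. f (a + 1))"
      by (simp add: f_def algebra_simps)
    also have "\<dots> = (\<Sum>a \<in> {- int A + 1..int A + 1}. f a)"
      by (rule sum.reindex_bij_witness[of _ "\<lambda>a. a - 1" "\<lambda>a. a + 1"]) auto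
    also have "\<dots> = (\<Sum>a = - int A..int A. f a) + f (int (Suc A)) - f (- int A)"
    proof -
      have "{- int A..int A + 1} = insert (- int A) {- int A + 1..int A + 1}" by auto
      then have 1: "(\<Sum>a \<in> {- int A..int A + 1}. f a) = f (- int A) + (\<Sum>a \<in> {- int A + 1..int A + 1}. f a)" by simp
      have "{- int A..int A + 1} = insert (int A + 1) {- int A..int A}" by auto
      then have "(\<Sum>a \<in> {- int A..int A + 1}. f a) = f (int A + 1) + (\<Sum>a = - int A..int A. f a)" by simp
      with 1 show ?thesis by (simp add: algebra_simps)
    qed
    finally show ?thesis .
  qed
  moreover have "(\<lambda>A. (\<Sum>a = - int A..int A. f a) + f (int (Suc A)) - f (- int A)) \<longlonglongrightarrow> Eis 1 (\<tau>, z) + (- of_real pi * \<i>) - of_real pi * \<i>"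
    using Eis_1_rows[OF reg] by (intro tendsto_add tendsto_diff e1 e2) (simp add: f_def)
  ultimately have "(\<lambda>A. \<Sum>a = - int A..int A. int_pole_sum 1 (z + \<tau> + of_int a * \<tau>)) \<longlonglongrightarrow> Eis 1 (\<tau>, z) + (- of_real pi * \<i>) - of_real pi * \<i>"
    by simp
  from LIMSEQ_unique[OF Eis_1_rows[OF reg'] this] show ?thesis by simp
qed

lemma Eis_1_shift:
  assumes reg: "(\<tau>, z) \<in> regular_domain"
  shows "Eis 1 (\<tau>, z + of_int m * \<tau> + of_int n) = Eis 1 (\<tau>, z) - 2 * of_real pi * \<i> * of_int m"
proof -
  have regm: "(\<tau>, z + of_int m * \<tau> + of_int n) \<in> regular_domain" for m n using reg regular_domain_shift by simp
  have regm0: "(\<tau>, z + of_int m * \<tau>) \<in> regular_domain" for m using regm[of m 0] by simp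
  have 1: "Eis 1 (\<tau>, z + of_int m * \<tau>) = Eis 1 (\<tau>, z) - 2 * of_real pi * \<i> * of_int m" for m
  proof (induction m rule: int_induct[where k = 0])
    case (step1 i)
    have e: "z + of_int (i + 1) * \<tau> = (z + of_int i * \<tau>) + \<tau>" by (simp add: algebra_simps)
    show ?case unfolding e Eis_1_shift_tau[OF regm0[of i]] step1(2) by (simp add: algebra_simps)
  next
    case (step2 i)
    have e: "(z + of_int (i - 1) * \<tau>) + \<tau> = z + of_int i * \<tau>" by (simp add: algebra_simps)
    have "Eis 1 (\<tau>, z + of_int (i - 1) * \<tau>) = Eis 1 (\<tau>, z + of_int i * \<tau>) + 2 * of_real pi * \<i>"
      using Eis_1_shift_tau[OF regm0[of "i - 1"]] unfolding e by simp
    then show ?case unfolding step2(2) by (simp add: algebra_simps)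
  qed simp
  have "Eis 1 (\<tau>, z + of_int m * \<tau> + of_int n) = Eis 1 (\<tau>, z + of_int m * \<tau>)" for n
  proof (induction n rule: int_induct[where k = 0])
    case (step1 i)
    have e: "z + of_int m * \<tau> + of_int (i + 1) = (z + of_int m * \<tau> + of_int i) + 1" by simp
    show ?case unfolding e Eis_1_shift_1[OF regm[of m i]] step1(2) ..
  next
    case (step2 i)
    have e: "(z + of_int m * \<tau> + of_int (i - 1)) + 1 = z + of_int m * \<tau> + of_int i" by simp
    show ?case using Eis_1_shift_1[OF regm[of m "i - 1"]] unfolding e step2(2) by simp
  qed simp
  with 1 show ?thesis by simp
qed

lemma Eis_shift:
  assumes reg: "(\<tau>, z) \<in> regular_domain"
  shows "Eis (Suc (Suc k)) (\<tau>, z + of_int m * \<tau> + of_int n) = Eis (Suc (Suc k)) (\<tau>, z)"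
  using reg
proof (induction k arbitrary: z)
  case (0 z)
  have \<tau>: "Im \<tau> > 0" using 0 by (simp add: regular_domain_iff)
  have r: "(\<tau>, z + (of_int m * \<tau> + of_int n)) \<in> regular_domain" using regular_domain_shift 0 by (simp add: add.assoc)
  have "((\<lambda>w. Eis 1 (\<tau>, w + (of_int m * \<tau> + of_int n))) has_field_derivative - Eis 2 (\<tau>, z + (of_int m * \<tau> + of_int n))) (at z)"
    using Eis_has_field_derivative[OF r, of 0] by (simp add: DERIV_shift numeral_2_eq_2)
  moreover have "((\<lambda>w. Eis 1 (\<tau>, w) - 2 * of_real pi * \<i> * of_int m) has_field_derivative - Eis 2 (\<tau>, z) - 0) (at z)"
    using Eis_has_field_derivative[OF 0, of 0] by (intro DERIV_diff DERIV_const) (simp add: numeral_2_eq_2)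
  then have "((\<lambda>w. Eis 1 (\<tau>, w + (of_int m * \<tau> + of_int n))) has_field_derivative - Eis 2 (\<tau>, z) - 0) (at z)"
    by (rule has_field_derivative_transform_within_open[OF _ open_period_lattice_compl[OF \<tau>]])
       (use 0 \<tau> Eis_1_shift[of \<tau> _ m n] in \<open>auto simp: regular_domain_iff_period_lattice add.assoc\<close>)
  ultimately have "- Eis 2 (\<tau>, z + (of_int m * \<tau> + of_int n)) = - Eis 2 (\<tau>, z) - 0" by (rule DERIV_unique)
  then show ?case by (simp add: numeral_2_eq_2 add.assoc)
next
  case (Suc k z)
  have \<tau>: "Im \<tau> > 0" using Suc.prems by (simp add: regular_domain_iff)
  have r: "(\<tau>, z + (of_int m * \<tau> + of_int n)) \<in> regular_domain" using regular_domain_shift Suc.prems by (simp add: add.assoc)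
  have "((\<lambda>w. Eis (Suc (Suc k)) (\<tau>, w + (of_int m * \<tau> + of_int n))) has_field_derivative
      - of_nat (Suc (Suc k)) * Eis (Suc (Suc (Suc k))) (\<tau>, z + (of_int m * \<tau> + of_int n))) (at z)"
    using Eis_has_field_derivative[OF r, of "Suc k"] by (simp only: DERIV_shift)
  moreover have "((\<lambda>w. Eis (Suc (Suc k)) (\<tau>, w + (of_int m * \<tau> + of_int n))) has_field_derivative
      - of_nat (Suc (Suc k)) * Eis (Suc (Suc (Suc k))) (\<tau>, z)) (at z)"
    by (rule has_field_derivative_transform_within_open[OF Eis_has_field_derivative[OF Suc.prems] open_period_lattice_compl[OF \<tau>]])
       (use Suc.prems Suc.IH \<tau> in \<open>auto simp: regular_domain_iff_period_lattice add.assoc\<close>)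
  ultimately have "- of_nat (Suc (Suc k)) * Eis (Suc (Suc (Suc k))) (\<tau>, z + (of_int m * \<tau> + of_int n)) = - of_nat (Suc (Suc k)) * Eis (Suc (Suc (Suc k))) (\<tau>, z)"
    by (rule DERIV_unique)
  moreover have "- of_nat (Suc (Suc k)) \<noteq> (0 :: complex)" using of_nat_neq_0[of "Suc k", where 'a = complex] by (simp del: of_nat_Suc)
  ultimately show ?case by (simp only: mult_cancel_left add.assoc) simp
qed

context
  fixes a b c d :: int and \<tau> :: complex and j \<tau>' :: complex
  assumes det: "a * d - b * c = 1" and \<tau>: "Im \<tau> > 0"
  defines "j \<equiv> of_int c * \<tau> + of_int d" and "\<tau>' \<equiv> (of_int a * \<tau> + of_int b) / (of_int c * \<tau> + of_int d)"
begin

lemma mobius_denominator_nonzero: "j \<noteq> 0"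
proof
  assume "j = 0"
  then have "Im j = 0 \<and> Re j = 0" by simp
  then have "c = 0 \<and> d = 0" using \<tau> by (auto simp: j_def)
  then show False using det by simp
qed

lemma mobius_inverse_denominator: "1 / j = of_int a - of_int c * \<tau>'" "\<tau> / j = of_int d * \<tau>' - of_int b"
proof -
  have dt: "of_int a * of_int d - of_int b * of_int c = (1 :: complex)"
    using arg_cong[OF det, of "of_int :: int \<Rightarrow> complex"] by simp
  have t: "\<tau>' = (of_int a * \<tau> + of_int b) / j" by (simp add: \<tau>'_def j_def)
  have "(of_int a - of_int c * \<tau>') * j = of_int a * j - of_int c * (of_int a * \<tau> + of_int b)"
    unfolding t using mobius_denominator_nonzero by (simp add: field_simps)
  also have "\<dots> = of_int a * of_int d - of_int b * of_int c" by (simp add: j_def algebra_simps)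
  finally show "1 / j = of_int a - of_int c * \<tau>'" using dt mobius_denominator_nonzero by (simp add: field_simps)
  have "(of_int d * \<tau>' - of_int b) * j = of_int d * (of_int a * \<tau> + of_int b) - of_int b * j"
    unfolding t using mobius_denominator_nonzero by (simp add: field_simps)
  also have "\<dots> = (of_int a * of_int d - of_int b * of_int c) * \<tau>" by (simp add: j_def algebra_simps)
  finally show "\<tau> / j = of_int d * \<tau>' - of_int b" using dt mobius_denominator_nonzero by (simp add: field_simps)
qed

lemma mobius_minus_cnj: "\<tau>' - cnj \<tau>' = (\<tau> - cnj \<tau>) / (j * cnj j)"
proof -
  have dt: "of_int a * of_int d - of_int b * of_int c = (1 :: complex)"
    using arg_cong[OF det, of "of_int :: int \<Rightarrow> complex"] by simp
  have j0: "j \<noteq> 0" "cnj j \<noteq> 0" using mobius_denominator_nonzero by auto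
  have "\<tau>' - cnj \<tau>' = (of_int a * \<tau> + of_int b) / j - (of_int a * cnj \<tau> + of_int b) / cnj j"
    by (simp add: \<tau>'_def j_def)
  also have "\<dots> = ((of_int a * \<tau> + of_int b) * cnj j - (of_int a * cnj \<tau> + of_int b) * j) / (j * cnj j)"
    using j0 by (simp add: field_simps)
  also have "(of_int a * \<tau> + of_int b) * cnj j - (of_int a * cnj \<tau> + of_int b) * j
     = (of_int a * of_int d - of_int b * of_int c) * (\<tau> - cnj \<tau>)"
    by (simp add: j_def algebra_simps)
  finally show ?thesis by (simp add: dt)
qed

lemma Im_mobius_pos: "Im \<tau>' > 0"
proof -
  have "2 * \<i> * of_real (Im \<tau>') = 2 * \<i> * of_real (Im \<tau>) / of_real ((norm j)\<^sup>2)"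
    using mobius_minus_cnj by (simp add: complex_diff_cnj complex_norm_square[symmetric] mult_ac)
  then have "2 * \<i> * of_real (Im \<tau>') = 2 * \<i> * (of_real (Im \<tau> / (norm j)\<^sup>2) :: complex)" by simp
  then have "of_real (Im \<tau>') = (of_real (Im \<tau> / (norm j)\<^sup>2) :: complex)"
    by (subst (asm) mult_left_cancel) auto
  then have "Im \<tau>' = Im \<tau> / (norm j)\<^sup>2" by (simp only: of_real_eq_iff)
  then show ?thesis using \<tau> mobius_denominator_nonzero by simp
qed

lemma mobius_shift:
  "(z + of_int m * \<tau> + of_int n) / j = z / j + of_int (m * d - n * c) * \<tau>' + of_int (n * a - m * b)"
proof -
  have "(z + of_int m * \<tau> + of_int n) / j = z / j + of_int m * (\<tau> / j) + of_int n * (1 / j)"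
    by (simp add: add_divide_distrib)
  then show ?thesis unfolding mobius_inverse_denominator by (simp add: algebra_simps)
qed

lemma period_lattice_mobius: "z / j \<in> period_lattice \<tau>' \<longleftrightarrow> z \<in> period_lattice \<tau>"
proof
  assume "z \<in> period_lattice \<tau>"
  then obtain m n :: int where "z = of_int m * \<tau> + of_int n" unfolding period_lattice_def by blast
  then have "z / j = of_int (m * d - n * c) * \<tau>' + of_int (n * a - m * b)" using mobius_shift[of 0 m n] by simp
  then show "z / j \<in> period_lattice \<tau>'" by (metis period_latticeI)
next
  assume "z / j \<in> period_lattice \<tau>'"
  then obtain m n :: int where "z / j = of_int m * \<tau>' + of_int n" unfolding period_lattice_def by blast
  then have "z = of_int m * (\<tau>' * j) + of_int n * j" using mobius_denominator_nonzero by (simp add: field_simps)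
  also have "\<tau>' * j = of_int a * \<tau> + of_int b" using mobius_denominator_nonzero by (simp add: \<tau>'_def j_def)
  also have "of_int m * (of_int a * \<tau> + of_int b) + of_int n * j = of_int (m * a + n * c) * \<tau> + of_int (m * b + n * d)"
    by (simp add: j_def algebra_simps)
  finally show "z \<in> period_lattice \<tau>" by (metis period_latticeI)
qed

lemma regular_domain_mobius: "(\<tau>', z / j) \<in> regular_domain \<longleftrightarrow> (\<tau>, z) \<in> regular_domain"
  using period_lattice_mobius[of z] Im_mobius_pos \<tau> by (simp add: regular_domain_iff_period_lattice)

lemma eis_regular_part_isCont:
  assumes "Im t > 0" shows "isCont (\<lambda>z. (dz ^^ k) e1_regular (nome t, z)) 0"
  using eis_regular_part_tendsto[OF assms, of k] by (simp add: isCont_def)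

text \<open>The linear term absorbs the quasi-periods of both Eisenstein series, so that the difference of the two sides is
  doubly periodic. It tends to 0 at the origin, and Liouville's theorem applies.\<close>

theorem Eis_1_mobius:
  assumes reg: "(\<tau>, z) \<in> regular_domain"
  shows "Eis 1 (\<tau>', z / j) = j * Eis 1 (\<tau>, z) + 2 * of_real pi * \<i> * of_int c * z"
proof -
  define f where "f = (\<lambda>z. Eis 1 (\<tau>', z / j) - j * Eis 1 (\<tau>, z) - 2 * of_real pi * \<i> * of_int c * z)"
  have "f w = 0" if w: "w \<notin> period_lattice \<tau>" for w
  proof (rule elliptic_Liouville[OF \<tau> _ _ _ w])
    have "(\<lambda>z. Eis (Suc 0) (\<tau>', z / j)) holomorphic_on - period_lattice \<tau>"
    proof -
      have "((\<lambda>w. Eis (Suc 0) (\<tau>', w)) \<circ> (\<lambda>z. z / j)) holomorphic_on - period_lattice \<tau>"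
      proof (rule holomorphic_on_compose)
        show "(\<lambda>z. z / j) holomorphic_on - period_lattice \<tau>"
          by (intro holomorphic_intros) (rule mobius_denominator_nonzero)
        show "(\<lambda>w. Eis (Suc 0) (\<tau>', w)) holomorphic_on (\<lambda>z. z / j) ` (- period_lattice \<tau>)"
          by (rule holomorphic_on_subset[OF Eis_holomorphic_on_slice[OF Im_mobius_pos]]) (auto simp: period_lattice_mobius)
      qed
      then show ?thesis by (simp add: o_def)
    qed
    then show "f holomorphic_on - period_lattice \<tau>"
      unfolding f_def One_nat_def using Eis_holomorphic_on_slice[OF \<tau>, of 0] by (intro holomorphic_intros)
    show "f (z + of_int m * \<tau> + of_int n) = f z" if z: "z \<notin> period_lattice \<tau>" for z m n
    proof -
      have r: "(\<tau>, z) \<in> regular_domain" using z \<tau> by (simp add: regular_domain_iff_period_lattice)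
      then have r': "(\<tau>', z / j) \<in> regular_domain" by (simp add: regular_domain_mobius)
      show ?thesis unfolding f_def mobius_shift Eis_1_shift[OF r] Eis_1_shift[OF r']
        by (simp add: j_def algebra_simps)
    qed
    define g where "g = (\<lambda>z. e1_regular (nome \<tau>', z / j) - j * e1_regular (nome \<tau>, z) - 2 * of_real pi * \<i> * of_int c * z)"
    have e0: "e1_regular (q, 0) = 0" for q by (simp add: e1_regular_def)
    have "((\<lambda>z. z / j) \<longlongrightarrow> 0) (at 0)" by (rule tendsto_eq_intros refl | simp add: mobius_denominator_nonzero)+
    from isCont_tendsto_compose[OF eis_regular_part_isCont[OF Im_mobius_pos, of 0] this]
    have "((\<lambda>z. e1_regular (nome \<tau>', z / j)) \<longlongrightarrow> 0) (at 0)" by (simp add: e0)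
    moreover have "((\<lambda>z. e1_regular (nome \<tau>, z)) \<longlongrightarrow> 0) (at 0)" using eis_regular_part_tendsto[OF \<tau>, of 0] by (simp add: e0)
    ultimately have "(g \<longlongrightarrow> 0 - j * 0 - 2 * of_real pi * \<i> * of_int c * 0) (at 0)"
      unfolding g_def by (intro tendsto_intros)
    moreover have "\<forall>\<^sub>F z in at 0. g z = f z"
      using eventually_at_0_regular[OF \<tau>]
    proof eventually_elim
      case (elim z)
      then have "(\<tau>', z / j) \<in> regular_domain" by (simp add: regular_domain_mobius)
      then have e: "Eis 1 (\<tau>', z / j) = j * (1 / z) + e1_regular (nome \<tau>', z / j)" "Eis 1 (\<tau>, z) = 1 / z + e1_regular (nome \<tau>, z)"
        using Eis_expansion[of \<tau>' "z / j" 0] Eis_expansion[OF elim, of 0] by simp_all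
      show ?case by (simp only: f_def g_def e) (simp add: algebra_simps)
    qed
    ultimately show "(f \<longlongrightarrow> 0) (at 0)" by (simp add: filterlim_cong)
  qed
  then show ?thesis using reg by (simp add: f_def regular_domain_iff_period_lattice algebra_simps)
qed

lemma Eis_mobius_derivative:
  assumes reg: "(\<tau>, z) \<in> regular_domain"
  shows "((\<lambda>w. Eis (Suc k) (\<tau>', w / j)) has_field_derivative - of_nat (Suc k) * Eis (Suc (Suc k)) (\<tau>', z / j) * (1 / j)) (at z)"
proof -
  have reg': "(\<tau>', z / j) \<in> regular_domain" using reg by (simp add: regular_domain_mobius)
  show ?thesis
    by (rule DERIV_chain2[where f = "\<lambda>w. Eis (Suc k) (\<tau>', w)" and g = "\<lambda>w. w / j", OF Eis_has_field_derivative[OF reg']])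
       (use mobius_denominator_nonzero in \<open>auto intro!: derivative_eq_intros\<close>)
qed

lemma Eis_2_mobius:
  assumes reg: "(\<tau>, z) \<in> regular_domain"
  shows "Eis 2 (\<tau>', z / j) = j ^ 2 * Eis 2 (\<tau>, z) - 2 * of_real pi * \<i> * of_int c * j"
proof -
  have "((\<lambda>w. j * Eis (Suc 0) (\<tau>, w) + 2 * of_real pi * \<i> * of_int c * w) has_field_derivative
      j * (- of_nat (Suc 0) * Eis (Suc (Suc 0)) (\<tau>, z)) + 2 * of_real pi * \<i> * of_int c * 1) (at z)"
    by (intro DERIV_add DERIV_cmult DERIV_ident Eis_has_field_derivative[OF reg])
  then have "((\<lambda>w. Eis (Suc 0) (\<tau>', w / j)) has_field_derivative
      j * (- of_nat (Suc 0) * Eis (Suc (Suc 0)) (\<tau>, z)) + 2 * of_real pi * \<i> * of_int c * 1) (at z)"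
  proof (rule has_field_derivative_transform_within_open[OF _ open_period_lattice_compl[OF \<tau>]])
    show "z \<in> - period_lattice \<tau>" using reg by (simp add: regular_domain_iff_period_lattice)
    fix w assume "w \<in> - period_lattice \<tau>"
    then have "(\<tau>, w) \<in> regular_domain" using \<tau> by (simp add: regular_domain_iff_period_lattice)
    from Eis_1_mobius[OF this]
    show "j * Eis (Suc 0) (\<tau>, w) + 2 * of_real pi * \<i> * of_int c * w = Eis (Suc 0) (\<tau>', w / j)" by simp
  qed
  from DERIV_unique[OF this Eis_mobius_derivative[OF reg, of 0]] show ?thesis
    using mobius_denominator_nonzero by (simp add: numeral_2_eq_2 field_simps)
qed

lemma Eis_mobius:
  assumes reg: "(\<tau>, z) \<in> regular_domain" and n: "n \<ge> 3"
  shows "Eis n (\<tau>', z / j) = j ^ n * Eis n (\<tau>, z)"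
proof -
  have step: "Eis (Suc (Suc k)) (\<tau>', z / j) = j ^ Suc (Suc k) * Eis (Suc (Suc k)) (\<tau>, z)"
    if IH: "\<And>w. (\<tau>, w) \<in> regular_domain \<Longrightarrow> Eis (Suc k) (\<tau>', w / j) = j ^ Suc k * Eis (Suc k) (\<tau>, w) + C"
      and reg: "(\<tau>, z) \<in> regular_domain" for k C z
  proof -
    have "((\<lambda>w. j ^ Suc k * Eis (Suc k) (\<tau>, w) + C) has_field_derivative
        j ^ Suc k * (- of_nat (Suc k) * Eis (Suc (Suc k)) (\<tau>, z)) + 0) (at z)"
      by (intro DERIV_add DERIV_cmult DERIV_const Eis_has_field_derivative[OF reg])
    then have "((\<lambda>w. Eis (Suc k) (\<tau>', w / j)) has_field_derivative
        j ^ Suc k * (- of_nat (Suc k) * Eis (Suc (Suc k)) (\<tau>, z)) + 0) (at z)"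
    proof (rule has_field_derivative_transform_within_open[OF _ open_period_lattice_compl[OF \<tau>]])
      show "z \<in> - period_lattice \<tau>" using reg by (simp add: regular_domain_iff_period_lattice)
      fix w assume "w \<in> - period_lattice \<tau>"
      then have "(\<tau>, w) \<in> regular_domain" using \<tau> by (simp add: regular_domain_iff_period_lattice)
      from IH[OF this] show "j ^ Suc k * Eis (Suc k) (\<tau>, w) + C = Eis (Suc k) (\<tau>', w / j)" by simp
    qed
    from DERIV_unique[OF this Eis_mobius_derivative[OF reg, of k]]
    have "- of_nat (Suc k) * (j ^ Suc k * Eis (Suc (Suc k)) (\<tau>, z)) = - of_nat (Suc k) * (Eis (Suc (Suc k)) (\<tau>', z / j) * (1 / j))"
      by (simp only: mult_ac add_0_right)
    moreover have "- of_nat (Suc k) \<noteq> (0 :: complex)" using of_nat_neq_0[of k, where 'a = complex] by (simp del: of_nat_Suc)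
    ultimately have "j ^ Suc k * Eis (Suc (Suc k)) (\<tau>, z) = Eis (Suc (Suc k)) (\<tau>', z / j) * (1 / j)"
      by (simp only: mult_cancel_left) simp
    then show ?thesis using mobius_denominator_nonzero by (simp add: field_simps)
  qed
  have "Eis (Suc (Suc (Suc k))) (\<tau>', z / j) = j ^ Suc (Suc (Suc k)) * Eis (Suc (Suc (Suc k))) (\<tau>, z)"
    if "(\<tau>, z) \<in> regular_domain" for k z
    using that
  proof (induction k arbitrary: z)
    case 0
    show ?case
      by (rule step[where C = "- 2 * of_real pi * \<i> * of_int c * j", OF _ 0])
         (use Eis_2_mobius in \<open>simp add: numeral_2_eq_2\<close>)
  next
    case (Suc k)
    show ?case by (rule step[where C = 0, OF _ Suc.prems]) (simp only: Suc.IH add_0_right)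
  qed
  from this[OF reg, of "n - 3"] n show ?thesis by (simp add: numeral_3_eq_3 Suc_diff_Suc)
qed

text \<open>Compare constant terms at \<open>z = 0\<close> in the transformation law of \<open>E\<^sub>2\<close>.\<close>

lemma eis2_mobius:
  assumes reg: "(\<tau>, z) \<in> regular_domain"
  shows "eis2 (\<tau>', z / j) = j ^ 2 * eis2 (\<tau>, z) - 2 * of_real pi * \<i> * of_int c * j"
proof -
  have reg': "(\<tau>', z / j) \<in> regular_domain" using reg by (simp add: regular_domain_mobius)
  have "((\<lambda>z. z / j) \<longlongrightarrow> 0) (at 0)" by (rule tendsto_eq_intros refl | simp add: mobius_denominator_nonzero)+
  from isCont_tendsto_compose[OF eis_regular_part_isCont[OF Im_mobius_pos, of 1] this]
  have l1: "((\<lambda>z. dz e1_regular (nome \<tau>', z / j)) \<longlongrightarrow> dz e1_regular (nome \<tau>', 0)) (at 0)" by simp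
  have "((\<lambda>z. dz e1_regular (nome \<tau>, z)) \<longlongrightarrow> dz e1_regular (nome \<tau>, 0)) (at 0)"
    using eis_regular_part_tendsto[OF \<tau>, of 1] by simp
  then have l2: "((\<lambda>z. j ^ 2 * dz e1_regular (nome \<tau>, z) + 2 * of_real pi * \<i> * of_int c * j)
     \<longlongrightarrow> j ^ 2 * dz e1_regular (nome \<tau>, 0) + 2 * of_real pi * \<i> * of_int c * j) (at 0)"
    by (intro tendsto_intros)
  have "\<forall>\<^sub>F z in at 0. dz e1_regular (nome \<tau>', z / j) = j ^ 2 * dz e1_regular (nome \<tau>, z) + 2 * of_real pi * \<i> * of_int c * j"
    using eventually_at_0_regular[OF \<tau>]
  proof eventually_elim
    case (elim z)
    then have r: "(\<tau>', z / j) \<in> regular_domain" by (simp add: regular_domain_mobius)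
    have z0: "z \<noteq> 0" using elim by (simp add: regular_domain_iff)
    have "j\<^sup>2 * (1 / z\<^sup>2) = 1 / (z / j)\<^sup>2" using z0 mobius_denominator_nonzero by (simp add: power_divide)
    then have h: "1 / (z / j)\<^sup>2 - X = 1 / (z / j)\<^sup>2 - j\<^sup>2 * Y - C" if "1 / (z / j)\<^sup>2 - X = j\<^sup>2 * (1 / z\<^sup>2 - Y) - C" for X Y C
      using that by (simp only: right_diff_distrib)
    have gen: "X = Y + C" if "B - X = B - Y - C" for B X Y C :: complex using that by (simp add: algebra_simps)
    have e: "Eis 2 (\<tau>', z / j) = 1 / (z / j)\<^sup>2 - dz e1_regular (nome \<tau>', z / j)" "Eis 2 (\<tau>, z) = 1 / z\<^sup>2 - dz e1_regular (nome \<tau>, z)"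
      using Eis_expansion[OF r, of 1] Eis_expansion[OF elim, of 1] by (simp_all add: numeral_2_eq_2)
    show ?case using Eis_2_mobius[OF elim] unfolding e by (rule gen[OF h])
  qed
  then have "((\<lambda>z. dz e1_regular (nome \<tau>', z / j)) \<longlongrightarrow> j ^ 2 * dz e1_regular (nome \<tau>, 0) + 2 * of_real pi * \<i> * of_int c * j) (at 0)"
    using l2 by (simp add: filterlim_cong)
  from tendsto_unique[OF _ l1 this] show ?thesis
    unfolding eis2_eq[OF reg] eis2_eq[OF reg'] by (simp add: algebra_simps)
qed

lemma jacobi_lambda_mobius: "jacobi_lambda (\<tau>', z / j) = j * jacobi_lambda (\<tau>, z) - of_int c * z"
proof -
  have j0: "j \<noteq> 0" "cnj j \<noteq> 0" using mobius_denominator_nonzero by auto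
  have t0: "\<tau> - cnj \<tau> \<noteq> 0" using \<tau> by (auto simp: complex_eq_iff)
  have "z / j - cnj (z / j) = (z * cnj j - cnj z * j) / (j * cnj j)" using j0 by (simp add: field_simps)
  then have "jacobi_lambda (\<tau>', z / j) = (z * cnj j - cnj z * j) / (\<tau> - cnj \<tau>)"
    unfolding jacobi_lambda_def case_prod_conv mobius_minus_cnj using j0 by simp
  also have "z * cnj j - cnj z * j = j * (z - cnj z) - of_int c * z * (\<tau> - cnj \<tau>)"
    by (simp add: j_def algebra_simps)
  also have "\<dots> / (\<tau> - cnj \<tau>) = j * ((z - cnj z) / (\<tau> - cnj \<tau>)) - of_int c * z"
  proof -
    have "(J * U - V * W) / W = J * (U / W) - V" if "W \<noteq> 0" for J U V W :: complex
      using that by (simp add: diff_divide_distrib)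
    then show ?thesis by this (rule t0)
  qed
  finally show ?thesis by (simp only: jacobi_lambda_def case_prod_conv)
qed

lemma jacobi_mu_mobius: "jacobi_mu (\<tau>', z / j) = j ^ 2 * jacobi_mu (\<tau>, z) - of_int c * j"
proof -
  have j0: "j \<noteq> 0" "cnj j \<noteq> 0" using mobius_denominator_nonzero by auto
  have t0: "\<tau> - cnj \<tau> \<noteq> 0" using \<tau> by (auto simp: complex_eq_iff)
  have "jacobi_mu (\<tau>', z / j) = j * cnj j / (\<tau> - cnj \<tau>)"
    unfolding jacobi_mu_def case_prod_conv mobius_minus_cnj using j0 by simp
  also have "j * cnj j = j ^ 2 - of_int c * j * (\<tau> - cnj \<tau>)"
    by (simp add: j_def algebra_simps power2_eq_square)
  finally show ?thesis using t0 by (simp add: jacobi_mu_def diff_divide_distrib)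
qed

end

lemma jacobi_lambda_shift:
  assumes "Im \<tau> > 0"
  shows "jacobi_lambda (\<tau>, z + of_int m * \<tau> + of_int n) = jacobi_lambda (\<tau>, z) + of_int m"
proof -
  have t0: "\<tau> - cnj \<tau> \<noteq> 0" using assms by (auto simp: complex_eq_iff)
  have "(z + of_int m * \<tau> + of_int n) - cnj (z + of_int m * \<tau> + of_int n) = (z - cnj z) + of_int m * (\<tau> - cnj \<tau>)"
    by (simp add: algebra_simps)
  moreover have "(U + V * W) / W = U / W + V" if "W \<noteq> 0" for U V W :: complex
    using that by (simp add: add_divide_distrib)
  note this[OF t0]
  ultimately show ?thesis by (simp only: jacobi_lambda_def case_prod_conv)
qed

text \<open>The anomaly \<open>-cz\<close> of \<open>\<lambda>\<close> under the modular group and its increment under \<open>z \<mapsto> z + \<tau>\<close> are proportional to those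
  of \<open>E\<^sub>1\<close>, with the same factor. In the same way \<open>\<mu>\<close> compensates \<open>E\<^sub>2\<close> and \<open>e\<^sub>2\<close>.\<close>

lemma jacobi_invariant_E1_completed: "jacobi_invariant 1 (\<lambda>p. Eis 1 p + 2 * of_real pi * \<i> * jacobi_lambda p)"
  unfolding jacobi_invariant_def
proof (intro allI impI conjI, goal_cases)
  case (1 \<tau> z a b c d)
  then have \<tau>: "Im \<tau> > 0" by (simp add: regular_domain_iff)
  show ?case by (simp only: Eis_1_mobius[OF 1(2) \<tau> 1(1)] jacobi_lambda_mobius[OF 1(2) \<tau>, of z]) (simp add: algebra_simps)
next
  case (2 \<tau> z m n)
  then have \<tau>: "Im \<tau> > 0" by (simp add: regular_domain_iff)
  show ?case using Eis_1_shift[OF 2, of m n] jacobi_lambda_shift[OF \<tau>, of z m n] by (simp add: algebra_simps)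
qed

lemma jacobi_invariant_Eis_2_completed: "jacobi_invariant 2 (\<lambda>p. Eis 2 p - 2 * of_real pi * \<i> * jacobi_mu p)"
  unfolding jacobi_invariant_def
proof (intro allI impI conjI, goal_cases)
  case (1 \<tau> z a b c d)
  then have \<tau>: "Im \<tau> > 0" by (simp add: regular_domain_iff)
  show ?case by (simp only: Eis_2_mobius[OF 1(2) \<tau> 1(1)] jacobi_mu_mobius[OF 1(2) \<tau>, of z]) (simp add: algebra_simps)
next
  case (2 \<tau> z m n)
  show ?case using Eis_shift[OF 2, of 0 m n] by (simp add: jacobi_mu_def numeral_2_eq_2)
qed

lemma jacobi_invariant_eis2_completed: "jacobi_invariant 2 (\<lambda>p. eis2 p - 2 * of_real pi * \<i> * jacobi_mu p)"
  unfolding jacobi_invariant_def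
proof (intro allI impI conjI, goal_cases)
  case (1 \<tau> z a b c d)
  then have \<tau>: "Im \<tau> > 0" by (simp add: regular_domain_iff)
  show ?case by (simp only: eis2_mobius[OF 1(2) \<tau> 1(1)] jacobi_mu_mobius[OF 1(2) \<tau>, of z]) (simp add: algebra_simps)
next
  case (2 \<tau> z m n)
  then have "(\<tau>, z + of_int m * \<tau> + of_int n) \<in> regular_domain" by (simp add: regular_domain_shift)
  from eis2_eq[OF this] eis2_eq[OF 2] show ?case by (simp add: jacobi_mu_def)
qed

lemma jacobi_invariant_Eis:
  assumes "n \<ge> 3" shows "jacobi_invariant (int n) (Eis n)"
  unfolding jacobi_invariant_def
proof (intro allI impI conjI, goal_cases)
  case (1 \<tau> z a b c d)
  then have \<tau>: "Im \<tau> > 0" by (simp add: regular_domain_iff)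
  show ?case using Eis_mobius[OF 1(2) \<tau> 1(1) assms] by simp
next
  case (2 \<tau> z m k)
  show ?case using Eis_shift[OF 2, of "n - 2" m k] assms by (simp add: numeral_2_eq_2 Suc_diff_Suc)
qed

section \<open>The generators are quasi-Jacobi forms\<close>

text \<open>The local quotients are required to have denominators without zeros on the regular domain. This
  is preserved by sums and products without any appeal to the identity theorem.\<close>

definition locally_quotient :: "(complex \<times> complex \<Rightarrow> complex) \<Rightarrow> bool" where
  "locally_quotient f \<longleftrightarrow> (\<forall>p. Im (fst p) > 0 \<longrightarrow> (\<exists>r>0. \<exists>g h. (\<forall>x\<in>ball p r. Im (fst x) > 0) \<and>
      holomorphic2_on g (ball p r) \<and> holomorphic2_on h (ball p r) \<and>
      (\<forall>x \<in> ball p r \<inter> regular_domain. h x \<noteq> 0 \<and> f x = g x / h x)))"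

text \<open>The conditions on the coefficients of an almost meromorphic Jacobi form, in a shape that is closed under sums and
  products.\<close>

definition jacobi_coefficient :: "(complex \<times> complex \<Rightarrow> complex) \<Rightarrow> bool" where
  "jacobi_coefficient f \<longleftrightarrow> holomorphic2_on f regular_domain \<and> locally_quotient f \<and> convergent_laurent_qz f"

lemma open_upper_pairs: "open {p :: complex \<times> complex. Im (fst p) > 0}"
  by (intro open_Collect_less continuous_intros)

lemma locally_quotientI:
  assumes "\<And>p. Im (fst p) > 0 \<Longrightarrow> \<exists>V g h. open V \<and> p \<in> V \<and> holomorphic2_on g V \<and> holomorphic2_on h V \<and>
      (\<forall>x \<in> V \<inter> regular_domain. h x \<noteq> 0 \<and> f x = g x / h x)"
  shows "locally_quotient f"
  unfolding locally_quotient_def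
proof (intro allI impI)
  fix p :: "complex \<times> complex" assume p: "Im (fst p) > 0"
  obtain V g h where V: "open V" "p \<in> V" "holomorphic2_on g V" "holomorphic2_on h V"
      "\<And>x. x \<in> V \<inter> regular_domain \<Longrightarrow> h x \<noteq> 0 \<and> f x = g x / h x"
    using assms[OF p] by blast
  have "open (V \<inter> {p. Im (fst p) > 0})" using V(1) open_upper_pairs by (rule open_Int)
  then obtain r where r: "r > 0" "ball p r \<subseteq> V \<inter> {p. Im (fst p) > 0}"
    using V(2) p open_contains_ball_eq[of "V \<inter> {p. Im (fst p) > 0}" p] by blast
  show "\<exists>r>0. \<exists>g h. (\<forall>x\<in>ball p r. Im (fst x) > 0) \<and> holomorphic2_on g (ball p r) \<and> holomorphic2_on h (ball p r) \<and>
      (\<forall>x \<in> ball p r \<inter> regular_domain. h x \<noteq> 0 \<and> f x = g x / h x)"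
  proof -
    have sub: "ball p r \<subseteq> V" using r(2) by blast
    have "\<forall>x\<in>ball p r. Im (fst x) > 0" using r(2) by blast
    moreover have "\<forall>x \<in> ball p r \<inter> regular_domain. h x \<noteq> 0 \<and> f x = g x / h x" using sub V(5) by blast
    ultimately show ?thesis
      using r(1) holomorphic2_on_subset[OF V(3) sub] holomorphic2_on_subset[OF V(4) sub] by metis
  qed
qed

lemma locally_quotient_holomorphic:
  assumes "holomorphic2_on f {p. Im (fst p) > 0}" shows "locally_quotient f"
proof (rule locally_quotientI)
  fix p :: "complex \<times> complex" assume p: "Im (fst p) > 0"
  show "\<exists>V g h. open V \<and> p \<in> V \<and> holomorphic2_on g V \<and> holomorphic2_on h V \<and>
      (\<forall>x \<in> V \<inter> regular_domain. h x \<noteq> 0 \<and> f x = g x / h x)"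
    by (rule exI[of _ "{p. Im (fst p) > 0}"], rule exI[of _ f], rule exI[of _ "\<lambda>_. 1"])
       (use p assms open_upper_pairs in simp)
qed

lemma locally_quotient_combine:
  assumes f: "locally_quotient f" and g: "locally_quotient g"
  shows "locally_quotient (\<lambda>p. f p + g p)" "locally_quotient (\<lambda>p. f p * g p)"
proof -
  have main: "\<exists>V g1 h1 g2 h2. open V \<and> p \<in> V \<and> holomorphic2_on g1 V \<and> holomorphic2_on h1 V \<and> holomorphic2_on g2 V \<and> holomorphic2_on h2 V
     \<and> (\<forall>x \<in> V \<inter> regular_domain. h1 x \<noteq> 0 \<and> f x = g1 x / h1 x \<and> h2 x \<noteq> 0 \<and> g x = g2 x / h2 x)" if p: "Im (fst p) > 0" for p
  proof -
    obtain r g1 h1 where 1: "r > 0" "holomorphic2_on g1 (ball p r)" "holomorphic2_on h1 (ball p r)"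
       "\<And>x. x \<in> ball p r \<inter> regular_domain \<Longrightarrow> h1 x \<noteq> 0 \<and> f x = g1 x / h1 x"
      using f p unfolding locally_quotient_def by metis
    obtain r' g2 h2 where 2: "r' > 0" "holomorphic2_on g2 (ball p r')" "holomorphic2_on h2 (ball p r')"
       "\<And>x. x \<in> ball p r' \<inter> regular_domain \<Longrightarrow> h2 x \<noteq> 0 \<and> g x = g2 x / h2 x"
      using g p unfolding locally_quotient_def by metis
    have sub: "ball p (min r r') \<subseteq> ball p r" "ball p (min r r') \<subseteq> ball p r'" by auto
    show ?thesis
      by (rule exI[of _ "ball p (min r r')"], rule exI[of _ g1], rule exI[of _ h1], rule exI[of _ g2], rule exI[of _ h2])
         (use 1 2 holomorphic2_on_subset[OF 1(2) sub(1)] holomorphic2_on_subset[OF 1(3) sub(1)]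
            holomorphic2_on_subset[OF 2(2) sub(2)] holomorphic2_on_subset[OF 2(3) sub(2)] in simp)
  qed
  show "locally_quotient (\<lambda>p. f p + g p)"
  proof (rule locally_quotientI)
    fix p :: "complex \<times> complex" assume "Im (fst p) > 0"
    from main[OF this] obtain V g1 h1 g2 h2 where V: "open V" "p \<in> V" "holomorphic2_on g1 V" "holomorphic2_on h1 V" "holomorphic2_on g2 V" "holomorphic2_on h2 V"
      "\<forall>x \<in> V \<inter> regular_domain. h1 x \<noteq> 0 \<and> f x = g1 x / h1 x \<and> h2 x \<noteq> 0 \<and> g x = g2 x / h2 x" by blast
    show "\<exists>V ga h. open V \<and> p \<in> V \<and> holomorphic2_on ga V \<and> holomorphic2_on h V \<and>
      (\<forall>x \<in> V \<inter> regular_domain. h x \<noteq> 0 \<and> f x + g x = ga x / h x)"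
      by (rule exI[of _ V], rule exI[of _ "\<lambda>x. g1 x * h2 x + g2 x * h1 x"], rule exI[of _ "\<lambda>x. h1 x * h2 x"])
         (use V in \<open>auto simp: field_simps\<close>)
  qed
  show "locally_quotient (\<lambda>p. f p * g p)"
  proof (rule locally_quotientI)
    fix p :: "complex \<times> complex" assume "Im (fst p) > 0"
    from main[OF this] obtain V g1 h1 g2 h2 where V: "open V" "p \<in> V" "holomorphic2_on g1 V" "holomorphic2_on h1 V" "holomorphic2_on g2 V" "holomorphic2_on h2 V"
      "\<forall>x \<in> V \<inter> regular_domain. h1 x \<noteq> 0 \<and> f x = g1 x / h1 x \<and> h2 x \<noteq> 0 \<and> g x = g2 x / h2 x" by blast
    show "\<exists>V ga h. open V \<and> p \<in> V \<and> holomorphic2_on ga V \<and> holomorphic2_on h V \<and>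
      (\<forall>x \<in> V \<inter> regular_domain. h x \<noteq> 0 \<and> f x * g x = ga x / h x)"
      by (rule exI[of _ V], rule exI[of _ "\<lambda>x. g1 x * g2 x"], rule exI[of _ "\<lambda>x. h1 x * h2 x"])
         (use V in auto)
  qed
qed

lemma jacobi_coefficient_const: "jacobi_coefficient (\<lambda>_. c)"
  by (simp add: jacobi_coefficient_def locally_quotient_holomorphic convergent_laurent_qz_const)

lemma jacobi_coefficient_0: "jacobi_coefficient 0" and jacobi_coefficient_1: "jacobi_coefficient 1"
  using jacobi_coefficient_const[of 0] jacobi_coefficient_const[of 1] by (simp_all add: zero_fun_def one_fun_def)

lemma jacobi_coefficient_add: "jacobi_coefficient f \<Longrightarrow> jacobi_coefficient g \<Longrightarrow> jacobi_coefficient (f + g)"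
  unfolding jacobi_coefficient_def plus_fun_def
  by (intro conjI holomorphic2_on_add locally_quotient_combine(1) convergent_laurent_qz_add) blast+

lemma jacobi_coefficient_mult: "jacobi_coefficient f \<Longrightarrow> jacobi_coefficient g \<Longrightarrow> jacobi_coefficient (f * g)"
  unfolding jacobi_coefficient_def times_fun_def
  by (intro conjI holomorphic2_on_mult locally_quotient_combine(2) convergent_laurent_qz_mult) blast+

lemma jacobi_coefficient_sum: "(\<And>i. i \<in> I \<Longrightarrow> jacobi_coefficient (f i)) \<Longrightarrow> jacobi_coefficient (\<Sum>i\<in>I. f i)"
  by (induction I rule: infinite_finite_induct) (auto intro: jacobi_coefficient_0 jacobi_coefficient_add)

text \<open>The lattice is countable.\<close>

lemma regular_point_in_open:
  assumes "open V" "p \<in> V" "Im (fst p) > 0" shows "\<exists>x\<in>V. x \<in> regular_domain"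
proof -
  obtain \<tau> z where p: "p = (\<tau>, z)" by (cases p)
  obtain r where r: "r > 0" "cball \<tau> r \<times> cball z r \<subseteq> V" using open_polydisc[of V \<tau> z] assms p by metis
  have "period_lattice \<tau> = (\<lambda>(m, n). of_int m * \<tau> + of_int n) ` (UNIV :: (int \<times> int) set)"
    by (auto simp: period_lattice_def)
  then have "countable (period_lattice \<tau>)" by simp
  moreover have "uncountable (ball z r)" using r(1) by (rule uncountable_ball)
  ultimately have "\<not> ball z r \<subseteq> period_lattice \<tau>" using countable_subset by blast
  then obtain w where w: "w \<in> ball z r" "w \<notin> period_lattice \<tau>" by blast
  have "(\<tau>, w) \<in> cball \<tau> r \<times> cball z r" using w r(1) by auto
  then have "(\<tau>, w) \<in> V" using r(2) by blast
  moreover have "(\<tau>, w) \<in> regular_domain" using w(2) assms(3) p by (simp add: regular_domain_iff_period_lattice)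
  ultimately show ?thesis by blast
qed

lemma jacobi_coefficient_meromorphic:
  assumes "jacobi_coefficient f" shows "meromorphic_lattice_poles f"
  unfolding meromorphic_lattice_poles_def
proof (intro conjI ballI)
  show "holomorphic2_on f regular_domain" using assms by (simp add: jacobi_coefficient_def)
  fix p :: "complex \<times> complex" assume "p \<in> upper_half_plane \<times> UNIV"
  then have p: "Im (fst p) > 0" by (auto simp: upper_half_plane_def)
  obtain r g h where r: "r > 0" "\<forall>x\<in>ball p r. Im (fst x) > 0" "holomorphic2_on g (ball p r)" "holomorphic2_on h (ball p r)"
      "\<forall>x \<in> ball p r \<inter> regular_domain. h x \<noteq> 0 \<and> f x = g x / h x"
    using assms p unfolding jacobi_coefficient_def locally_quotient_def by metis
  have "\<exists>x\<in>ball p r. h x \<noteq> 0" using regular_point_in_open[of "ball p r" p] r(1,5) p by force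
  then show "\<exists>V g h. open V \<and> connected V \<and> p \<in> V \<and> V \<subseteq> upper_half_plane \<times> UNIV \<and>
        holomorphic2_on g V \<and> holomorphic2_on h V \<and> (\<exists>x\<in>V. h x \<noteq> 0) \<and>
        (\<forall>x \<in> V \<inter> regular_domain. h x \<noteq> 0 \<longrightarrow> f x = g x / h x)"
    by (intro exI[of _ "ball p r"] exI[of _ g] exI[of _ h] conjI)
       (use r in \<open>auto simp: upper_half_plane_def convex_connected\<close>)
qed

definition eis_numerator :: "nat \<Rightarrow> complex \<times> complex \<Rightarrow> complex" where
  "eis_numerator k = (\<lambda>p. 1 + snd p ^ Suc k * ((-1) ^ k / fact k * (dz ^^ k) e1_regular p))"

lemma eis_numerator_holomorphic2_on: "holomorphic2_on (eis_numerator k) e1_domain"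
  unfolding eis_numerator_def
  by (intro holomorphic2_on_add holomorphic2_on_mult holomorphic2_on_power holomorphic2_on_const holomorphic2_on_snd
        dz_funpow_holomorphic2_on open_e1_domain e1_regular_holomorphic2_on)

lemma Eis_eq_quotient:
  assumes "(\<tau>, z) \<in> regular_domain"
  shows "Eis (Suc k) (\<tau>, z) = eis_numerator k (nome \<tau>, z) / z ^ Suc k"
  using assms Eis_expansion[OF assms, of k] by (simp add: eis_numerator_def regular_domain_iff field_simps)

lemma nome_fst_holomorphic2_on: "holomorphic2_on (\<lambda>p. nome (fst p)) U"
  by (rule holomorphic2_on_of_fst[where V = UNIV]) (auto intro!: holomorphic_intros)

lemma e1_polydisc:
  obtains r where "r > 0" "ball 0 r \<times> ball 0 r \<subseteq> e1_domain"
proof -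
  obtain r where r: "r > 0" "cball 0 r \<times> cball 0 r \<subseteq> e1_domain"
    using open_polydisc[OF open_e1_domain zero_in_e1_domain] by metis
  have "ball (0::complex) r \<times> ball (0::complex) r \<subseteq> cball 0 r \<times> cball 0 r" by auto
  with r show ?thesis by (intro that[of r]) blast+
qed

lemma jacobi_coefficient_Eis: "jacobi_coefficient (Eis (Suc k))"
  unfolding jacobi_coefficient_def
proof (intro conjI)
  have num: "holomorphic2_on (\<lambda>p. eis_numerator k (nome (fst p), w p)) U"
    if "holomorphic2_on w U" "\<And>p. p \<in> U \<Longrightarrow> (nome (fst p), w p) \<in> e1_domain" for w U
    by (rule holomorphic2_on_compose_Pair[OF nome_fst_holomorphic2_on that(1) eis_numerator_holomorphic2_on that(2)])
  show hol: "holomorphic2_on (Eis (Suc k)) regular_domain"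
  proof (rule holomorphic2_on_transform[OF _ open_regular_domain])
    show "holomorphic2_on (\<lambda>p. eis_numerator k (nome (fst p), snd p) / snd p ^ Suc k) regular_domain"
      by (intro holomorphic2_on_divide num holomorphic2_on_power holomorphic2_on_snd)
         (auto simp: regular_domain_iff)
    show "eis_numerator k (nome (fst p), snd p) / snd p ^ Suc k = Eis (Suc k) p" if "p \<in> regular_domain" for p
      using that Eis_eq_quotient[of "fst p" "snd p" k] by simp
  qed
  show "convergent_laurent_qz (Eis (Suc k))"
  proof -
    obtain r where r: "r > 0" "ball 0 r \<times> ball 0 r \<subseteq> e1_domain" by (rule e1_polydisc)
    show ?thesis unfolding convergent_laurent_qz_iff
      by (intro exI[of _ "eis_numerator k"] exI[of _ r] exI[of _ "Suc k"] conjI)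
         (use r Eis_eq_quotient holomorphic2_on_subset[OF eis_numerator_holomorphic2_on r(2)] in auto)
  qed
  show "locally_quotient (Eis (Suc k))"
  proof (rule locally_quotientI)
    fix p :: "complex \<times> complex" assume p: "Im (fst p) > 0"
    show "\<exists>V g h. open V \<and> p \<in> V \<and> holomorphic2_on g V \<and> holomorphic2_on h V \<and>
      (\<forall>x \<in> V \<inter> regular_domain. h x \<noteq> 0 \<and> Eis (Suc k) x = g x / h x)"
    proof (cases "p \<in> regular_domain")
      case True
      then show ?thesis
        by (intro exI[of _ regular_domain] exI[of _ "Eis (Suc k)"] exI[of _ "\<lambda>_. 1"]) (use hol open_regular_domain in auto)
    next
      case False
      \<comment> \<open>translate the lattice point to the origin\<close>
      with p obtain m n :: int where mn: "snd p = of_int m * fst p + of_int n"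
        by (cases p) (auto simp: regular_domain_iff_period_lattice period_lattice_def)
      define w where "w = (\<lambda>x :: complex \<times> complex. snd x - of_int m * fst x - of_int n)"
      define C where "C = (if k = 0 then 2 * of_real pi * \<i> * of_int m else 0 :: complex)"
      have wh: "holomorphic2_on w U" for U unfolding w_def by (intro holomorphic2_on_diff holomorphic2_on_mult) auto
      define V where "V = (\<lambda>x. (nome (fst x), w x)) -` e1_domain"
      have "continuous_on UNIV (\<lambda>x. (nome (fst x), w x))" unfolding w_def by (intro continuous_intros)
      then have oV: "open V" unfolding V_def by (rule open_vimage[OF open_e1_domain])
      have "w p = 0" using mn by (simp add: w_def)
      then have pV: "p \<in> V" using zero_in_e1_slice[OF p] by (simp add: V_def)
      have val: "w x ^ Suc k \<noteq> 0 \<and> Eis (Suc k) x = (eis_numerator k (nome (fst x), w x) - C * w x ^ Suc k) / w x ^ Suc k"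
        if "x \<in> V \<inter> regular_domain" for x
      proof -
        obtain \<tau> z where x: "x = (\<tau>, z)" by (cases x)
        have z: "z = w x + of_int m * \<tau> + of_int n" by (simp add: w_def x)
        then have r: "(\<tau>, w x) \<in> regular_domain" using that x regular_domain_shift[of \<tau> "w x" m n] by simp
        then have w0: "w x \<noteq> 0" by (simp add: regular_domain_iff)
        have "Eis (Suc k) (\<tau>, z) = Eis (Suc k) (\<tau>, w x) - C"
        proof (cases k)
          case 0 then show ?thesis using Eis_1_shift[OF r, of m n] z by (simp add: C_def)
        next
          case (Suc l) then show ?thesis using Eis_shift[OF r, of l m n] z by (simp add: C_def)
        qed
        then show ?thesis using w0 Eis_eq_quotient[OF r, of k] by (simp add: x diff_divide_distrib del: power_Suc)
      qed
      have "holomorphic2_on (\<lambda>x. eis_numerator k (nome (fst x), w x) - C * w x ^ Suc k) V"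
        by (intro holomorphic2_on_diff holomorphic2_on_mult holomorphic2_on_power holomorphic2_on_const wh num) (simp add: V_def)
      moreover have "holomorphic2_on (\<lambda>x. w x ^ Suc k) V" by (intro holomorphic2_on_power wh)
      ultimately show ?thesis
        by (intro exI[of _ V] exI[of _ "\<lambda>x. eis_numerator k (nome (fst x), w x) - C * w x ^ Suc k"] exI[of _ "\<lambda>x. w x ^ Suc k"]
            conjI[OF oV] conjI[OF pV] conjI ballI val)
    qed
  qed
qed

lemma jacobi_coefficient_eis2: "jacobi_coefficient eis2"
proof -
  have h: "holomorphic2_on (\<lambda>p. - dz e1_regular (nome (fst p), 0)) {p. Im (fst p) > 0}"
    by (intro holomorphic2_on_uminus holomorphic2_on_compose_Pair[OF nome_fst_holomorphic2_on holomorphic2_on_const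
         dz_holomorphic2_on[OF open_e1_domain e1_regular_holomorphic2_on]]) (simp add: zero_in_e1_slice)
  have lq: "locally_quotient eis2"
  proof (rule locally_quotientI)
    fix p :: "complex \<times> complex" assume p: "Im (fst p) > 0"
    show "\<exists>V g h. open V \<and> p \<in> V \<and> holomorphic2_on g V \<and> holomorphic2_on h V \<and>
      (\<forall>x \<in> V \<inter> regular_domain. h x \<noteq> 0 \<and> eis2 x = g x / h x)"
      by (intro exI[of _ "{p. Im (fst p) > 0}"] exI[of _ "\<lambda>p. - dz e1_regular (nome (fst p), 0)"] exI[of _ "\<lambda>_. 1"])
         (use h p open_upper_pairs eis2_eq in auto)
  qed
  have hol: "holomorphic2_on eis2 regular_domain"
  proof (rule holomorphic2_on_transform[OF _ open_regular_domain])
    show "holomorphic2_on (\<lambda>p. - dz e1_regular (nome (fst p), 0)) regular_domain"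
      by (rule holomorphic2_on_subset[OF h]) (auto simp: regular_domain_iff)
  qed (use eis2_eq in auto)
  obtain r where r: "r > 0" "ball 0 r \<times> ball 0 r \<subseteq> e1_domain" by (rule e1_polydisc)
  have "(q, 0) \<in> e1_domain" if "q \<in> ball 0 r" for q
    using subsetD[OF r(2), of "(q, 0)"] that r(1) by simp
  then have "holomorphic2_on (\<lambda>p. - dz e1_regular (fst p, 0)) (ball 0 r \<times> ball 0 r)"
    by (intro holomorphic2_on_uminus holomorphic2_on_compose_Pair[OF holomorphic2_on_fst holomorphic2_on_const
         dz_holomorphic2_on[OF open_e1_domain e1_regular_holomorphic2_on]]) auto
  then have "convergent_laurent_qz eis2"
    unfolding convergent_laurent_qz_iff
    by (intro exI[of _ "\<lambda>p. - dz e1_regular (fst p, 0)"] exI[of _ r] exI[of _ 0]) (use r eis2_eq in auto)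
  with hol lq show ?thesis by (simp add: jacobi_coefficient_def)
qed

text \<open>Almost meromorphic Jacobi forms as polynomials in \<open>\<lambda>\<close> (outer variable) and \<open>\<mu>\<close> (inner variable)
  over the ring of functions; multiplicativity of evaluation takes care of the products.\<close>

definition jacobi_eval :: "(complex \<times> complex \<Rightarrow> complex) poly poly \<Rightarrow> complex \<times> complex \<Rightarrow> complex" where
  "jacobi_eval P = poly (poly P [:jacobi_lambda:]) jacobi_mu"

definition jacobi_polynomial :: "int \<Rightarrow> (complex \<times> complex \<Rightarrow> complex) poly poly \<Rightarrow> bool" where
  "jacobi_polynomial k P \<longleftrightarrow> (\<forall>i j. jacobi_coefficient (coeff (coeff P i) j)) \<and> jacobi_invariant k (jacobi_eval P)"

lemma fun_sum_apply: "(\<Sum>i\<in>I. f i) x = (\<Sum>i\<in>I. f i x)"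
  by (induction I rule: infinite_finite_induct) auto

lemma fun_power_apply: "(f ^ n) x = (f x :: 'a :: comm_ring_1) ^ n"
  by (induction n) auto

lemma poly_eq_sum_atMost:
  fixes p :: "'a::comm_ring_1 poly"
  assumes "degree p \<le> t" shows "poly p x = (\<Sum>j\<le>t. coeff p j * x ^ j)"
  unfolding poly_altdef
  by (rule sum.mono_neutral_left) (use assms in \<open>auto simp: coeff_eq_0\<close>)

lemma jacobi_eval_expand:
  assumes t: "\<And>i. i \<le> degree P \<Longrightarrow> degree (coeff P i) \<le> t"
  shows "jacobi_eval P p = (\<Sum>i\<le>degree P. \<Sum>j\<le>t. coeff (coeff P i) j p * jacobi_lambda p ^ i * jacobi_mu p ^ j)"
proof -
  have "jacobi_eval P = (\<Sum>i\<le>degree P. poly (coeff P i) jacobi_mu * jacobi_lambda ^ i)"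
    unfolding jacobi_eval_def poly_altdef[of P] by (simp add: poly_sum)
  also have "\<dots> = (\<Sum>i\<le>degree P. (\<Sum>j\<le>t. coeff (coeff P i) j * jacobi_mu ^ j) * jacobi_lambda ^ i)"
  proof (rule sum.cong)
    fix i assume "i \<in> {..degree P}"
    then have "poly (coeff P i) jacobi_mu = (\<Sum>j\<le>t. coeff (coeff P i) j * jacobi_mu ^ j)"
      using t[of i] by (intro poly_eq_sum_atMost) auto
    then show "poly (coeff P i) jacobi_mu * jacobi_lambda ^ i = (\<Sum>j\<le>t. coeff (coeff P i) j * jacobi_mu ^ j) * jacobi_lambda ^ i" by simp
  qed simp
  finally show ?thesis
    by (simp add: fun_sum_apply fun_power_apply sum_distrib_right sum_distrib_left mult_ac)
qed

lemma jacobi_polynomial_imp_quasi_jacobi: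
  assumes "jacobi_polynomial k P"
  shows "on_regular (coeff (coeff P 0) 0) \<in> (\<Union>k s t. quasi_jacobi_forms k s t)"
proof -
  define t where "t = Max ((\<lambda>i. degree (coeff P i)) ` {..degree P})"
  have t: "degree (coeff P i) \<le> t" if "i \<le> degree P" for i
    unfolding t_def by (rule Max_ge) (use that in auto)
  have "jacobi_eval P = (\<lambda>p. \<Sum>i\<le>degree P. \<Sum>j\<le>t. coeff (coeff P i) j p * jacobi_lambda p ^ i * jacobi_mu p ^ j)"
    using jacobi_eval_expand[of P t] t by auto
  then have "almost_meromorphic_jacobi k (degree P) t (\<lambda>i j. coeff (coeff P i) j)"
    using assms unfolding almost_meromorphic_jacobi_def jacobi_polynomial_def
    by (auto intro: jacobi_coefficient_meromorphic simp: jacobi_coefficient_def)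
  then have "on_regular (coeff (coeff P 0) 0) \<in> quasi_jacobi_forms k (degree P) t"
    unfolding quasi_jacobi_forms_def by (intro CollectI exI[of _ "\<lambda>i j. coeff (coeff P i) j"] conjI refl)
  then show ?thesis by blast
qed

lemma jacobi_invariant_mult:
  assumes F: "jacobi_invariant k F" and G: "jacobi_invariant l G"
  shows "jacobi_invariant (k + l) (F * G)"
  unfolding jacobi_invariant_def
proof (intro allI impI conjI, goal_cases)
  case (1 \<tau> z a b c d)
  then have \<tau>: "Im \<tau> > 0" by (simp add: regular_domain_iff)
  have j: "of_int c * \<tau> + of_int d \<noteq> 0" using mobius_denominator_nonzero[OF 1(2) \<tau>] .
  show ?case
    using F[unfolded jacobi_invariant_def, rule_format, OF 1(1), THEN conjunct1, rule_format, OF 1(2)]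
      G[unfolded jacobi_invariant_def, rule_format, OF 1(1), THEN conjunct1, rule_format, OF 1(2)] j
    by (simp add: power_int_add)
next
  case (2 \<tau> z m n)
  then show ?case using F G unfolding jacobi_invariant_def by simp
qed

lemma jacobi_polynomial_mult:
  assumes P: "jacobi_polynomial k P" and Q: "jacobi_polynomial l Q"
  shows "jacobi_polynomial (k + l) (P * Q)"
proof -
  have "jacobi_coefficient (coeff (coeff (P * Q) i) j)" for i j
    using P Q unfolding coeff_mult coeff_sum jacobi_polynomial_def
    by (intro jacobi_coefficient_sum jacobi_coefficient_mult) auto
  moreover have "jacobi_eval (P * Q) = jacobi_eval P * jacobi_eval Q" by (simp add: jacobi_eval_def)
  ultimately show ?thesis using P Q jacobi_invariant_mult by (simp add: jacobi_polynomial_def)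
qed

lemma on_regular_idem: "on_regular (on_regular f) = on_regular f"
  by (auto simp: on_regular_def fun_eq_iff)

lemma on_regular_mult: "on_regular f * on_regular g = on_regular (f * g)"
  by (auto simp: on_regular_def fun_eq_iff)

text \<open>Constant terms are multiplicative on polynomials in \<open>\<lambda>\<close> and \<open>\<mu>\<close>, so the constant terms of invariant polynomials
  span an algebra. Each generator is the constant term of its completion.\<close>

theorem hull_subset_quasi_jacobi_algebra:
  "complex_subalgebra hull ({Eis n | n. n \<ge> 1} \<union> {eis2}) \<subseteq> quasi_jacobi_algebra"
proof -
  define G where "G = {on_regular (coeff (coeff P 0) 0) | k P. jacobi_polynomial k P}"
  have GI: "on_regular (coeff (coeff P 0) 0) \<in> G" if "jacobi_polynomial k P" for k P
    using that unfolding G_def by blast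
  have GG: "f * g \<in> G" if fg: "f \<in> G" "g \<in> G" for f g
  proof -
    obtain k P l Q where "jacobi_polynomial k P" "f = on_regular (coeff (coeff P 0) 0)"
      "jacobi_polynomial l Q" "g = on_regular (coeff (coeff Q 0) 0)" using fg unfolding G_def by blast
    then show ?thesis using GI[OF jacobi_polynomial_mult[of k P l Q]] by (simp add: on_regular_mult coeff_mult_0)
  qed
  have "complex_subalgebra (cfun.span G)"
    unfolding complex_subalgebra_def
  proof (intro conjI ballI)
    show "cfun.subspace (cfun.span G)" by (rule cfun.subspace_span)
    show "on_regular f = f" if "f \<in> cfun.span G" for f
      using that
    proof (induction rule: cfun.span_induct_alt)
      case base
      show ?case by (auto simp: on_regular_def zero_fun_def)
    next
      case (step c x y)
      then have "on_regular x = x" by (auto simp: G_def on_regular_idem)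
      then have "x p = 0" "y p = 0" if "p \<notin> regular_domain" for p
        using that \<open>on_regular x = x\<close> step.IH by (metis on_regular_def)+
      then show ?case by (auto simp: on_regular_def fun_eq_iff)
    qed
    have "jacobi_polynomial 0 1"
      unfolding jacobi_polynomial_def
    proof (intro conjI allI)
      show "jacobi_coefficient (coeff (coeff 1 i) j)" for i j
        by (cases i; cases j; simp add: jacobi_coefficient_0 jacobi_coefficient_1)
      show "jacobi_invariant 0 (jacobi_eval 1)" by (simp add: jacobi_eval_def jacobi_invariant_def)
    qed
    from GI[OF this] show "on_regular (\<lambda>_. 1) \<in> cfun.span G"
      by (intro cfun.span_base) (simp add: one_fun_def)
    show "f * g \<in> cfun.span G" if f: "f \<in> cfun.span G" and g: "g \<in> cfun.span G" for f g
      using f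
    proof (induction rule: cfun.span_induct_alt)
      case base
      show ?case using cfun.span_zero[of G] by (simp add: times_fun_def zero_fun_def)
    next
      case (step c x y)
      have "x * g \<in> cfun.span G"
        using g
      proof (induction rule: cfun.span_induct_alt)
        case base
        show ?case using cfun.span_zero[of G] by (simp add: times_fun_def zero_fun_def)
      next
        case (step c' x' y')
        have "x * ((\<lambda>z. c' * x' z) + y') = (\<lambda>z. c' * (x * x') z) + x * y'" by (auto simp: fun_eq_iff algebra_simps)
        moreover have "(\<lambda>z. c' * (x * x') z) + x * y' \<in> cfun.span G"
          by (rule cfun.span_add[OF cfun.span_scale[OF cfun.span_base[OF GG[OF \<open>x \<in> G\<close> \<open>x' \<in> G\<close>]]] \<open>x * y' \<in> cfun.span G\<close>])
        ultimately show ?case by (simp only:)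
      qed
      moreover have "((\<lambda>z. c * x z) + y) * g = (\<lambda>z. c * (x * g) z) + y * g" by (auto simp: fun_eq_iff algebra_simps)
      moreover have "(\<lambda>z. c * (x * g) z) + y * g \<in> cfun.span G"
        by (rule cfun.span_add[OF cfun.span_scale[OF \<open>x * g \<in> cfun.span G\<close>] \<open>y * g \<in> cfun.span G\<close>])
      ultimately show ?case by (simp only:)
    qed
  qed
  moreover have "{Eis n | n. n \<ge> 1} \<union> {eis2} \<subseteq> cfun.span G"
  proof -
    have orE: "on_regular (Eis n) = Eis n" for n unfolding Eis_def by (rule on_regular_idem)
    have orE2: "on_regular eis2 = eis2" unfolding eis2_def by (rule on_regular_idem)
    have E1: "jacobi_polynomial 1 [:[:Eis 1:], [:\<lambda>_. 2 * of_real pi * \<i>:]:]"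
      using jacobi_invariant_E1_completed
      by (auto simp: jacobi_polynomial_def jacobi_eval_def coeff_pCons split: nat.splits
          intro: jacobi_coefficient_0 jacobi_coefficient_const jacobi_coefficient_Eis[of 0, simplified]
          elim!: back_subst[of "jacobi_invariant 1"])
    have c2: "jacobi_polynomial 2 [:[:f, \<lambda>_. - 2 * of_real pi * \<i>:]:]"
      if "jacobi_invariant 2 (\<lambda>p. f p - 2 * of_real pi * \<i> * jacobi_mu p)" "jacobi_coefficient f" for f
    proof -
      have "jacobi_eval [:[:f, \<lambda>_. - 2 * of_real pi * \<i>:]:] = (\<lambda>p. f p - 2 * of_real pi * \<i> * jacobi_mu p)"
        by (auto simp: jacobi_eval_def fun_eq_iff)
      then show ?thesis using that
        by (auto simp: jacobi_polynomial_def coeff_pCons split: nat.splits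
          intro: jacobi_coefficient_0 jacobi_coefficient_const)
    qed
    have En: "jacobi_polynomial (int n) [:[:Eis n:]:]" if n: "n \<ge> 3" for n
      using jacobi_invariant_Eis[OF n] jacobi_coefficient_Eis[of "n - 1"] n
      by (auto simp: jacobi_polynomial_def jacobi_eval_def coeff_pCons split: nat.splits intro: jacobi_coefficient_0)
    have "Eis n \<in> G" if n: "n \<ge> 1" for n
    proof -
      consider "n = 1" | "n = 2" | "n \<ge> 3" using n by linarith
      then show ?thesis
      proof cases
        case 1 then show ?thesis using GI[OF E1] orE[of 1] by simp
      next
        case 2 then show ?thesis
          using GI[OF c2[OF jacobi_invariant_Eis_2_completed]] jacobi_coefficient_Eis[of 1] orE[of 2] by (simp add: numeral_2_eq_2)
      next
        case 3 then show ?thesis using GI[OF En[OF 3]] orE[of n] by simp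
      qed
    qed
    moreover have "eis2 \<in> G"
      using GI[OF c2[OF jacobi_invariant_eis2_completed jacobi_coefficient_eis2]] orE2 by simp
    ultimately show ?thesis using cfun.span_base by auto
  qed
  ultimately have "complex_subalgebra hull ({Eis n | n. n \<ge> 1} \<union> {eis2}) \<subseteq> cfun.span G"
    by (rule hull_minimal[rotated])
  also have "cfun.span G \<subseteq> quasi_jacobi_algebra"
    unfolding quasi_jacobi_algebra_def
    by (rule cfun.span_mono) (use jacobi_polynomial_imp_quasi_jacobi in \<open>auto simp: G_def\<close>)
  finally show ?thesis .
qed

section \<open>Modular forms for the full modular group\<close>

text \<open>A modular form is represented by its expansion in \<open>q\<close>, a holomorphic function on the unit disc.
  Invariance under translation and holomorphy at the cusp are built in, and the value at the cusp
  is the value at 0.\<close>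

definition modular_form :: "int \<Rightarrow> (complex \<Rightarrow> complex) \<Rightarrow> bool" where
  "modular_form k \<phi> \<longleftrightarrow> \<phi> holomorphic_on ball 0 1 \<and>
     (\<forall>\<tau>. Im \<tau> > 0 \<longrightarrow> \<phi> (nome (- 1 / \<tau>)) = \<tau> powi k * \<phi> (nome \<tau>))"

lemma nome_surj:
  assumes "q \<noteq> 0" "norm q < 1" obtains \<tau> where "Im \<tau> > 0" "nome \<tau> = q"
proof
  have n: "nome (Ln q / (2 * of_real pi * \<i>)) = q" using assms by simp
  then show "nome (Ln q / (2 * of_real pi * \<i>)) = q" .
  have "Ln q / (2 * of_real pi * \<i>) = of_real (1 / (2 * pi)) * (- \<i> * Ln q)" by (simp add: field_simps)
  then have e: "Im (Ln q / (2 * of_real pi * \<i>)) = 1 / (2 * pi) * (- ln (norm q))" using assms by simp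
  show "Im (Ln q / (2 * of_real pi * \<i>)) > 0"
    unfolding e by (rule mult_pos_pos) (use assms in auto)
qed

lemma nome_eq_iff: "nome a = nome b \<longleftrightarrow> (\<exists>n :: int. a = b + of_int n)"
proof
  assume "nome a = nome b"
  then have "nome (a - b) = 1" by (simp add: right_diff_distrib exp_diff)
  then have "a - b \<in> \<int>" by (simp only: exp_2pi_i_eq_1_iff)
  then show "\<exists>n :: int. a = b + of_int n" by (auto elim!: Ints_cases simp: algebra_simps)
qed (auto simp: nome_add_of_int)

lemma Im_neg_inverse: "Im \<tau> > 0 \<Longrightarrow> Im (- 1 / \<tau>) > 0"
  by (simp add: Im_divide sum_power2_gt_zero_iff)

text \<open>A translation invariant function on the upper half plane is a function of \<open>q\<close>, holomorphic because
  \<open>\<tau> \<mapsto> q\<close> has local holomorphic inverses. The function \<open>\<psi>\<close> supplies holomorphy at the cusp.\<close>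

lemma periodic_imp_function_of_nome:
  assumes hol: "f holomorphic_on {\<tau>. Im \<tau> > 0}" and per: "\<And>\<tau> n. Im \<tau> > 0 \<Longrightarrow> f (\<tau> + of_int n) = f \<tau>"
    and \<psi>: "r > 0" "\<psi> holomorphic_on ball 0 r" "\<And>\<tau>. Im \<tau> > 0 \<Longrightarrow> norm (nome \<tau>) < r \<Longrightarrow> f \<tau> = \<psi> (nome \<tau>)"
  obtains \<phi> where "\<phi> holomorphic_on ball 0 1" "\<And>\<tau>. Im \<tau> > 0 \<Longrightarrow> f \<tau> = \<phi> (nome \<tau>)"
proof -
  define \<phi> where "\<phi> = (\<lambda>q. if q = 0 then \<psi> 0 else f (SOME \<tau>. Im \<tau> > 0 \<and> nome \<tau> = q))"
  have \<phi>: "f \<tau> = \<phi> (nome \<tau>)" if "Im \<tau> > 0" for \<tau>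
  proof -
    define \<sigma> where "\<sigma> = (SOME \<sigma>. Im \<sigma> > 0 \<and> nome \<sigma> = nome \<tau>)"
    have \<sigma>: "Im \<sigma> > 0 \<and> nome \<sigma> = nome \<tau>" unfolding \<sigma>_def by (rule someI[of _ \<tau>]) (use that in simp)
    then obtain n :: int where "\<sigma> = \<tau> + of_int n" using nome_eq_iff by blast
    then have "f \<sigma> = f \<tau>" using per[OF that] by simp
    then show ?thesis by (simp add: \<phi>_def \<sigma>_def)
  qed
  have oH: "open {\<tau>. Im \<tau> > 0}" by (rule open_halfspace_Im_gt)
  have "\<phi> field_differentiable at q" if q: "q \<in> ball 0 1" for q
  proof (cases "q = 0")
    case True
    have "\<psi> field_differentiable at 0" using \<psi> by (simp add: holomorphic_on_imp_differentiable_at)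
    then obtain D where "(\<psi> has_field_derivative D) (at 0)" by (auto simp: field_differentiable_def)
    then have "(\<phi> has_field_derivative D) (at 0)"
    proof (rule has_field_derivative_transform_within_open[where S = "ball 0 (min r 1)"])
      fix x :: complex assume x: "x \<in> ball 0 (min r 1)"
      show "\<psi> x = \<phi> x"
      proof (cases "x = 0")
        case False
        obtain \<tau> where "Im \<tau> > 0" "nome \<tau> = x" using nome_surj[OF False] x by auto
        with \<phi>[of \<tau>] \<psi>(3)[of \<tau>] x show ?thesis by auto
      qed (simp add: \<phi>_def)
    qed (use \<psi>(1) in auto)
    then show ?thesis using True by (auto simp: field_differentiable_def)
  next
    case False
    obtain \<tau>0 where \<tau>0: "Im \<tau>0 > 0" "nome \<tau>0 = q" using nome_surj[OF False] q by auto
    define t where "t = (\<lambda>x. \<tau>0 + Ln (x / q) / (2 * of_real pi * \<i>))"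
    have td: "t field_differentiable at q"
      unfolding t_def using False by (auto intro!: derivative_intros simp: field_differentiable_def) (auto intro!: derivative_eq_intros)
    have tq: "t q = \<tau>0" using False by (simp add: t_def)
    have "f field_differentiable at \<tau>0" using hol oH \<tau>0 by (auto intro: holomorphic_on_imp_differentiable_at)
    then obtain a b where "(f has_field_derivative a) (at (t q))" "(t has_field_derivative b) (at q)"
      using td by (auto simp: field_differentiable_def tq)
    then have d: "((\<lambda>x. f (t x)) has_field_derivative a * b) (at q)" by (rule DERIV_chain2)
    have "isCont t q" using td by (rule field_differentiable_imp_continuous_at)
    then have "(t \<longlongrightarrow> t q) (nhds q)" by (simp add: isCont_def tendsto_at_iff_tendsto_nhds)
    from topological_tendstoD[OF this oH] have "\<forall>\<^sub>F x in nhds q. t x \<in> {\<tau>. Im \<tau> > 0}"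
      using \<tau>0 tq by simp
    moreover have "\<forall>\<^sub>F x in nhds q. x \<noteq> 0" using False by (intro t1_space_nhds) auto
    ultimately have "\<forall>\<^sub>F x in nhds q. f (t x) = \<phi> x"
    proof eventually_elim
      case (elim x)
      have "nome (t x) = nome \<tau>0 * (x / q)" unfolding t_def nome_add using elim False by simp
      then have "nome (t x) = x" using \<tau>0 False by simp
      then show ?case using \<phi>[of "t x"] elim by simp
    qed
    then have "(\<phi> has_field_derivative a * b) (at q)" using d by (subst (asm) DERIV_cong_ev) auto
    then show ?thesis by (auto simp: field_differentiable_def)
  qed
  then have "\<phi> holomorphic_on ball 0 1" by (auto simp: holomorphic_on_def intro: field_differentiable_at_within)
  then show ?thesis using \<phi> by (rule that)
qed

lemma modular_form_mult:
  assumes "modular_form k \<phi>" "modular_form l \<psi>" shows "modular_form (k + l) (\<lambda>q. \<phi> q * \<psi> q)"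
proof -
  have "\<tau> powi (k + l) = \<tau> powi k * \<tau> powi l" if "Im \<tau> > 0" for \<tau>
    by (rule power_int_add) (use that in auto)
  then show ?thesis using assms unfolding modular_form_def by (auto intro!: holomorphic_intros)
qed

lemma modular_form_cmult:
  assumes "modular_form k \<phi>" shows "modular_form k (\<lambda>q. c * \<phi> q)"
  using assms unfolding modular_form_def by (auto intro!: holomorphic_intros)

lemma modular_form_diff:
  assumes "modular_form k \<phi>" "modular_form k \<psi>" shows "modular_form k (\<lambda>q. \<phi> q - \<psi> q)"
  using assms unfolding modular_form_def by (auto intro!: holomorphic_intros simp: algebra_simps)

lemma modular_form_power:
  assumes "modular_form k \<phi>" shows "modular_form (int n * k) (\<lambda>q. \<phi> q ^ n)"
proof (induction n)
  case 0 show ?case by (simp add: modular_form_def)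
next
  case (Suc n)
  from modular_form_mult[OF assms Suc] show ?case by (simp add: algebra_simps)
qed

text \<open>Translating into the strip \<open>\<bar>Re \<tau>\<bar> \<le> 1/2\<close> and inverting at least doubles an imaginary part
  below \<open>1/2\<close>.\<close>

lemma modular_reduction:
  assumes f1: "\<And>\<tau> n. Im \<tau> > 0 \<Longrightarrow> f (\<tau> + of_int n) = f \<tau>" and f2: "\<And>\<tau>. Im \<tau> > 0 \<Longrightarrow> f (- 1 / \<tau>) = f \<tau>"
    and \<tau>: "Im \<tau> > 0"
  obtains \<sigma> where "Im \<sigma> \<ge> 1 / 2" "f \<sigma> = f \<tau>"
proof -
  have "\<exists>\<sigma>. Im \<sigma> \<ge> 1 / 2 \<and> f \<sigma> = f \<tau>" if "Im \<tau> > 0" "2 ^ N * Im \<tau> \<ge> 1 / 2" for N \<tau>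
    using that
  proof (induction N arbitrary: \<tau>)
    case 0 then show ?case by auto
  next
    case (Suc N)
    show ?case
    proof (cases "Im \<tau> \<ge> 1 / 2")
      case False
      define t where "t = \<tau> + of_int (- round (Re \<tau>))"
      have ft: "f t = f \<tau>" unfolding t_def by (rule f1[OF Suc.prems(1)])
      have It: "Im t = Im \<tau>" by (simp add: t_def)
      have "\<bar>Re t\<bar> \<le> 1 / 2" using of_int_round_abs_le[of "Re \<tau>"] by (simp add: t_def abs_minus_commute)
      then have "(Re t)\<^sup>2 \<le> (1 / 2)\<^sup>2" by (rule power2_le_iff_abs_le[THEN iffD2, rotated]) simp
      moreover have "(Im t)\<^sup>2 \<le> (1 / 2)\<^sup>2" using False Suc.prems(1) It by (intro power_mono) auto
      ultimately have n: "(Re t)\<^sup>2 + (Im t)\<^sup>2 \<le> 1 / 2" by (simp add: power2_eq_square)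
      have pos: "(Re t)\<^sup>2 + (Im t)\<^sup>2 > 0" using Suc.prems(1) It by (simp add: sum_power2_gt_zero_iff)
      have "Im (- 1 / t) = Im \<tau> / ((Re t)\<^sup>2 + (Im t)\<^sup>2)" by (simp add: Im_divide It)
      moreover have "2 * Im \<tau> \<le> Im \<tau> / ((Re t)\<^sup>2 + (Im t)\<^sup>2)"
      proof -
        have "2 * Im \<tau> * ((Re t)\<^sup>2 + (Im t)\<^sup>2) \<le> 2 * Im \<tau> * (1 / 2)" using n Suc.prems(1) by (intro mult_left_mono) auto
        then show ?thesis using pos by (simp add: field_simps)
      qed
      ultimately have I2: "Im (- 1 / t) \<ge> 2 * Im \<tau>" by simp
      have "Im (- 1 / t) > 0" using I2 Suc.prems(1) by linarith
      moreover have "2 ^ N * Im (- 1 / t) \<ge> 1 / 2"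
        using mult_left_mono[OF I2, of "2 ^ N"] Suc.prems(2) by simp
      ultimately obtain \<sigma> where "Im \<sigma> \<ge> 1 / 2" "f \<sigma> = f (- 1 / t)" using Suc.IH by blast
      moreover have "f (- 1 / t) = f t" using f2[of t] It Suc.prems(1) by simp
      ultimately show ?thesis using ft by auto
    qed auto
  qed
  moreover obtain N where "1 / 2 / Im \<tau> < 2 ^ N" using real_arch_pow[of 2 "1 / 2 / Im \<tau>"] by auto
  then have "2 ^ N * Im \<tau> \<ge> 1 / 2" using \<tau> by (simp add: field_simps)
  ultimately show ?thesis using \<tau> that by blast
qed

text \<open>Every orbit meets \<open>Im \<tau> \<ge> 1/2\<close>, which is a compact disc in \<open>q\<close>. In weight 0 the supremum of the modulus is
  therefore attained, and the maximum modulus principle applies.\<close>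

lemma modular_form_weight_0:
  assumes "modular_form 0 \<phi>" shows "\<phi> constant_on ball 0 1"
proof -
  have hol: "\<phi> holomorphic_on ball 0 1" and inv: "\<And>\<tau>. Im \<tau> > 0 \<Longrightarrow> \<phi> (nome (- 1 / \<tau>)) = \<phi> (nome \<tau>)"
    using assms by (auto simp: modular_form_def)
  define R where "R = exp (- pi)"
  have R: "0 < R" "R < 1" by (auto simp: R_def)
  have "continuous_on (cball 0 R) (\<lambda>q. norm (\<phi> q))"
    by (intro continuous_on_norm holomorphic_on_imp_continuous_on holomorphic_on_subset[OF hol]) (use R in auto)
  moreover have "cball (0::complex) R \<noteq> {}" using R by auto
  ultimately obtain q0 where q0: "q0 \<in> cball 0 R" "\<And>q. q \<in> cball 0 R \<Longrightarrow> norm (\<phi> q) \<le> norm (\<phi> q0)"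
    using continuous_attains_sup[OF compact_cball, of 0 R "\<lambda>q. norm (\<phi> q)"] by blast
  have max: "norm (\<phi> q) \<le> norm (\<phi> q0)" if q: "q \<in> ball 0 1" for q
  proof (cases "q = 0")
    case True then show ?thesis using q0 R by auto
  next
    case False
    obtain \<tau> where \<tau>: "Im \<tau> > 0" "nome \<tau> = q" using nome_surj[OF False] q by auto
    obtain \<sigma> where \<sigma>: "Im \<sigma> \<ge> 1 / 2" "\<phi> (nome \<sigma>) = \<phi> (nome \<tau>)"
      by (rule modular_reduction[of "\<lambda>\<tau>. \<phi> (nome \<tau>)" \<tau>]) (use inv \<tau> nome_add_of_int in auto)
    have "norm (nome \<sigma>) \<le> R" unfolding R_def norm_exp_eq_Re using \<sigma>(1) mult_left_mono[of "1/2" "Im \<sigma>" "2 * pi"] by simp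
    then show ?thesis using q0(2)[of "nome \<sigma>"] \<sigma>(2) \<tau>(2) by simp
  qed
  show ?thesis
    by (rule maximum_modulus_principle[OF hol, of "ball 0 1" q0]) (use q0(1) R max in auto)
qed

text \<open>Inverting twice is the identity on \<open>\<tau>\<close> but multiplies a form of weight \<open>k\<close> by \<open>(-1)\<^sup>k\<close>.\<close>

lemma modular_form_odd_weight:
  assumes \<phi>: "modular_form k \<phi>" and k: "odd k" and q: "q \<noteq> 0" "norm q < 1" shows "\<phi> q = 0"
proof -
  obtain \<tau> where \<tau>: "Im \<tau> > 0" "nome \<tau> = q" using nome_surj[OF q] .
  have t0: "\<tau> \<noteq> 0" using \<tau> by auto
  have m: "- 1 / (- 1 / \<tau>) = \<tau>" using t0 by simp
  have "\<phi> (nome \<tau>) = (- 1 / \<tau>) powi k * (\<tau> powi k * \<phi> (nome \<tau>))"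
    using \<phi> \<tau>(1) Im_neg_inverse[OF \<tau>(1)] unfolding modular_form_def by (metis m)
  also have "\<dots> = ((- 1 / \<tau>) * \<tau>) powi k * \<phi> (nome \<tau>)" by (simp only: power_int_mult_distrib mult.assoc)
  also have "(- 1 / \<tau>) * \<tau> = - 1" using t0 by simp
  also have "(- 1 :: complex) powi k = - 1" using k by (simp add: power_int_minus_left)
  finally have "2 * \<phi> (nome \<tau>) = 0" by simp
  then show ?thesis using \<tau> by simp
qed

section \<open>The discriminant\<close>

definition eis2_q :: "complex \<Rightarrow> complex" where "eis2_q q = - dz e1_regular (q, 0)"

lemma disc_slice_e1_domain: "norm q < 1 \<Longrightarrow> (q, 0) \<in> e1_domain"
proof -
  assume q: "norm q < 1"
  have pw: "q ^ Suc a \<noteq> 1" for a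
  proof
    assume "q ^ Suc a = 1"
    then have "norm q ^ Suc a = 1" by (metis norm_one norm_power)
    moreover have "norm q ^ Suc a \<le> norm q ^ 1" by (rule power_decreasing) (use q in auto)
    then have "norm q ^ Suc a < 1" using q by simp
    ultimately show False by simp
  qed
  have "(q, 1) \<in> lambert_domain"
    unfolding lambert_domain_def mem_Collect_eq case_prod_conv mult_1 using q pw by blast
  moreover have "(1::complex) \<notin> \<int>\<^sub>\<le>\<^sub>0" by (auto elim!: nonpos_Ints_cases)
  ultimately show ?thesis by (simp add: e1_domain_def)
qed

lemma eis2_q_holomorphic: "eis2_q holomorphic_on ball 0 1"
proof -
  have "(\<lambda>q. dz e1_regular (q, 0)) holomorphic_on ball 0 1"
    by (rule holomorphic2_on_slice_fst[OF dz_holomorphic2_on[OF open_e1_domain e1_regular_holomorphic2_on]])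
       (auto intro: disc_slice_e1_domain)
  then show ?thesis unfolding eis2_q_def by (intro holomorphic_intros)
qed

lemma eis2_q_0: "eis2_q 0 = of_real pi ^ 2 / 3"
proof -
  have i1: "(1::complex) \<notin> \<int>\<^sub>\<le>\<^sub>0" by (auto elim!: nonpos_Ints_cases)
  have d1: "((\<lambda>z. Digamma (1 - z)) has_field_derivative Polygamma 1 (1::complex) * (-1)) (at 0)"
    by (rule DERIV_chain2[where f = Digamma and g = "\<lambda>z. 1 - z"])
       (use i1 in \<open>auto intro!: derivative_eq_intros simp: has_field_derivative_Polygamma\<close>)
  have d2: "((\<lambda>z. Digamma (1 + z)) has_field_derivative Polygamma 1 (1::complex) * 1) (at 0)"
    by (rule DERIV_chain2[where f = Digamma and g = "\<lambda>z. 1 + z"])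
       (use i1 in \<open>auto intro!: derivative_eq_intros simp: has_field_derivative_Polygamma\<close>)
  have "((\<lambda>z. Digamma (1 - z) - Digamma (1 + z)) has_field_derivative - (of_real pi ^ 2 / 3)) (at (0::complex))"
    using DERIV_diff[OF d1 d2] unfolding Polygamma_1_1 by simp
  moreover have "(\<lambda>z. e1_regular (0, z)) = (\<lambda>z. Digamma (1 - z) - Digamma (1 + z))"
    by (simp add: e1_regular_def lambert_series_def lambert_def fun_eq_iff)
  ultimately show ?thesis unfolding eis2_q_def dz_def by (simp add: DERIV_imp_deriv)
qed

lemma eis2_q_inversion:
  assumes \<tau>: "Im \<tau> > 0" shows "eis2_q (nome (- 1 / \<tau>)) = \<tau>\<^sup>2 * eis2_q (nome \<tau>) - 2 * of_real pi * \<i> * \<tau>"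
proof -
  obtain z where z: "(\<tau>, z) \<in> regular_domain"
    using regular_point_in_open[of "{\<tau>} \<times> UNIV" "(\<tau>, 0)"] punctured_neighbourhood_regular[OF \<tau>]
    by (metis dense norm_of_real abs_of_pos of_real_eq_0_iff less_irrefl)
  have "(- 1 / \<tau>, z / \<tau>) \<in> regular_domain" using regular_domain_mobius[of 0 0 "-1" 1 \<tau> z] z \<tau> by simp
  then show ?thesis using eis2_mobius[of 0 0 "-1" 1 \<tau> z] eis2_eq[OF z] eis2_eq[of "- 1 / \<tau>" "z / \<tau>"] z \<tau>
    by (simp add: eis2_q_def)
qed

lemma i_neg_inverse: "- 1 / \<i> = \<i>"
  by (simp add: complex_eq_iff Re_divide Im_divide)

text \<open>The discriminant is obtained by integrating its logarithmic derivative, a multiple of \<open>e\<^sub>2\<close>.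
  By construction it has no zeros in the upper half plane and a simple zero at the cusp; its
  transformation law comes from the one of \<open>e\<^sub>2\<close>, the constant of integration being fixed
  at the fixed point \<open>\<i>\<close> of the inversion.\<close>

lemma discriminant_exists:
  obtains D where "modular_form 12 (\<lambda>q. q * D q)" "D holomorphic_on ball 0 1" "\<And>q. D q \<noteq> 0"
proof -
  \<comment> \<open>\<open>\<kappa>\<close> times the value \<open>\<pi>\<^sup>2/3\<close> of \<open>e\<^sub>2\<close> at the cusp is \<open>2\<pi>\<i>\<close>, the logarithmic derivative of \<open>q\<close>; so \<open>\<kappa> e\<^sub>2\<close> integrates to
      \<open>q\<close> times a function without zeros, and its anomaly produces the weight 12\<close>
  define \<kappa> where "\<kappa> = 6 * \<i> / of_real pi"
  have \<kappa>: "\<kappa> * (of_real pi ^ 2 / 3) = 2 * of_real pi * \<i>" "- (2 * of_real pi * \<i>) * \<kappa> = 12"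
    by (simp_all add: \<kappa>_def power2_eq_square)
  define h where "h = (\<lambda>q. if q = 0 then deriv eis2_q 0 else (eis2_q q - eis2_q 0) / (q - 0))"
  have "h holomorphic_on ball 0 1" unfolding h_def by (rule pole_lemma[OF eis2_q_holomorphic]) simp
  then have "(\<lambda>q. \<kappa> / (2 * of_real pi * \<i>) * h q) holomorphic_on ball 0 1" by (intro holomorphic_intros)
  then obtain K where K': "\<And>q. q \<in> ball 0 1 \<Longrightarrow> (K has_field_derivative \<kappa> / (2 * of_real pi * \<i>) * h q) (at q within ball 0 1)"
    using holomorphic_convex_primitive'[OF convex_ball open_ball] by blast
  have K: "(K has_field_derivative \<kappa> / (2 * of_real pi * \<i>) * h q) (at q)" if "q \<in> ball 0 1" for q
    using K'[OF that] that by (simp add: at_within_open[OF _ open_ball])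
  have Kh: "K holomorphic_on ball 0 1" unfolding holomorphic_on_open[OF open_ball] using K by blast
  define D where "D = (\<lambda>q. exp (K q))"
  have Dh: "D holomorphic_on ball 0 1" unfolding D_def using Kh by (intro holomorphic_intros)
  define \<Delta> where "\<Delta> = (\<lambda>\<tau>. nome \<tau> * D (nome \<tau>))"
  have \<Delta>0: "\<Delta> \<tau> \<noteq> 0" for \<tau> by (simp add: \<Delta>_def D_def)
  have \<Delta>d: "(\<Delta> has_field_derivative \<kappa> * eis2_q (nome \<tau>) * \<Delta> \<tau>) (at \<tau>)" if "Im \<tau> > 0" for \<tau>
  proof -
    have q: "nome \<tau> \<in> ball 0 1" using nome_norm_less_1[OF that] by simp
    have nd: "(nome has_field_derivative nome \<tau> * (2 * of_real pi * \<i>)) (at \<tau>)" by (auto intro!: derivative_eq_intros)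
    have "((\<lambda>\<tau>. K (nome \<tau>)) has_field_derivative (\<kappa> / (2 * of_real pi * \<i>) * h (nome \<tau>)) * (nome \<tau> * (2 * of_real pi * \<i>))) (at \<tau>)"
      by (rule DERIV_chain2[OF K[OF q] nd])
    then have "((\<lambda>\<tau>. exp (K (nome \<tau>))) has_field_derivative exp (K (nome \<tau>)) * ((\<kappa> / (2 * of_real pi * \<i>) * h (nome \<tau>)) * (nome \<tau> * (2 * of_real pi * \<i>)))) (at \<tau>)"
      by (rule DERIV_chain2[OF DERIV_exp])
    from DERIV_mult[OF nd this]
    have "(\<Delta> has_field_derivative nome \<tau> * (2 * of_real pi * \<i>) * D (nome \<tau>)
        + exp (K (nome \<tau>)) * ((\<kappa> / (2 * of_real pi * \<i>) * h (nome \<tau>)) * (nome \<tau> * (2 * of_real pi * \<i>))) * nome \<tau>) (at \<tau>)"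
      unfolding \<Delta>_def D_def .
    moreover have "nome \<tau> * (2 * of_real pi * \<i>) * D (nome \<tau>)
        + exp (K (nome \<tau>)) * ((\<kappa> / (2 * of_real pi * \<i>) * h (nome \<tau>)) * (nome \<tau> * (2 * of_real pi * \<i>))) * nome \<tau>
        = \<kappa> * eis2_q (nome \<tau>) * \<Delta> \<tau>"
    proof -
      have "h (nome \<tau>) * nome \<tau> = eis2_q (nome \<tau>) - of_real pi ^ 2 / 3" by (simp add: h_def eis2_q_0)
      then have "\<kappa> * (h (nome \<tau>) * nome \<tau>) = \<kappa> * eis2_q (nome \<tau>) - 2 * of_real pi * \<i>" using \<kappa>(1) by (simp add: right_diff_distrib)
      moreover have "nome \<tau> * (2 * of_real pi * \<i>) * D (nome \<tau>)
        + exp (K (nome \<tau>)) * ((\<kappa> / (2 * of_real pi * \<i>) * h (nome \<tau>)) * (nome \<tau> * (2 * of_real pi * \<i>))) * nome \<tau>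
        = (2 * of_real pi * \<i> + \<kappa> * (h (nome \<tau>) * nome \<tau>)) * \<Delta> \<tau>"
        unfolding \<Delta>_def D_def by (simp add: algebra_simps)
      ultimately show ?thesis by simp
    qed
    ultimately show ?thesis by simp
  qed
  define \<Psi> where "\<Psi> = (\<lambda>\<tau>. \<Delta> (- 1 / \<tau>) / (\<tau> ^ 12 * \<Delta> \<tau>))"
  have \<Psi>d: "(\<Psi> has_field_derivative 0) (at \<tau>)" if \<tau>: "Im \<tau> > 0" for \<tau>
  proof -
    have t0: "\<tau> \<noteq> 0" using \<tau> by auto
    have "((\<lambda>\<tau>. - 1 / \<tau>) has_field_derivative 1 / \<tau>\<^sup>2) (at \<tau>)"
      using t0 by (auto intro!: derivative_eq_intros simp: power2_eq_square)
    from DERIV_chain2[OF \<Delta>d[OF Im_neg_inverse[OF \<tau>]] this]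
    have a: "((\<lambda>\<tau>. \<Delta> (- 1 / \<tau>)) has_field_derivative \<kappa> * eis2_q (nome (- 1 / \<tau>)) * \<Delta> (- 1 / \<tau>) * (1 / \<tau>\<^sup>2)) (at \<tau>)" .
    have b: "((\<lambda>\<tau>. \<tau> ^ 12 * \<Delta> \<tau>) has_field_derivative 12 * \<tau> ^ 11 * \<Delta> \<tau> + \<kappa> * eis2_q (nome \<tau>) * \<Delta> \<tau> * \<tau> ^ 12) (at \<tau>)"
      by (rule DERIV_mult[OF _ \<Delta>d[OF \<tau>]]) (auto intro!: derivative_eq_intros)
    have e: "\<kappa> * eis2_q (nome (- 1 / \<tau>)) * (1 / \<tau>\<^sup>2) = \<kappa> * eis2_q (nome \<tau>) + 12 / \<tau>"
    proof -
      have "\<kappa> * eis2_q (nome (- 1 / \<tau>)) = \<tau>\<^sup>2 * (\<kappa> * eis2_q (nome \<tau>)) + (- (2 * of_real pi * \<i>) * \<kappa>) * \<tau>"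
        unfolding eis2_q_inversion[OF \<tau>] by (simp add: algebra_simps)
      then show ?thesis unfolding \<kappa>(2) using t0 by (simp add: power2_eq_square field_simps)
    qed
    have t12: "\<tau> ^ 12 = \<tau> ^ 11 * \<tau>" using power_Suc2[of \<tau> 11] by simp
    from DERIV_divide[OF a b] t0 \<Delta>0[of \<tau>]
    have "(\<Psi> has_field_derivative ((\<kappa> * eis2_q (nome (- 1 / \<tau>)) * (1 / \<tau>\<^sup>2)) * \<Delta> (- 1 / \<tau>) * (\<tau> ^ 12 * \<Delta> \<tau>)
        - \<Delta> (- 1 / \<tau>) * (12 * \<tau> ^ 11 * \<Delta> \<tau> + \<kappa> * eis2_q (nome \<tau>) * \<Delta> \<tau> * \<tau> ^ 12)) / ((\<tau> ^ 12 * \<Delta> \<tau>) * (\<tau> ^ 12 * \<Delta> \<tau>))) (at \<tau>)"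
      unfolding \<Psi>_def by (simp add: mult_ac)
    moreover have "(\<kappa> * eis2_q (nome (- 1 / \<tau>)) * (1 / \<tau>\<^sup>2)) * \<Delta> (- 1 / \<tau>) * (\<tau> ^ 12 * \<Delta> \<tau>)
        - \<Delta> (- 1 / \<tau>) * (12 * \<tau> ^ 11 * \<Delta> \<tau> + \<kappa> * eis2_q (nome \<tau>) * \<Delta> \<tau> * \<tau> ^ 12) = 0"
      unfolding e t12 using t0 by (simp add: field_simps)
    ultimately show ?thesis by simp
  qed
  have cv: "convex {\<tau>. Im \<tau> > 0}" by (rule convex_halfspace_Im_gt)
  have "\<exists>c. \<forall>\<tau>\<in>{\<tau>. Im \<tau> > 0}. \<Psi> \<tau> = c"
    by (rule has_field_derivative_zero_constant[OF cv]) (use \<Psi>d in \<open>auto intro: has_field_derivative_at_within\<close>)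
  then obtain c where c: "\<And>\<tau>. Im \<tau> > 0 \<Longrightarrow> \<Psi> \<tau> = c" by auto
  have "\<i> ^ 12 = 1" by (simp add: power_numeral_reduce)
  then have "\<Psi> \<i> = 1" using \<Delta>0[of \<i>] by (simp add: \<Psi>_def i_neg_inverse)
  then have "c = 1" using c[of \<i>] by simp
  have S: "\<Delta> (- 1 / \<tau>) = \<tau> ^ 12 * \<Delta> \<tau>" if "Im \<tau> > 0" for \<tau>
  proof -
    have "\<tau> \<noteq> 0" using that by auto
    then show ?thesis using c[OF that] \<open>c = 1\<close> \<Delta>0[of \<tau>] by (simp add: \<Psi>_def)
  qed
  have "modular_form 12 (\<lambda>q. q * D q)"
    unfolding modular_form_def using Dh S unfolding \<Delta>_def by (auto intro!: holomorphic_intros)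
  then show ?thesis using Dh by (rule that) (simp add: D_def)
qed

section \<open>The structure of the ring of modular forms\<close>

lemma modular_form_at_i:
  assumes "modular_form k \<phi>" "\<i> powi k = - 1" shows "\<phi> (nome \<i>) = 0"
proof -
  have "Im \<i> > 0" by simp
  then have "\<phi> (nome (- 1 / \<i>)) = \<i> powi k * \<phi> (nome \<i>)"
    using assms(1) unfolding modular_form_def by blast
  then have "\<phi> (nome \<i>) = - \<phi> (nome \<i>)" unfolding i_neg_inverse assms(2) by simp
  then show ?thesis by simp
qed

definition rho :: complex where "rho = Complex (- 1 / 2) (sqrt 3 / 2)"

lemma rho: "Im rho > 0" "rho * rho + rho + 1 = 0" "rho \<noteq> 0" "rho \<noteq> 1"
  by (auto simp: rho_def complex_eq_iff)

lemma modular_form_4_at_rho: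
  assumes "modular_form 4 \<phi>" shows "\<phi> (nome rho) = 0"
proof -
  have "rho * (rho + 1) = - 1" using rho(2) by (simp add: algebra_simps add_eq_0_iff)
  then have inv: "- 1 / rho = rho + 1" using rho(3) by (simp add: field_simps)
  have "rho ^ 3 - 1 = (rho - 1) * (rho * rho + rho + 1)" by (simp add: power3_eq_cube algebra_simps)
  then have r3: "rho ^ 3 = 1" using rho(2) by simp
  have "rho ^ 4 = rho ^ 3 * rho" by (simp add: power_numeral_reduce)
  then have r4: "rho powi 4 = rho" using r3 by simp
  have "\<phi> (nome (- 1 / rho)) = rho powi 4 * \<phi> (nome rho)"
    using assms rho(1) unfolding modular_form_def by blast
  moreover have "nome (rho + 1) = nome rho" using nome_add_of_int[of rho 1] by simp
  ultimately have "\<phi> (nome rho) = rho * \<phi> (nome rho)" unfolding inv r4 by simp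
  then have "(rho - 1) * \<phi> (nome rho) = 0" by (simp add: algebra_simps)
  then show ?thesis using rho(4) by simp
qed

text \<open>The discriminant vanishes only at the cusp, and to first order, so it divides every form that vanishes there.\<close>

lemma modular_form_div_discriminant:
  assumes D: "modular_form 12 (\<lambda>q. q * D q)" "D holomorphic_on ball 0 1" "\<And>q. D q \<noteq> 0"
    and \<phi>: "modular_form k \<phi>" "\<phi> 0 = 0"
  obtains \<psi> where "modular_form (k - 12) \<psi>" "\<And>q. \<phi> q = q * D q * \<psi> q"
proof -
  define h where "h = (\<lambda>q. if q = 0 then deriv \<phi> 0 else (\<phi> q - \<phi> 0) / (q - 0))"
  have hh: "h holomorphic_on ball 0 1" unfolding h_def by (rule pole_lemma) (use \<phi>(1) in \<open>auto simp: modular_form_def\<close>)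
  have qh: "q * h q = \<phi> q" for q using \<phi>(2) by (simp add: h_def)
  define \<psi> where "\<psi> = (\<lambda>q. h q / D q)"
  have eq: "\<phi> q = q * D q * \<psi> q" for q using D(3)[of q] qh[of q] by (simp add: \<psi>_def)
  have "\<psi> (nome (- 1 / \<tau>)) = \<tau> powi (k - 12) * \<psi> (nome \<tau>)" if \<tau>: "Im \<tau> > 0" for \<tau>
  proof -
    have t0: "\<tau> \<noteq> 0" using \<tau> by auto
    define A B where "A = nome \<tau> * D (nome \<tau>)" and "B = nome (- 1 / \<tau>) * D (nome (- 1 / \<tau>))"
    have A0: "A \<noteq> 0" using D(3) by (simp add: A_def)
    have B: "B = \<tau> powi 12 * A" using D(1) \<tau> unfolding modular_form_def A_def B_def by blast
    have "B * \<psi> (nome (- 1 / \<tau>)) = \<tau> powi k * (A * \<psi> (nome \<tau>))"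
      using \<phi>(1) \<tau> eq unfolding modular_form_def A_def B_def by metis
    also have "\<tau> powi k = \<tau> powi (k - 12) * \<tau> powi 12" using power_int_add[of \<tau> "k - 12" 12] t0 by simp
    finally have "\<tau> powi 12 * A * \<psi> (nome (- 1 / \<tau>)) = \<tau> powi 12 * A * (\<tau> powi (k - 12) * \<psi> (nome \<tau>))"
      unfolding B by (simp only: mult_ac)
    moreover have "\<tau> powi 12 * A \<noteq> 0" using t0 A0 by simp
    ultimately show ?thesis by (subst (asm) mult_left_cancel)
  qed
  moreover have "\<psi> holomorphic_on ball 0 1" unfolding \<psi>_def using hh D(2,3) by (intro holomorphic_intros) auto
  ultimately have "modular_form (k - 12) \<psi>" by (simp add: modular_form_def)
  then show ?thesis using eq by (rule that)
qed

text \<open>With \<open>n = -k\<close> the product of \<open>\<phi>\<^bsup>12\<^esup>\<close> and the \<open>n\<close>-th power of the discriminant has weight 0; it is constant, and it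
  vanishes at the cusp.\<close>

lemma modular_form_negative_weight:
  assumes \<phi>: "modular_form k \<phi>" and k: "k < 0" and q: "q \<noteq> 0" "norm q < 1" shows "\<phi> q = 0"
proof -
  obtain D where D: "modular_form 12 (\<lambda>q. q * D q)" "D holomorphic_on ball 0 1" "\<And>q. D q \<noteq> 0"
    by (rule discriminant_exists) (rule that)
  define n where "n = nat (- k)"
  have n: "int n = - k" "n > 0" using k by (auto simp: n_def)
  have "modular_form (int 12 * k + int n * 12) (\<lambda>q. \<phi> q ^ 12 * (q * D q) ^ n)"
    by (rule modular_form_mult[OF modular_form_power[OF \<phi>] modular_form_power[OF D(1)]])
  also have "int 12 * k + int n * 12 = 0" using n by simp
  finally have "(\<lambda>q. \<phi> q ^ 12 * (q * D q) ^ n) constant_on ball 0 1" by (rule modular_form_weight_0)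
  then obtain c where c: "\<And>q. q \<in> ball 0 1 \<Longrightarrow> \<phi> q ^ 12 * (q * D q) ^ n = c" unfolding constant_on_def by blast
  have "c = 0" using c[of 0] n(2) by (simp add: zero_power)
  then show ?thesis using c[of q] q D(3)[of q] by simp
qed

text \<open>A form of weight 4 is forced to vanish at the fixed point \<open>\<rho>\<close>, and one of weight 6 at \<open>\<i>\<close>; without common zeros,
  neither vanishes at the other point. Hence neither vanishes at the cusp, since otherwise its quotient by the
  discriminant would be a nonzero form of negative weight. So a combination of \<open>g\<^sub>4\<^sup>3\<close> and \<open>g\<^sub>6\<^sup>2\<close> is the discriminant, and an arbitrary form is reduced to
  lower weight by making it vanish at the cusp with a monomial in \<open>g\<^sub>4\<close> and \<open>g\<^sub>6\<close> and dividing. In weight 2, where there is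
  no monomial, the square of the form is a multiple of \<open>g\<^sub>4\<close> and vanishes at \<open>\<i>\<close>, where \<open>g\<^sub>4\<close> does not.\<close>

theorem modular_form_generated:
  assumes g4: "modular_form 4 g4" and g6: "modular_form 6 g6"
    and ncz: "\<And>\<tau>. Im \<tau> > 0 \<Longrightarrow> \<not> (g4 (nome \<tau>) = 0 \<and> g6 (nome \<tau>) = 0)"
    and R: "\<And>c. (\<lambda>_. c) \<in> R" "\<And>f g. f \<in> R \<Longrightarrow> g \<in> R \<Longrightarrow> (\<lambda>q. f q + g q) \<in> R"
      "\<And>f g. f \<in> R \<Longrightarrow> g \<in> R \<Longrightarrow> (\<lambda>q. f q * g q) \<in> R" "g4 \<in> R" "g6 \<in> R"
    and R_cong: "\<And>f g. f \<in> R \<Longrightarrow> (\<And>q. q \<noteq> 0 \<Longrightarrow> norm q < 1 \<Longrightarrow> f q = g q) \<Longrightarrow> g \<in> R"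
    and \<phi>: "modular_form k \<phi>"
  shows "\<phi> \<in> R"
proof -
  obtain D where D: "modular_form 12 (\<lambda>q. q * D q)" "D holomorphic_on ball 0 1" "\<And>q. D q \<noteq> 0"
    by (rule discriminant_exists) (rule that)
  note quot = modular_form_div_discriminant[OF D]
  have Rpow: "(\<lambda>q. f q ^ n) \<in> R" if "f \<in> R" for f n
    by (induction n) (use R that in auto)
  have zero: "\<psi> \<in> R" if "\<And>q. q \<noteq> 0 \<Longrightarrow> norm q < 1 \<Longrightarrow> \<psi> q = 0" for \<psi>
    by (rule R_cong[OF R(1)[of 0]]) (use that in simp)
  have nq: "nome \<tau> \<noteq> 0" "norm (nome \<tau>) < 1" if "Im \<tau> > 0" for \<tau>
    using nome_norm_less_1[OF that] by auto
  have neg: "\<psi> q = 0" if l: "modular_form l \<psi>" "\<psi> 0 = 0" "l < 12" "q \<noteq> 0" "norm q < 1" for l \<psi> q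
  proof -
    obtain \<omega> where "modular_form (l - 12) \<omega>" "\<And>q. \<psi> q = q * D q * \<omega> q" using quot[OF l(1,2)] by metis
    then show ?thesis using modular_form_negative_weight[of "l - 12" \<omega> q] l by simp
  qed
  have i6: "\<i> powi 6 = - 1" by (simp add: power_numeral_reduce)
  have g6i: "g6 (nome \<i>) = 0" by (rule modular_form_at_i[OF g6 i6])
  have g4i: "g4 (nome \<i>) \<noteq> 0" using ncz[of \<i>] g6i by auto
  have g6r: "g6 (nome rho) \<noteq> 0" using ncz[OF rho(1)] modular_form_4_at_rho[OF g4] by auto
  have g40: "g4 0 \<noteq> 0" using neg[OF g4, of "nome \<i>"] g4i nq[of \<i>] by auto
  have g60: "g6 0 \<noteq> 0" using neg[OF g6, of "nome rho"] g6r nq[OF rho(1)] by auto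
  have Rd: "(\<lambda>q. q * D q) \<in> R"
  proof -
    define a b where "a = 1 / g4 0 ^ 3" and "b = 1 / g6 0 ^ 2"
    define E where "E = (\<lambda>q. a * g4 q ^ 3 - b * g6 q ^ 2)"
    have "modular_form (int 3 * 4) (\<lambda>q. g4 q ^ 3)" by (rule modular_form_power[OF g4])
    moreover have "modular_form (int 2 * 6) (\<lambda>q. g6 q ^ 2)" by (rule modular_form_power[OF g6])
    ultimately have E: "modular_form 12 E" unfolding E_def by (intro modular_form_diff modular_form_cmult) simp_all
    have "E 0 = 0" using g40 g60 by (simp add: E_def a_def b_def)
    then obtain \<omega> where \<omega>: "modular_form (12 - 12) \<omega>" "\<And>q. E q = q * D q * \<omega> q" using quot[OF E] by metis
    have "\<omega> constant_on ball 0 1" using modular_form_weight_0 \<omega>(1) by simp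
    then obtain d where d: "\<And>q. norm q < 1 \<Longrightarrow> \<omega> q = d" unfolding constant_on_def by auto
    have "E (nome \<i>) \<noteq> 0" using g4i g6i g40 by (simp add: E_def a_def)
    then have d0: "d \<noteq> 0" using \<omega>(2)[of "nome \<i>"] d[OF nq(2), of \<i>] by auto
    have "(\<lambda>q. 1 / d * (a * g4 q ^ 3 + (- b) * g6 q ^ 2)) \<in> R" by (intro R Rpow)
    then show ?thesis
    proof (rule R_cong)
      fix q :: complex assume "q \<noteq> 0" "norm q < 1"
      then have "E q = q * D q * d" using \<omega>(2) d by simp
      then show "1 / d * (a * g4 q ^ 3 + (- b) * g6 q ^ 2) = q * D q" using d0 by (simp add: E_def field_simps)
    qed
  qed
  have w2: "\<psi> q = 0" if \<psi>: "modular_form 2 \<psi>" and q: "q \<noteq> 0" "norm q < 1" for \<psi> q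
  proof -
    define c where "c = \<psi> 0 ^ 2 / g4 0"
    have "modular_form (int 2 * 2) (\<lambda>q. \<psi> q ^ 2)" by (rule modular_form_power[OF \<psi>])
    then have m: "modular_form 4 (\<lambda>q. \<psi> q ^ 2 - c * g4 q)" by (intro modular_form_diff modular_form_cmult[OF g4]) simp
    have z: "\<psi> p ^ 2 - c * g4 p = 0" if "p \<noteq> 0" "norm p < 1" for p
      by (rule neg[OF m]) (use that g40 in \<open>auto simp: c_def\<close>)
    have "\<i> powi 2 = - 1" by simp
    then have "\<psi> (nome \<i>) = 0" by (rule modular_form_at_i[OF \<psi>])
    then have "c = 0" using z[OF nq(1,2), of \<i>] g4i by auto
    then show ?thesis using z[OF q] by simp
  qed
  have main: "\<psi> \<in> R" if "modular_form (2 * int m) \<psi>" for m \<psi>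
    using that
  proof (induction m arbitrary: \<psi> rule: less_induct)
    case (less m)
    consider "m = 0" | "m = 1" | "m \<ge> 2" by linarith
    then show ?case
    proof cases
      case 1
      then have "\<psi> constant_on ball 0 1" using less.prems modular_form_weight_0 by simp
      then obtain c where "\<And>q. norm q < 1 \<Longrightarrow> \<psi> q = c" unfolding constant_on_def by auto
      then show ?thesis by (intro R_cong[OF R(1)[of c]]) auto
    next
      case 2
      then show ?thesis using less.prems w2 zero by simp
    next
      case 3
      \<comment> \<open>every even weight at least 4 is of the form \<open>4a + 6b\<close> with \<open>b \<le> 1\<close>\<close>
      define b where "b = m mod 2"
      define a where "a = (m - 3 * b) div 2"
      have ab: "m = 2 * a + 3 * b" 
      proof (cases "even m")
        case False
        then obtain l where "m = 2 * l + 1" by (elim oddE)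
        moreover from this obtain l' where "l = Suc l'" using 3 by (cases l) auto
        ultimately have m: "m = 2 * l' + 3" by simp
        then have "b = 1" unfolding b_def by presburger
        then show ?thesis unfolding a_def using m by simp
      qed (auto simp: a_def b_def)
      define G where "G = (\<lambda>q. g4 q ^ a * g6 q ^ b)"
      have "modular_form (int a * 4 + int b * 6) G" unfolding G_def
        by (intro modular_form_mult modular_form_power g4 g6)
      then have G: "modular_form (2 * int m) G" using ab by (simp add: algebra_simps)
      have G0: "G 0 \<noteq> 0" using g40 g60 by (simp add: G_def)
      define c where "c = \<psi> 0 / G 0"
      have m1: "modular_form (2 * int m) (\<lambda>q. \<psi> q - c * G q)" by (intro modular_form_diff modular_form_cmult G less.prems)
      have m2: "\<psi> 0 - c * G 0 = 0" using G0 by (simp add: c_def)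
      obtain \<omega> where \<omega>: "modular_form (2 * int m - 12) \<omega>" "\<And>q. \<psi> q - c * G q = q * D q * \<omega> q"
        by (rule quot[OF m1 m2]) (rule that)
      have "\<omega> \<in> R"
      proof (cases "m \<ge> 6")
        case True
        then have e: "2 * int m - 12 = 2 * int (m - 6)" by simp
        show ?thesis by (rule less.IH[OF _ \<omega>(1)[unfolded e]]) (use 3 in simp)
      next
        case False
        then show ?thesis using modular_form_negative_weight[OF \<omega>(1)] by (intro zero) simp
      qed
      then have "(\<lambda>q. c * (g4 q ^ a * g6 q ^ b) + q * D q * \<omega> q) \<in> R" by (intro R Rpow Rd)
      moreover have "(\<lambda>q. c * (g4 q ^ a * g6 q ^ b) + q * D q * \<omega> q) = \<psi>"
        using \<omega>(2) by (auto simp: fun_eq_iff G_def diff_eq_eq add.commute)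
      ultimately show ?thesis by simp
    qed
  qed
  consider "odd k" | "k < 0" | m where "k = 2 * int m"
  proof -
    assume a: "odd k \<Longrightarrow> thesis" "k < 0 \<Longrightarrow> thesis" "\<And>m. k = 2 * int m \<Longrightarrow> thesis"
    have ev: "thesis" if e: "even k" "k \<ge> 0"
    proof -
      obtain c where "k = 2 * c" using e(1) by (rule evenE)
      then have "k = 2 * int (nat c)" using e(2) by simp
      then show thesis by (rule a(3))
    qed
    show thesis
    proof (cases "odd k")
      case True then show thesis by (rule a(1))
    next
      case False then show thesis using a(2) ev by (cases "k \<ge> 0") auto
    qed
  qed
  then show ?thesis
  proof cases
    case 1 then show ?thesis using modular_form_odd_weight[OF \<phi>] by (intro zero)
  next
    case 2 then show ?thesis using modular_form_negative_weight[OF \<phi>] by (intro zero)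
  next
    case 3 then show ?thesis using main \<phi> by simp
  qed
qed

section \<open>Elliptic functions with small poles\<close>

lemma connected_period_lattice_compl: "connected (- period_lattice \<tau>)"
proof -
  have "period_lattice \<tau> = (\<lambda>(m, n). of_int m * \<tau> + of_int n) ` (UNIV :: (int \<times> int) set)"
    by (auto simp: period_lattice_def)
  then have "countable (period_lattice \<tau>)" by simp
  from connected_open_diff_countable[OF _ open_UNIV connected_UNIV this]
  have "connected (UNIV - period_lattice \<tau>)" by simp
  then show ?thesis by (simp add: Compl_eq_Diff_UNIV)
qed

lemma removable_singularity_at_origin:
  assumes \<tau>: "Im \<tau> > 0" and hol: "f holomorphic_on - period_lattice \<tau>" and lim: "(f \<longlongrightarrow> c) (at 0)"
  obtains r where "r > 0" "(\<lambda>z. if z = 0 then c else f z) holomorphic_on ball 0 r"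
    "\<And>z. norm z < r \<Longrightarrow> z \<noteq> 0 \<Longrightarrow> z \<notin> period_lattice \<tau>"
proof -
  obtain r where r: "r > 0" "\<And>z. norm z < r \<Longrightarrow> z \<noteq> 0 \<Longrightarrow> (\<tau>, z) \<in> regular_domain"
    using punctured_neighbourhood_regular[OF \<tau>] by metis
  have r': "z \<notin> period_lattice \<tau>" if "norm z < r" "z \<noteq> 0" for z
    using r(2)[OF that] by (simp add: regular_domain_iff_period_lattice)
  have "(\<lambda>z. if z = 0 then c else f z) holomorphic_on ball 0 r"
    by (rule removable_singularity[OF _ _ lim]) (use r' in \<open>auto intro!: holomorphic_on_subset[OF hol]\<close>)
  then show ?thesis using r(1) r' by (intro that[of r])
qed

lemma holomorphic_zero_divide_limit:
  assumes \<tau>: "Im \<tau> > 0" and hol: "f holomorphic_on - period_lattice \<tau>" and lim: "(f \<longlongrightarrow> 0) (at 0)"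
  shows "\<exists>l. ((\<lambda>z. f z / z) \<longlongrightarrow> l) (at 0)"
proof -
  obtain r where r: "r > 0" "(\<lambda>z. if z = 0 then 0 else f z) holomorphic_on ball 0 r"
    by (rule removable_singularity_at_origin[OF \<tau> hol lim]) (rule that)
  then have "(\<lambda>z. if z = 0 then 0 else f z) field_differentiable at 0"
    by (simp add: holomorphic_on_imp_differentiable_at)
  then obtain D where "((\<lambda>z. if z = 0 then 0 else f z) has_field_derivative D) (at 0)" by (auto simp: field_differentiable_def)
  then have "((\<lambda>z. ((if z = 0 then 0 else f z) - 0) / (z - 0)) \<longlongrightarrow> D) (at 0)"
    unfolding has_field_derivative_iff by simp
  moreover have "\<forall>\<^sub>F z in at 0. ((if z = 0 then 0 else f z) - 0) / (z - 0) = f z / z"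
    unfolding eventually_at_filter by (rule always_eventually) simp
  ultimately have "((\<lambda>z. f z / z) \<longlongrightarrow> D) (at 0)" by (rule Lim_transform_eventually)
  then show ?thesis by blast
qed

text \<open>An elliptic function cannot have a single simple pole per period cell: subtracting the residue times
  the first Eisenstein series leaves a function without poles, whose derivative is constant, and a linear
  function has the wrong quasi-periods.\<close>

lemma elliptic_no_simple_pole:
  assumes \<tau>: "Im \<tau> > 0" and hol: "f holomorphic_on - period_lattice \<tau>"
    and per: "\<And>z m n. z \<notin> period_lattice \<tau> \<Longrightarrow> f (z + of_int m * \<tau> + of_int n) = f z"
    and lim: "((\<lambda>z. z * f z) \<longlongrightarrow> a) (at 0)"
  shows "a = 0"
proof -
  have regI: "(\<tau>, z) \<in> regular_domain" if "z \<notin> period_lattice \<tau>" for z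
    using that \<tau> by (simp add: regular_domain_iff_period_lattice)
  have oL: "open (- period_lattice \<tau>)" by (rule open_period_lattice_compl[OF \<tau>])
  define g where "g = (\<lambda>z. f z - a * Eis (Suc 0) (\<tau>, z))"
  have gh: "g holomorphic_on - period_lattice \<tau>"
    unfolding g_def by (intro holomorphic_intros hol Eis_holomorphic_on_slice[OF \<tau>])
  have gper: "g (z + of_int m * \<tau> + of_int n) = g z + 2 * of_real pi * \<i> * of_int m * a" if "z \<notin> period_lattice \<tau>" for z m n
    by (simp only: g_def per[OF that] Eis_1_shift[OF regI[OF that], unfolded One_nat_def]) (simp add: algebra_simps)
  have "((\<lambda>z. 1 + z * e1_regular (nome \<tau>, z)) \<longlongrightarrow> 1 + 0 * e1_regular (nome \<tau>, 0)) (at 0)"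
    using eis_regular_part_tendsto[OF \<tau>, of 0] by (intro tendsto_intros) simp_all
  then have "((\<lambda>z. z * f z - a * (1 + z * e1_regular (nome \<tau>, z))) \<longlongrightarrow> a - a * 1) (at 0)"
    using lim by (intro tendsto_intros) simp_all
  moreover have "\<forall>\<^sub>F z in at 0. z * f z - a * (1 + z * e1_regular (nome \<tau>, z)) = z * g z"
    using eventually_at_0_regular[OF \<tau>]
  proof eventually_elim
    case (elim z)
    then show ?case using Eis_expansion[OF elim, of 0] by (simp add: g_def regular_domain_iff field_simps)
  qed
  ultimately have "((\<lambda>z. z * g z) \<longlongrightarrow> 0) (at 0)" by (simp add: filterlim_cong)
  moreover have "(\<lambda>z. z * g z) holomorphic_on - period_lattice \<tau>" by (intro holomorphic_intros gh)
  ultimately obtain l where "((\<lambda>z. z * g z / z) \<longlongrightarrow> l) (at 0)"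
    using holomorphic_zero_divide_limit[OF \<tau>] by blast
  moreover have "\<forall>\<^sub>F z in at 0. z * g z / z = g z"
    unfolding eventually_at_filter by (rule always_eventually) simp
  ultimately have gl: "(g \<longlongrightarrow> l) (at 0)" by (simp add: filterlim_cong)
  obtain r where r: "r > 0" "\<And>z. norm z < r \<Longrightarrow> z \<noteq> 0 \<Longrightarrow> z \<notin> period_lattice \<tau>"
    by (rule removable_singularity_at_origin[OF \<tau> gh gl]) (rule that)
  have "isolated_singularity_at g 0"
    by (rule isolated_singularity_at_holomorphic[of _ "ball 0 r"])
       (use r in \<open>auto intro!: holomorphic_on_subset[OF gh]\<close>)
  then obtain C where C: "(deriv g \<longlongrightarrow> C) (at 0)" using removable_singularity_deriv[OF gl] by blast
  have dC: "deriv g z = C" if "z \<notin> period_lattice \<tau>" for z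
  proof (rule elliptic_Liouville[OF \<tau> holomorphic_deriv[OF gh oL] _ C that])
    fix z m n assume z: "z \<notin> period_lattice \<tau>"
    define w where "w = of_int m * \<tau> + of_int n"
    have zw: "z + w \<notin> period_lattice \<tau>" using z period_lattice_shift[of z m \<tau> n] by (simp add: w_def add.assoc)
    have "(g has_field_derivative deriv g (z + w)) (at (z + w))" by (rule holomorphic_derivI[OF gh oL]) (use zw in simp)
    then have "((\<lambda>z. g (z + w)) has_field_derivative deriv g (z + w)) (at z)" by (simp add: DERIV_shift)
    moreover have "((\<lambda>z. g z + 2 * of_real pi * \<i> * of_int m * a) has_field_derivative deriv g z + 0) (at z)"
      by (intro DERIV_add DERIV_const holomorphic_derivI[OF gh oL]) (use z in simp)
    then have "((\<lambda>z. g (z + w)) has_field_derivative deriv g z + 0) (at z)"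
      by (rule has_field_derivative_transform_within_open[OF _ oL]) (use z gper in \<open>auto simp: w_def add.assoc\<close>)
    ultimately have "deriv g (z + w) = deriv g z + 0" by (rule DERIV_unique)
    then show "deriv g (z + of_int m * \<tau> + of_int n) = deriv g z" by (simp add: w_def add.assoc)
  qed
  have "\<exists>B. \<forall>z \<in> - period_lattice \<tau>. g z - C * z = B"
  proof -
    have "((\<lambda>z. g z - C * z) has_field_derivative 0) (at z)" if "z \<in> - period_lattice \<tau>" for z
    proof -
      have "((\<lambda>z. g z - C * z) has_field_derivative deriv g z - C * 1) (at z)"
        by (intro DERIV_diff DERIV_cmult DERIV_ident holomorphic_derivI[OF gh oL that])
      then show ?thesis using dC[of z] that by simp
    qed
    then have "(\<lambda>z. g z - C * z) constant_on - period_lattice \<tau>"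
      by (intro has_field_derivative_0_imp_constant_on connected_period_lattice_compl oL)
    then show ?thesis by (auto simp: constant_on_def)
  qed
  then obtain B where B: "\<And>z. z \<notin> period_lattice \<tau> \<Longrightarrow> g z = C * z + B" by (auto simp: algebra_simps)
  obtain z where z: "z \<notin> period_lattice \<tau>" using r(2)[of "of_real (r / 2)"] r(1) by auto
  have zs: "z + of_int m * \<tau> + of_int n \<notin> period_lattice \<tau>" for m n using z by (simp add: period_lattice_shift)
  have "C = 0" using gper[OF z, of 0 1] B[OF z] B[OF zs[of 0 1]] by (simp add: algebra_simps)
  then show ?thesis using gper[OF z, of 1 0] B[OF z] B[OF zs[of 1 0]] by simp
qed

text \<open>The pole has order at most one, and a single simple pole per cell is impossible.\<close>

lemma elliptic_small_pole_limit:
  assumes \<tau>: "Im \<tau> > 0" and hol: "f holomorphic_on - period_lattice \<tau>"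
    and per: "\<And>z m n. z \<notin> period_lattice \<tau> \<Longrightarrow> f (z + of_int m * \<tau> + of_int n) = f z"
    and lim: "((\<lambda>z. z ^ 2 * f z) \<longlongrightarrow> 0) (at 0)"
  shows "\<exists>c. (f \<longlongrightarrow> c) (at 0)"
proof -
  have "\<exists>l. ((\<lambda>z. z ^ 2 * f z / z) \<longlongrightarrow> l) (at 0)"
    by (rule holomorphic_zero_divide_limit[OF \<tau> _ lim]) (intro holomorphic_intros hol)
  then obtain a where a: "((\<lambda>z. z ^ 2 * f z / z) \<longlongrightarrow> a) (at 0)" by blast
  have "(\<lambda>z. z ^ 2 * f z / z) = (\<lambda>z. z * f z)" by (auto simp: fun_eq_iff power2_eq_square)
  with a have a': "((\<lambda>z. z * f z) \<longlongrightarrow> a) (at 0)" by simp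
  have "a = 0" by (rule elliptic_no_simple_pole[OF \<tau> hol per a'])
  with a' have "((\<lambda>z. z * f z) \<longlongrightarrow> 0) (at 0)" by simp
  then have "\<exists>l. ((\<lambda>z. z * f z / z) \<longlongrightarrow> l) (at 0)"
    by (rule holomorphic_zero_divide_limit[OF \<tau>, rotated]) (intro holomorphic_intros hol)
  moreover have "\<forall>\<^sub>F z in at 0. z * f z / z = f z"
    unfolding eventually_at_filter by (rule always_eventually) simp
  ultimately show ?thesis by (simp add: filterlim_cong)
qed

section \<open>Meromorphic Jacobi forms\<close>

text \<open>The almost meromorphic Jacobi forms of depth \<open>(0, 0)\<close>, that is, without \<open>\<lambda>\<close> and \<open>\<mu>\<close>.\<close>

definition jacobi_form :: "int \<Rightarrow> (complex \<times> complex \<Rightarrow> complex) \<Rightarrow> bool" where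
  "jacobi_form k g \<longleftrightarrow> holomorphic2_on g regular_domain \<and> convergent_laurent_qz g \<and> jacobi_invariant k g"

lemma jacobi_form_mult: "jacobi_form k f \<Longrightarrow> jacobi_form l g \<Longrightarrow> jacobi_form (k + l) (\<lambda>p. f p * g p)"
  using jacobi_invariant_mult[of k f l g]
  by (auto simp: jacobi_form_def times_fun_def intro: holomorphic2_on_mult convergent_laurent_qz_mult)

lemma jacobi_form_cmult: "jacobi_form k f \<Longrightarrow> jacobi_form k (\<lambda>p. c * f p)"
  unfolding jacobi_form_def jacobi_invariant_def
  by (intro conjI holomorphic2_on_mult holomorphic2_on_const convergent_laurent_qz_mult convergent_laurent_qz_const) (auto simp: mult_ac)

lemma jacobi_form_add: "jacobi_form k f \<Longrightarrow> jacobi_form k g \<Longrightarrow> jacobi_form k (\<lambda>p. f p + g p)"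
  unfolding jacobi_form_def jacobi_invariant_def
  by (intro conjI holomorphic2_on_add convergent_laurent_qz_add) (auto simp: algebra_simps)

lemma jacobi_form_diff: "jacobi_form k f \<Longrightarrow> jacobi_form k g \<Longrightarrow> jacobi_form k (\<lambda>p. f p - g p)"
  using jacobi_form_add[of k f "\<lambda>p. - 1 * g p"] jacobi_form_cmult[of k g "- 1"] by simp

lemma jacobi_form_slice:
  assumes "jacobi_form k g" "Im \<tau> > 0"
  shows "(\<lambda>z. g (\<tau>, z)) holomorphic_on - period_lattice \<tau>"
    "\<And>z m n. z \<notin> period_lattice \<tau> \<Longrightarrow> g (\<tau>, z + of_int m * \<tau> + of_int n) = g (\<tau>, z)"
proof -
  show "(\<lambda>z. g (\<tau>, z)) holomorphic_on - period_lattice \<tau>"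
    by (rule holomorphic2_on_slice_snd[of g regular_domain])
       (use assms open_period_lattice_compl in \<open>auto simp: jacobi_form_def regular_domain_iff_period_lattice\<close>)
  show "g (\<tau>, z + of_int m * \<tau> + of_int n) = g (\<tau>, z)" if "z \<notin> period_lattice \<tau>" for z m n
    using assms that by (auto simp: jacobi_form_def jacobi_invariant_def regular_domain_iff_period_lattice)
qed

text \<open>A nonzero lattice point has imaginary part at least \<open>Im \<tau>\<close> in absolute value, or is a nonzero integer.\<close>

lemma small_regular:
  assumes "0 < R" "R < 1" "R < Im \<tau>" "z \<noteq> 0" "norm z \<le> R"
  shows "(\<tau>, z) \<in> regular_domain"
proof -
  have "z \<notin> period_lattice \<tau>"
  proof
    assume "z \<in> period_lattice \<tau>"
    then obtain m n :: int where z: "z = of_int m * \<tau> + of_int n" unfolding period_lattice_def by blast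
    show False
    proof (cases "m = 0")
      case True
      then have "norm z = \<bar>real_of_int n\<bar>" using z by simp
      moreover have "\<bar>real_of_int n\<bar> \<ge> 1" using True z assms(4) by (cases "n = 0") auto
      ultimately show False using assms by simp
    next
      case False
      then have m1: "\<bar>real_of_int m\<bar> \<ge> 1" by linarith
      have "Im z = real_of_int m * Im \<tau>" by (simp add: z)
      then have "\<bar>Im z\<bar> = \<bar>real_of_int m\<bar> * Im \<tau>" using assms by (simp add: abs_mult)
      moreover have "1 * Im \<tau> \<le> \<bar>real_of_int m\<bar> * Im \<tau>" using m1 assms by (intro mult_right_mono) auto
      ultimately show False using abs_Im_le_cmod[of z] assms by linarith
    qed
  qed
  then show ?thesis using assms by (simp add: regular_domain_iff_period_lattice)
qed

text \<open>The circle stays away from the lattice in the whole half plane, so its Cauchy integrals, and with them the Laurent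
  coefficients of \<open>g\<close>, depend holomorphically on \<open>\<tau>\<close>.\<close>

lemma jacobi_circle_integral_holomorphic:
  assumes g: "holomorphic2_on g regular_domain" and R: "0 < R" "R < 1" and z: "norm z < R"
  shows "(\<lambda>\<tau>. contour_integral (circlepath 0 R) (\<lambda>w. w ^ N * g (\<tau>, w) / (w - z))) holomorphic_on {\<tau>. R < Im \<tau>}"
proof (rule holomorphic_contour_integral_circlepath)
  have reg: "(\<tau>, w) \<in> regular_domain" if "R < Im \<tau>" "norm w = R" for \<tau> w
    by (rule small_regular[OF R that(1)]) (use that R in auto)
  have nz: "w - z \<noteq> 0" if "norm w = R" for w using that z by auto
  have "continuous_on ({\<tau>. R < Im \<tau>} \<times> sphere 0 R) g"
    by (rule continuous_on_subset[OF holomorphic2_on_imp_continuous_on[OF g]]) (use reg in auto)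
  then show "continuous_on ({\<tau>. R < Im \<tau>} \<times> sphere 0 R) (\<lambda>(\<tau>, w). w ^ N * g (\<tau>, w) / (w - z))"
    unfolding split_def by (intro continuous_intros) (use nz in auto)
  show "open {\<tau>. R < Im \<tau>}" by (rule open_halfspace_Im_gt)
  show "(\<lambda>\<tau>. w ^ N * g (\<tau>, w) / (w - z)) holomorphic_on {\<tau>. R < Im \<tau>}" if "w \<in> sphere 0 R" for w
  proof -
    have "(\<lambda>\<tau>. g (\<tau>, w)) holomorphic_on {\<tau>. R < Im \<tau>}"
      by (rule holomorphic2_on_slice_fst[OF g open_halfspace_Im_gt]) (use that reg in auto)
    then show ?thesis by (intro holomorphic_intros) (use nz that in auto)
  qed
qed (use R in auto)

lemma nome_small_imp_Im_large: "norm (nome \<tau>) < exp (- 2 * pi * R) \<Longrightarrow> R < Im \<tau>"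
proof -
  assume "norm (nome \<tau>) < exp (- 2 * pi * R)"
  then have "- (2 * pi * Im \<tau>) < - 2 * pi * R" unfolding norm_exp_eq_Re by simp
  then show ?thesis by simp
qed

text \<open>Near the cusp the order of the pole at \<open>z = 0\<close> is bounded by the Laurent expansion. The Cauchy integral
  that witnesses this is holomorphic in \<open>\<tau>\<close>, so the bound persists for all \<open>\<tau>\<close> by the identity theorem.\<close>

lemma jacobi_form_pole_order:
  assumes g: "holomorphic2_on g regular_domain" "convergent_laurent_qz g"
  obtains N where "\<And>\<tau>. Im \<tau> > 0 \<Longrightarrow> \<exists>a. ((\<lambda>z. z ^ N * g (\<tau>, z)) \<longlongrightarrow> a) (at 0)"
proof -
  obtain S r M where r: "r > 0" "holomorphic2_on S (ball 0 r \<times> ball 0 r)"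
    "\<And>\<tau> z. (\<tau>, z) \<in> regular_domain \<Longrightarrow> norm (nome \<tau>) < r \<Longrightarrow> norm z < r \<Longrightarrow> g (\<tau>, z) = S (nome \<tau>, z) / z ^ M"
    using g(2) unfolding convergent_laurent_qz_iff by blast
  have "\<exists>a. ((\<lambda>z. z ^ M * g (\<tau>, z)) \<longlongrightarrow> a) (at 0)" if \<tau>: "Im \<tau> > 0" for \<tau>
  proof -
    obtain R where R: "0 < R" "R < 1" "R < Im \<tau>" "R < r"
      using dense[of 0 "min (min 1 (Im \<tau>)) r"] \<tau> r(1) by auto
    define X where "X = {\<sigma>. R < Im \<sigma>}"
    define G where "G = (\<lambda>\<sigma> z. contour_integral (circlepath 0 R) (\<lambda>w. w ^ M * g (\<sigma>, w) / (w - z)))"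
    have eq: "G \<tau> z = 2 * of_real pi * \<i> * (z ^ M * g (\<tau>, z))" if z: "z \<noteq> 0" "norm z < R" for z
    proof -
      define X' where "X' = {\<sigma>. max R (- ln r / (2 * pi)) < Im \<sigma>}"
      have small: "norm (nome \<sigma>) < r" if "\<sigma> \<in> X'" for \<sigma>
      proof -
        have "- ln r < 2 * pi * Im \<sigma>" using that by (simp add: X'_def field_simps)
        then have "exp (- (2 * pi * Im \<sigma>)) < exp (ln r)" by simp
        then show ?thesis unfolding norm_exp_eq_Re using r(1) by simp
      qed
      show ?thesis
      proof (rule analytic_continuation_open[of X' X "\<lambda>\<sigma>. G \<sigma> z" "\<lambda>\<sigma>. 2 * of_real pi * \<i> * (z ^ M * g (\<sigma>, z))"])
        show "open X'" "open X" unfolding X'_def X_def by (rule open_halfspace_Im_gt)+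
        show "connected X" unfolding X_def by (rule convex_connected[OF convex_halfspace_Im_gt])
        have "\<i> * of_real (max R (- ln r / (2 * pi)) + 1) \<in> X'" unfolding X'_def by (simp add: max_def)
        then show "X' \<noteq> {}" by blast
        show "X' \<subseteq> X" unfolding X'_def X_def by auto
        show "(\<lambda>\<sigma>. G \<sigma> z) holomorphic_on X"
          unfolding G_def X_def by (rule jacobi_circle_integral_holomorphic[OF g(1) R(1,2) z(2)])
        have "(\<lambda>\<sigma>. g (\<sigma>, z)) holomorphic_on X"
          unfolding X_def
          by (rule holomorphic2_on_slice_fst[OF g(1) open_halfspace_Im_gt]) (use small_regular[OF R(1,2)] z in auto)
        then show "(\<lambda>\<sigma>. 2 * of_real pi * \<i> * (z ^ M * g (\<sigma>, z))) holomorphic_on X" by (intro holomorphic_intros)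
        show "\<tau> \<in> X" using R by (simp add: X_def)
        fix \<sigma> assume \<sigma>: "\<sigma> \<in> X'"
        then have I: "R < Im \<sigma>" by (simp add: X'_def)
        have Sg: "w ^ M * g (\<sigma>, w) = S (nome \<sigma>, w)" if "w \<noteq> 0" "norm w \<le> R" for w
          using r(3)[OF small_regular[OF R(1,2) I that] small[OF \<sigma>]] that R by simp
        have hS: "(\<lambda>w. S (nome \<sigma>, w)) holomorphic_on ball 0 r"
          by (rule holomorphic2_on_slice_snd[OF r(2)]) (use small[OF \<sigma>] in auto)
        have "((\<lambda>w. S (nome \<sigma>, w) / (w - z)) has_contour_integral (2 * of_real pi * \<i> * S (nome \<sigma>, z))) (circlepath 0 R)"
          by (rule Cauchy_integral_circlepath)
             (use R z in \<open>auto intro!: holomorphic_on_imp_continuous_on holomorphic_on_subset[OF hS]\<close>)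
        then have "contour_integral (circlepath 0 R) (\<lambda>w. S (nome \<sigma>, w) / (w - z)) = 2 * of_real pi * \<i> * S (nome \<sigma>, z)"
          by (rule contour_integral_unique)
        moreover have "G \<sigma> z = contour_integral (circlepath 0 R) (\<lambda>w. S (nome \<sigma>, w) / (w - z))"
          unfolding G_def by (rule contour_integral_cong) (use Sg R in auto)
        ultimately show "G \<sigma> z = 2 * of_real pi * \<i> * (z ^ M * g (\<sigma>, z))" using Sg[of z] z by simp
      qed
    qed
    have Gh: "G \<tau> holomorphic_on ball 0 R"
      unfolding G_def
    proof (rule holomorphic_contour_integral_circlepath)
      have "continuous_on (sphere 0 R) (\<lambda>w. g (\<tau>, w))"
        by (rule continuous_on_compose2[OF holomorphic2_on_imp_continuous_on[OF g(1)]])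
           (use R small_regular[OF R(1,2,3)] in \<open>auto intro!: continuous_intros\<close>)
      then have c: "continuous_on (ball 0 R \<times> sphere 0 R) (\<lambda>p. g (\<tau>, snd p))"
        by (rule continuous_on_compose2) (auto intro!: continuous_intros)
      show "continuous_on (ball 0 R \<times> sphere 0 R) (\<lambda>(z, w). w ^ M * g (\<tau>, w) / (w - z))"
        unfolding split_def by (intro continuous_intros c) auto
      show "(\<lambda>z. w ^ M * g (\<tau>, w) / (w - z)) holomorphic_on ball 0 R" if "w \<in> sphere 0 R" for w
        by (intro holomorphic_intros) (use that in auto)
    qed (use R in auto)
    have "isCont (G \<tau>) 0"
      using holomorphic_on_imp_continuous_on[OF Gh] R(1) by (simp add: continuous_on_eq_continuous_at)
    then have "((\<lambda>z. G \<tau> z / (2 * of_real pi * \<i>)) \<longlongrightarrow> G \<tau> 0 / (2 * of_real pi * \<i>)) (at 0)"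
      unfolding isCont_def by (intro tendsto_intros) auto
    moreover have "\<forall>\<^sub>F z in at 0. G \<tau> z / (2 * of_real pi * \<i>) = z ^ M * g (\<tau>, z)"
      unfolding eventually_at by (rule exI[of _ R]) (use eq R in auto)
    ultimately have "((\<lambda>z. z ^ M * g (\<tau>, z)) \<longlongrightarrow> G \<tau> 0 / (2 * of_real pi * \<i>)) (at 0)" by (simp add: filterlim_cong)
    then show ?thesis by blast
  qed
  then show ?thesis by (rule that)
qed

text \<open>The coefficient is a Cauchy integral and hence holomorphic in \<open>\<tau>\<close>. Replacing \<open>z\<close> by \<open>z/(c\<tau> + d)\<close> in \<open>z\<^sup>N g\<close> lowers the
  weight by \<open>N\<close>, and the Laurent expansion in \<open>q\<close> and \<open>z\<close> gives holomorphy at the cusp.\<close>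

theorem jacobi_form_leading_coefficient:
  assumes g: "jacobi_form k g" and lim: "\<And>\<tau>. Im \<tau> > 0 \<Longrightarrow> \<exists>a. ((\<lambda>z. z ^ N * g (\<tau>, z)) \<longlongrightarrow> a) (at 0)"
  obtains \<phi> where "modular_form (k - int N) \<phi>" "jacobi_form (k - int N) (\<lambda>p. \<phi> (nome (fst p)))"
    "\<And>\<tau>. Im \<tau> > 0 \<Longrightarrow> ((\<lambda>z. z ^ N * g (\<tau>, z)) \<longlongrightarrow> \<phi> (nome \<tau>)) (at 0)"
proof -
  have g1: "holomorphic2_on g regular_domain" "convergent_laurent_qz g" "jacobi_invariant k g"
    using g by (auto simp: jacobi_form_def)
  define a where "a = (\<lambda>\<tau>. Lim (at 0) (\<lambda>z. z ^ N * g (\<tau>, z)))"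
  have a: "((\<lambda>z. z ^ N * g (\<tau>, z)) \<longlongrightarrow> a \<tau>) (at 0)" if "Im \<tau> > 0" for \<tau>
    using lim[OF that] unfolding a_def by (metis tendsto_Lim trivial_limit_at)
  have aint: "contour_integral (circlepath 0 R) (\<lambda>w. w ^ N * g (\<tau>, w) / (w - 0)) = 2 * of_real pi * \<i> * a \<tau>"
    if R: "0 < R" "R < 1" "R < Im \<tau>" for R \<tau>
  proof -
    have \<tau>: "Im \<tau> > 0" using R by simp
    obtain R' where R': "R < R'" "R' < 1" "R' < Im \<tau>" using dense[of R "min 1 (Im \<tau>)"] R by auto
    have hol: "(\<lambda>z. z ^ N * g (\<tau>, z)) holomorphic_on ball 0 R' - {0}"
      by (intro holomorphic_intros holomorphic_on_subset[OF jacobi_form_slice(1)[OF g \<tau>]])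
         (use small_regular[of R' \<tau>] R R' in \<open>auto simp: regular_domain_iff_period_lattice\<close>)
    define h where "h = (\<lambda>z. if z = 0 then a \<tau> else z ^ N * g (\<tau>, z))"
    have hh: "h holomorphic_on ball 0 R'" unfolding h_def by (rule removable_singularity[OF hol _ a[OF \<tau>]]) auto
    have "((\<lambda>w. h w / (w - 0)) has_contour_integral (2 * of_real pi * \<i> * h 0)) (circlepath 0 R)"
      by (rule Cauchy_integral_circlepath) (use R R' in \<open>auto intro!: holomorphic_on_imp_continuous_on holomorphic_on_subset[OF hh]\<close>)
    then have "contour_integral (circlepath 0 R) (\<lambda>w. h w / (w - 0)) = 2 * of_real pi * \<i> * a \<tau>"
      by (simp add: contour_integral_unique h_def)
    moreover have "contour_integral (circlepath 0 R) (\<lambda>w. w ^ N * g (\<tau>, w) / (w - 0)) = contour_integral (circlepath 0 R) (\<lambda>w. h w / (w - 0))"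
      by (rule contour_integral_cong) (use R in \<open>auto simp: h_def\<close>)
    ultimately show ?thesis by simp
  qed
  have ahR: "a holomorphic_on {\<tau>. R < Im \<tau>}" if R: "0 < R" "R < 1" for R
  proof -
    have "(\<lambda>\<tau>. contour_integral (circlepath 0 R) (\<lambda>w. w ^ N * g (\<tau>, w) / (w - 0)) / (2 * of_real pi * \<i>)) holomorphic_on {\<tau>. R < Im \<tau>}"
      by (intro holomorphic_on_divide jacobi_circle_integral_holomorphic[OF g1(1) R] holomorphic_on_const) (use R in auto)
    then show ?thesis by (rule holomorphic_transform) (use aint R in auto)
  qed
  have ah: "a holomorphic_on {\<tau>. Im \<tau> > 0}"
    unfolding holomorphic_on_open[OF open_halfspace_Im_gt]
  proof
    fix \<tau> assume "\<tau> \<in> {\<tau>. Im \<tau> > 0}"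
    then obtain R where R: "0 < R" "R < 1" "R < Im \<tau>" using dense[of 0 "min 1 (Im \<tau>)"] by auto
    from ahR[OF R(1,2)] R(3) show "\<exists>f'. (a has_field_derivative f') (at \<tau>)"
      by (auto simp: holomorphic_on_open open_halfspace_Im_gt)
  qed
  have ainv: "a ((of_int \<alpha> * \<tau> + of_int \<beta>) / (of_int \<gamma> * \<tau> + of_int \<delta>)) = (of_int \<gamma> * \<tau> + of_int \<delta>) powi (k - int N) * a \<tau>"
    if det: "\<alpha> * \<delta> - \<beta> * \<gamma> = 1" and \<tau>: "Im \<tau> > 0" for \<alpha> \<beta> \<gamma> \<delta> :: int and \<tau>
  proof -
    define j where "j = of_int \<gamma> * \<tau> + of_int \<delta>"
    define \<tau>' where "\<tau>' = (of_int \<alpha> * \<tau> + of_int \<beta>) / (of_int \<gamma> * \<tau> + of_int \<delta>)"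
    have j0: "j \<noteq> 0" unfolding j_def by (rule mobius_denominator_nonzero[OF det \<tau>])
    have \<tau>': "Im \<tau>' > 0" unfolding \<tau>'_def by (rule Im_mobius_pos[OF det \<tau>])
    have "filterlim (\<lambda>z. z / j) (at 0) (at 0)"
      by (rule filterlim_atI) (use j0 in \<open>auto intro!: tendsto_eq_intros simp: eventually_at_filter\<close>)
    from filterlim_compose[OF a[OF \<tau>'] this]
    have 1: "((\<lambda>z. (z / j) ^ N * g (\<tau>', z / j)) \<longlongrightarrow> a \<tau>') (at 0)" .
    have 2: "((\<lambda>z. j powi (k - int N) * (z ^ N * g (\<tau>, z))) \<longlongrightarrow> j powi (k - int N) * a \<tau>) (at 0)"
      by (intro tendsto_intros a[OF \<tau>])
    have "\<forall>\<^sub>F z in at 0. j powi (k - int N) * (z ^ N * g (\<tau>, z)) = (z / j) ^ N * g (\<tau>', z / j)"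
      using eventually_at_0_regular[OF \<tau>]
    proof eventually_elim
      case (elim z)
      have "g (\<tau>', z / j) = j powi k * g (\<tau>, z)"
        using g1(3) elim det unfolding jacobi_invariant_def \<tau>'_def j_def by blast
      moreover have "j powi (k - int N) = j powi k / j ^ N" using j0 by (simp add: power_int_diff)
      ultimately show ?case by (simp add: power_divide)
    qed
    then have "((\<lambda>z. (z / j) ^ N * g (\<tau>', z / j)) \<longlongrightarrow> j powi (k - int N) * a \<tau>) (at 0)"
      using 2 by (simp add: filterlim_cong)
    from tendsto_unique[OF _ 1 this] show ?thesis by (simp add: \<tau>'_def j_def)
  qed
  have aper: "a (\<tau> + of_int n) = a \<tau>" if "Im \<tau> > 0" for \<tau> n
    using ainv[of 1 1 n 0 \<tau>] that by simp
  have acusp: "\<exists>r \<psi>. r > 0 \<and> \<psi> holomorphic_on ball 0 r \<and> (\<forall>\<tau>. Im \<tau> > 0 \<longrightarrow> norm (nome \<tau>) < r \<longrightarrow> a \<tau> = \<psi> (nome \<tau>))"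
  proof -
    obtain S r M where r: "r > 0" "holomorphic2_on S (ball 0 r \<times> ball 0 r)"
      "\<And>\<tau> z. (\<tau>, z) \<in> regular_domain \<Longrightarrow> norm (nome \<tau>) < r \<Longrightarrow> norm z < r \<Longrightarrow> g (\<tau>, z) = S (nome \<tau>, z) / z ^ M"
      using g1(2) unfolding convergent_laurent_qz_iff by blast
    obtain R where R: "0 < R" "R < 1" "R < r" using dense[of 0 "min 1 r"] r(1) by auto
    define \<psi> where "\<psi> = (\<lambda>q. contour_integral (circlepath 0 R) (\<lambda>w. w ^ N * (S (q, w) / w ^ M) / (w - 0)) / (2 * of_real pi * \<i>))"
    have "(\<lambda>q. contour_integral (circlepath 0 R) (\<lambda>w. w ^ N * (S (q, w) / w ^ M) / (w - 0))) holomorphic_on ball 0 r"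
    proof (rule holomorphic_contour_integral_circlepath)
      have c: "continuous_on (ball 0 r \<times> sphere 0 R) S"
        by (rule continuous_on_subset[OF holomorphic2_on_imp_continuous_on[OF r(2)]]) (use R in auto)
      show "continuous_on (ball 0 r \<times> sphere 0 R) (\<lambda>(q, w). w ^ N * (S (q, w) / w ^ M) / (w - 0))"
        unfolding split_def using c R by (intro continuous_intros) auto
      show "(\<lambda>q. w ^ N * (S (q, w) / w ^ M) / (w - 0)) holomorphic_on ball 0 r" if "w \<in> sphere 0 R" for w
      proof -
        have "(\<lambda>q. S (q, w)) holomorphic_on ball 0 r"
          by (rule holomorphic2_on_slice_fst[OF r(2)]) (use that R in auto)
        then show ?thesis by (intro holomorphic_intros) (use that R in auto)
      qed
    qed (use R in auto)
    then have \<psi>h: "\<psi> holomorphic_on ball 0 r" unfolding \<psi>_def by (intro holomorphic_intros) auto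
    define r' where "r' = min r (exp (- 2 * pi * R))"
    have "a \<tau> = \<psi> (nome \<tau>)" if "norm (nome \<tau>) < r'" for \<tau>
    proof -
      have I: "R < Im \<tau>" by (rule nome_small_imp_Im_large) (use that in \<open>simp add: r'_def\<close>)
      have "contour_integral (circlepath 0 R) (\<lambda>w. w ^ N * g (\<tau>, w) / (w - 0)) = contour_integral (circlepath 0 R) (\<lambda>w. w ^ N * (S (nome \<tau>, w) / w ^ M) / (w - 0))"
      proof (rule contour_integral_cong)
        fix w assume "w \<in> path_image (circlepath 0 R)"
        then have w: "norm w = R" "w \<noteq> 0" using R by auto
        have "g (\<tau>, w) = S (nome \<tau>, w) / w ^ M"
          by (rule r(3)[OF small_regular[OF R(1,2) I w(2)]]) (use w R that in \<open>auto simp: r'_def\<close>)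
        then show "w ^ N * g (\<tau>, w) / (w - 0) = w ^ N * (S (nome \<tau>, w) / w ^ M) / (w - 0)" by simp
      qed auto
      then show ?thesis unfolding \<psi>_def using aint[OF R(1,2) I] by simp
    qed
    moreover have "r' > 0" using r(1) by (simp add: r'_def)
    moreover have "\<psi> holomorphic_on ball 0 r'" by (rule holomorphic_on_subset[OF \<psi>h]) (auto simp: r'_def)
    ultimately show ?thesis by blast
  qed
  then obtain r \<psi> where r: "r > 0" "\<psi> holomorphic_on ball 0 r" "\<And>\<tau>. Im \<tau> > 0 \<Longrightarrow> norm (nome \<tau>) < r \<Longrightarrow> a \<tau> = \<psi> (nome \<tau>)" by blast
  obtain \<phi> where \<phi>: "\<phi> holomorphic_on ball 0 1" "\<And>\<tau>. Im \<tau> > 0 \<Longrightarrow> a \<tau> = \<phi> (nome \<tau>)"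
    by (rule periodic_imp_function_of_nome[OF ah aper r]) (assumption | rule that)+
  show ?thesis
  proof (rule that)
    show "modular_form (k - int N) \<phi>"
      unfolding modular_form_def
    proof (intro conjI allI impI)
      fix \<tau> :: complex assume \<tau>: "Im \<tau> > 0"
      show "\<phi> (nome (- 1 / \<tau>)) = \<tau> powi (k - int N) * \<phi> (nome \<tau>)"
        using ainv[of 0 0 "- 1" 1 \<tau>] \<tau> \<phi>(2)[OF \<tau>] \<phi>(2)[OF Im_neg_inverse[OF \<tau>]] by simp
    qed (rule \<phi>(1))
    show "((\<lambda>z. z ^ N * g (\<tau>, z)) \<longlongrightarrow> \<phi> (nome \<tau>)) (at 0)" if "Im \<tau> > 0" for \<tau>
      using a[OF that] \<phi>(2)[OF that] by simp
    show "jacobi_form (k - int N) (\<lambda>p. \<phi> (nome (fst p)))"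
      unfolding jacobi_form_def
    proof (intro conjI)
      show "holomorphic2_on (\<lambda>p. \<phi> (nome (fst p))) regular_domain"
        by (rule holomorphic2_on_compose[OF nome_fst_holomorphic2_on \<phi>(1) open_ball])
           (auto simp: regular_domain_iff)
      have h: "holomorphic2_on (\<lambda>p. \<phi> (fst p)) (ball 0 1 \<times> ball 0 1)"
        by (rule holomorphic2_on_of_fst[OF \<phi>(1) open_ball]) auto
      show "convergent_laurent_qz (\<lambda>p. \<phi> (nome (fst p)))"
        unfolding convergent_laurent_qz_iff
        by (rule exI[of _ "\<lambda>p. \<phi> (fst p)"], rule exI[of _ 1], rule exI[of _ 0]) (use h in auto)
      show "jacobi_invariant (k - int N) (\<lambda>p. \<phi> (nome (fst p)))"
        unfolding jacobi_invariant_def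
      proof (intro allI impI conjI, goal_cases)
        case (1 \<tau> z \<alpha> \<beta> \<gamma> \<delta>)
        then have \<tau>: "Im \<tau> > 0" by (simp add: regular_domain_iff)
        show ?case using ainv[OF 1(2) \<tau>] \<phi>(2)[OF \<tau>] \<phi>(2)[OF Im_mobius_pos[OF 1(2) \<tau>]] by simp
      qed simp
    qed
  qed
qed

section \<open>The Weierstrass function and its invariants\<close>

text \<open>The Weierstrass function \<open>\<wp>\<close>, for which \<open>\<wp>' = -2 E\<^sub>3\<close> and \<open>\<wp>'' = 6 E\<^sub>4\<close>.\<close>

definition weierstrass :: "complex \<times> complex \<Rightarrow> complex" where
  "weierstrass = (\<lambda>p. Eis 2 p - eis2 p)"

lemma jacobi_form_Eis: "n \<ge> 3 \<Longrightarrow> jacobi_form (int n) (Eis n)"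
  using jacobi_coefficient_Eis[of "n - 1"] jacobi_invariant_Eis[of n]
  by (simp add: jacobi_form_def jacobi_coefficient_def)

lemma jacobi_form_weierstrass: "jacobi_form 2 weierstrass"
  unfolding jacobi_form_def
proof (intro conjI)
  have c: "jacobi_coefficient (Eis 2)" using jacobi_coefficient_Eis[of 1] by (simp add: numeral_2_eq_2)
  show "holomorphic2_on weierstrass regular_domain" unfolding weierstrass_def
    using c jacobi_coefficient_eis2 by (intro holomorphic2_on_diff) (auto simp: jacobi_coefficient_def)
  have "convergent_laurent_qz (\<lambda>p. Eis 2 p + (- 1) * eis2 p)"
    using c jacobi_coefficient_eis2
    by (intro convergent_laurent_qz_add convergent_laurent_qz_mult convergent_laurent_qz_const) (auto simp: jacobi_coefficient_def)
  then show "convergent_laurent_qz weierstrass" by (simp add: weierstrass_def)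
  show "jacobi_invariant 2 weierstrass"
    unfolding jacobi_invariant_def
  proof (intro allI impI conjI, goal_cases)
    case (1 \<tau> z a b c d)
    then have \<tau>: "Im \<tau> > 0" by (simp add: regular_domain_iff)
    show ?case unfolding weierstrass_def Eis_2_mobius[OF 1(2) \<tau> 1(1)] eis2_mobius[OF 1(2) \<tau> 1(1)]
      by (simp add: algebra_simps)
  next
    case (2 \<tau> z m n)
    then have "(\<tau>, z + of_int m * \<tau> + of_int n) \<in> regular_domain" by (simp add: regular_domain_shift)
    from eis2_eq[OF this] eis2_eq[OF 2] Eis_shift[OF 2, of 0 m n] show ?case by (simp add: weierstrass_def numeral_2_eq_2)
  qed
qed

lemma Eis_leading_term:
  assumes \<tau>: "Im \<tau> > 0" shows "((\<lambda>z. z ^ Suc k * Eis (Suc k) (\<tau>, z)) \<longlongrightarrow> 1) (at 0)"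
proof -
  have "((\<lambda>z. 1 + z ^ Suc k * ((-1) ^ k / fact k * (dz ^^ k) e1_regular (nome \<tau>, z))) \<longlongrightarrow>
      1 + 0 ^ Suc k * ((-1) ^ k / fact k * (dz ^^ k) e1_regular (nome \<tau>, 0))) (at 0)"
    by (intro tendsto_intros eis_regular_part_tendsto[OF \<tau>])
  then have "((\<lambda>z. 1 + z ^ Suc k * ((-1) ^ k / fact k * (dz ^^ k) e1_regular (nome \<tau>, z))) \<longlongrightarrow> 1) (at 0)" by simp
  moreover have "\<forall>\<^sub>F z in at 0. 1 + z ^ Suc k * ((-1) ^ k / fact k * (dz ^^ k) e1_regular (nome \<tau>, z)) = z ^ Suc k * Eis (Suc k) (\<tau>, z)"
    using eventually_at_0_regular[OF \<tau>]
  proof eventually_elim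
    case (elim z)
    then have "z \<noteq> 0" by (simp add: regular_domain_iff)
    then show ?case unfolding Eis_expansion[OF elim] by (simp add: distrib_left)
  qed
  ultimately show ?thesis by (rule Lim_transform_eventually)
qed

lemma weierstrass_principal_part:
  assumes \<tau>: "Im \<tau> > 0"
  obtains u where "(u \<longlongrightarrow> 0) (at 0)" "\<And>z. (\<tau>, z) \<in> regular_domain \<Longrightarrow> weierstrass (\<tau>, z) = 1 / z ^ 2 + u z"
proof -
  define u where "u = (\<lambda>z. dz e1_regular (nome \<tau>, 0) - dz e1_regular (nome \<tau>, z))"
  have "(u \<longlongrightarrow> dz e1_regular (nome \<tau>, 0) - dz e1_regular (nome \<tau>, 0)) (at 0)"
    unfolding u_def using eis_regular_part_tendsto[OF \<tau>, of 1] by (intro tendsto_intros) simp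
  moreover have "weierstrass (\<tau>, z) = 1 / z ^ 2 + u z" if "(\<tau>, z) \<in> regular_domain" for z
    using Eis_expansion[OF that, of 1] eis2_eq[OF that] by (simp add: weierstrass_def u_def numeral_2_eq_2)
  ultimately show ?thesis using that[of u] by simp
qed

lemma weierstrass_leading_term:
  assumes \<tau>: "Im \<tau> > 0" shows "((\<lambda>z. z ^ 2 * weierstrass (\<tau>, z)) \<longlongrightarrow> 1) (at 0)"
proof -
  obtain u where u: "(u \<longlongrightarrow> 0) (at 0)" "\<And>z. (\<tau>, z) \<in> regular_domain \<Longrightarrow> weierstrass (\<tau>, z) = 1 / z ^ 2 + u z"
    by (rule weierstrass_principal_part[OF \<tau>]) (rule that)
  have "((\<lambda>z. 1 + z ^ 2 * u z) \<longlongrightarrow> 1 + 0 ^ 2 * 0) (at 0)" by (intro tendsto_intros u(1))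
  then have "((\<lambda>z. 1 + z ^ 2 * u z) \<longlongrightarrow> 1) (at 0)" by simp
  moreover have "\<forall>\<^sub>F z in at 0. 1 + z ^ 2 * u z = z ^ 2 * weierstrass (\<tau>, z)"
    using eventually_at_0_regular[OF \<tau>]
    by eventually_elim (auto simp: u(2) regular_domain_iff distrib_left)
  ultimately show ?thesis by (rule Lim_transform_eventually)
qed

lemma weierstrass_has_field_derivative:
  assumes reg: "(\<tau>, z) \<in> regular_domain"
  shows "((\<lambda>w. weierstrass (\<tau>, w)) has_field_derivative - 2 * Eis 3 (\<tau>, z)) (at z)"
proof -
  have \<tau>: "Im \<tau> > 0" using reg by (simp add: regular_domain_iff)
  have "((\<lambda>w. Eis (Suc 1) (\<tau>, w) - - dz e1_regular (nome \<tau>, 0)) has_field_derivative - of_nat (Suc 1) * Eis (Suc (Suc 1)) (\<tau>, z) - 0) (at z)"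
    by (intro DERIV_diff DERIV_const Eis_has_field_derivative[OF reg])
  then have "((\<lambda>w. Eis 2 (\<tau>, w) - - dz e1_regular (nome \<tau>, 0)) has_field_derivative - 2 * Eis 3 (\<tau>, z)) (at z)"
    by (simp add: numeral_2_eq_2 numeral_3_eq_3)
  then show ?thesis
    by (rule has_field_derivative_transform_within_open[OF _ open_period_lattice_compl[OF \<tau>]])
       (use reg \<tau> eis2_eq in \<open>auto simp: weierstrass_def regular_domain_iff_period_lattice\<close>)
qed

text \<open>Liouville's theorem on each torus makes the form equal to its leading coefficient for \<open>N = 0\<close>.\<close>

lemma jacobi_form_no_pole:
  assumes g: "jacobi_form k g" and lim: "\<And>\<tau>. Im \<tau> > 0 \<Longrightarrow> \<exists>c. ((\<lambda>z. g (\<tau>, z)) \<longlongrightarrow> c) (at 0)"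
  obtains \<phi> where "modular_form k \<phi>" "\<And>\<tau> z. (\<tau>, z) \<in> regular_domain \<Longrightarrow> g (\<tau>, z) = \<phi> (nome \<tau>)"
proof -
  have lim': "\<exists>a. ((\<lambda>z. z ^ 0 * g (\<tau>, z)) \<longlongrightarrow> a) (at 0)" if "Im \<tau> > 0" for \<tau> using lim[OF that] by simp
  obtain \<phi> where \<phi>: "modular_form (k - int 0) \<phi>" "jacobi_form (k - int 0) (\<lambda>p. \<phi> (nome (fst p)))"
    "\<And>\<tau>. Im \<tau> > 0 \<Longrightarrow> ((\<lambda>z. z ^ 0 * g (\<tau>, z)) \<longlongrightarrow> \<phi> (nome \<tau>)) (at 0)"
    by (rule jacobi_form_leading_coefficient[OF g lim']) (assumption | rule that)+
  have "g (\<tau>, z) = \<phi> (nome \<tau>)" if "(\<tau>, z) \<in> regular_domain" for \<tau> z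
  proof -
    have \<tau>: "Im \<tau> > 0" and z: "z \<notin> period_lattice \<tau>" using that by (auto simp: regular_domain_iff_period_lattice)
    show ?thesis
      by (rule elliptic_Liouville[OF \<tau> jacobi_form_slice(1)[OF g \<tau>] jacobi_form_slice(2)[OF g \<tau>] _ z])
         (use \<phi>(3)[OF \<tau>] in auto)
  qed
  with \<phi>(1) show ?thesis using that[of \<phi>] by simp
qed

text \<open>The differential equation \<open>\<wp>'' = 6\<wp>\<^sup>2 - g\<^sub>2/2\<close>, where \<open>\<phi>\<close> is \<open>-g\<^sub>2/12\<close>. The poles of order 4 cancel and, as \<open>\<wp>\<close> has no
  constant term at 0, so do those of order 2.\<close>

lemma weight_4_invariant:
  obtains \<phi> where "modular_form 4 \<phi>"
    "\<And>\<tau> z. (\<tau>, z) \<in> regular_domain \<Longrightarrow> Eis 4 (\<tau>, z) - weierstrass (\<tau>, z) ^ 2 = \<phi> (nome \<tau>)"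
proof -
  have j: "jacobi_form 4 (\<lambda>p. Eis 4 p - weierstrass p ^ 2)"
    using jacobi_form_Eis[of 4] jacobi_form_mult[OF jacobi_form_weierstrass jacobi_form_weierstrass]
    by (intro jacobi_form_diff) (simp_all add: power2_eq_square)
  have l: "\<exists>c. ((\<lambda>z. Eis 4 (\<tau>, z) - weierstrass (\<tau>, z) ^ 2) \<longlongrightarrow> c) (at 0)" if \<tau>: "Im \<tau> > 0" for \<tau>
  proof (rule elliptic_small_pole_limit[OF \<tau> jacobi_form_slice(1)[OF j \<tau>] jacobi_form_slice(2)[OF j \<tau>]])
    obtain u where u: "(u \<longlongrightarrow> 0) (at 0)" "\<And>z. (\<tau>, z) \<in> regular_domain \<Longrightarrow> weierstrass (\<tau>, z) = 1 / z ^ 2 + u z"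
      by (rule weierstrass_principal_part[OF \<tau>]) (rule that)
    define v where "v = (\<lambda>z. (-1) ^ 3 / fact 3 * (dz ^^ 3) e1_regular (nome \<tau>, z))"
    have v: "(v \<longlongrightarrow> (-1) ^ 3 / fact 3 * (dz ^^ 3) e1_regular (nome \<tau>, 0)) (at 0)"
      unfolding v_def by (intro tendsto_intros eis_regular_part_tendsto[OF \<tau>])
    have "((\<lambda>z. z ^ 2 * v z - 2 * u z - z ^ 2 * u z ^ 2) \<longlongrightarrow> 0 ^ 2 * ((-1) ^ 3 / fact 3 * (dz ^^ 3) e1_regular (nome \<tau>, 0)) - 2 * 0 - 0 ^ 2 * 0 ^ 2) (at 0)"
      by (intro tendsto_intros u(1) v)
    then have "((\<lambda>z. z ^ 2 * v z - 2 * u z - z ^ 2 * u z ^ 2) \<longlongrightarrow> 0) (at 0)" by simp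
    moreover have "\<forall>\<^sub>F z in at 0. z ^ 2 * v z - 2 * u z - z ^ 2 * u z ^ 2 = z ^ 2 * (Eis 4 (\<tau>, z) - weierstrass (\<tau>, z) ^ 2)"
      using eventually_at_0_regular[OF \<tau>]
    proof eventually_elim
      case (elim z)
      then have z0: "z \<noteq> 0" by (simp add: regular_domain_iff)
      have "Eis 4 (\<tau>, z) = 1 / z ^ 4 + v z" using Eis_expansion[OF elim, of 3] by (simp add: v_def eval_nat_numeral)
      moreover have "z ^ 2 * (1 / z ^ 4 + V - (1 / z ^ 2 + U) ^ 2) = z ^ 2 * V - 2 * U - z ^ 2 * U ^ 2" for U V
        using z0 by (simp add: field_simps power2_eq_square power4_eq_xxxx)
      ultimately show ?case by (simp only: u(2)[OF elim])
    qed
    ultimately show "((\<lambda>z. z ^ 2 * (Eis 4 (\<tau>, z) - weierstrass (\<tau>, z) ^ 2)) \<longlongrightarrow> 0) (at 0)"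
      by (rule Lim_transform_eventually)
  qed
  show ?thesis
    by (rule jacobi_form_no_pole[OF j l]) (assumption | rule that)+
qed

text \<open>The differential equation \<open>\<wp>'\<^sup>2 = 4\<wp>\<^sup>3 - g\<^sub>2\<wp> - g\<^sub>3\<close>, where \<open>\<psi>\<close> is \<open>-g\<^sub>3/4\<close>. By the equation of second order, the combination
  has derivative zero.\<close>

lemma weight_6_invariant:
  assumes \<phi>: "\<And>\<tau> z. (\<tau>, z) \<in> regular_domain \<Longrightarrow> Eis 4 (\<tau>, z) - weierstrass (\<tau>, z) ^ 2 = \<phi> (nome \<tau>)"
  obtains \<psi> where "modular_form 6 \<psi>"
    "\<And>\<tau> z. (\<tau>, z) \<in> regular_domain \<Longrightarrow>
       Eis 3 (\<tau>, z) ^ 2 - weierstrass (\<tau>, z) ^ 3 - 3 * (Eis 4 (\<tau>, z) - weierstrass (\<tau>, z) ^ 2) * weierstrass (\<tau>, z) = \<psi> (nome \<tau>)"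
proof -
  define F where "F = (\<lambda>p. Eis 3 p ^ 2 - weierstrass p ^ 3 - 3 * (Eis 4 p - weierstrass p ^ 2) * weierstrass p)"
  note W = jacobi_form_weierstrass
  have j3: "jacobi_form 3 (Eis 3)" and j4: "jacobi_form 4 (Eis 4)" using jacobi_form_Eis[of 3] jacobi_form_Eis[of 4] by simp_all
  have W2: "jacobi_form 4 (\<lambda>p. weierstrass p ^ 2)" using jacobi_form_mult[OF W W] by (simp add: power2_eq_square)
  have W3: "jacobi_form 6 (\<lambda>p. weierstrass p ^ 3)" using jacobi_form_mult[OF W2 W] by (simp add: power2_eq_square power3_eq_cube)
  have E32: "jacobi_form 6 (\<lambda>p. Eis 3 p ^ 2)" using jacobi_form_mult[OF j3 j3] by (simp add: power2_eq_square)
  have "jacobi_form 6 (\<lambda>p. 3 * ((Eis 4 p - weierstrass p ^ 2) * weierstrass p))"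
    using jacobi_form_cmult[OF jacobi_form_mult[OF jacobi_form_diff[OF j4 W2] W]] by simp
  then have j: "jacobi_form 6 F"
    unfolding F_def using jacobi_form_diff[OF jacobi_form_diff[OF E32 W3]] by (simp only: mult.assoc)
  have l: "\<exists>c. ((\<lambda>z. F (\<tau>, z)) \<longlongrightarrow> c) (at 0)" if \<tau>: "Im \<tau> > 0" for \<tau>
  proof -
    define c where "c = \<phi> (nome \<tau>)"
    define f where "f = (\<lambda>z. Eis 3 (\<tau>, z) ^ 2 - weierstrass (\<tau>, z) ^ 3 - 3 * c * weierstrass (\<tau>, z))"
    have regI: "(\<tau>, z) \<in> regular_domain" if "z \<in> - period_lattice \<tau>" for z
      using that \<tau> by (simp add: regular_domain_iff_period_lattice)
    have "(f has_field_derivative 0) (at z)" if z: "z \<in> - period_lattice \<tau>" for z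
    proof -
      note r = regI[OF z]
      have d3: "((\<lambda>z. Eis 3 (\<tau>, z)) has_field_derivative - 3 * Eis 4 (\<tau>, z)) (at z)"
        using Eis_has_field_derivative[OF r, of 2] by (simp add: eval_nat_numeral)
      note dw = weierstrass_has_field_derivative[OF r]
      have "(f has_field_derivative 2 * Eis 3 (\<tau>, z) * (- 3 * Eis 4 (\<tau>, z)) - 3 * weierstrass (\<tau>, z) ^ 2 * (- 2 * Eis 3 (\<tau>, z)) - 3 * c * (- 2 * Eis 3 (\<tau>, z))) (at z)"
      proof -
        have "((\<lambda>z. Eis 3 (\<tau>, z) ^ 2) has_field_derivative 2 * Eis 3 (\<tau>, z) * (- 3 * Eis 4 (\<tau>, z))) (at z)"
          by (rule DERIV_cong[OF DERIV_power[OF d3, of 2]]) simp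
        moreover have "((\<lambda>z. weierstrass (\<tau>, z) ^ 3) has_field_derivative 3 * weierstrass (\<tau>, z) ^ 2 * (- 2 * Eis 3 (\<tau>, z))) (at z)"
          by (rule DERIV_cong[OF DERIV_power[OF dw, of 3]]) (simp add: numeral_3_eq_3 power2_eq_square)
        ultimately show ?thesis unfolding f_def by (rule DERIV_diff[OF DERIV_diff DERIV_cmult[OF dw]])
      qed
      moreover have "Eis 4 (\<tau>, z) = c + weierstrass (\<tau>, z) ^ 2" using \<phi>[OF r] by (simp add: c_def algebra_simps)
      ultimately show ?thesis by (simp add: algebra_simps)
    qed
    then have "f constant_on - period_lattice \<tau>"
      by (intro has_field_derivative_0_imp_constant_on connected_period_lattice_compl open_period_lattice_compl[OF \<tau>])
    then obtain B where B: "\<And>z. z \<in> - period_lattice \<tau> \<Longrightarrow> f z = B" by (auto simp: constant_on_def)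
    have "\<forall>\<^sub>F z in at 0. B = F (\<tau>, z)"
      using eventually_at_0_regular[OF \<tau>]
    proof eventually_elim
      case (elim z)
      then have "f z = B" using B by (simp add: regular_domain_iff_period_lattice)
      moreover have "F (\<tau>, z) = f z" unfolding F_def f_def \<phi>[OF elim] c_def ..
      ultimately show ?case by simp
    qed
    from Lim_transform_eventually[OF tendsto_const this] show ?thesis by blast
  qed
  show ?thesis
    by (rule jacobi_form_no_pole[OF j l]) (assumption | rule that | simp add: F_def)+
qed

text \<open>If both invariants vanished, the Weierstrass cubic would have a cusp. Then \<open>E\<^sub>3/\<wp>\<close> would be a square root of \<open>\<wp>\<close>, hence
  bounded near the zeros of \<open>\<wp>\<close> and holomorphic there, and its only pole in a period cell would be simple.\<close>

lemma weierstrass_cubic_not_cusp: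
  assumes \<tau>: "Im \<tau> > 0" and eq: "\<And>z. (\<tau>, z) \<in> regular_domain \<Longrightarrow> Eis 3 (\<tau>, z) ^ 2 = weierstrass (\<tau>, z) ^ 3"
  shows False
proof -
  define P where "P = (\<lambda>z. weierstrass (\<tau>, z))"
  define E where "E = (\<lambda>z. Eis 3 (\<tau>, z))"
  define h where "h = (\<lambda>z. if P z = 0 then 0 else E z / P z)"
  have oL: "open (- period_lattice \<tau>)" by (rule open_period_lattice_compl[OF \<tau>])
  have regI: "(\<tau>, z) \<in> regular_domain" if "z \<notin> period_lattice \<tau>" for z
    using that \<tau> by (simp add: regular_domain_iff_period_lattice)
  have Ph: "P holomorphic_on - period_lattice \<tau>" unfolding P_def by (rule jacobi_form_slice(1)[OF jacobi_form_weierstrass \<tau>])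
  have Eh: "E holomorphic_on - period_lattice \<tau>" unfolding E_def
    using Eis_holomorphic_on_slice[OF \<tau>, of 2] by (simp add: eval_nat_numeral)
  have h2: "h z ^ 2 = P z" if "z \<notin> period_lattice \<tau>" for z
    using eq[OF regI[OF that]] by (auto simp: h_def P_def E_def power2_eq_square power3_eq_cube field_simps)
  have P0: "((\<lambda>z. z ^ 2 * P z) \<longlongrightarrow> 1) (at 0)" unfolding P_def by (rule weierstrass_leading_term[OF \<tau>])
  have E0: "((\<lambda>z. z ^ 3 * E z) \<longlongrightarrow> 1) (at 0)" unfolding E_def
    using Eis_leading_term[OF \<tau>, of 2] by (simp add: eval_nat_numeral)
  have evP: "\<forall>\<^sub>F z in at 0. z ^ 2 * P z \<noteq> 0" by (rule tendsto_imp_eventually_ne[OF P0]) simp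
  have "\<forall>\<^sub>F z in at 0. z \<notin> period_lattice \<tau> \<and> P z \<noteq> 0"
    using evP eventually_at_0_regular[OF \<tau>] by eventually_elim (auto simp: regular_domain_iff_period_lattice)
  then obtain \<beta> where \<beta>: "\<beta> \<notin> period_lattice \<tau>" "P \<beta> \<noteq> 0"
    using eventually_happens[of _ "at (0::complex)"] by (auto simp: trivial_limit_at)
  have hh: "h holomorphic_on - period_lattice \<tau>"
    unfolding holomorphic_on_open[OF oL]
  proof
    fix z assume z: "z \<in> - period_lattice \<tau>"
    show "\<exists>f'. (h has_field_derivative f') (at z)"
    proof (cases "P z = 0")
      case False
      have Pc: "isCont P z" using holomorphic_on_imp_continuous_on[OF Ph] oL z by (simp add: continuous_on_eq_continuous_at)
      have "open (- period_lattice \<tau> \<inter> P -` (- {0}))"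
        by (rule continuous_open_preimage[OF holomorphic_on_imp_continuous_on[OF Ph] oL open_Compl[OF closed_singleton]])
      moreover have "(\<lambda>z. E z / P z) holomorphic_on - period_lattice \<tau> \<inter> P -` (- {0})"
        by (intro holomorphic_intros holomorphic_on_subset[OF Ph] holomorphic_on_subset[OF Eh]) auto
      then have "h holomorphic_on - period_lattice \<tau> \<inter> P -` (- {0})"
        by (rule holomorphic_transform) (auto simp: h_def)
      ultimately show ?thesis using z False by (auto simp: holomorphic_on_open)
    next
      case True
      obtain r where r: "0 < r" "ball z r \<subseteq> - period_lattice \<tau>" "\<And>w. w \<in> ball z r - {z} \<Longrightarrow> P w \<noteq> 0"
        using isolated_zeros[OF Ph oL connected_period_lattice_compl z True, of \<beta>] \<beta> by auto
      have nz: "P w \<noteq> 0" if "w \<in> ball z r" "w \<noteq> z" for w using r(3) that by auto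
      have "(\<lambda>z. E z / P z) holomorphic_on ball z r - {z}"
        by (intro holomorphic_intros holomorphic_on_subset[OF Ph] holomorphic_on_subset[OF Eh]) (use r nz in auto)
      then have h1: "h holomorphic_on ball z r - {z}"
        by (rule holomorphic_transform) (use nz in \<open>auto simp: h_def\<close>)
      have "(P \<longlongrightarrow> P z) (at z)"
        using holomorphic_on_imp_continuous_on[OF Ph] oL z by (simp add: continuous_on_eq_continuous_at isCont_def)
      then have "((\<lambda>w. sqrt (norm (P w))) \<longlongrightarrow> sqrt (norm (P z))) (at z)" by (intro tendsto_intros)
      then have "((\<lambda>w. sqrt (norm (P w))) \<longlongrightarrow> 0) (at z)" using True by simp
      moreover have "\<forall>\<^sub>F w in at z. sqrt (norm (P w)) = norm (h w)"
        unfolding eventually_at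
      proof (intro exI[of _ r] conjI ballI impI)
        fix w assume "w \<noteq> z \<and> dist w z < r"
        then have "w \<in> ball z r" by (simp add: dist_commute)
        then have "w \<notin> period_lattice \<tau>" using r(2) by blast
        then have "norm (P w) = norm (h w) ^ 2" using h2 by (simp flip: norm_power)
        then show "sqrt (norm (P w)) = norm (h w)" by simp
      qed (rule r(1))
      ultimately have "((\<lambda>w. norm (h w)) \<longlongrightarrow> 0) (at z)" by (rule Lim_transform_eventually)
      then have "(h \<longlongrightarrow> 0) (at z)" by (rule tendsto_norm_zero_cancel)
      from removable_singularity[OF h1 open_ball this]
      have "h holomorphic_on ball z r"
        by (rule holomorphic_transform) (use True in \<open>auto simp: h_def\<close>)
      then show ?thesis using r(1) by (auto simp: holomorphic_on_open)
    qed
  qed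
  have per: "h (z + of_int m * \<tau> + of_int n) = h z" if "z \<notin> period_lattice \<tau>" for z m n
    using jacobi_form_slice(2)[OF jacobi_form_weierstrass \<tau> that, of m n] jacobi_form_slice(2)[OF jacobi_form_Eis[of 3] \<tau> that, of m n]
    by (simp add: h_def P_def E_def)
  have "((\<lambda>z. (z ^ 3 * E z) / (z ^ 2 * P z)) \<longlongrightarrow> 1 / 1) (at 0)" by (intro tendsto_divide E0 P0) simp
  then have "((\<lambda>z. (z ^ 3 * E z) / (z ^ 2 * P z)) \<longlongrightarrow> 1) (at 0)" by simp
  moreover have "\<forall>\<^sub>F z in at 0. (z ^ 3 * E z) / (z ^ 2 * P z) = z * h z"
    using evP by eventually_elim (auto simp: h_def field_simps power2_eq_square power3_eq_cube)
  ultimately have "((\<lambda>z. z * h z) \<longlongrightarrow> 1) (at 0)" by (rule Lim_transform_eventually)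
  from elliptic_no_simple_pole[OF \<tau> hh per this] show False by simp
qed

section \<open>Jacobi forms in the algebra of Eisenstein series\<close>

context
  fixes A :: "(complex \<times> complex \<Rightarrow> complex) set"
  assumes alg: "complex_subalgebra A" and gens: "{Eis n | n. n \<ge> 1} \<union> {eis2} \<subseteq> A"
begin

lemma subalgebra_const: "on_regular (\<lambda>_. c) \<in> A"
proof -
  have "(\<lambda>x. c * on_regular (\<lambda>_. 1) x) \<in> A" using alg cfun.subspace_scale unfolding complex_subalgebra_def by blast
  moreover have "(\<lambda>x. c * on_regular (\<lambda>_. 1) x) = on_regular (\<lambda>_. c)" by (auto simp: on_regular_def)
  ultimately show ?thesis by simp
qed

lemma subalgebra_add: "on_regular f \<in> A \<Longrightarrow> on_regular g \<in> A \<Longrightarrow> on_regular (\<lambda>p. f p + g p) \<in> A"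
proof -
  assume "on_regular f \<in> A" "on_regular g \<in> A"
  then have "on_regular f + on_regular g \<in> A" using alg cfun.subspace_add unfolding complex_subalgebra_def by blast
  moreover have "on_regular f + on_regular g = on_regular (\<lambda>p. f p + g p)" by (auto simp: on_regular_def fun_eq_iff)
  ultimately show ?thesis by simp
qed

lemma subalgebra_mult: "on_regular f \<in> A \<Longrightarrow> on_regular g \<in> A \<Longrightarrow> on_regular (\<lambda>p. f p * g p) \<in> A"
proof -
  assume "on_regular f \<in> A" "on_regular g \<in> A"
  then have "on_regular f * on_regular g \<in> A" using alg unfolding complex_subalgebra_def by blast
  moreover have "on_regular f * on_regular g = on_regular (\<lambda>p. f p * g p)" by (auto simp: on_regular_def fun_eq_iff)
  ultimately show ?thesis by simp
qed

lemma subalgebra_diff: "on_regular f \<in> A \<Longrightarrow> on_regular g \<in> A \<Longrightarrow> on_regular (\<lambda>p. f p - g p) \<in> A"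
  using subalgebra_add[of f "\<lambda>p. (- 1) * g p"] subalgebra_mult[OF subalgebra_const[of "- 1"], of g] by simp

lemma subalgebra_power: "on_regular f \<in> A \<Longrightarrow> on_regular (\<lambda>p. f p ^ n) \<in> A"
  by (induction n) (simp_all add: subalgebra_const subalgebra_mult)

lemma subalgebra_sum: "(\<And>i. i \<in> I \<Longrightarrow> on_regular (f i) \<in> A) \<Longrightarrow> on_regular (\<lambda>p. \<Sum>i\<in>I. f i p) \<in> A"
  by (induction I rule: infinite_finite_induct) (simp_all add: subalgebra_const subalgebra_add)

lemma subalgebra_cong: "on_regular f \<in> A \<Longrightarrow> (\<And>p. p \<in> regular_domain \<Longrightarrow> f p = g p) \<Longrightarrow> on_regular g \<in> A"
proof -
  assume f: "on_regular f \<in> A" and e: "\<And>p. p \<in> regular_domain \<Longrightarrow> f p = g p"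
  have "on_regular f = on_regular g" using e by (auto simp: on_regular_def fun_eq_iff)
  with f show ?thesis by simp
qed

lemma subalgebra_Eis: "n \<ge> 1 \<Longrightarrow> on_regular (Eis n) \<in> A"
  and subalgebra_eis2: "on_regular eis2 \<in> A"
proof -
  have e: "on_regular (Eis n) = Eis n" "on_regular eis2 = eis2" for n
    unfolding Eis_def eis2_def by (rule on_regular_idem)+
  show "n \<ge> 1 \<Longrightarrow> on_regular (Eis n) \<in> A" "on_regular eis2 \<in> A" unfolding e using gens by auto
qed

lemma subalgebra_weierstrass: "on_regular weierstrass \<in> A"
  unfolding weierstrass_def by (intro subalgebra_diff subalgebra_Eis subalgebra_eis2) simp

text \<open>The two invariants of \<open>\<wp>\<close> are polynomials in Eisenstein series and have no common zero, so they generate all modular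
  forms.\<close>

theorem modular_form_in_subalgebra:
  assumes "modular_form k \<phi>" shows "on_regular (\<lambda>p. \<phi> (nome (fst p))) \<in> A"
proof -
  obtain g4 where g4: "modular_form 4 g4"
    "\<And>\<tau> z. (\<tau>, z) \<in> regular_domain \<Longrightarrow> Eis 4 (\<tau>, z) - weierstrass (\<tau>, z) ^ 2 = g4 (nome \<tau>)"
    by (rule weight_4_invariant) (rule that)
  obtain g6 where g6: "modular_form 6 g6"
    "\<And>\<tau> z. (\<tau>, z) \<in> regular_domain \<Longrightarrow>
       Eis 3 (\<tau>, z) ^ 2 - weierstrass (\<tau>, z) ^ 3 - 3 * (Eis 4 (\<tau>, z) - weierstrass (\<tau>, z) ^ 2) * weierstrass (\<tau>, z) = g6 (nome \<tau>)"
    by (rule weight_6_invariant[OF g4(2)]) (assumption | rule that)+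
  define R where "R = {\<phi>. on_regular (\<lambda>p. \<phi> (nome (fst p))) \<in> A}"
  have "\<phi> \<in> R"
  proof (rule modular_form_generated[OF g4(1) g6(1) _ _ _ _ _ _ _ assms])
    show "\<not> (g4 (nome \<tau>) = 0 \<and> g6 (nome \<tau>) = 0)" if \<tau>: "Im \<tau> > 0" for \<tau>
    proof
      assume z: "g4 (nome \<tau>) = 0 \<and> g6 (nome \<tau>) = 0"
      show False
      proof (rule weierstrass_cubic_not_cusp[OF \<tau>])
        show "Eis 3 (\<tau>, w) ^ 2 = weierstrass (\<tau>, w) ^ 3" if "(\<tau>, w) \<in> regular_domain" for w
          using g4(2)[OF that] g6(2)[OF that] z by simp
      qed
    qed
    show "(\<lambda>_. c) \<in> R" for c by (simp add: R_def subalgebra_const)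
    show "(\<lambda>q. f q + g q) \<in> R" if "f \<in> R" "g \<in> R" for f g using that by (simp add: R_def subalgebra_add)
    show "(\<lambda>q. f q * g q) \<in> R" if "f \<in> R" "g \<in> R" for f g using that by (simp add: R_def subalgebra_mult)
    have "on_regular (\<lambda>p. Eis 4 p - weierstrass p ^ 2) \<in> A"
      by (intro subalgebra_diff subalgebra_power subalgebra_Eis subalgebra_weierstrass) simp
    then have "on_regular (\<lambda>p. g4 (nome (fst p))) \<in> A"
    proof (rule subalgebra_cong, goal_cases)
      case (1 p)
      then show ?case using g4(2)[of "fst p" "snd p"] by (simp only: prod.collapse)
    qed
    then show "g4 \<in> R" by (simp add: R_def)
    have "on_regular (\<lambda>p. Eis 3 p ^ 2 - weierstrass p ^ 3 - 3 * (Eis 4 p - weierstrass p ^ 2) * weierstrass p) \<in> A"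
      by (intro subalgebra_diff subalgebra_mult subalgebra_const subalgebra_power subalgebra_Eis subalgebra_weierstrass) simp_all
    then have "on_regular (\<lambda>p. g6 (nome (fst p))) \<in> A"
    proof (rule subalgebra_cong, goal_cases)
      case (1 p)
      then show ?case using g6(2)[of "fst p" "snd p"] by (simp only: prod.collapse)
    qed
    then show "g6 \<in> R" by (simp add: R_def)
    show "g \<in> R" if "f \<in> R" "\<And>q. q \<noteq> 0 \<Longrightarrow> norm q < 1 \<Longrightarrow> f q = g q" for f g
    proof -
      have "on_regular (\<lambda>p. f (nome (fst p))) \<in> A" using that(1) by (simp add: R_def)
      then have "on_regular (\<lambda>p. g (nome (fst p))) \<in> A"
        by (rule subalgebra_cong) (auto intro!: that(2) simp: regular_domain_iff)
      then show ?thesis by (simp add: R_def)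
    qed
  qed
  then show ?thesis by (simp add: R_def)
qed

text \<open>Induction on the order of the pole at the lattice points: the leading coefficient is a modular form, and
  it is removed by subtracting its product with an Eisenstein series of the same pole order. For order 2 the
  Weierstrass function is used, because \<open>E\<^sub>2\<close> is not a Jacobi form; order 1 does not occur.\<close>

lemma jacobi_form_pole_induction:
  assumes "jacobi_form k g" "\<And>\<tau>. Im \<tau> > 0 \<Longrightarrow> \<exists>a. ((\<lambda>z. z ^ N * g (\<tau>, z)) \<longlongrightarrow> a) (at 0)"
  shows "on_regular g \<in> A"
  using assms
proof (induction N arbitrary: g)
  case (0 g)
  obtain \<phi> where \<phi>: "modular_form k \<phi>" "\<And>\<tau> z. (\<tau>, z) \<in> regular_domain \<Longrightarrow> g (\<tau>, z) = \<phi> (nome \<tau>)"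
    by (rule jacobi_form_no_pole[OF 0(1)]) (use 0(2) in \<open>auto intro: that\<close>)
  show ?case by (rule subalgebra_cong[OF modular_form_in_subalgebra[OF \<phi>(1)]]) (auto simp: \<phi>(2))
next
  case (Suc N g)
  obtain \<phi> where \<phi>: "modular_form (k - int (Suc N)) \<phi>" "jacobi_form (k - int (Suc N)) (\<lambda>p. \<phi> (nome (fst p)))"
    "\<And>\<tau>. Im \<tau> > 0 \<Longrightarrow> ((\<lambda>z. z ^ Suc N * g (\<tau>, z)) \<longlongrightarrow> \<phi> (nome \<tau>)) (at 0)"
    by (rule jacobi_form_leading_coefficient[OF Suc.prems]) (assumption | rule that)+
  have reduce: "\<exists>a. ((\<lambda>z. z ^ N * f (\<tau>, z)) \<longlongrightarrow> a) (at 0)"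
    if f: "jacobi_form k f" and \<tau>: "Im \<tau> > 0" and l: "((\<lambda>z. z ^ Suc N * f (\<tau>, z)) \<longlongrightarrow> 0) (at 0)" for f \<tau>
  proof -
    have "(\<lambda>z. z ^ Suc N * f (\<tau>, z)) holomorphic_on - period_lattice \<tau>"
      by (intro holomorphic_intros jacobi_form_slice(1)[OF f \<tau>])
    from holomorphic_zero_divide_limit[OF \<tau> this l]
    obtain a where a: "((\<lambda>z. z ^ Suc N * f (\<tau>, z) / z) \<longlongrightarrow> a) (at 0)" by blast
    have "\<forall>\<^sub>F z in at 0. z ^ Suc N * f (\<tau>, z) / z = z ^ N * f (\<tau>, z)"
      unfolding eventually_at_filter by (rule always_eventually) simp
    from Lim_transform_eventually[OF a this] show ?thesis by blast
  qed
  show ?case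
  proof (cases "N = 0")
    case True
    have "\<phi> (nome \<tau>) = 0" if \<tau>: "Im \<tau> > 0" for \<tau>
      by (rule elliptic_no_simple_pole[OF \<tau> jacobi_form_slice(1)[OF Suc.prems(1) \<tau>] jacobi_form_slice(2)[OF Suc.prems(1) \<tau>]])
         (use \<phi>(3)[OF \<tau>] True in auto)
    then show ?thesis using reduce[OF Suc.prems(1)] \<phi>(3) by (intro Suc.IH[OF Suc.prems(1)]) simp
  next
    case False
    obtain E where E: "jacobi_form (int (Suc N)) E" "on_regular E \<in> A"
      "\<And>\<tau>. Im \<tau> > 0 \<Longrightarrow> ((\<lambda>z. z ^ Suc N * E (\<tau>, z)) \<longlongrightarrow> 1) (at 0)"
    proof (cases "N = 1")
      case True
      show ?thesis
        by (rule that[of weierstrass])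
           (use True jacobi_form_weierstrass subalgebra_weierstrass weierstrass_leading_term in \<open>auto simp: numeral_2_eq_2\<close>)
    next
      case n1: False
      then have "Suc N \<ge> 3" using False by simp
      then show ?thesis
        by (intro that[of "Eis (Suc N)"] jacobi_form_Eis subalgebra_Eis Eis_leading_term) auto
    qed
    define f where "f = (\<lambda>p. g p - \<phi> (nome (fst p)) * E p)"
    have jE: "jacobi_form k (\<lambda>p. \<phi> (nome (fst p)) * E p)"
      using jacobi_form_mult[OF \<phi>(2) E(1)] by simp
    have jf: "jacobi_form k f" unfolding f_def by (rule jacobi_form_diff[OF Suc.prems(1) jE])
    have lf: "((\<lambda>z. z ^ Suc N * f (\<tau>, z)) \<longlongrightarrow> 0) (at 0)" if \<tau>: "Im \<tau> > 0" for \<tau>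
    proof -
      have "((\<lambda>z. z ^ Suc N * g (\<tau>, z) - \<phi> (nome \<tau>) * (z ^ Suc N * E (\<tau>, z))) \<longlongrightarrow> \<phi> (nome \<tau>) - \<phi> (nome \<tau>) * 1) (at 0)"
        by (intro tendsto_diff tendsto_mult tendsto_const \<phi>(3)[OF \<tau>] E(3)[OF \<tau>])
      then show ?thesis by (simp add: f_def algebra_simps)
    qed
    have "on_regular f \<in> A" by (rule Suc.IH[OF jf]) (rule reduce[OF jf _ lf])
    then have "on_regular (\<lambda>p. f p + \<phi> (nome (fst p)) * E p) \<in> A"
      by (intro subalgebra_add subalgebra_mult modular_form_in_subalgebra[OF \<phi>(1)] E(2))
    then show ?thesis by (simp add: f_def)
  qed
qed

theorem jacobi_form_in_subalgebra:
  assumes g: "jacobi_form k g" shows "on_regular g \<in> A"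
proof -
  have "holomorphic2_on g regular_domain" "convergent_laurent_qz g" using g by (auto simp: jacobi_form_def)
  then obtain N where "\<And>\<tau>. Im \<tau> > 0 \<Longrightarrow> \<exists>a. ((\<lambda>z. z ^ N * g (\<tau>, z)) \<longlongrightarrow> a) (at 0)"
    by (rule jacobi_form_pole_order) (rule that)
  with g show ?thesis by (rule jacobi_form_pole_induction)
qed

end

section \<open>Uniqueness of the expansion in the completed Eisenstein series\<close>

text \<open>The segment accumulates inside the disc, so the identity theorem applies.\<close>

lemma holomorphic_zero_on_horizontal_segment:
  assumes f: "f holomorphic_on ball c r" and y: "\<bar>y - Im c\<bar> < r"
    and z: "\<And>w. w \<in> ball c r \<Longrightarrow> Im w = y \<Longrightarrow> f w = 0"
  shows "f c = 0"
proof -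
  define \<xi> where "\<xi> = Complex (Re c) y"
  define U where "U = {w \<in> ball c r. Im w = y}"
  have "dist c \<xi> = \<bar>y - Im c\<bar>" by (simp add: \<xi>_def dist_norm cmod_def)
  then have \<xi>: "\<xi> \<in> ball c r" using y by simp
  have "\<xi> islimpt U"
    unfolding islimpt_approachable
  proof (intro allI impI)
    fix e :: real assume e: "e > 0"
    define t where "t = min e (r - dist c \<xi>) / 2"
    have t: "0 < t" "t < e" "t < r - dist c \<xi>" using e \<xi> by (auto simp: t_def min_def)
    have "dist c (\<xi> + of_real t) \<le> dist c \<xi> + dist \<xi> (\<xi> + of_real t)" by (rule dist_triangle)
    also have "dist \<xi> (\<xi> + of_real t) = t" using t by (simp add: dist_norm)
    finally have "\<xi> + of_real t \<in> ball c r" using t by simp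
    then have "\<xi> + of_real t \<in> U" by (simp add: U_def \<xi>_def)
    moreover have "\<xi> + of_real t \<noteq> \<xi>" using t by simp
    moreover have "dist (\<xi> + of_real t) \<xi> < e" using t by (simp add: dist_norm)
    ultimately show "\<exists>x'\<in>U. x' \<noteq> \<xi> \<and> dist x' \<xi> < e" by blast
  qed
  moreover have "U \<subseteq> ball c r" by (auto simp: U_def)
  moreover have "f w = 0" if "w \<in> U" for w using z that by (simp add: U_def)
  moreover have "c \<in> ball c r" using y by simp
  ultimately show ?thesis
    using analytic_continuation[OF f open_ball connected_ball _ \<xi>, of U c] by blast
qed

lemma polynomial_many_zeros:
  fixes c :: "nat \<Rightarrow> complex"
  assumes "infinite X" "\<And>x. x \<in> X \<Longrightarrow> (\<Sum>i\<le>n. c i * x ^ i) = 0" "i \<le> n"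
  shows "c i = 0"
proof (rule ccontr)
  assume "c i \<noteq> 0"
  then have "finite {x. (\<Sum>i\<le>n. c i * x ^ i) = 0}" using polyfun_finite_roots[of c n] assms(3) by blast
  moreover have "X \<subseteq> {x. (\<Sum>i\<le>n. c i * x ^ i) = 0}" using assms(2) by blast
  ultimately show False using assms(1) finite_subset by blast
qed

lemma jacobi_lambda_eq: "jacobi_lambda (\<tau>, z) = of_real (Im z / Im \<tau>)"
  by (cases "Im \<tau> = 0") (simp_all add: jacobi_lambda_def complex_diff_cnj)

lemma jacobi_mu_eq: "jacobi_mu (\<tau>, z) = 1 / (2 * \<i> * of_real (Im \<tau>))"
  by (simp add: jacobi_mu_def complex_diff_cnj)

text \<open>The functions \<open>\<lambda>\<close> and \<open>\<mu>\<close> are constant on the totally real planes where \<open>Im \<tau>\<close> and \<open>Im z\<close> are fixed. On such a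
  plane the expansion is holomorphic, and a holomorphic function vanishing on the plane vanishes nearby. Hence
  \<open>\<lambda>\<close> and \<open>\<mu>\<close> may be treated as independent variables.\<close>

lemma almost_holomorphic_expansion_unique:
  fixes h :: "nat \<Rightarrow> nat \<Rightarrow> complex \<times> complex \<Rightarrow> complex"
  assumes h: "\<And>i j. i \<le> s \<Longrightarrow> j \<le> t \<Longrightarrow> holomorphic2_on (h i j) regular_domain"
    and E: "holomorphic2_on E regular_domain" and e: "holomorphic2_on e regular_domain" and ab: "\<alpha> \<noteq> 0" "\<beta> \<noteq> 0"
    and zero: "\<And>p. p \<in> regular_domain \<Longrightarrow>
      (\<Sum>i\<le>s. \<Sum>j\<le>t. h i j p * (E p + \<alpha> * jacobi_lambda p) ^ i * (e p + \<beta> * jacobi_mu p) ^ j) = 0"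
    and p: "p \<in> regular_domain" and ij: "i \<le> s" "j \<le> t"
  shows "h i j p = 0"
proof -
  obtain \<tau>0 z0 where p0: "p = (\<tau>0, z0)" by (cases p)
  have \<tau>0: "Im \<tau>0 > 0" using p p0 by (simp add: regular_domain_iff)
  obtain r where r: "r > 0" "cball \<tau>0 r \<times> cball z0 r \<subseteq> regular_domain"
    using open_polydisc[OF open_regular_domain] p p0 by metis
  have reg: "(\<tau>, z) \<in> regular_domain" if "\<tau> \<in> ball \<tau>0 r" "z \<in> ball z0 r" for \<tau> z
    using r(2) that by (auto dest!: subsetD[of _ _ "(\<tau>, z)"])
  define H where "H = (\<lambda>(l :: real) (y :: real) p. \<Sum>i\<le>s. \<Sum>j\<le>t. h i j p * (E p + \<alpha> * of_real l) ^ i * (e p + \<beta> * (1 / (2 * \<i> * of_real y))) ^ j)"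
  have Hh: "holomorphic2_on (H l y) regular_domain" for l y
    unfolding H_def by (intro holomorphic2_on_sum holomorphic2_on_mult holomorphic2_on_power holomorphic2_on_add holomorphic2_on_const E e h) auto
  have H0: "H l y p = 0" if l: "\<bar>l * y - Im z0\<bar> < r" and y: "\<bar>y - Im \<tau>0\<bar> < r" and y0: "y > 0" for l y
  proof -
    have 1: "H l y (\<tau>, z) = 0" if "\<tau> \<in> ball \<tau>0 r" "Im \<tau> = y" "z \<in> ball z0 r" "Im z = l * y" for \<tau> z
    proof -
      have "jacobi_lambda (\<tau>, z) = of_real l" "jacobi_mu (\<tau>, z) = 1 / (2 * \<i> * of_real y)"
        using that y0 by (simp_all add: jacobi_lambda_eq jacobi_mu_eq)
      then show ?thesis using zero[OF reg[OF that(1,3)]] by (simp add: H_def)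
    qed
    have 2: "H l y (\<tau>, z0) = 0" if \<tau>: "\<tau> \<in> ball \<tau>0 r" "Im \<tau> = y" for \<tau>
      by (rule holomorphic_zero_on_horizontal_segment[of "\<lambda>z. H l y (\<tau>, z)" z0 r "l * y"])
         (use 1 \<tau> l reg in \<open>auto intro!: holomorphic2_on_slice_snd[OF Hh]\<close>)
    have "H l y (\<tau>0, z0) = 0"
      by (rule holomorphic_zero_on_horizontal_segment[of "\<lambda>\<tau>. H l y (\<tau>, z0)" \<tau>0 r y])
         (use 2 y r(1) reg in \<open>auto intro!: holomorphic2_on_slice_fst[OF Hh]\<close>)
    then show ?thesis by (simp add: p0)
  qed
  define Y where "Y = {max (Im \<tau>0 - r) 0 <..< Im \<tau>0 + r}"
  have Y: "y > 0" "\<bar>y - Im \<tau>0\<bar> < r" if "y \<in> Y" for y using that by (auto simp: Y_def)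
  have "max (Im \<tau>0 - r) 0 < Im \<tau>0 + r" using \<tau>0 r(1) by simp
  then have infY: "infinite Y" unfolding Y_def by (rule infinite_Ioo)
  have inner: "(\<Sum>j\<le>t. h i j p * (e p + \<beta> * (1 / (2 * \<i> * of_real y))) ^ j) = 0" if y: "y \<in> Y" and i: "i \<le> s" for i y
  proof -
    define L where "L = {(Im z0 - r) / y <..< (Im z0 + r) / y}"
    have "(Im z0 - r) / y < (Im z0 + r) / y" using Y[OF y] r(1) by (simp add: divide_strict_right_mono)
    then have "infinite L" unfolding L_def by (simp add: infinite_Ioo)
    moreover have "inj_on (\<lambda>l. E p + \<alpha> * complex_of_real l) L" using ab by (auto simp: inj_on_def)
    ultimately have inf: "infinite ((\<lambda>l. E p + \<alpha> * complex_of_real l) ` L)" by (simp add: finite_image_iff)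
    show ?thesis
    proof (rule polynomial_many_zeros[OF inf _ i])
      fix x assume "x \<in> (\<lambda>l. E p + \<alpha> * complex_of_real l) ` L"
      then obtain l where l: "l \<in> L" "x = E p + \<alpha> * of_real l" by blast
      have "\<bar>l * y - Im z0\<bar> < r" using l(1) Y[OF y] by (auto simp: L_def abs_less_iff field_simps)
      from H0[OF this Y(2)[OF y] Y(1)[OF y]]
      have "(\<Sum>i\<le>s. \<Sum>j\<le>t. h i j p * x ^ i * (e p + \<beta> * (1 / (2 * \<i> * of_real y))) ^ j) = 0" by (simp add: H_def l(2))
      then show "(\<Sum>i\<le>s. (\<Sum>j\<le>t. h i j p * (e p + \<beta> * (1 / (2 * \<i> * of_real y))) ^ j) * x ^ i) = 0"
        by (simp add: sum_distrib_left sum_distrib_right mult_ac)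
    qed
  qed
  have "inj_on (\<lambda>y. e p + \<beta> * (1 / (2 * \<i> * complex_of_real y))) Y" using ab Y(1) by (fastforce simp: inj_on_def)
  then have inf: "infinite ((\<lambda>y. e p + \<beta> * (1 / (2 * \<i> * complex_of_real y))) ` Y)" using infY by (simp add: finite_image_iff)
  show ?thesis
    by (rule polynomial_many_zeros[OF inf _ ij(2)]) (use inner ij(1) in auto)
qed

section \<open>Quasi-Jacobi forms are polynomials in Eisenstein series\<close>

text \<open>The binomial expansion of a power of \<open>\<lambda>\<close> or \<open>\<mu>\<close> around the completed series. The summation runs to the fixed
  bound \<open>s\<close>, so that the order of summation can be exchanged.\<close>

lemma power_expand_shift:
  fixes X E \<alpha> :: complex
  assumes "\<alpha> \<noteq> 0" "i \<le> s"
  shows "X ^ i = (\<Sum>p\<le>s. of_nat (i choose p) * (- E) ^ (i - p) / \<alpha> ^ i * (E + \<alpha> * X) ^ p)"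
proof -
  have "(\<alpha> * X) ^ i = ((E + \<alpha> * X) + (- E)) ^ i" by simp
  also have "\<dots> = (\<Sum>p\<le>i. of_nat (i choose p) * (E + \<alpha> * X) ^ p * (- E) ^ (i - p))" by (rule binomial_ring)
  also have "\<dots> = (\<Sum>p\<le>s. of_nat (i choose p) * (E + \<alpha> * X) ^ p * (- E) ^ (i - p))"
    by (rule sum.mono_neutral_left) (use assms(2) in \<open>auto simp: binomial_eq_0\<close>)
  finally have "X ^ i = (\<Sum>p\<le>s. of_nat (i choose p) * (E + \<alpha> * X) ^ p * (- E) ^ (i - p)) / \<alpha> ^ i"
    using assms(1) by (simp add: power_mult_distrib field_simps)
  then show ?thesis by (simp add: sum_divide_distrib mult_ac)
qed

text \<open>Let \<open>G\<^sub>p\<^sub>q\<close> be the coefficients in the expansion by powers of the completed series. Both sides of the transformation law of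
  the form are expanded in the completed series, which are invariant of weights 1 and 2. Comparing coefficients
  shows that \<open>G\<^sub>p\<^sub>q\<close> is a Jacobi form of weight \<open>k - p - 2q\<close>.\<close>

theorem quasi_jacobi_in_subalgebra:
  assumes alg: "complex_subalgebra A" and gens: "{Eis n | n. n \<ge> 1} \<union> {eis2} \<subseteq> A"
    and f: "almost_meromorphic_jacobi k s t f"
  shows "on_regular (f 0 0) \<in> A"
proof -
  define \<alpha> \<beta> :: complex where "\<alpha> = 2 * of_real pi * \<i>" and "\<beta> = - 2 * of_real pi * \<i>"
  have ab: "\<alpha> \<noteq> 0" "\<beta> \<noteq> 0" by (simp_all add: \<alpha>_def \<beta>_def)
  define W where "W = (\<lambda>i p x. of_nat (i choose p) * (- Eis 1 x) ^ (i - p) / \<alpha> ^ i)"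
  define V where "V = (\<lambda>j q x. of_nat (j choose q) * (- eis2 x) ^ (j - q) / \<beta> ^ j)"
  define G where "G = (\<lambda>p q x. \<Sum>i\<le>s. \<Sum>j\<le>t. f i j x * W i p x * V j q x)"
  have fm: "holomorphic2_on (f i j) regular_domain" "convergent_laurent_qz (f i j)" if "i \<le> s" "j \<le> t" for i j
    using f that by (auto simp: almost_meromorphic_jacobi_def meromorphic_lattice_poles_def)
  have finv: "jacobi_invariant k (\<lambda>p. \<Sum>i\<le>s. \<Sum>j\<le>t. f i j p * jacobi_lambda p ^ i * jacobi_mu p ^ j)"
    using f by (simp add: almost_meromorphic_jacobi_def)
  have c1: "jacobi_coefficient (Eis 1)" using jacobi_coefficient_Eis[of 0] by simp
  have hE: "holomorphic2_on (Eis 1) regular_domain" and he: "holomorphic2_on eis2 regular_domain"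
    and lE: "convergent_laurent_qz (Eis 1)" and le: "convergent_laurent_qz eis2"
    using c1 jacobi_coefficient_eis2 by (auto simp: jacobi_coefficient_def)
  have lpow: "convergent_laurent_qz (\<lambda>p. u p ^ n)" if "convergent_laurent_qz u" for u n
    by (induction n) (use that convergent_laurent_qz_mult convergent_laurent_qz_const in auto)
  have lsum: "convergent_laurent_qz (\<lambda>p. \<Sum>i\<in>I. u i p)" if "\<And>i. i \<in> I \<Longrightarrow> convergent_laurent_qz (u i)" for u and I :: "nat set"
    using that by (induction I rule: infinite_finite_induct) (auto intro: convergent_laurent_qz_const convergent_laurent_qz_add)
  have lW: "convergent_laurent_qz (\<lambda>x. c * (- u x) ^ n / d)" if "convergent_laurent_qz u" for u c n d
  proof -
    have "convergent_laurent_qz (\<lambda>x. (c / d) * ((- 1) * u x) ^ n)"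
      by (intro convergent_laurent_qz_mult convergent_laurent_qz_const lpow that)
    then show ?thesis by simp
  qed
  have Gh: "holomorphic2_on (G p q) regular_domain" for p q
    unfolding G_def W_def V_def
    by (intro holomorphic2_on_sum holomorphic2_on_mult holomorphic2_on_divide holomorphic2_on_power holomorphic2_on_uminus
         holomorphic2_on_const hE he fm) (use ab in auto)
  have Gl: "convergent_laurent_qz (G p q)" for p q
    unfolding G_def W_def V_def by (intro lsum convergent_laurent_qz_mult lW lE le fm) auto
  have ident: "(\<Sum>i\<le>s. \<Sum>j\<le>t. f i j x * X ^ i * Y ^ j) =
      (\<Sum>p\<le>s. \<Sum>q\<le>t. G p q x * (Eis 1 x + \<alpha> * X) ^ p * (eis2 x + \<beta> * Y) ^ q)" for x X Y
  proof -
    have "(\<Sum>i\<le>s. \<Sum>j\<le>t. f i j x * X ^ i * Y ^ j) =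
      (\<Sum>i\<le>s. \<Sum>j\<le>t. f i j x * (\<Sum>p\<le>s. W i p x * (Eis 1 x + \<alpha> * X) ^ p) * (\<Sum>q\<le>t. V j q x * (eis2 x + \<beta> * Y) ^ q))"
    proof (intro sum.cong refl)
      fix i j assume ij: "i \<in> {..s}" "j \<in> {..t}"
      have "X ^ i = (\<Sum>p\<le>s. W i p x * (Eis 1 x + \<alpha> * X) ^ p)"
        unfolding W_def by (rule power_expand_shift[OF ab(1)]) (use ij in simp)
      moreover have "Y ^ j = (\<Sum>q\<le>t. V j q x * (eis2 x + \<beta> * Y) ^ q)"
        unfolding V_def by (rule power_expand_shift[OF ab(2)]) (use ij in simp)
      ultimately show "f i j x * X ^ i * Y ^ j = f i j x * (\<Sum>p\<le>s. W i p x * (Eis 1 x + \<alpha> * X) ^ p) * (\<Sum>q\<le>t. V j q x * (eis2 x + \<beta> * Y) ^ q)"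
        by metis
    qed
    also have "\<dots> = (\<Sum>i\<le>s. \<Sum>j\<le>t. \<Sum>p\<le>s. \<Sum>q\<le>t. f i j x * W i p x * V j q x * (Eis 1 x + \<alpha> * X) ^ p * (eis2 x + \<beta> * Y) ^ q)"
      by (simp add: sum_distrib_left sum_distrib_right mult_ac)
    also have "\<dots> = (\<Sum>i\<le>s. \<Sum>p\<le>s. \<Sum>q\<le>t. \<Sum>j\<le>t. f i j x * W i p x * V j q x * (Eis 1 x + \<alpha> * X) ^ p * (eis2 x + \<beta> * Y) ^ q)"
    proof (rule sum.cong[OF refl])
      fix i
      show "(\<Sum>j\<le>t. \<Sum>p\<le>s. \<Sum>q\<le>t. f i j x * W i p x * V j q x * (Eis 1 x + \<alpha> * X) ^ p * (eis2 x + \<beta> * Y) ^ q) =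
        (\<Sum>p\<le>s. \<Sum>q\<le>t. \<Sum>j\<le>t. f i j x * W i p x * V j q x * (Eis 1 x + \<alpha> * X) ^ p * (eis2 x + \<beta> * Y) ^ q)"
        by (rule trans[OF sum.swap sum.cong[OF refl sum.swap]])
    qed
    also have "\<dots> = (\<Sum>p\<le>s. \<Sum>q\<le>t. \<Sum>i\<le>s. \<Sum>j\<le>t. f i j x * W i p x * V j q x * (Eis 1 x + \<alpha> * X) ^ p * (eis2 x + \<beta> * Y) ^ q)"
      by (rule trans[OF sum.swap sum.cong[OF refl sum.swap]])
    also have "\<dots> = (\<Sum>p\<le>s. \<Sum>q\<le>t. G p q x * (Eis 1 x + \<alpha> * X) ^ p * (eis2 x + \<beta> * Y) ^ q)"
      by (simp add: G_def sum_distrib_right)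
    finally show ?thesis .
  qed
  define F where "F = (\<lambda>x. \<Sum>p\<le>s. \<Sum>q\<le>t. G p q x * (Eis 1 x + \<alpha> * jacobi_lambda x) ^ p * (eis2 x + \<beta> * jacobi_mu x) ^ q)"
  have Finv: "jacobi_invariant k F" using finv unfolding F_def ident .
  have E1inv: "jacobi_invariant 1 (\<lambda>x. Eis 1 x + \<alpha> * jacobi_lambda x)"
    using jacobi_invariant_E1_completed by (simp add: \<alpha>_def)
  have e2inv: "jacobi_invariant 2 (\<lambda>x. eis2 x + \<beta> * jacobi_mu x)"
    using jacobi_invariant_eis2_completed by (simp add: \<beta>_def)
  note unique = almost_holomorphic_expansion_unique[OF _ hE he ab]
  have Gj: "jacobi_form (k - int p - 2 * int q) (G p q)" if pq: "p \<le> s" "q \<le> t" for p q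
    unfolding jacobi_form_def
  proof (intro conjI Gh Gl)
    show "jacobi_invariant (k - int p - 2 * int q) (G p q)"
      unfolding jacobi_invariant_def
    proof (intro allI impI conjI)
      fix \<tau>1 z1 :: complex and a b c d :: int
      assume reg1: "(\<tau>1, z1) \<in> regular_domain" and det: "a * d - b * c = 1"
      define J where "J = (\<lambda>x :: complex \<times> complex. of_int c * fst x + of_int d)"
      define g where "g = (\<lambda>x :: complex \<times> complex. ((of_int a * fst x + of_int b) / J x, snd x / J x))"
      have J0: "J x \<noteq> 0" if "x \<in> regular_domain" for x
        unfolding J_def by (rule mobius_denominator_nonzero[OF det]) (use that in \<open>cases x; simp add: regular_domain_iff\<close>)
      have greg: "g x \<in> regular_domain" if "x \<in> regular_domain" for x
        using regular_domain_mobius[OF det, of "fst x" "snd x"] that by (cases x) (simp add: g_def J_def regular_domain_iff)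
      have Jh: "holomorphic2_on J U" for U unfolding J_def by (intro holomorphic2_on_add holomorphic2_on_mult) auto
      have comp: "holomorphic2_on (\<lambda>x. G p q (g x)) regular_domain" for p q
        unfolding g_def
        by (rule holomorphic2_on_compose_Pair[OF _ _ Gh])
           (use J0 greg in \<open>auto intro!: holomorphic2_on_divide holomorphic2_on_add holomorphic2_on_mult holomorphic2_on_fst
              holomorphic2_on_snd Jh simp: g_def\<close>)
      \<comment> \<open>the defect of the law of weight \<open>k - p - 2q\<close>, multiplied by \<open>J\<^bsup>p + 2q\<^esup>\<close>\<close>
      define h where "h = (\<lambda>p q x. G p q (g x) * J x ^ (p + 2 * q) - J x powi k * G p q x)"
      have inv: "u (g x) = J x powi l * u x" if "jacobi_invariant l u" "x \<in> regular_domain" for u l x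
        using that det unfolding jacobi_invariant_def g_def J_def by (cases x) auto
      have powih: "holomorphic2_on (\<lambda>x. J x powi k) regular_domain"
        by (rule holomorphic2_on_compose[OF Jh, where F = "\<lambda>w. w powi k" and V = "- {0}"]) (use J0 in \<open>auto intro!: holomorphic_intros\<close>)
      have "h p q (\<tau>1, z1) = 0"
      proof (rule unique[OF _ _ reg1 pq])
        show "holomorphic2_on (h i j) regular_domain" for i j
          unfolding h_def by (intro holomorphic2_on_diff holomorphic2_on_mult comp Gh powih holomorphic2_on_power Jh)
        fix x assume x: "x \<in> regular_domain"
        have "(\<Sum>i\<le>s. \<Sum>j\<le>t. h i j x * (Eis 1 x + \<alpha> * jacobi_lambda x) ^ i * (eis2 x + \<beta> * jacobi_mu x) ^ j) =
           (\<Sum>i\<le>s. \<Sum>j\<le>t. G i j (g x) * (J x * (Eis 1 x + \<alpha> * jacobi_lambda x)) ^ i * (J x ^ 2 * (eis2 x + \<beta> * jacobi_mu x)) ^ j)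
           - J x powi k * F x"
        proof -
          have "h i j x * a ^ i * b ^ j = G i j (g x) * (J x * a) ^ i * (J x ^ 2 * b) ^ j - J x powi k * (G i j x * a ^ i * b ^ j)"
            for i j a b
            unfolding h_def power_mult_distrib power_add power_mult by (simp add: algebra_simps)
          then show ?thesis unfolding F_def by (simp add: sum_distrib_left sum_subtractf)
        qed
        also have "(\<Sum>i\<le>s. \<Sum>j\<le>t. G i j (g x) * (J x * (Eis 1 x + \<alpha> * jacobi_lambda x)) ^ i * (J x ^ 2 * (eis2 x + \<beta> * jacobi_mu x)) ^ j) = F (g x)"
          unfolding F_def using inv[OF E1inv x] inv[OF e2inv x] by simp
        also have "F (g x) = J x powi k * F x" by (rule inv[OF Finv x])
        finally show "(\<Sum>i\<le>s. \<Sum>j\<le>t. h i j x * (Eis 1 x + \<alpha> * jacobi_lambda x) ^ i * (eis2 x + \<beta> * jacobi_mu x) ^ j) = 0" by simp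
      qed
      then have "G p q (g (\<tau>1, z1)) * J (\<tau>1, z1) ^ (p + 2 * q) = J (\<tau>1, z1) powi k * G p q (\<tau>1, z1)" by (simp add: h_def)
      moreover have "J (\<tau>1, z1) powi (k - int p - 2 * int q) = J (\<tau>1, z1) powi k / J (\<tau>1, z1) ^ (p + 2 * q)"
      proof -
        have "k - int p - 2 * int q = k - int (p + 2 * q)" by simp
        moreover have "J (\<tau>1, z1) powi (k - int (p + 2 * q)) = J (\<tau>1, z1) powi k / J (\<tau>1, z1) powi int (p + 2 * q)"
          by (rule power_int_diff) (use J0[OF reg1] in simp)
        ultimately show ?thesis by (simp only: power_int_of_nat)
      qed
      ultimately have "G p q (g (\<tau>1, z1)) = J (\<tau>1, z1) powi (k - int p - 2 * int q) * G p q (\<tau>1, z1)"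
        using J0[OF reg1] by (metis (no_types, lifting) nonzero_mult_div_cancel_right power_not_zero times_divide_eq_left)
      then show "G p q ((of_int a * \<tau>1 + of_int b) / (of_int c * \<tau>1 + of_int d), z1 / (of_int c * \<tau>1 + of_int d)) =
          (of_int c * \<tau>1 + of_int d) powi (k - int p - 2 * int q) * G p q (\<tau>1, z1)"
        by (simp add: g_def J_def)
    next
      fix \<tau>1 z1 :: complex and m n :: int
      assume reg1: "(\<tau>1, z1) \<in> regular_domain"
      define g where "g = (\<lambda>x :: complex \<times> complex. (fst x, snd x + of_int m * fst x + of_int n))"
      have greg: "g x \<in> regular_domain" if "x \<in> regular_domain" for x
        using that regular_domain_shift[of "fst x" "snd x" m n] by (cases x) (simp add: g_def)
      have comp: "holomorphic2_on (\<lambda>x. G p q (g x)) regular_domain" for p q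
        unfolding g_def
        by (rule holomorphic2_on_compose_Pair[OF _ _ Gh])
           (use greg in \<open>auto intro!: holomorphic2_on_add holomorphic2_on_mult holomorphic2_on_fst holomorphic2_on_snd simp: g_def\<close>)
      define h where "h = (\<lambda>p q x. G p q (g x) - G p q x)"
      have inv: "u (g x) = u x" if "jacobi_invariant l u" "x \<in> regular_domain" for u l x
        using that unfolding jacobi_invariant_def g_def by (cases x) auto
      have "h p q (\<tau>1, z1) = 0"
      proof (rule unique[OF _ _ reg1 pq])
        show "holomorphic2_on (h i j) regular_domain" for i j
          unfolding h_def by (intro holomorphic2_on_diff comp Gh)
        fix x assume x: "x \<in> regular_domain"
        have "(\<Sum>i\<le>s. \<Sum>j\<le>t. h i j x * (Eis 1 x + \<alpha> * jacobi_lambda x) ^ i * (eis2 x + \<beta> * jacobi_mu x) ^ j) =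
           (\<Sum>i\<le>s. \<Sum>j\<le>t. G i j (g x) * (Eis 1 x + \<alpha> * jacobi_lambda x) ^ i * (eis2 x + \<beta> * jacobi_mu x) ^ j) - F x"
          unfolding F_def h_def by (simp add: sum_subtractf[symmetric] left_diff_distrib)
        also have "(\<Sum>i\<le>s. \<Sum>j\<le>t. G i j (g x) * (Eis 1 x + \<alpha> * jacobi_lambda x) ^ i * (eis2 x + \<beta> * jacobi_mu x) ^ j) = F (g x)"
          unfolding F_def using inv[OF E1inv x] inv[OF e2inv x] by simp
        also have "F (g x) = F x" by (rule inv[OF Finv x])
        finally show "(\<Sum>i\<le>s. \<Sum>j\<le>t. h i j x * (Eis 1 x + \<alpha> * jacobi_lambda x) ^ i * (eis2 x + \<beta> * jacobi_mu x) ^ j) = 0" by simp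
      qed
      then show "G p q (\<tau>1, z1 + of_int m * \<tau>1 + of_int n) = G p q (\<tau>1, z1)" by (simp add: h_def g_def)
    qed
  qed
  \<comment> \<open>the identity of polynomials holds for all values of \<open>X\<close> and \<open>Y\<close>, in particular for 0\<close>
  have const: "f 0 0 x = (\<Sum>p\<le>s. \<Sum>q\<le>t. G p q x * Eis 1 x ^ p * eis2 x ^ q)" for x
  proof -
    have "(\<Sum>i\<le>s. \<Sum>j\<le>t. f i j x * 0 ^ i * 0 ^ j) = (\<Sum>i\<le>s. if i = 0 then f i 0 x else 0)"
    proof (intro sum.cong refl)
      fix i
      have "(\<Sum>j\<le>t. f i j x * 0 ^ i * 0 ^ j) = (\<Sum>j\<le>t. if j = 0 then f i j x * 0 ^ i else 0)"
        by (intro sum.cong refl) auto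
      then show "(\<Sum>j\<le>t. f i j x * 0 ^ i * 0 ^ j) = (if i = 0 then f i 0 x else 0)" by simp
    qed
    then have "f 0 0 x = (\<Sum>i\<le>s. \<Sum>j\<le>t. f i j x * 0 ^ i * 0 ^ j)" by simp
    then show ?thesis unfolding ident by simp
  qed
  note A = jacobi_form_in_subalgebra[OF alg gens] subalgebra_sum[OF alg gens] subalgebra_mult[OF alg gens]
    subalgebra_power[OF alg gens] subalgebra_Eis[OF alg gens] subalgebra_eis2[OF alg gens]
  have "on_regular (\<lambda>x. \<Sum>p\<le>s. \<Sum>q\<le>t. G p q x * Eis 1 x ^ p * eis2 x ^ q) \<in> A"
    by (intro A(2,3,4) A(5) A(6) A(1)[OF Gj]) auto
  then show ?thesis by (rule subalgebra_cong[OF alg gens]) (simp add: const)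
qed

theorem proposition2p9:
  "quasi_jacobi_algebra = complex_subalgebra hull ({Eis n | n. n \<ge> 1} \<union> {eis2})"
proof
  show "complex_subalgebra hull ({Eis n | n. n \<ge> 1} \<union> {eis2}) \<subseteq> quasi_jacobi_algebra"
    by (rule hull_subset_quasi_jacobi_algebra)
  show "quasi_jacobi_algebra \<subseteq> complex_subalgebra hull ({Eis n | n. n \<ge> 1} \<union> {eis2})"
    unfolding hull_def
  proof (intro Inter_greatest)
    fix A assume "A \<in> {A. complex_subalgebra A \<and> {Eis n | n. n \<ge> 1} \<union> {eis2} \<subseteq> A}"
    then have A: "complex_subalgebra A" "{Eis n | n. n \<ge> 1} \<union> {eis2} \<subseteq> A" by auto
    show "quasi_jacobi_algebra \<subseteq> A"
      unfolding quasi_jacobi_algebra_def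
    proof (rule cfun.span_minimal)
      show "(\<Union>k s t. quasi_jacobi_forms k s t) \<subseteq> A"
        using quasi_jacobi_in_subalgebra[OF A] by (auto simp: quasi_jacobi_forms_def)
      show "cfun.subspace A" using A(1) by (simp add: complex_subalgebra_def)
    qed
  qed
qed

end
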